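(* Let $p\geq1$ be an integer and let $\eta=(\eta_1,\dots,\eta_{2p+1})$ be a sequence of signs with an odd number of $+$ signs. Then the Schubert variety $C_\eta\subset\mathbb G_Q^+(2p+1,4p+2)$ is suitable if and only if $\eta$ is admissible, and in this case its dual variety in $\mathbb G_Q^-(2p+1,4p+2)$ is $C_\eta^Q=D_{\eta^*}$.
   Context: Let $V$ be a complex vector space of dimension $4p+2$ with basis $(e_1^+,\dots,e_{2p+1}^+,e_1^-,\dots,e_{2p+1}^-)$ and quadratic form $Q(\sum x_i^+e_i^++\sum x_i^-e_i^-)=\sum x_i^+x_i^-$. The variety of $(2p+1)$-dimensional isotropic subspaces has two components: $\mathbb G_Q^+(2p+1,4p+2)$ (resp. $\mathbb G_Q^-(2p+1,4p+2)$) is the one containing the subspaces $\langle e_1^{\eta_1},\dots,e_{2p+1}^{\eta_{2p+1}}\rangle$ for sign sequences $\eta$ with an odd number of $+$ signs (resp. an odd number of $-$ signs). $B$ is the Borel subgroup of $Spin(V)$ stabilizing the flag of subspaces $\langle e_1^+,\dots,e_i^+\rangle$, $1\le i\le 2p+1$. $C_\eta$ (resp. $D_\eta$) is the closure of the $B$-orbit of $\langle e_i^{\eta_i}\rangle_{1\leq i\leq 2p+1}$ in $\mathbb G_Q^+$ (resp. $\mathbb G_Q^-$). Combinatorics: for an integer $j$, $\varphi(\eta,j)$ is the sequence obtained from $\eta$ by changing exactly the sign $\eta_j$. $\eta$ is \emph{admissible} if for all $i\in\{1,\dots,p\}$, $\#\{j:1\leq j\leq 2i,\ \eta_j=+\}\geq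 i$. For admissible $\eta$, $\eta^*$ is defined as follows. If there exists $i\in\{1,\dots,p+1\}$ such that $\#\{j:1\leq j\leq 2i-1,\ \eta_j=+\}=i-1$, let $i_0$ be the minimal such $i$ and $\eta^*=\varphi(\eta,2i_0-1)$. Otherwise there exists $i\in\{1,\dots,2p+1\}$ such that for all $k$ with $i\leq k\leq 2p+1$, $\#\{j\leq k:\eta_j=+\}>\#\{j\leq k:\eta_j=-\}$; let $i_0$ be the minimal such $i$ and $\eta^*=\varphi(\eta,i_0)$. Duality: for $x\in\mathbb G_Q^+(2p+1,4p+2)$ with corresponding subspace $L_x$, $T_x^*\mathbb G_Q^+(2p+1,4p+2)\simeq\wedge^2L_x$. A form $\omega\in\wedge^2L_x$ is \emph{generic} if it has rank $2p$; its image (the smallest subspace $L_\omega\subset L_x$ with $\omega\in\wedge^2L_\omega$) is then a hyperplane of $L_x$, and $q(\omega)$ is the unique $h\in\mathbb G_Q^-(2p+1,4p+2)$ with $L_x\cap L_h=L_\omega$. For closed irreducible $X\subset\mathbb G_Q^+$, $N^*X$ is the conormal bundle of the smooth locus of $X$; $X$ is \emph{suitable} if $N^*X$ contains generic forms, and then $X^Q\subset\mathbb G_Q^-$ is the closure of $\{q(\omega):\omega\in N^*X\text{ generic}\}$. *)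

theory Defs
  imports
    "Jordan_Normal_Form.DL_Rank"
    "HOL-Analysis.Abstract_Topology_2"
    "HOL-Analysis.Function_Topology"
begin

section \<open>Grassmannians as varieties\<close>

abbreviation lin_subspace :: "nat \<Rightarrow> complex vec set \<Rightarrow> bool" where
  "lin_subspace N L \<equiv> VectorSpace.subspace class_ring L (module_vec TYPE(complex) N)"

abbreviation lin_dim :: "nat \<Rightarrow> complex vec set \<Rightarrow> nat" where
  "lin_dim N L \<equiv> vectorspace.dim class_ring ((module_vec TYPE(complex) N)\<lparr>carrier := L\<rparr>)"

abbreviation lin_span :: "nat \<Rightarrow> complex vec set \<Rightarrow> complex vec set" where
  "lin_span N S \<equiv> LinearCombinations.module.span class_ring (module_vec TYPE(complex) N) S"

definition grassmannian :: "nat \<Rightarrow> nat \<Rightarrow> complex vec set set" where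
  "grassmannian k N = {L. lin_subspace N L \<and> lin_dim N L = k}"

text \<open>Polynomial functions on the affine space of \<open>r \<times> c\<close> matrices.\<close>

inductive_set poly_fun :: "nat \<Rightarrow> nat \<Rightarrow> (complex mat \<Rightarrow> complex) set" for r c :: nat where
  const: "(\<lambda>_. a) \<in> poly_fun r c"
| entry: "\<lbrakk>i < r; j < c\<rbrakk> \<Longrightarrow> (\<lambda>X. X $$ (i, j)) \<in> poly_fun r c"
| add: "\<lbrakk>f \<in> poly_fun r c; g \<in> poly_fun r c\<rbrakk> \<Longrightarrow> (\<lambda>X. f X + g X) \<in> poly_fun r c"
| mult: "\<lbrakk>f \<in> poly_fun r c; g \<in> poly_fun r c\<rbrakk> \<Longrightarrow> (\<lambda>X. f X * g X) \<in> poly_fun r c"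

definition zariski_affine :: "nat \<Rightarrow> nat \<Rightarrow> complex mat topology" where
  "zariski_affine r c =
     topology_generated_by {{X \<in> carrier_mat r c. f X \<noteq> 0} | f. f \<in> poly_fun r c}"

text \<open>The columns of an invertible matrix \<open>P\<close> split the ambient space as \<open>L \<oplus> L'\<close>, where \<open>L\<close> is
  spanned by the first \<open>k\<close> columns and \<open>L'\<close> by the others. The matrix \<open>X\<close>, regarded as a linear
  map from \<open>L\<close> to \<open>L'\<close>, is sent to its graph. These maps are the standard affine charts of the
  Grassmannian; \<open>X = 0\<close> is sent to \<open>L\<close>.\<close>

definition frames :: "nat \<Rightarrow> complex mat set" where
  "frames N = {P \<in> carrier_mat N N. invertible_mat P}"

definition gr_chart :: "nat \<Rightarrow> complex mat \<Rightarrow> complex mat \<Rightarrow> complex vec set" where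
  "gr_chart k P X = {P *\<^sub>v (y @\<^sub>v (X *\<^sub>v y)) | y. y \<in> carrier_vec k}"

definition chart_preimage ::
    "nat \<Rightarrow> nat \<Rightarrow> complex mat \<Rightarrow> complex vec set set \<Rightarrow> complex mat set" where
  "chart_preimage k N P U = {X \<in> carrier_mat (N - k) k. gr_chart k P X \<in> U}"

definition zariski_gr :: "nat \<Rightarrow> nat \<Rightarrow> complex vec set topology" where
  "zariski_gr k N = topology (\<lambda>U. U \<subseteq> grassmannian k N \<and>
     (\<forall>P\<in>frames N. openin (zariski_affine (N - k) k) (chart_preimage k N P U)))"

lemma openin_zariski_gr:
  "openin (zariski_gr k N) U \<longleftrightarrow> U \<subseteq> grassmannian k N \<and>
     (\<forall>P\<in>frames N. openin (zariski_affine (N - k) k) (chart_preimage k N P U))"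
proof -
  have Int: "chart_preimage k N P (S \<inter> T) = chart_preimage k N P S \<inter> chart_preimage k N P T"
    for P S T by (auto simp: chart_preimage_def)
  have Un: "chart_preimage k N P (\<Union>K) = \<Union>(chart_preimage k N P ` K)" for P K
    by (auto simp: chart_preimage_def)
  have "istopology (\<lambda>U. U \<subseteq> grassmannian k N \<and>
     (\<forall>P\<in>frames N. openin (zariski_affine (N - k) k) (chart_preimage k N P U)))"
    unfolding istopology_def Int Un by (auto intro!: openin_Union)
  then show ?thesis
    by (simp add: zariski_gr_def)
qed

section \<open>Smooth points and tangent spaces\<close>

definition frames_at :: "nat \<Rightarrow> nat \<Rightarrow> complex vec set \<Rightarrow> complex mat set" where
  "frames_at k N L = {P \<in> frames N. gr_chart k P (0\<^sub>m (N - k) k) = L}"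

text \<open>\<open>has_differential f S d\<close> says that the differential of \<open>f\<close> at the origin takes the value
  \<open>d\<close> on the vector \<open>S\<close>.\<close>

definition has_differential :: "(complex mat \<Rightarrow> complex) \<Rightarrow> complex mat \<Rightarrow> complex \<Rightarrow> bool" where
  "has_differential f S d \<longleftrightarrow> ((\<lambda>t. f (t \<cdot>\<^sub>m S)) has_field_derivative d) (at 0)"

text \<open>The point \<open>L\<close> of \<open>X\<close> is smooth if, in a Zariski neighbourhood of \<open>L\<close> in an affine chart
  centred at \<open>L\<close>, the set \<open>X\<close> is defined by equations \<open>f\<^sub>0 = \<dots> = f\<^sub>c\<^sub>-\<^sub>1 = 0\<close> whose Jacobian has
  rank \<open>c\<close> at \<open>L\<close> (the last conjunct says that the differential of \<open>(f\<^sub>0, \<dots>, f\<^sub>c\<^sub>-\<^sub>1)\<close> is onto).\<close>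

definition smooth_point ::
    "nat \<Rightarrow> nat \<Rightarrow> complex vec set set \<Rightarrow> complex vec set \<Rightarrow> bool" where
  "smooth_point k N X L \<longleftrightarrow> L \<in> X \<and>
     (\<exists>P\<in>frames_at k N L. \<exists>(c::nat) f U.
        (\<forall>i<c. f i \<in> poly_fun (N - k) k) \<and>
        openin (zariski_affine (N - k) k) U \<and> 0\<^sub>m (N - k) k \<in> U \<and>
        chart_preimage k N P X \<inter> U = {Y \<in> U. \<forall>i<c. f i Y = 0} \<and>
        (\<forall>d::nat \<Rightarrow> complex. \<exists>S\<in>carrier_mat (N - k) k. \<forall>i<c. has_differential (f i) S (d i)))"

text \<open>Zariski tangent space at the origin of the chart \<open>P\<close>.\<close>

definition chart_tangent ::
    "nat \<Rightarrow> nat \<Rightarrow> complex mat \<Rightarrow> complex vec set set \<Rightarrow> complex mat set" where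
  "chart_tangent k N P X = {S \<in> carrier_mat (N - k) k.
     \<forall>f\<in>poly_fun (N - k) k. (\<forall>Y\<in>chart_preimage k N P X. f Y = 0) \<longrightarrow> has_differential f S 0}"

text \<open>The tangent space of the Grassmannian at \<open>L\<close> is \<open>Hom(L, V/L)\<close>, the chart coordinate \<open>S\<close>
  corresponding to \<open>P (y, 0) \<mapsto> P (0, S y) mod L\<close>. A tangent vector is represented by any
  endomorphism \<open>A\<close> of \<open>V\<close> inducing this map, so the set below is the full preimage of the tangent
  space of \<open>X\<close> under the surjection from \<open>End V\<close> to \<open>Hom(L, V/L)\<close>.\<close>

definition tangent_endos ::
    "nat \<Rightarrow> nat \<Rightarrow> complex vec set set \<Rightarrow> complex vec set \<Rightarrow> complex mat set" where
  "tangent_endos k N X L = {A \<in> carrier_mat N N.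
     \<exists>P\<in>frames_at k N L. \<exists>S\<in>chart_tangent k N P X. \<forall>y\<in>carrier_vec k.
       A *\<^sub>v (P *\<^sub>v (y @\<^sub>v 0\<^sub>v (N - k))) - P *\<^sub>v (0\<^sub>v k @\<^sub>v (S *\<^sub>v y)) \<in> L}"

section \<open>The quadratic space and its spinor varieties\<close>

datatype sign = Plus | Minus

text \<open>Sign sequences are functions on \<open>nat\<close> of which only the values at \<open>1, \<dots>, 2p+1\<close> matter.
  The basis vector \<open>e\<^sub>i\<^sup>+\<close> is the unit vector with (0-based) index \<open>i - 1\<close>, and \<open>e\<^sub>i\<^sup>-\<close> the one with
  index \<open>2p+1 + (i-1)\<close>.\<close>

definition basis_vec :: "nat \<Rightarrow> sign \<Rightarrow> nat \<Rightarrow> complex vec" where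
  "basis_vec p s i = unit_vec (4*p+2) (case s of Plus \<Rightarrow> i - 1 | Minus \<Rightarrow> (2*p+1) + (i - 1))"

definition quad_form :: "nat \<Rightarrow> complex vec \<Rightarrow> complex" where
  "quad_form p v = (\<Sum>i<2*p+1. v $ i * v $ ((2*p+1) + i))"

definition polar_form :: "nat \<Rightarrow> complex vec \<Rightarrow> complex vec \<Rightarrow> complex" where
  "polar_form p u v = quad_form p (u + v) - quad_form p u - quad_form p v"

definition isotropic_gr :: "nat \<Rightarrow> complex vec set set" where
  "isotropic_gr p = {L \<in> grassmannian (2*p+1) (4*p+2). \<forall>v\<in>L. quad_form p v = 0}"

definition zariski_iso :: "nat \<Rightarrow> complex vec set topology" where
  "zariski_iso p = subtopology (zariski_gr (2*p+1) (4*p+2)) (isotropic_gr p)"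

definition coord_subspace :: "nat \<Rightarrow> (nat \<Rightarrow> sign) \<Rightarrow> complex vec set" where
  "coord_subspace p \<eta> = lin_span (4*p+2) {basis_vec p (\<eta> i) i | i. i \<in> {1..2*p+1}}"

definition odd_sign :: "nat \<Rightarrow> sign \<Rightarrow> (nat \<Rightarrow> sign) \<Rightarrow> bool" where
  "odd_sign p s \<eta> \<longleftrightarrow> odd (card {j \<in> {1..2*p+1}. \<eta> j = s})"

text \<open>\<open>spinor_variety p Plus\<close> and \<open>spinor_variety p Minus\<close> are the two components.\<close>

definition spinor_variety :: "nat \<Rightarrow> sign \<Rightarrow> complex vec set set" where
  "spinor_variety p s =
     {L. \<exists>\<eta>. odd_sign p s \<eta> \<and> connected_component_of (zariski_iso p) (coord_subspace p \<eta>) L}"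

definition zariski_spinor :: "nat \<Rightarrow> sign \<Rightarrow> complex vec set topology" where
  "zariski_spinor p s = subtopology (zariski_iso p) (spinor_variety p s)"

section \<open>Schubert varieties\<close>

definition flag :: "nat \<Rightarrow> nat \<Rightarrow> complex vec set" where
  "flag p i = lin_span (4*p+2) {basis_vec p Plus j | j. j \<in> {1..i}}"

definition special_orthogonal :: "nat \<Rightarrow> complex mat set" where
  "special_orthogonal p = {g \<in> carrier_mat (4*p+2) (4*p+2). det g = 1 \<and>
     (\<forall>v\<in>carrier_vec (4*p+2). quad_form p (g *\<^sub>v v) = quad_form p v)}"

text \<open>The group \<open>Spin(V)\<close> acts on subspaces of \<open>V\<close> through its surjection onto \<open>SO(V)\<close>; this is
  the image in \<open>SO(V)\<close> of the Borel subgroup of \<open>Spin(V)\<close>, which has the same orbits.\<close>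

definition borel_group :: "nat \<Rightarrow> complex mat set" where
  "borel_group p = {g \<in> special_orthogonal p.
     \<forall>i\<in>{1..2*p+1}. (\<lambda>v. g *\<^sub>v v) ` flag p i = flag p i}"

definition borel_orbit :: "nat \<Rightarrow> complex vec set \<Rightarrow> complex vec set set" where
  "borel_orbit p L = {(\<lambda>v. g *\<^sub>v v) ` L | g. g \<in> borel_group p}"

definition schubert_C :: "nat \<Rightarrow> (nat \<Rightarrow> sign) \<Rightarrow> complex vec set set" where
  "schubert_C p \<eta> = zariski_spinor p Plus closure_of borel_orbit p (coord_subspace p \<eta>)"

definition schubert_D :: "nat \<Rightarrow> (nat \<Rightarrow> sign) \<Rightarrow> complex vec set set" where
  "schubert_D p \<eta> = zariski_spinor p Minus closure_of borel_orbit p (coord_subspace p \<eta>)"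

section \<open>Duality\<close>

text \<open>The second exterior power of \<open>L\<close> is realised by skew-symmetric matrices.\<close>

definition wedge :: "nat \<Rightarrow> complex vec \<Rightarrow> complex vec \<Rightarrow> complex mat" where
  "wedge N u w = mat N N (\<lambda>(i, j). u $ i * w $ j - w $ i * u $ j)"

definition wedge2 :: "nat \<Rightarrow> complex vec set \<Rightarrow> complex mat set" where
  "wedge2 N L = LinearCombinations.module.span class_ring (module_mat TYPE(complex) N N)
     {wedge N u w | u w. u \<in> L \<and> w \<in> L}"

text \<open>A tangent vector of the isotropic Grassmannian at \<open>L\<close>, induced by \<open>A\<close> in \<open>End V\<close>, is the
  alternating form \<open>(u, w) \<mapsto> b(A u, w)\<close> on \<open>L\<close>, where \<open>b\<close> is the polar form; this identifies the
  cotangent space with the second exterior power of \<open>L\<close>. The contraction below sends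
  \<open>(u \<and> w, A)\<close> to \<open>b(A u, w) - b(A w, u)\<close>, which on such \<open>A\<close> equals \<open>2 b(A u, w)\<close>.\<close>

definition cotangent_pairing :: "nat \<Rightarrow> complex mat \<Rightarrow> complex mat \<Rightarrow> complex" where
  "cotangent_pairing p \<omega> A = (\<Sum>i<4*p+2. \<Sum>j<4*p+2.
     \<omega> $$ (i, j) * polar_form p (A *\<^sub>v unit_vec (4*p+2) i) (unit_vec (4*p+2) j))"

definition conormal_bundle :: "nat \<Rightarrow> complex vec set set \<Rightarrow> (complex vec set \<times> complex mat) set" where
  "conormal_bundle p X = {(L, \<omega>). smooth_point (2*p+1) (4*p+2) X L \<and> \<omega> \<in> wedge2 (4*p+2) L \<and>
     (\<forall>A\<in>tangent_endos (2*p+1) (4*p+2) X L. cotangent_pairing p \<omega> A = 0)}"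

definition generic_form :: "nat \<Rightarrow> complex mat \<Rightarrow> bool" where
  "generic_form p \<omega> \<longleftrightarrow> vec_space.rank (4*p+2) \<omega> = 2*p"

definition form_image :: "nat \<Rightarrow> complex vec set \<Rightarrow> complex mat \<Rightarrow> complex vec set" where
  "form_image p L \<omega> =
     (LEAST K. lin_subspace (4*p+2) K \<and> K \<subseteq> L \<and> \<omega> \<in> wedge2 (4*p+2) K)"

definition q_map :: "nat \<Rightarrow> complex vec set \<Rightarrow> complex mat \<Rightarrow> complex vec set" where
  "q_map p L \<omega> = (THE h. h \<in> spinor_variety p Minus \<and> L \<inter> h = form_image p L \<omega>)"

definition suitable :: "nat \<Rightarrow> complex vec set set \<Rightarrow> bool" where
  "suitable p X \<longleftrightarrow> (\<exists>(L, \<omega>)\<in>conormal_bundle p X. generic_form p \<omega>)"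

definition dual_variety :: "nat \<Rightarrow> complex vec set set \<Rightarrow> complex vec set set" where
  "dual_variety p X = zariski_spinor p Minus closure_of
     {q_map p L \<omega> | L \<omega>. (L, \<omega>) \<in> conormal_bundle p X \<and> generic_form p \<omega>}"

section \<open>Combinatorics of sign sequences\<close>

definition count_sign :: "(nat \<Rightarrow> sign) \<Rightarrow> sign \<Rightarrow> nat \<Rightarrow> nat" where
  "count_sign \<eta> s k = card {j. 1 \<le> j \<and> j \<le> k \<and> \<eta> j = s}"

definition flip :: "(nat \<Rightarrow> sign) \<Rightarrow> nat \<Rightarrow> nat \<Rightarrow> sign" where
  "flip \<eta> j = \<eta>(j := (case \<eta> j of Plus \<Rightarrow> Minus | Minus \<Rightarrow> Plus))"

definition admissible :: "nat \<Rightarrow> (nat \<Rightarrow> sign) \<Rightarrow> bool" where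
  "admissible p \<eta> \<longleftrightarrow> (\<forall>i\<in>{1..p}. count_sign \<eta> Plus (2*i) \<ge> i)"

definition eta_star :: "nat \<Rightarrow> (nat \<Rightarrow> sign) \<Rightarrow> nat \<Rightarrow> sign" where
  "eta_star p \<eta> =
     (if \<exists>i\<in>{1..p+1}. count_sign \<eta> Plus (2*i-1) = i-1
      then flip \<eta> (2 * (LEAST i. i \<in> {1..p+1} \<and> count_sign \<eta> Plus (2*i-1) = i-1) - 1)
      else flip \<eta> (LEAST i. i \<in> {1..2*p+1} \<and>
             (\<forall>k\<in>{i..2*p+1}. count_sign \<eta> Plus k > count_sign \<eta> Minus k)))"

end

theory Submission
  imports Defs
begin

text \<open>Write \<open>n = 2 p + 1\<close> and record a sign sequence by the set \<open>S\<close> of the positions, counted from \<open>0\<close>,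
  of its minus signs. Let \<open>F\<close> be the span of \<open>e\<^sub>1\<^sup>+, \<dots>, e\<^sub>n\<^sup>+\<close>. A Lagrangian is \<open>P F\<close> for an orthogonal
  frame \<open>P\<close>, and the determinant of \<open>P\<close> tells to which spinor variety it belongs
  (\<open>spinor_variety_eq\<close>). In a frame, a cotangent vector is a skew matrix \<open>w\<close> of size \<open>n\<close>. It is generic
  if its kernel is a line \<open>\<langle>v\<rangle>\<close>; its image is then the hyperplane \<open>P v\<^sup>\<bottom>\<close>, and the map to the dual variety
  sends it to \<open>P (v\<^sup>\<bottom> \<oplus> \<langle>v\<rangle>)\<close>, where \<open>v\<^sup>\<bottom>\<close> lies in \<open>F\<close> and \<open>v\<close> is read in the span of the \<open>e\<^sub>i\<^sup>-\<close>
  (\<open>q_map_eq\<close>).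

  Let \<open>Q\<close> be the coordinate frame of \<open>S\<close>, moved by a Borel element. In the chart of \<open>Q\<close> the Schubert
  variety is the linear space of the skew matrices supported on the pairs \<open>i < j\<close> with \<open>i \<in> S\<close>
  (\<open>schubert_chart\<close>). Hence it is smooth at the centre, and a skew matrix \<open>w\<close> is conormal there if it
  is supported on the pairs whose smaller member is a plus sign, in other words if it joins every minus
  sign only to earlier plus signs. If for some \<open>k\<close> there are at least two more minus than plus signs
  among the first \<open>k\<close>, a vector supported on these minus signs has at least two more entries than
  equations to satisfy in order to be in the kernel of \<open>w\<close>, so \<open>w\<close> is not generic
  (\<open>conormal_degenerate\<close>). Such a \<open>k\<close> exists if and only if the sequence is not admissible.

  If the sequence is admissible, let \<open>m\<close> be the position changed by \<open>\<eta>\<^sup>*\<close>. Plus and minus signs balance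
  before \<open>m\<close>, and without position \<open>m\<close> the sequence is a ballot sequence of even length
  (\<open>admissible_eta_star\<close>). Its indices can therefore be matched in pairs that begin with a plus sign.
  The form of this matching is conormal, with kernel \<open>\<langle>e\<^sub>m\<rangle>\<close> (\<open>matching_form\<close>), so the Schubert variety is
  suitable. The dual point is the coordinate point of \<open>\<eta>\<^sup>*\<close>, and by moving it with the Borel group the
  whole orbit of \<open>\<eta>\<^sup>*\<close> is obtained. Conversely, if the kernel of a conormal form at a point of the orbit
  is spanned by \<open>v\<close> with \<open>v\<^sub>m \<noteq> 0\<close>, the balance before \<open>m\<close> restricts the support of \<open>v\<close>
  (\<open>conormal_kernel_support\<close>), and the dual point lies in the orbit of \<open>\<eta>\<^sup>*\<close>. If \<open>v\<^sub>m = 0\<close>, the form is a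
  limit of forms with \<open>v\<^sub>m \<noteq> 0\<close>, on the line to the form of the matching (\<open>dual_lag_in_schubert\<close>).

  The Schubert variety may have smooth points outside the orbit. A conormal vector at such a point is
  the differential of one polynomial of the ideal of the variety (\<open>conormal_eq_gradient\<close>), and the
  gradient of this polynomial is a polynomial family of conormal vectors at the points of the orbit
  (\<open>conormal_family\<close>). So the conormal vector is a limit of conormal vectors along the orbit. Its
  degeneracy, and the membership of its dual point in the Schubert variety of \<open>\<eta>\<^sup>*\<close>, follow from the
  case of the orbit: the kernel of a skew matrix \<open>w\<close> of corank one is spanned by
  \<open>adj (w + c c\<^sup>T) c\<close>, which is polynomial in \<open>w\<close>, and limits of subspaces given by polynomial matrices
  remain in the closure (\<open>family_limit\<close>).\<close>

section \<open>Linear algebra over the complex numbers\<close>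

definition inj_mat :: "nat \<Rightarrow> nat \<Rightarrow> complex mat \<Rightarrow> bool" where
  "inj_mat N k A \<longleftrightarrow> A \<in> carrier_mat N k \<and> (\<forall>y\<in>carrier_vec k. A *\<^sub>v y = 0\<^sub>v N \<longrightarrow> y = 0\<^sub>v k)"

definition col_image :: "nat \<Rightarrow> complex mat \<Rightarrow> complex vec set" where
  "col_image k A = (\<lambda>y. A *\<^sub>v y) ` carrier_vec k"

lemma mult_mat_0_vec: "A \<in> carrier_mat N k \<Longrightarrow> A *\<^sub>v 0\<^sub>v k = (0\<^sub>v N :: complex vec)"
  by (intro eq_vecI) auto

lemma mult_mat_unit_vec:
  assumes "A \<in> carrier_mat N k" "j < k"
  shows "A *\<^sub>v unit_vec k j = (col A j :: complex vec)"
  using assms by (intro eq_vecI) auto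

lemma inj_mat_distinct_cols:
  assumes "inj_mat N k A"
  shows "distinct (cols A)"
proof -
  have A: "A \<in> carrier_mat N k" using assms by (simp add: inj_mat_def)
  have "i = j" if ij: "i < k" "j < k" "col A i = col A j" for i j
  proof (rule ccontr)
    assume "i \<noteq> j"
    have "A *\<^sub>v (unit_vec k i - unit_vec k j) = col A i - col A j"
      using A ij by (simp add: mult_minus_distrib_mat_vec mult_mat_unit_vec[of A N k])
    also have "\<dots> = 0\<^sub>v N" using A ij by auto
    finally have "unit_vec k i - unit_vec k j = (0\<^sub>v k :: complex vec)"
      using assms by (simp add: inj_mat_def)
    then have "(unit_vec k i - unit_vec k j) $ i = (0 :: complex)" using ij by simp
    then show False using ij \<open>i \<noteq> j\<close> by simp
  qed
  then show ?thesis using A by (auto simp: distinct_conv_nth)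
qed

lemma col_image_eq_span:
  assumes "A \<in> carrier_mat N k"
  shows "col_image k A = lin_span N (set (cols A))"
proof -
  interpret vec_space "TYPE(complex)" N .
  show ?thesis
    using col_space_eq[OF assms] assms unfolding col_space_def col_image_def by auto
qed

lemma lin_dim_col_image:
  assumes "A \<in> carrier_mat N k"
  shows "lin_dim N (col_image k A) = vec_space.rank N A"
proof -
  interpret vec_space "TYPE(complex)" N .
  show ?thesis
    unfolding rank_def col_image_eq_span[OF assms] ..
qed

lemma lin_subspaceD:
  assumes "lin_subspace N L"
  shows "L \<subseteq> carrier_vec N" "0\<^sub>v N \<in> L" "u \<in> L \<Longrightarrow> v \<in> L \<Longrightarrow> u + v \<in> L"
    "u \<in> L \<Longrightarrow> c \<cdot>\<^sub>v u \<in> L"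
proof -
  have "submodule class_ring L (module_vec TYPE(complex) N)"
    using assms by (simp add: VectorSpace.subspace_def)
  then show "L \<subseteq> carrier_vec N" "0\<^sub>v N \<in> L" "u \<in> L \<Longrightarrow> v \<in> L \<Longrightarrow> u + v \<in> L"
    "u \<in> L \<Longrightarrow> c \<cdot>\<^sub>v u \<in> L"
    unfolding submodule_def by (auto simp: module_vec_simps)
qed

lemma lin_subspaceI:
  assumes "L \<subseteq> carrier_vec N" "0\<^sub>v N \<in> L" "\<And>u v. u \<in> L \<Longrightarrow> v \<in> L \<Longrightarrow> u + v \<in> L"
    "\<And>c u. u \<in> L \<Longrightarrow> c \<cdot>\<^sub>v u \<in> L"
  shows "lin_subspace N L"
proof -
  have "vectorspace class_ring (module_vec TYPE(complex) N)" by (rule vec_vs)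
  moreover have "Module.module class_ring (module_vec TYPE(complex) N)" by (rule vec_module)
  ultimately show ?thesis
    using assms by (auto simp: VectorSpace.subspace_def submodule_def module_vec_simps)
qed

lemma subspace_col_image:
  assumes A: "A \<in> carrier_mat N k"
  shows "lin_subspace N (col_image k A)"
proof (rule lin_subspaceI)
  show "col_image k A \<subseteq> carrier_vec N" using A by (auto simp: col_image_def)
  have "A *\<^sub>v 0\<^sub>v k = 0\<^sub>v N" using A by (rule mult_mat_0_vec)
  then show "0\<^sub>v N \<in> col_image k A"
    unfolding col_image_def by (metis image_eqI zero_carrier_vec)
next
  fix u v assume "u \<in> col_image k A" "v \<in> col_image k A"
  then obtain x y where xy: "x \<in> carrier_vec k" "y \<in> carrier_vec k" "u = A *\<^sub>v x" "v = A *\<^sub>v y"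
    by (auto simp: col_image_def)
  then have "u + v = A *\<^sub>v (x + y)" using A by (simp add: mult_add_distrib_mat_vec)
  then show "u + v \<in> col_image k A" unfolding col_image_def using xy by auto
next
  fix c u assume "u \<in> col_image k A"
  then obtain x where x: "x \<in> carrier_vec k" "u = A *\<^sub>v x" by (auto simp: col_image_def)
  then have "c \<cdot>\<^sub>v u = A *\<^sub>v (c \<cdot>\<^sub>v x)" using mult_mat_vec[OF A x(1)] by simp
  then show "c \<cdot>\<^sub>v u \<in> col_image k A" unfolding col_image_def using x by auto
qed

text \<open>This trades the dimension of a subspace for a matrix of basis vectors, on which determinants and
  charts can be computed.\<close>

lemma grassmannian_iff:
  "L \<in> grassmannian k N \<longleftrightarrow> (\<exists>A. inj_mat N k A \<and> L = col_image k A)"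
proof
  interpret vec_space "TYPE(complex)" N .
  assume "L \<in> grassmannian k N"
  then have sub: "VectorSpace.subspace class_ring L V" and dim: "lin_dim N L = k"
    by (auto simp: grassmannian_def)
  interpret W: vectorspace class_ring "vs L" using sub by (rule subspace_is_vs)
  have LV: "L \<subseteq> carrier_vec N" using lin_subspaceD(1)[OF sub] .
  have subm: "submodule class_ring L V" using sub by (simp add: VectorSpace.subspace_def)
  have li: "lin_indpt B" if "B \<subseteq> L" "W.lin_indpt B" for B
    using span_li_not_depend(2)[OF that(1) subm] that(2) by simp
  have sp: "W.span B = span B" if "B \<subseteq> L" for B
    using span_li_not_depend(1)[OF that subm] by simp
  have "\<exists>B. finite B \<and> W.basis B"
  proof -
    define P where "P = (\<lambda>B. B \<subseteq> L \<and> W.lin_indpt B)"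
    have bd: "finite B \<and> card B \<le> N" if "P B" for B
    proof -
      have "lin_indpt B" "B \<subseteq> carrier V" using that li LV unfolding P_def by auto
      then show ?thesis using li_le_dim[OF fin_dim, of B] fin_dim_li_fin[OF fin_dim, of B] dim_is_n by auto
    qed
    have "P {}" unfolding P_def W.lin_dep_def by auto
    have "\<exists>B. finite B \<and> maximal B P"
      by (rule maximal_exists[of P N "{}"]) (use bd \<open>P {}\<close> in auto)
    then obtain B where B: "finite B" "maximal B P" by blast
    have "W.basis B"
      by (rule W.max_li_is_basis) (use B(2) in \<open>simp add: P_def\<close>)
    then show ?thesis using B by blast
  qed
  then obtain B where B: "finite B" "W.basis B" by blast
  have BL: "B \<subseteq> L" and liB: "lin_indpt B" and spB: "span B = L"
    using B(2) li sp unfolding W.basis_def by auto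
  have cB: "card B = k" using W.dim_basis[OF B] dim by simp
  obtain bs where bs: "set bs = B" "distinct bs" using finite_distinct_list[OF B(1)] by blast
  define A where "A = mat_of_cols N bs"
  have len: "length bs = k" using bs cB distinct_card by fastforce
  have A: "A \<in> carrier_mat N k" unfolding A_def using len by auto
  have cols: "cols A = bs" unfolding A_def using bs BL LV by (intro cols_mat_of_cols) auto
  have "inj_mat N k A"
    unfolding inj_mat_def using A lin_depI[OF A] cols bs liB by auto
  moreover have "L = col_image k A" using col_image_eq_span[OF A] cols bs spB by simp
  ultimately show "\<exists>A. inj_mat N k A \<and> L = col_image k A" by blast
next
  interpret vec_space "TYPE(complex)" N .
  assume "\<exists>A. inj_mat N k A \<and> L = col_image k A"
  then obtain A where A: "inj_mat N k A" "L = col_image k A" by blast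
  then have Ac: "A \<in> carrier_mat N k" by (simp add: inj_mat_def)
  have d: "distinct (cols A)" using inj_mat_distinct_cols A by blast
  have "lin_indpt (set (cols A))"
    using lin_depE[OF Ac _ d] A(1) unfolding inj_mat_def by metis
  then have "rank A = k" using lin_indpt_full_rank[OF Ac d] by simp
  then show "L \<in> grassmannian k N"
    unfolding grassmannian_def A(2) mem_Collect_eq lin_dim_col_image[OF Ac]
    using subspace_col_image[OF Ac] by blast
qed

lemma det_nonzero_inverse:
  fixes A :: "complex mat"
  assumes A: "A \<in> carrier_mat n n" and d: "det A \<noteq> 0"
  shows "(1 / det A) \<cdot>\<^sub>m adj_mat A \<in> carrier_mat n n"
   "A * ((1 / det A) \<cdot>\<^sub>m adj_mat A) = 1\<^sub>m n" "((1 / det A) \<cdot>\<^sub>m adj_mat A) * A = 1\<^sub>m n"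
proof -
  note adj = adj_mat[OF A]
  show "(1 / det A) \<cdot>\<^sub>m adj_mat A \<in> carrier_mat n n" by (rule smult_carrier_mat[OF adj(1)])
  have e: "(1 / det A) \<cdot>\<^sub>m (det A \<cdot>\<^sub>m 1\<^sub>m n) = 1\<^sub>m n"
    by (rule eq_matI) (use d in simp_all)
  show "A * ((1 / det A) \<cdot>\<^sub>m adj_mat A) = 1\<^sub>m n"
    unfolding mult_smult_distrib[OF A adj(1)] adj(2) by (rule e)
  show "((1 / det A) \<cdot>\<^sub>m adj_mat A) * A = 1\<^sub>m n"
    unfolding mult_smult_assoc_mat[OF adj(1) A] adj(3) by (rule e)
qed

lemma inj_mat_det:
  assumes "A \<in> carrier_mat n n"
  shows "inj_mat n n A \<longleftrightarrow> det A \<noteq> 0"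
  using det_0_iff_vec_prod_zero_field[OF assms] assms unfolding inj_mat_def by auto

text \<open>Gaussian elimination: an equation with a nonzero coefficient at some unknown removes that
  unknown and the equation.\<close>

lemma underdetermined_system:
  fixes c :: "'a \<Rightarrow> 'b \<Rightarrow> complex"
  assumes "finite A" "finite S" "card A < card S"
  shows "\<exists>u. (\<exists>i\<in>S. u i \<noteq> 0) \<and> (\<forall>i. i \<notin> S \<longrightarrow> u i = 0) \<and> (\<forall>a\<in>A. (\<Sum>i\<in>S. c a i * u i) = 0)"
  using assms
proof (induction A arbitrary: S c rule: finite_induct)
  case empty
  then obtain i where "i \<in> S" by fastforce
  then show ?case by (intro exI[of _ "\<lambda>j. if j = i then 1 else 0"]) auto
next
  case (insert a A)
  show ?case
  proof (cases "\<forall>i\<in>S. c a i = 0")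
    case True
    have "card A < card S" using insert by simp
    from insert.IH[OF insert.prems(1) this, of c] True show ?thesis by auto
  next
    case False
    then obtain k where k: "k \<in> S" "c a k \<noteq> 0" by blast
    define T where "T = S - {k}"
    have T: "finite T" "card A < card T" "k \<notin> T" "S = insert k T"
      using insert k unfolding T_def by auto
    from insert.IH[OF T(1,2), of "\<lambda>b i. c b i - c b k * c a i / c a k"]
    obtain u where u: "\<exists>i\<in>T. u i \<noteq> 0" "\<forall>i. i \<notin> T \<longrightarrow> u i = 0"
      "\<And>b. b \<in> A \<Longrightarrow> (\<Sum>i\<in>T. (c b i - c b k * c a i / c a k) * u i) = 0" by blast
    define s where "s = (\<Sum>i\<in>T. c a i * u i)"
    define v where "v = u(k := - s / c a k)"
    have vk: "v k = - s / c a k" by (simp add: v_def)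
    have vs: "(\<Sum>i\<in>T. d i * v i) = (\<Sum>i\<in>T. d i * u i)" for d
      using T by (intro sum.cong) (auto simp: v_def)
    have "(\<Sum>i\<in>S. c b i * v i) = 0" if "b \<in> insert a A" for b
    proof -
      have e: "(\<Sum>i\<in>S. c b i * v i) = (\<Sum>i\<in>T. c b i * u i) - c b k * s / c a k"
        using T by (simp add: vs vk)
      show ?thesis
      proof (cases "b = a")
        case True
        then show ?thesis unfolding e s_def using k by simp
      next
        case False
        then have "0 = (\<Sum>i\<in>T. (c b i - c b k * c a i / c a k) * u i)" using u(3) that by simp
        also have "\<dots> = (\<Sum>i\<in>T. c b i * u i) - (c b k / c a k) * s"
          unfolding s_def by (simp add: sum_subtractf left_diff_distrib sum_distrib_left mult.assoc)
        finally show ?thesis unfolding e by simp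
      qed
    qed
    moreover have "\<exists>i\<in>S. v i \<noteq> 0" using u(1) T by (auto simp: v_def)
    moreover have "\<forall>i. i \<notin> S \<longrightarrow> v i = 0" using u(2) T by (auto simp: v_def)
    ultimately show ?thesis by blast
  qed
qed

text \<open>If \<open>e\<close> has entry \<open>1\<close> at \<open>i\<close>, the form on the left is the extension of \<open>s\<close> that vanishes on \<open>e\<close>.\<close>

lemma extend_form:
  fixes s e v :: "'i \<Rightarrow> complex"
  assumes "finite I" "i \<notin> I"
  shows "(\<Sum>j\<in>insert i I. (s(i := - (\<Sum>j\<in>I. s j * e j))) j * v j) = (\<Sum>j\<in>I. s j * (v j - v i * e j))"
proof -
  let ?t = "s(i := - (\<Sum>j\<in>I. s j * e j))"
  have "(\<Sum>j\<in>insert i I. ?t j * v j) = ?t i * v i + (\<Sum>j\<in>I. ?t j * v j)"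
    using assms by (rule sum.insert)
  also have "(\<Sum>j\<in>I. ?t j * v j) = (\<Sum>j\<in>I. s j * v j)"
  proof (rule sum.cong[OF refl])
    fix j assume "j \<in> I"
    then have "j \<noteq> i" using assms by blast
    then show "?t j * v j = s j * v j" by simp
  qed
  also have "?t i * v i = - (\<Sum>j\<in>I. s j * (v i * e j))"
    by (simp add: sum_distrib_right mult.assoc mult.commute[of "v i"])
  also have "- (\<Sum>j\<in>I. s j * (v i * e j)) + (\<Sum>j\<in>I. s j * v j) = (\<Sum>j\<in>I. s j * (v j - v i * e j))"
    by (simp add: right_diff_distrib sum_subtractf)
  finally show ?thesis .
qed

text \<open>Induction on the number of coordinates. An element \<open>e\<close> of \<open>V\<close> with \<open>e\<^sub>i = 1\<close> reduces \<open>V\<close> to its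
  elements that vanish at \<open>i\<close>, since every form on the other coordinates extends to a form that
  vanishes on \<open>e\<close>. Later \<open>V\<close> consists of the differentials at a point of the polynomials that
  vanish on a variety.\<close>

lemma double_annihilator:
  fixes V :: "('i \<Rightarrow> complex) set"
  assumes "finite I" "(\<lambda>_. 0) \<in> V" "\<And>u v. u \<in> V \<Longrightarrow> v \<in> V \<Longrightarrow> (\<lambda>i. u i + v i) \<in> V"
    "\<And>c u. u \<in> V \<Longrightarrow> (\<lambda>i. c * u i) \<in> V"
    "\<And>s. (\<forall>v\<in>V. (\<Sum>i\<in>I. s i * v i) = 0) \<Longrightarrow> (\<Sum>i\<in>I. s i * w i) = 0"
  shows "\<exists>v\<in>V. \<forall>i\<in>I. v i = w i"
  using assms
proof (induction I arbitrary: V w rule: finite_induct)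
  case empty
  show ?case by (rule bexI[OF _ empty.prems(1)]) simp
next
  case (insert i I)
  note V = insert.prems(1-3) and ann = insert.prems(4)
  show ?case
  proof (cases "\<forall>v\<in>V. v i = 0")
    case True
    have "w i = 0"
    proof -
      have unit: "(\<Sum>j\<in>insert i I. (if j = i then 1 else 0) * v j) = v i" for v :: "'i \<Rightarrow> complex"
      proof -
        have "(\<Sum>j\<in>I. (if j = i then 1 else 0) * v j) = 0"
          using insert.hyps by (intro sum.neutral) auto
        then show ?thesis using insert.hyps by simp
      qed
      show ?thesis
        using ann[of "\<lambda>j. if j = i then 1 else 0"] True unfolding unit by blast
    qed
    have "\<exists>v\<in>V. \<forall>i\<in>I. v i = w i"
    proof (rule insert.IH[OF V])
      fix s assume s: "\<forall>v\<in>V. (\<Sum>i\<in>I. s i * v i) = 0"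
      have z: "(\<Sum>j\<in>insert i I. (s(i := 0)) j * v j) = (\<Sum>j\<in>I. s j * v j)" for v
      proof -
        have "(\<Sum>j\<in>I. (s(i := 0)) j * v j) = (\<Sum>j\<in>I. s j * v j)"
          using insert.hyps(2) by (intro sum.cong[OF refl]) auto
        then show ?thesis using insert.hyps(1,2) by simp
      qed
      show "(\<Sum>i\<in>I. s i * w i) = 0"
        using ann[of "s(i := 0)"] s unfolding z by blast
    qed
    then obtain v where v: "v \<in> V" "\<forall>i\<in>I. v i = w i" by blast
    have "v i = w i" using True v(1) \<open>w i = 0\<close> by simp
    then show ?thesis using v by (intro bexI[OF _ v(1)]) simp
  next
    case False
    then obtain e' where e': "e' \<in> V" "e' i \<noteq> 0" by blast
    define e where "e = (\<lambda>j. (1 / e' i) * e' j)"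
    have "e \<in> V" unfolding e_def by (rule V(3)[OF e'(1)])
    then have e: "e \<in> V" "e i = 1" using e'(2) by (simp_all add: e_def)
    define V' where "V' = {v \<in> V. v i = 0}"
    have V': "(\<lambda>j. v j - v i * e j) \<in> V'" if "v \<in> V" for v
    proof -
      have n: "(\<lambda>j. - v i * e j) \<in> V" by (rule V(3)[OF e(1)])
      have m: "(\<lambda>j. v j + - v i * e j) \<in> V" by (rule V(2)[OF that n])
      have f: "(\<lambda>j. v j + - v i * e j) = (\<lambda>j. v j - v i * e j)" by (rule ext) simp
      have z: "v i - v i * e i = 0" unfolding e(2) by simp
      show ?thesis unfolding V'_def mem_Collect_eq using m[unfolded f] z by (rule conjI)
    qed
    have "\<exists>v\<in>V'. \<forall>j\<in>I. v j = w j - w i * e j"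
    proof (rule insert.IH)
      fix s assume s: "\<forall>v\<in>V'. (\<Sum>i\<in>I. s i * v i) = 0"
      define t where "t = s(i := - (\<Sum>j\<in>I. s j * e j))"
      have t: "(\<Sum>j\<in>insert i I. t j * v j) = (\<Sum>j\<in>I. s j * (v j - v i * e j))" for v
        unfolding t_def by (rule extend_form[OF insert.hyps])
      have "\<forall>v\<in>V. (\<Sum>j\<in>insert i I. t j * v j) = 0"
        unfolding t using bspec[OF s V'] by blast
      from ann[OF this] show "(\<Sum>j\<in>I. s j * (w j - w i * e j)) = 0" unfolding t .
    next
      show "(\<lambda>_. 0) \<in> V'" using V(1) by (simp add: V'_def)
    next
      fix u v assume "u \<in> V'" "v \<in> V'"
      then show "(\<lambda>i. u i + v i) \<in> V'" using V(2)[of u v] by (simp add: V'_def)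
    next
      fix c u assume "u \<in> V'"
      then show "(\<lambda>i. c * u i) \<in> V'" using V(3)[of u c] by (simp add: V'_def)
    qed
    then obtain v where v: "v \<in> V" "v i = 0" "\<forall>j\<in>I. v j = w j - w i * e j"
      unfolding V'_def by blast
    have "(\<lambda>j. v j + w i * e j) \<in> V" by (rule V(2)[OF v(1) V(3)[OF e(1)]])
    then show ?thesis
    proof (rule bexI[rotated])
      show "\<forall>j\<in>insert i I. v j + w i * e j = w j"
      proof
        fix j assume "j \<in> insert i I"
        then show "v j + w i * e j = w j" using v(2,3) e(2) by (cases "j = i") auto
      qed
    qed
  qed
qed

section \<open>Rings of regular functions\<close>

text \<open>The entries of a family of matrices are polynomials either in the coordinates of a chart or in one
  parameter. Both cases are treated together by letting the entries belong to a ring of functions.\<close>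

definition function_ring :: "('a \<Rightarrow> complex) set \<Rightarrow> bool" where
  "function_ring R \<longleftrightarrow> (\<forall>a. (\<lambda>_. a) \<in> R) \<and> (\<forall>f\<in>R. \<forall>g\<in>R. (\<lambda>x. f x + g x) \<in> R) \<and>
     (\<forall>f\<in>R. \<forall>g\<in>R. (\<lambda>x. f x * g x) \<in> R)"

lemma function_ringD:
  assumes "function_ring R"
  shows "(\<lambda>_. a) \<in> R" "f \<in> R \<Longrightarrow> g \<in> R \<Longrightarrow> (\<lambda>x. f x + g x) \<in> R"
    "f \<in> R \<Longrightarrow> g \<in> R \<Longrightarrow> (\<lambda>x. f x * g x) \<in> R"
  using assms unfolding function_ring_def by blast+

lemma function_ring_sum:
  assumes "function_ring R" "finite I" "\<And>i. i \<in> I \<Longrightarrow> f i \<in> R"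
  shows "(\<lambda>x. \<Sum>i\<in>I. f i x) \<in> R"
  using assms(2,3)
proof (induction I rule: finite_induct)
  case empty
  then show ?case using function_ringD(1)[OF assms(1)] by simp
next
  case (insert i I)
  have "(\<lambda>x. f i x + (\<Sum>i\<in>I. f i x)) \<in> R"
    by (rule function_ringD(2)[OF assms(1)]) (use insert in simp_all)
  then show ?case using insert.hyps by simp
qed

lemma function_ring_prod:
  assumes "function_ring R" "finite I" "\<And>i. i \<in> I \<Longrightarrow> f i \<in> R"
  shows "(\<lambda>x. \<Prod>i\<in>I. f i x) \<in> R"
  using assms(2,3)
proof (induction I rule: finite_induct)
  case empty
  then show ?case using function_ringD(1)[OF assms(1)] by simp
next
  case (insert i I)
  have "(\<lambda>x. f i x * (\<Prod>i\<in>I. f i x)) \<in> R"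
    by (rule function_ringD(3)[OF assms(1)]) (use insert in simp_all)
  then show ?case using insert.hyps by simp
qed

lemma function_ring_power:
  assumes "function_ring R" "f \<in> R"
  shows "(\<lambda>x. f x ^ m) \<in> R"
proof (induction m)
  case 0
  then show ?case using function_ringD(1)[OF assms(1)] by simp
next
  case (Suc m)
  then show ?case using function_ringD(3)[OF assms Suc] by simp
qed

definition mat_over :: "('a \<Rightarrow> complex) set \<Rightarrow> nat \<Rightarrow> nat \<Rightarrow> ('a \<Rightarrow> complex mat) \<Rightarrow> bool" where
  "mat_over R r c M \<longleftrightarrow> (\<forall>x. M x \<in> carrier_mat r c) \<and> (\<forall>i<r. \<forall>j<c. (\<lambda>x. M x $$ (i, j)) \<in> R)"

lemma mat_overD:
  assumes "mat_over R r c M"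
  shows "M x \<in> carrier_mat r c" "i < r \<Longrightarrow> j < c \<Longrightarrow> (\<lambda>x. M x $$ (i, j)) \<in> R"
  using assms by (auto simp: mat_over_def)

lemma mat_overI:
  assumes "\<And>x. M x \<in> carrier_mat r c" "\<And>i j. i < r \<Longrightarrow> j < c \<Longrightarrow> (\<lambda>x. M x $$ (i, j)) \<in> R"
  shows "mat_over R r c M"
  using assms by (auto simp: mat_over_def)

lemma mat_over_const:
  assumes "function_ring R" "A \<in> carrier_mat r c"
  shows "mat_over R r c (\<lambda>_. A)"
  using assms function_ringD(1)[OF assms(1)] by (auto simp: mat_over_def)

lemma mat_over_mult:
  assumes R: "function_ring R" and A: "mat_over R r k A" and B: "mat_over R k c B"
  shows "mat_over R r c (\<lambda>x. A x * B x)"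
proof (rule mat_overI)
  show "A x * B x \<in> carrier_mat r c" for x
    by (rule mult_carrier_mat[OF mat_overD(1)[OF A] mat_overD(1)[OF B]])
  fix i j assume ij: "i < r" "j < c"
  have "(A x * B x) $$ (i, j) = (\<Sum>l\<in>{0..<k}. A x $$ (i, l) * B x $$ (l, j))" for x
    using mat_overD(1)[OF A, of x] mat_overD(1)[OF B, of x] ij by (auto simp: scalar_prod_def)
  moreover have "(\<lambda>x. \<Sum>l\<in>{0..<k}. A x $$ (i, l) * B x $$ (l, j)) \<in> R"
    by (rule function_ring_sum[OF R], simp, rule function_ringD(3)[OF R])
      (use mat_overD(2)[OF A] mat_overD(2)[OF B] ij in auto)
  ultimately show "(\<lambda>x. (A x * B x) $$ (i, j)) \<in> R" by simp
qed

lemma mat_over_add: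
  assumes R: "function_ring R" and A: "mat_over R r c A" and B: "mat_over R r c B"
  shows "mat_over R r c (\<lambda>x. A x + B x)"
proof (rule mat_overI)
  show "A x + B x \<in> carrier_mat r c" for x using mat_overD(1)[OF A] mat_overD(1)[OF B] by auto
  fix i j assume ij: "i < r" "j < c"
  have "(A x + B x) $$ (i, j) = A x $$ (i, j) + B x $$ (i, j)" for x
    using mat_overD(1)[OF A, of x] mat_overD(1)[OF B, of x] ij by auto
  then show "(\<lambda>x. (A x + B x) $$ (i, j)) \<in> R"
    using function_ringD(2)[OF R mat_overD(2)[OF A ij] mat_overD(2)[OF B ij]] by simp
qed

lemma mat_over_smult:
  assumes R: "function_ring R" and f: "f \<in> R" and A: "mat_over R r c A"
  shows "mat_over R r c (\<lambda>x. f x \<cdot>\<^sub>m A x)"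
proof (rule mat_overI)
  show "f x \<cdot>\<^sub>m A x \<in> carrier_mat r c" for x using mat_overD(1)[OF A] by auto
  fix i j assume ij: "i < r" "j < c"
  have "(f x \<cdot>\<^sub>m A x) $$ (i, j) = f x * A x $$ (i, j)" for x
    using mat_overD(1)[OF A, of x] ij by auto
  then show "(\<lambda>x. (f x \<cdot>\<^sub>m A x) $$ (i, j)) \<in> R"
    using function_ringD(3)[OF R f mat_overD(2)[OF A ij]] by simp
qed

lemma mat_over_four_block:
  assumes A: "mat_over R r1 c1 A" and B: "mat_over R r1 c2 B"
    and C: "mat_over R r2 c1 C" and D: "mat_over R r2 c2 D"
  shows "mat_over R (r1 + r2) (c1 + c2) (\<lambda>x. four_block_mat (A x) (B x) (C x) (D x))"
proof (rule mat_overI)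
  note car = mat_overD(1)[OF A] mat_overD(1)[OF B] mat_overD(1)[OF C] mat_overD(1)[OF D]
  show "four_block_mat (A x) (B x) (C x) (D x) \<in> carrier_mat (r1 + r2) (c1 + c2)" for x
    using car[of x] by simp
  fix i j assume ij: "i < r1 + r2" "j < c1 + c2"
  have "four_block_mat (A x) (B x) (C x) (D x) $$ (i, j) =
      (if i < r1 then if j < c1 then A x $$ (i, j) else B x $$ (i, j - c1)
       else if j < c1 then C x $$ (i - r1, j) else D x $$ (i - r1, j - c1))" for x
    using car(1,4)[of x] ij by auto
  then show "(\<lambda>x. four_block_mat (A x) (B x) (C x) (D x) $$ (i, j)) \<in> R"
    using mat_overD(2)[OF A, of i j] mat_overD(2)[OF B, of i "j - c1"]
      mat_overD(2)[OF C, of "i - r1" j] mat_overD(2)[OF D, of "i - r1" "j - c1"] ij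
    by (cases "i < r1"; cases "j < c1") auto
qed

lemma det_over:
  assumes R: "function_ring R" and A: "mat_over R n n A"
  shows "(\<lambda>x. det (A x)) \<in> R"
proof -
  have "(\<lambda>x. \<Sum>p\<in>{p. p permutes {0..<n}}. signof p * (\<Prod>i\<in>{0..<n}. A x $$ (i, p i))) \<in> R"
  proof (rule function_ring_sum[OF R], rule finite_permutations, simp)
    fix p assume "p \<in> {p. p permutes {0..<n}}"
    then have "p i < n" if "i < n" for i using that permutes_in_image[of p "{0..<n}" i] by auto
    then show "(\<lambda>x. signof p * (\<Prod>i\<in>{0..<n}. A x $$ (i, p i))) \<in> R"
      by (intro function_ringD(3)[OF R] function_ringD(1)[OF R] function_ring_prod[OF R])
        (use mat_overD(2)[OF A] in auto)
  qed
  then show ?thesis by (simp add: det_def'[OF mat_overD(1)[OF A]])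
qed

lemma adj_mat_over:
  assumes R: "function_ring R" and A: "mat_over R n n A"
  shows "mat_over R n n (\<lambda>x. adj_mat (A x))"
proof (rule mat_overI)
  show "adj_mat (A x) \<in> carrier_mat n n" for x using adj_mat(1)[OF mat_overD(1)[OF A]] .
  fix i j assume ij: "i < n" "j < n"
  have d: "mat_over R (n - 1) (n - 1) (\<lambda>x. mat_delete (A x) j i)"
  proof (rule mat_overI)
    show "mat_delete (A x) j i \<in> carrier_mat (n - 1) (n - 1)" for x
      by (rule mat_delete_carrier[OF mat_overD(1)[OF A]])
    fix i' j' assume "i' < n - 1" "j' < n - 1"
    then have "mat_delete (A x) j i $$ (i', j') =
        A x $$ (if i' < j then i' else Suc i', if j' < i then j' else Suc j')" for x
      using mat_overD(1)[OF A, of x] by (simp add: mat_delete_def)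
    moreover have "(\<lambda>x. A x $$ (if i' < j then i' else Suc i', if j' < i then j' else Suc j')) \<in> R"
      using \<open>i' < n - 1\<close> \<open>j' < n - 1\<close> by (intro mat_overD(2)[OF A]) auto
    ultimately show "(\<lambda>x. mat_delete (A x) j i $$ (i', j')) \<in> R" by simp
  qed
  have "adj_mat (A x) $$ (i, j) = (-1) ^ (j + i) * det (mat_delete (A x) j i)" for x
    using mat_overD(1)[OF A, of x] ij by (simp add: adj_mat_def cofactor_def)
  then show "(\<lambda>x. adj_mat (A x) $$ (i, j)) \<in> R"
    using function_ringD(3)[OF R function_ringD(1)[OF R] det_over[OF R d]] by simp
qed

lemma function_ring_poly_fun: "function_ring (poly_fun r c)"
  unfolding function_ring_def by (auto intro: poly_fun.intros)

definition line_ring :: "(complex \<Rightarrow> complex) set" where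
  "line_ring = range poly"

lemma function_ring_line: "function_ring line_ring"
proof -
  have "(\<lambda>_. a) \<in> line_ring" for a
    unfolding line_ring_def by (rule image_eqI[of _ _ "[:a:]"]) auto
  moreover have "(\<lambda>x. f x + g x) \<in> line_ring" "(\<lambda>x. f x * g x) \<in> line_ring"
    if fg: "f \<in> line_ring" "g \<in> line_ring" for f g
  proof -
    obtain p q where pq: "f = poly p" "g = poly q" using fg by (auto simp: line_ring_def)
    show "(\<lambda>x. f x + g x) \<in> line_ring"
      unfolding line_ring_def pq by (rule image_eqI[of _ _ "p + q"]) auto
    show "(\<lambda>x. f x * g x) \<in> line_ring"
      unfolding line_ring_def pq by (rule image_eqI[of _ _ "p * q"]) auto
  qed
  ultimately show ?thesis unfolding function_ring_def by blast
qed

lemma id_in_line_ring: "(\<lambda>t. t) \<in> line_ring"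
  unfolding line_ring_def by (rule image_eqI[of _ _ "[:0, 1:]"]) auto

lemma poly_fun_comp:
  assumes R: "function_ring R" and M: "mat_over R r c M" and f: "f \<in> poly_fun r c"
  shows "(\<lambda>x. f (M x)) \<in> R"
  using f
proof (induction rule: poly_fun.induct)
  case (const a)
  then show ?case using function_ringD(1)[OF R] by simp
next
  case (entry i j)
  then show ?case using mat_overD(2)[OF M] by simp
next
  case (add f g)
  then show ?case using function_ringD(2)[OF R] by simp
next
  case (mult f g)
  then show ?case using function_ringD(3)[OF R] by simp
qed

text \<open>Clearing denominators: a polynomial evaluated at \<open>M\<^sub>2 M\<^sub>1\<inverse>\<close> becomes regular after
  multiplication by a power of \<open>det M\<^sub>1\<close>. This is how changes of chart act on polynomials.\<close>

lemma poly_fun_fraction: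
  assumes R: "function_ring R" and M1: "mat_over R k k M1" and M2: "mat_over R r k M2"
    and f: "f \<in> poly_fun r k"
  shows "\<exists>F\<in>R. \<exists>m. \<forall>x. det (M1 x) \<noteq> 0 \<longrightarrow>
    F x = det (M1 x) ^ m * f (M2 x * ((1 / det (M1 x)) \<cdot>\<^sub>m adj_mat (M1 x)))"
  using f
proof (induction rule: poly_fun.induct)
  case (const a)
  show ?case by (rule bexI[of _ "\<lambda>_. a"], rule exI[of _ 0]) (simp_all add: function_ringD(1)[OF R])
next
  case (entry i j)
  have "(\<lambda>x. (M2 x * adj_mat (M1 x)) $$ (i, j)) \<in> R"
    by (rule mat_overD(2)[OF mat_over_mult[OF R M2 adj_mat_over[OF R M1]] entry])
  moreover have "(M2 x * adj_mat (M1 x)) $$ (i, j) = det (M1 x) ^ 1 *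
      (M2 x * ((1 / det (M1 x)) \<cdot>\<^sub>m adj_mat (M1 x))) $$ (i, j)" if "det (M1 x) \<noteq> 0" for x
  proof -
    have "M2 x * ((1 / det (M1 x)) \<cdot>\<^sub>m adj_mat (M1 x)) = (1 / det (M1 x)) \<cdot>\<^sub>m (M2 x * adj_mat (M1 x))"
      by (rule mult_smult_distrib[OF mat_overD(1)[OF M2] adj_mat(1)[OF mat_overD(1)[OF M1]]])
    moreover have "M2 x * adj_mat (M1 x) \<in> carrier_mat r k"
      using mat_overD(1)[OF M2, of x] adj_mat(1)[OF mat_overD(1)[OF M1, of x]] by simp
    ultimately show ?thesis using that entry by (simp only: index_smult_mat carrier_matD) simp
  qed
  ultimately show ?case by (intro bexI[of _ "\<lambda>x. (M2 x * adj_mat (M1 x)) $$ (i, j)"] exI[of _ 1]) auto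
next
  case (add f g)
  let ?d = "\<lambda>x. det (M1 x)" and ?Z = "\<lambda>x. M2 x * ((1 / det (M1 x)) \<cdot>\<^sub>m adj_mat (M1 x))"
  from add.IH obtain F m G l where F: "F \<in> R" "\<And>x. ?d x \<noteq> 0 \<Longrightarrow> F x = ?d x ^ m * f (?Z x)"
    and G: "G \<in> R" "\<And>x. ?d x \<noteq> 0 \<Longrightarrow> G x = ?d x ^ l * g (?Z x)" by blast
  note dR = function_ring_power[OF R det_over[OF R M1]]
  have "(\<lambda>x. ?d x ^ l * F x + ?d x ^ m * G x) \<in> R"
    by (rule function_ringD(2)[OF R function_ringD(3)[OF R dR F(1)] function_ringD(3)[OF R dR G(1)]])
  moreover have "?d x ^ l * F x + ?d x ^ m * G x = ?d x ^ (m + l) * (f (?Z x) + g (?Z x))"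
    if "?d x \<noteq> 0" for x
    unfolding F(2)[OF that] G(2)[OF that] by (simp add: power_add algebra_simps)
  ultimately show ?case by (intro bexI[of _ "\<lambda>x. ?d x ^ l * F x + ?d x ^ m * G x"] exI[of _ "m + l"]) auto
next
  case (mult f g)
  let ?d = "\<lambda>x. det (M1 x)" and ?Z = "\<lambda>x. M2 x * ((1 / det (M1 x)) \<cdot>\<^sub>m adj_mat (M1 x))"
  from mult.IH obtain F m G l where F: "F \<in> R" "\<And>x. ?d x \<noteq> 0 \<Longrightarrow> F x = ?d x ^ m * f (?Z x)"
    and G: "G \<in> R" "\<And>x. ?d x \<noteq> 0 \<Longrightarrow> G x = ?d x ^ l * g (?Z x)" by blast
  have "(\<lambda>x. F x * G x) \<in> R" by (rule function_ringD(3)[OF R F(1) G(1)])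
  moreover have "F x * G x = ?d x ^ (m + l) * (f (?Z x) * g (?Z x))" if "?d x \<noteq> 0" for x
    unfolding F(2)[OF that] G(2)[OF that] by (simp add: power_add algebra_simps)
  ultimately show ?case by (intro bexI[of _ "\<lambda>x. F x * G x"] exI[of _ "m + l"]) auto
qed

section \<open>Charts of the Grassmannian\<close>

definition graph_mat :: "nat \<Rightarrow> nat \<Rightarrow> complex mat \<Rightarrow> complex mat" where
  "graph_mat k N X = mat N k (\<lambda>(i, j). if i < k then (if i = j then 1 else 0) else X $$ (i - k, j))"

definition upper_block :: "nat \<Rightarrow> complex mat \<Rightarrow> complex mat" where
  "upper_block k M = mat k k (\<lambda>(i, j). M $$ (i, j))"

definition lower_block :: "nat \<Rightarrow> nat \<Rightarrow> complex mat \<Rightarrow> complex mat" where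
  "lower_block k N M = mat (N - k) k (\<lambda>(i, j). M $$ (i + k, j))"

lemma block_carrier [simp]:
  "graph_mat k N X \<in> carrier_mat N k" "upper_block k M \<in> carrier_mat k k"
  "lower_block k N M \<in> carrier_mat (N - k) k"
  by (auto simp: graph_mat_def upper_block_def lower_block_def)

lemma graph_mat_mult_vec:
  assumes "k \<le> N" "X \<in> carrier_mat (N - k) k" "y \<in> carrier_vec k"
  shows "graph_mat k N X *\<^sub>v y = y @\<^sub>v (X *\<^sub>v y)"
proof (rule eq_vecI)
  show "dim_vec (graph_mat k N X *\<^sub>v y) = dim_vec (y @\<^sub>v (X *\<^sub>v y))"
    using assms by (simp add: graph_mat_def)
  fix i assume "i < dim_vec (y @\<^sub>v (X *\<^sub>v y))"
  then have i: "i < N" using assms by simp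
  show "(graph_mat k N X *\<^sub>v y) $ i = (y @\<^sub>v (X *\<^sub>v y)) $ i"
  proof (cases "i < k")
    case True
    then have "row (graph_mat k N X) i = unit_vec k i"
      using assms by (intro eq_vecI) (auto simp: graph_mat_def)
    then show ?thesis using True i assms by (simp add: graph_mat_def)
  next
    case False
    then have "row (graph_mat k N X) i = row X (i - k)"
      using assms i by (intro eq_vecI) (auto simp: graph_mat_def)
    then show ?thesis using False i assms by (simp add: graph_mat_def)
  qed
qed

lemma gr_chart_eq_col_image:
  assumes "k \<le> N" "P \<in> carrier_mat N N" "X \<in> carrier_mat (N - k) k"
  shows "gr_chart k P X = col_image k (P * graph_mat k N X)"
proof -
  have "P *\<^sub>v (y @\<^sub>v (X *\<^sub>v y)) = P * graph_mat k N X *\<^sub>v y" if "y \<in> carrier_vec k" for y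
    using assoc_mult_mat_vec[OF assms(2) block_carrier(1) that] graph_mat_mult_vec[OF assms(1,3) that]
    by simp
  then have "col_image k (P * graph_mat k N X) = (\<lambda>y. P *\<^sub>v (y @\<^sub>v (X *\<^sub>v y))) ` carrier_vec k"
    unfolding col_image_def by (intro image_cong) auto
  then show ?thesis unfolding gr_chart_def by auto
qed

lemma block_mult_vec:
  assumes "k \<le> N" "M \<in> carrier_mat N k" "y \<in> carrier_vec k"
  shows "M *\<^sub>v y = (upper_block k M *\<^sub>v y) @\<^sub>v (lower_block k N M *\<^sub>v y)"
proof (rule eq_vecI)
  show "dim_vec (M *\<^sub>v y) = dim_vec ((upper_block k M *\<^sub>v y) @\<^sub>v (lower_block k N M *\<^sub>v y))"
    using assms by (simp add: upper_block_def lower_block_def)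
  fix i assume "i < dim_vec ((upper_block k M *\<^sub>v y) @\<^sub>v (lower_block k N M *\<^sub>v y))"
  then have i: "i < N" using assms by (simp add: upper_block_def lower_block_def)
  have "row (if i < k then upper_block k M else lower_block k N M) (if i < k then i else i - k) = row M i"
    using assms i by (intro eq_vecI) (auto simp: upper_block_def lower_block_def)
  then show "(M *\<^sub>v y) $ i = ((upper_block k M *\<^sub>v y) @\<^sub>v (lower_block k N M *\<^sub>v y)) $ i"
    using i assms by (auto simp: upper_block_def lower_block_def split: if_splits)
qed

lemma frames_inverse:
  assumes "P \<in> frames N"
  obtains Q where "Q \<in> carrier_mat N N" "P * Q = 1\<^sub>m N" "Q * P = 1\<^sub>m N"
proof -
  have P: "P \<in> carrier_mat N N" "invertible_mat P" using assms by (auto simp: frames_def)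
  then obtain Q where Q: "P * Q = 1\<^sub>m N" "Q * P = 1\<^sub>m (dim_row Q)"
    unfolding invertible_mat_def inverts_mat_def by auto
  have "dim_col Q = N" using arg_cong[OF Q(1), of dim_col] by simp
  moreover have "dim_row Q = N" using arg_cong[OF Q(2), of dim_col] P by simp
  ultimately show ?thesis using that[of Q] Q by auto
qed

lemma framesI:
  assumes "P \<in> carrier_mat N N" "Q \<in> carrier_mat N N" "P * Q = 1\<^sub>m N" "Q * P = 1\<^sub>m N"
  shows "P \<in> frames N"
  using assms by (auto simp: frames_def invertible_mat_def inverts_mat_def)

lemma frames_inj:
  assumes "P \<in> frames N" "u \<in> carrier_vec N" "v \<in> carrier_vec N" "P *\<^sub>v u = P *\<^sub>v v"
  shows "u = v"
proof -
  obtain Q where Q: "Q \<in> carrier_mat N N" "Q * P = 1\<^sub>m N" using frames_inverse[OF assms(1)] by metis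
  have P: "P \<in> carrier_mat N N" using assms by (simp add: frames_def)
  have "Q *\<^sub>v (P *\<^sub>v u) = Q *\<^sub>v (P *\<^sub>v v)" using assms by simp
  then show ?thesis
    using assoc_mult_mat_vec[OF Q(1) P assms(2)] assoc_mult_mat_vec[OF Q(1) P assms(3)] Q assms by simp
qed

lemma mat_eqI_vec:
  fixes A B :: "complex mat"
  assumes "A \<in> carrier_mat r k" "B \<in> carrier_mat r k"
    and "\<And>y. y \<in> carrier_vec k \<Longrightarrow> A *\<^sub>v y = B *\<^sub>v y"
  shows "A = B"
proof (rule eq_matI)
  fix i j assume "i < dim_row B" "j < dim_col B"
  then have ij: "i < r" "j < k" using assms by auto
  have "col A j = col B j"
    using assms(3)[of "unit_vec k j"] mult_mat_unit_vec[OF assms(1) ij(2)] mult_mat_unit_vec[OF assms(2) ij(2)]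
    by simp
  then have "col A j $ i = col B j $ i" by simp
  then show "A $$ (i, j) = B $$ (i, j)" using assms ij by simp
qed (use assms in auto)

lemma surj_imp_det_nonzero:
  fixes U :: "complex mat"
  assumes U: "U \<in> carrier_mat k k" and surj: "\<And>x. x \<in> carrier_vec k \<Longrightarrow> \<exists>y\<in>carrier_vec k. U *\<^sub>v y = x"
  shows "det U \<noteq> 0"
proof
  assume "det U = 0"
  then have "det U\<^sup>T = 0" using det_transpose[OF U] by simp
  then obtain z where z: "z \<in> carrier_vec k" "z \<noteq> 0\<^sub>v k" "U\<^sup>T *\<^sub>v z = 0\<^sub>v k"
    using det_0_iff_vec_prod_zero_field[of "U\<^sup>T" k] U by auto
  have "z $ i = 0" if i: "i < k" for i
  proof -
    obtain y where y: "y \<in> carrier_vec k" "U *\<^sub>v y = unit_vec k i" using surj[of "unit_vec k i"] by auto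
    have "z $ i = z \<bullet> (U *\<^sub>v y)" using y z i by simp
    also have "\<dots> = (U\<^sup>T *\<^sub>v z) \<bullet> y"
      using transpose_vec_mult_scalar[OF U y(1) z(1)] by simp
    finally show ?thesis using z y by simp
  qed
  then have "z = 0\<^sub>v k" using z by (intro eq_vecI) auto
  then show False using z by simp
qed

text \<open>A change of the columns of \<open>M\<close> by an invertible matrix does not change their span, and the graph
  of \<open>X\<close> is the span for the choice whose upper block is the identity.\<close>

lemma gr_chart_iff:
  assumes k: "k \<le> N" and P: "P \<in> frames N" and M: "M \<in> carrier_mat N k"
    and X: "X \<in> carrier_mat (N - k) k"
  shows "col_image k (P * M) = gr_chart k P X \<longleftrightarrow>
    det (upper_block k M) \<noteq> 0 \<and> lower_block k N M = X * upper_block k M"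
proof
  let ?U = "upper_block k M" and ?W = "lower_block k N M"
  have Pc: "P \<in> carrier_mat N N" using P by (simp add: frames_def)
  have PM: "P * M *\<^sub>v y = P *\<^sub>v ((?U *\<^sub>v y) @\<^sub>v (?W *\<^sub>v y))" if "y \<in> carrier_vec k" for y
    using assoc_mult_mat_vec[OF Pc M that] block_mult_vec[OF k M that] by simp
  have car: "(u @\<^sub>v w) \<in> carrier_vec N" if "u \<in> carrier_vec k" "w \<in> carrier_vec (N - k)"
    for u w :: "complex vec" using that k by (metis append_carrier_vec le_add_diff_inverse)
  have cU: "?U *\<^sub>v y \<in> carrier_vec k" if "y \<in> carrier_vec k" for y
    by (rule mult_mat_vec_carrier[OF block_carrier(2) that])
  have cW: "?W *\<^sub>v y \<in> carrier_vec (N - k)" if "y \<in> carrier_vec k" for y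
    by (rule mult_mat_vec_carrier[OF block_carrier(3) that])
  have cX: "X *\<^sub>v y \<in> carrier_vec (N - k)" if "y \<in> carrier_vec k" for y
    by (rule mult_mat_vec_carrier[OF X that])
  {
    assume eq: "col_image k (P * M) = gr_chart k P X"
    have inv: "x = ?U *\<^sub>v y \<and> X *\<^sub>v x = ?W *\<^sub>v y"
      if "x \<in> carrier_vec k" "y \<in> carrier_vec k" "P *\<^sub>v (x @\<^sub>v (X *\<^sub>v x)) = P * M *\<^sub>v y" for x y
    proof -
      have "x @\<^sub>v (X *\<^sub>v x) = (?U *\<^sub>v y) @\<^sub>v (?W *\<^sub>v y)"
        by (rule frames_inj[OF P car[OF that(1) cX[OF that(1)]] car[OF cU cW]])
          (use that PM in auto)
      then show ?thesis using append_vec_eq[OF that(1) cU[OF that(2)]] by blast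
    qed
    have "\<exists>y\<in>carrier_vec k. ?U *\<^sub>v y = x" if x: "x \<in> carrier_vec k" for x
    proof -
      have "P *\<^sub>v (x @\<^sub>v (X *\<^sub>v x)) \<in> col_image k (P * M)" unfolding eq gr_chart_def using x by auto
      then obtain y where y: "y \<in> carrier_vec k" "P *\<^sub>v (x @\<^sub>v (X *\<^sub>v x)) = P * M *\<^sub>v y"
        by (auto simp: col_image_def)
      show ?thesis using inv[OF x y] y by auto
    qed
    then have "det ?U \<noteq> 0" by (rule surj_imp_det_nonzero[OF block_carrier(2)])
    moreover have "?W = X * ?U"
    proof (rule mat_eqI_vec[of _ "N - k" k])
      fix y :: "complex vec" assume y: "y \<in> carrier_vec k"
      then have "P * M *\<^sub>v y \<in> gr_chart k P X" unfolding eq[symmetric] by (auto simp: col_image_def)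
      then obtain x where x: "x \<in> carrier_vec k" "P *\<^sub>v (x @\<^sub>v (X *\<^sub>v x)) = P * M *\<^sub>v y"
        by (auto simp: gr_chart_def)
      show "?W *\<^sub>v y = X * ?U *\<^sub>v y"
        using inv[OF x(1) y x(2)] assoc_mult_mat_vec[OF X block_carrier(2) y, of M] by metis
    qed (use X in \<open>auto intro: mult_carrier_mat[OF X]\<close>)
    ultimately show "det ?U \<noteq> 0 \<and> ?W = X * ?U" by blast
  }
  {
    assume a: "det ?U \<noteq> 0 \<and> ?W = X * ?U"
    note I = det_nonzero_inverse[OF block_carrier(2)[of k M]]
    have PM': "P * M *\<^sub>v y = P *\<^sub>v ((?U *\<^sub>v y) @\<^sub>v (X *\<^sub>v (?U *\<^sub>v y)))" if "y \<in> carrier_vec k" for y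
      using PM[OF that] a assoc_mult_mat_vec[OF X block_carrier(2) that] by simp
    show "col_image k (P * M) = gr_chart k P X"
    proof
      show "col_image k (P * M) \<subseteq> gr_chart k P X"
        unfolding col_image_def gr_chart_def using PM' cU by blast
      show "gr_chart k P X \<subseteq> col_image k (P * M)"
      proof
        fix v assume "v \<in> gr_chart k P X"
        then obtain x where x: "x \<in> carrier_vec k" "v = P *\<^sub>v (x @\<^sub>v (X *\<^sub>v x))"
          by (auto simp: gr_chart_def)
        define y where "y = ((1 / det ?U) \<cdot>\<^sub>m adj_mat ?U) *\<^sub>v x"
        have Ic: "(1 / det ?U) \<cdot>\<^sub>m adj_mat ?U \<in> carrier_mat k k" using I(1) a by blast
        have y: "y \<in> carrier_vec k" unfolding y_def by (rule mult_mat_vec_carrier[OF Ic x(1)])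
        have "?U *\<^sub>v y = (?U * ((1 / det ?U) \<cdot>\<^sub>m adj_mat ?U)) *\<^sub>v x"
          unfolding y_def by (rule assoc_mult_mat_vec[OF block_carrier(2) Ic x(1), symmetric])
        also have "?U * ((1 / det ?U) \<cdot>\<^sub>m adj_mat ?U) = 1\<^sub>m k" using I(2) a by blast
        finally have "?U *\<^sub>v y = x" using x by simp
        then have "v = P * M *\<^sub>v y" using PM'[OF y] x by simp
        then show "v \<in> col_image k (P * M)" using y by (auto simp: col_image_def)
      qed
    qed
  }
qed

lemma grassmannian_subset_eq:
  assumes "L \<in> grassmannian k N" "L' \<in> grassmannian k N" "L \<subseteq> L'"
  shows "L = L'"
proof -
  obtain A B where A: "inj_mat N k A" "L = col_image k A" and B: "inj_mat N k B" "L' = col_image k B"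
    using assms(1,2) unfolding grassmannian_iff by blast
  have Ac: "A \<in> carrier_mat N k" and Bc: "B \<in> carrier_mat N k" using A B by (auto simp: inj_mat_def)
  have "\<exists>c\<in>carrier_vec k. B *\<^sub>v c = col A j" if "j < k" for j
  proof -
    have "col A j \<in> L" unfolding A(2) col_image_def using mult_mat_unit_vec[OF Ac that]
      by (metis image_eqI unit_vec_carrier)
    then have "col A j \<in> (\<lambda>c. B *\<^sub>v c) ` carrier_vec k"
      using assms(3) unfolding B(2) col_image_def by blast
    then show ?thesis by (metis imageE)
  qed
  then obtain c where c: "\<And>j. j < k \<Longrightarrow> c j \<in> carrier_vec k \<and> B *\<^sub>v c j = col A j" by metis
  define C where "C = mat k k (\<lambda>(i, j). c j $ i)"
  have C: "C \<in> carrier_mat k k" by (simp add: C_def)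
  have BC: "A = B * C"
  proof (rule eq_matI)
    fix i j assume "i < dim_row (B * C)" "j < dim_col (B * C)"
    then have ij: "i < N" "j < k" using Bc C by auto
    have "col C j = c j" using c[OF ij(2)] ij unfolding C_def by (intro eq_vecI) auto
    then have "(B * C) $$ (i, j) = (B *\<^sub>v c j) $ i" using ij Bc C by simp
    also have "\<dots> = A $$ (i, j)" using c[OF ij(2)] ij Ac by simp
    finally show "A $$ (i, j) = (B * C) $$ (i, j)" by simp
  qed (use Ac Bc C in auto)
  have "inj_mat k k C"
    unfolding inj_mat_def
  proof (intro conjI C ballI impI)
    fix y assume y: "y \<in> carrier_vec k" "C *\<^sub>v y = 0\<^sub>v k"
    have "A *\<^sub>v y = 0\<^sub>v N" unfolding BC
      using assoc_mult_mat_vec[OF Bc C y(1)] y(2) mult_mat_0_vec[OF Bc] by simp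
    then show "y = 0\<^sub>v k" using A(1) y(1) by (simp add: inj_mat_def)
  qed
  then have "det C \<noteq> 0" using inj_mat_det[OF C] by blast
  note I = det_nonzero_inverse[OF C this]
  have "L' \<subseteq> L"
  proof
    fix v assume "v \<in> L'"
    then obtain y where y: "y \<in> carrier_vec k" "v = B *\<^sub>v y" unfolding B(2) by (auto simp: col_image_def)
    let ?x = "((1 / det C) \<cdot>\<^sub>m adj_mat C) *\<^sub>v y"
    have x: "?x \<in> carrier_vec k" by (rule mult_mat_vec_carrier[OF I(1) y(1)])
    have "C *\<^sub>v ?x = y" using assoc_mult_mat_vec[OF C I(1) y(1)] I(2) y(1) by simp
    then have "A *\<^sub>v ?x = v" unfolding BC using assoc_mult_mat_vec[OF Bc C x] y(2) by simp
    then show "v \<in> L" unfolding A(2) col_image_def using x by blast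
  qed
  then show ?thesis using assms(3) by blast
qed

lemma upper_graph [simp]: "k \<le> N \<Longrightarrow> upper_block k (graph_mat k N X) = 1\<^sub>m k"
  by (rule eq_matI) (auto simp: upper_block_def graph_mat_def)

lemma lower_graph [simp]:
  "k \<le> N \<Longrightarrow> X \<in> carrier_mat (N - k) k \<Longrightarrow> lower_block k N (graph_mat k N X) = X"
  by (rule eq_matI) (auto simp: lower_block_def graph_mat_def)

lemma inj_mat_graph:
  assumes "k \<le> N" "P \<in> frames N" "X \<in> carrier_mat (N - k) k"
  shows "inj_mat N k (P * graph_mat k N X)"
proof -
  have P: "P \<in> carrier_mat N N" using assms by (simp add: frames_def)
  have "y = 0\<^sub>v k" if y: "y \<in> carrier_vec k" "P * graph_mat k N X *\<^sub>v y = 0\<^sub>v N" for y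
  proof -
    have g: "graph_mat k N X *\<^sub>v y \<in> carrier_vec N" by (rule mult_mat_vec_carrier[OF block_carrier(1) y(1)])
    have "P *\<^sub>v (graph_mat k N X *\<^sub>v y) = P *\<^sub>v 0\<^sub>v N"
      using y assoc_mult_mat_vec[OF P block_carrier(1) y(1)] mult_mat_0_vec[OF P] by simp
    then have "y @\<^sub>v (X *\<^sub>v y) = 0\<^sub>v N"
      using frames_inj[OF assms(2) g zero_carrier_vec] graph_mat_mult_vec[OF assms(1,3) y(1)] by simp
    moreover have "y $ i = (y @\<^sub>v (X *\<^sub>v y)) $ i" if "i < k" for i using that y(1) by simp
    ultimately show ?thesis using y assms(1) by (intro eq_vecI) auto
  qed
  then show ?thesis unfolding inj_mat_def using mult_carrier_mat[OF P block_carrier(1)] by blast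
qed

lemma gr_chart_in_grassmannian:
  assumes "k \<le> N" "P \<in> frames N" "X \<in> carrier_mat (N - k) k"
  shows "gr_chart k P X \<in> grassmannian k N"
  unfolding grassmannian_iff
  using inj_mat_graph[OF assms] gr_chart_eq_col_image[OF assms(1) _ assms(3), of P] assms(2)
  by (auto simp: frames_def)

section \<open>The Zariski topology in charts\<close>

lemma openin_zariski_affine_basic:
  "f \<in> poly_fun r c \<Longrightarrow> openin (zariski_affine r c) {X \<in> carrier_mat r c. f X \<noteq> 0}"
  unfolding zariski_affine_def openin_topology_generated_by_iff
  by (rule generate_topology_on.Basis) blast

lemma openin_zariski_affineD:
  assumes "openin (zariski_affine r c) U" "X \<in> U"
  shows "\<exists>f\<in>poly_fun r c. f X \<noteq> 0 \<and> {Y \<in> carrier_mat r c. f Y \<noteq> 0} \<subseteq> U"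
  using assms unfolding zariski_affine_def openin_topology_generated_by_iff
proof (induction U rule: generate_topology_on.induct)
  case (Int A B)
  then obtain f g where fg: "f \<in> poly_fun r c" "g \<in> poly_fun r c" "f X \<noteq> 0" "g X \<noteq> 0"
    "{Y \<in> carrier_mat r c. f Y \<noteq> 0} \<subseteq> A" "{Y \<in> carrier_mat r c. g Y \<noteq> 0} \<subseteq> B" by blast
  then show ?case
    by (intro bexI[of _ "\<lambda>X. f X * g X"]) (auto intro: poly_fun.mult)
next
  case (UN K)
  then obtain A where A: "A \<in> K" "X \<in> A" by blast
  from UN.IH[OF this] show ?case using A by (meson Union_upper order_trans)
next
  case (Basis S)
  then show ?case by blast
qed simp

lemma openin_zariski_affine_carrier: "openin (zariski_affine r c) (carrier_mat r c)"
  using openin_zariski_affine_basic[OF poly_fun.const[of 1 r c]] by simp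

text \<open>A family has matrices of the same format as values at all arguments, so arguments of another
  format are cut or filled up.\<close>

lemma mat_over_extend:
  "mat_over (poly_fun r c) r c (\<lambda>X. mat r c (\<lambda>ij. X $$ ij))"
  by (rule mat_overI) (auto intro: poly_fun.entry)

lemma mat_over_graph_mat:
  assumes "function_ring R" "k \<le> N" "\<And>i j. i < N - k \<Longrightarrow> j < k \<Longrightarrow> (\<lambda>x. X x $$ (i, j)) \<in> R"
  shows "mat_over R N k (\<lambda>x. graph_mat k N (X x))"
proof (rule mat_overI)
  fix i j assume ij: "i < N" "j < k"
  then have "graph_mat k N (X x) $$ (i, j) =
      (if i < k then (if i = j then 1 else 0) else X x $$ (i - k, j))" for x
    by (simp add: graph_mat_def)
  then show "(\<lambda>x. graph_mat k N (X x) $$ (i, j)) \<in> R"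
    using function_ringD(1)[OF assms(1)] assms(3)[of "i - k" j] ij by (cases "i < k") auto
qed simp

lemma mat_over_blocks:
  assumes "mat_over R N k M" "k \<le> N"
  shows "mat_over R k k (\<lambda>x. upper_block k (M x))" "mat_over R (N - k) k (\<lambda>x. lower_block k N (M x))"
  using mat_overD(2)[OF assms(1)] assms(2) by (auto simp: mat_over_def upper_block_def lower_block_def)

text \<open>Sets of the form \<open>f \<noteq> 0\<close> in one chart are open in the Grassmannian: another chart sees
  them through the transition function, a fraction whose denominators can be cleared.\<close>

lemma openin_zariski_gr_chart:
  assumes k: "k \<le> N" and P: "P \<in> frames N" and f: "f \<in> poly_fun (N - k) k"
  shows "openin (zariski_gr k N) {gr_chart k P X | X. X \<in> carrier_mat (N - k) k \<and> f X \<noteq> 0}"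
  (is "openin _ ?U")
  unfolding openin_zariski_gr
proof (intro conjI ballI)
  show "?U \<subseteq> grassmannian k N" using gr_chart_in_grassmannian[OF k P] by blast
  fix P' assume P': "P' \<in> frames N"
  then have P'c: "P' \<in> carrier_mat N N" by (simp add: frames_def)
  have Pc: "P \<in> carrier_mat N N" using P by (simp add: frames_def)
  obtain Q where Q: "Q \<in> carrier_mat N N" "P * Q = 1\<^sub>m N" using frames_inverse[OF P] by metis
  let ?R = "poly_fun (N - k) k"
  note R = function_ring_poly_fun[of "N - k" k]
  define M where "M = (\<lambda>Y. Q * P' * graph_mat k N Y)"
  have QP: "Q * P' \<in> carrier_mat N N" by (rule mult_carrier_mat[OF Q(1) P'c])
  have MR: "mat_over ?R N k M" unfolding M_def
    by (rule mat_over_mult[OF R mat_over_const[OF R QP] mat_over_graph_mat[OF R k]])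
      (rule poly_fun.entry)
  have PM: "P * M Y = P' * graph_mat k N Y" for Y
  proof -
    have "P * M Y = (P * (Q * P')) * graph_mat k N Y"
      unfolding M_def by (rule assoc_mult_mat[OF Pc QP block_carrier(1), symmetric])
    also have "P * (Q * P') = P'" using assoc_mult_mat[OF Pc Q(1) P'c] Q(2) P'c by simp
    finally show ?thesis .
  qed
  let ?d = "\<lambda>Y. det (upper_block k (M Y))"
  let ?I = "\<lambda>Y. (1 / ?d Y) \<cdot>\<^sub>m adj_mat (upper_block k (M Y))"
  let ?Z = "\<lambda>Y. lower_block k N (M Y) * ?I Y"
  obtain F m where F: "F \<in> ?R" "\<And>Y. ?d Y \<noteq> 0 \<Longrightarrow> F Y = ?d Y ^ m * f (?Z Y)"
    using poly_fun_fraction[OF R mat_over_blocks[OF MR k] f] by blast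
  have inU: "gr_chart k P' Y \<in> ?U \<longleftrightarrow> ?d Y * F Y \<noteq> 0" if Y: "Y \<in> carrier_mat (N - k) k" for Y
  proof -
    have L: "gr_chart k P' Y = col_image k (P * M Y)"
      unfolding PM by (rule gr_chart_eq_col_image[OF k P'c Y])
    have iff: "gr_chart k P' Y = gr_chart k P X \<longleftrightarrow> ?d Y \<noteq> 0 \<and> lower_block k N (M Y) = X * upper_block k (M Y)"
      if "X \<in> carrier_mat (N - k) k" for X
      unfolding L by (rule gr_chart_iff[OF k P mat_overD(1)[OF MR] that])
    note I = det_nonzero_inverse[OF block_carrier(2)[of k "M Y"]]
    have Zc: "?Z Y \<in> carrier_mat (N - k) k" if "?d Y \<noteq> 0"
      by (rule mult_carrier_mat[OF block_carrier(3) I(1)[OF that]])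
    have sol: "X = ?Z Y" if "X \<in> carrier_mat (N - k) k" "?d Y \<noteq> 0" "lower_block k N (M Y) = X * upper_block k (M Y)" for X
      unfolding that(3) using assoc_mult_mat[OF that(1) block_carrier(2) I(1)[OF that(2)]] I(2)[OF that(2)] that(1)
      by simp
    have sol': "lower_block k N (M Y) = ?Z Y * upper_block k (M Y)" if "?d Y \<noteq> 0"
      using assoc_mult_mat[OF block_carrier(3) I(1)[OF that] block_carrier(2)] I(3)[OF that]
        right_mult_one_mat[OF block_carrier(3)] by simp
    show ?thesis
    proof
      assume "gr_chart k P' Y \<in> ?U"
      then obtain X where X: "X \<in> carrier_mat (N - k) k" "f X \<noteq> 0" "gr_chart k P' Y = gr_chart k P X" by blast
      then have d: "?d Y \<noteq> 0" and "X = ?Z Y" using iff sol by blast+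
      then show "?d Y * F Y \<noteq> 0" using F(2)[OF d] X(2) by simp
    next
      assume dF: "?d Y * F Y \<noteq> 0"
      then have d: "?d Y \<noteq> 0" by simp
      have "f (?Z Y) \<noteq> 0" using dF F(2)[OF d] by auto
      moreover have "gr_chart k P' Y = gr_chart k P (?Z Y)" using iff[OF Zc[OF d]] d sol'[OF d] by blast
      ultimately show "gr_chart k P' Y \<in> ?U" using Zc[OF d] by blast
    qed
  qed
  have "(\<lambda>Y. ?d Y * F Y) \<in> ?R"
    by (rule function_ringD(3)[OF R det_over[OF R mat_over_blocks(1)[OF MR k]] F(1)])
  from openin_zariski_affine_basic[OF this]
  have "openin (zariski_affine (N - k) k) {Y \<in> carrier_mat (N - k) k. ?d Y * F Y \<noteq> 0}" .
  moreover have "chart_preimage k N P' ?U = {Y \<in> carrier_mat (N - k) k. ?d Y * F Y \<noteq> 0}"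
    unfolding chart_preimage_def using inU by blast
  ultimately show "openin (zariski_affine (N - k) k) (chart_preimage k N P' ?U)" by metis
qed

lemma topspace_zariski_gr:
  assumes "k \<le> N"
  shows "topspace (zariski_gr k N) = grassmannian k N"
proof -
  have "chart_preimage k N P (grassmannian k N) = carrier_mat (N - k) k" if "P \<in> frames N" for P
    using gr_chart_in_grassmannian[OF assms that] by (auto simp: chart_preimage_def)
  then have "openin (zariski_gr k N) (grassmannian k N)"
    unfolding openin_zariski_gr by (auto simp: openin_zariski_affine_carrier)
  moreover have "topspace (zariski_gr k N) \<subseteq> grassmannian k N"
    using openin_topspace[of "zariski_gr k N"] unfolding openin_zariski_gr by blast
  ultimately show ?thesis using openin_subset by blast
qed

text \<open>By the next two lemmas, closures can be studied through the polynomials on a single chart around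
  the point.\<close>

lemma closure_of_chartD:
  assumes k: "k \<le> N" and P: "P \<in> frames N" and f: "f \<in> poly_fun (N - k) k"
    and X: "X \<in> carrier_mat (N - k) k"
    and cl: "gr_chart k P X \<in> subtopology (zariski_gr k N) S closure_of A"
    and van: "\<And>Y. Y \<in> chart_preimage k N P A \<Longrightarrow> f Y = 0"
  shows "f X = 0"
proof (rule ccontr)
  assume "f X \<noteq> 0"
  let ?U = "{gr_chart k P X | X. X \<in> carrier_mat (N - k) k \<and> f X \<noteq> 0}"
  have op: "openin (subtopology (zariski_gr k N) S) (?U \<inter> S)"
    by (rule openin_subtopology_Int[OF openin_zariski_gr_chart[OF k P f]])
  have "gr_chart k P X \<in> S" using cl unfolding in_closure_of topspace_subtopology by blast
  then have "gr_chart k P X \<in> ?U \<inter> S" using X \<open>f X \<noteq> 0\<close> by blast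
  with cl op have "\<exists>M. M \<in> A \<and> M \<in> ?U \<inter> S"
    unfolding in_closure_of by (meson conjI)
  then obtain M where "M \<in> A" "M \<in> ?U" by blast
  then obtain Y where "Y \<in> carrier_mat (N - k) k" "f Y \<noteq> 0" "gr_chart k P Y \<in> A" by blast
  then show False using van[of Y] unfolding chart_preimage_def by blast
qed

lemma closure_of_chartI:
  assumes k: "k \<le> N" and P: "P \<in> frames N"
    and X: "X \<in> carrier_mat (N - k) k" and S: "gr_chart k P X \<in> S" and A: "A \<subseteq> S"
    and van: "\<And>f. f \<in> poly_fun (N - k) k \<Longrightarrow> (\<And>Y. Y \<in> chart_preimage k N P A \<Longrightarrow> f Y = 0) \<Longrightarrow> f X = 0"
  shows "gr_chart k P X \<in> subtopology (zariski_gr k N) S closure_of A"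
  unfolding in_closure_of
proof (intro conjI allI impI)
  show "gr_chart k P X \<in> topspace (subtopology (zariski_gr k N) S)"
    unfolding topspace_subtopology topspace_zariski_gr[OF k]
    using gr_chart_in_grassmannian[OF k P X] S by blast
  fix T assume "gr_chart k P X \<in> T \<and> openin (subtopology (zariski_gr k N) S) T"
  then obtain U where U: "openin (zariski_gr k N) U" "T = U \<inter> S" "gr_chart k P X \<in> U"
    unfolding openin_subtopology by blast
  have "openin (zariski_affine (N - k) k) (chart_preimage k N P U)"
    using U(1) P unfolding openin_zariski_gr by blast
  moreover have "X \<in> chart_preimage k N P U" using X U(3) by (simp add: chart_preimage_def)
  ultimately obtain f where f: "f \<in> poly_fun (N - k) k" "f X \<noteq> 0"
    "{Y \<in> carrier_mat (N - k) k. f Y \<noteq> 0} \<subseteq> chart_preimage k N P U"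
    using openin_zariski_affineD by blast
  then obtain Y where "Y \<in> chart_preimage k N P A" "f Y \<noteq> 0" using van by blast
  then have "gr_chart k P Y \<in> A" "gr_chart k P Y \<in> U" using f(3) by (auto simp: chart_preimage_def)
  then show "\<exists>y. y \<in> A \<and> y \<in> T" using A U(2) by blast
qed

text \<open>Limits of subspaces, for a parameter \<open>x\<^sub>0\<close> in the \<open>R\<close>-closure of \<open>T\<close>. Suitable combinations of
  the columns of \<open>H\<close>, with constant coefficients, are a basis of the limit at \<open>x\<^sub>0\<close>. They are a basis
  of the subspace at every parameter where a certain determinant does not vanish, and its coordinates
  in the chart are fractions of elements of \<open>R\<close>. So \<open>f\<close> becomes an element of \<open>R\<close> once the denominators
  are cleared.\<close>

lemma family_limit:
  assumes k: "k \<le> N" and R: "function_ring R" and H: "mat_over R N m H"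
    and T: "\<And>F. F \<in> R \<Longrightarrow> (\<And>x. x \<in> T \<Longrightarrow> F x = 0) \<Longrightarrow> F x0 = 0"
    and d: "d \<in> R" "d x0 \<noteq> 0"
    and Z: "\<And>x. x \<in> T \<Longrightarrow> d x \<noteq> 0 \<Longrightarrow> \<exists>L\<in>Z. col_image m (H x) \<subseteq> L" "Z \<subseteq> grassmannian k N"
    and P: "P \<in> frames N" and lim: "col_image m (H x0) = gr_chart k P (0\<^sub>m (N - k) k)"
    and f: "f \<in> poly_fun (N - k) k" "\<And>X. X \<in> chart_preimage k N P Z \<Longrightarrow> f X = 0"
  shows "f (0\<^sub>m (N - k) k) = 0"
proof -
  have Pc: "P \<in> carrier_mat N N" using P by (simp add: frames_def)
  obtain Q where Q: "Q \<in> carrier_mat N N" "P * Q = 1\<^sub>m N" using frames_inverse[OF P] by metis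
  have Q': "Q * P = 1\<^sub>m N" by (rule mat_mult_left_right_inverse[OF Pc Q(1,2)])
  let ?G = "graph_mat k N (0\<^sub>m (N - k) k)"
  \<comment> \<open>The constant matrix \<open>C\<close> selects combinations of the columns of \<open>H\<close> which at \<open>x\<^sub>0\<close> are the
    first \<open>k\<close> columns of \<open>P\<close>.\<close>
  have ex: "\<exists>c\<in>carrier_vec m. H x0 *\<^sub>v c = P * ?G *\<^sub>v unit_vec k j" for j
  proof -
    have "P * ?G *\<^sub>v unit_vec k j \<in> col_image m (H x0)"
      unfolding lim gr_chart_eq_col_image[OF k Pc zero_carrier_mat] by (auto simp: col_image_def)
    then show ?thesis by (auto simp: col_image_def)
  qed
  define c where "c = (\<lambda>j. SOME c. c \<in> carrier_vec m \<and> H x0 *\<^sub>v c = P * ?G *\<^sub>v unit_vec k j)"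
  have c: "c j \<in> carrier_vec m \<and> H x0 *\<^sub>v c j = P * ?G *\<^sub>v unit_vec k j" for j
    unfolding c_def by (rule someI_ex) (use ex in blast)
  define C where "C = mat m k (\<lambda>(i, j). c j $ i)"
  have C: "C \<in> carrier_mat m k" by (simp add: C_def)
  have colC: "col C j = c j" if "j < k" for j using that c[of j] unfolding C_def by (intro eq_vecI) auto
  have Hc: "H x \<in> carrier_mat N m" for x by (rule mat_overD(1)[OF H])
  have PG: "P * ?G \<in> carrier_mat N k" by (rule mult_carrier_mat[OF Pc block_carrier(1)])
  have HC: "H x0 * C = P * ?G"
  proof (rule eq_matI)
    fix i j assume "i < dim_row (P * ?G)" "j < dim_col (P * ?G)"
    then have ij: "i < N" "j < k" using PG by auto
    have "(H x0 * C) $$ (i, j) = (H x0 *\<^sub>v c j) $ i"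
      using ij Hc[of x0] C colC[OF ij(2)] by simp
    also have "\<dots> = (P * ?G *\<^sub>v unit_vec k j) $ i" using c by simp
    also have "\<dots> = (P * ?G) $$ (i, j)"
      unfolding mult_mat_unit_vec[OF PG ij(2)]
      by (rule index_col) (use ij carrier_matD[OF PG] in \<open>simp_all only:\<close>)
    finally show "(H x0 * C) $$ (i, j) = (P * ?G) $$ (i, j)" .
  qed (use PG Hc[of x0] C in auto)
  define M where "M = (\<lambda>x. Q * (H x * C))"
  have HCR: "mat_over R N k (\<lambda>x. H x * C)" by (rule mat_over_mult[OF R H mat_over_const[OF R C]])
  have MR: "mat_over R N k M" unfolding M_def by (rule mat_over_mult[OF R mat_over_const[OF R Q(1)] HCR])
  have PM: "P * M x = H x * C" for x
    unfolding M_def assoc_mult_mat[OF Pc Q(1) mat_overD(1)[OF HCR], symmetric] Q(2)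
    by (rule left_mult_one_mat[OF mat_overD(1)[OF HCR]])
  have M0: "M x0 = ?G"
    unfolding M_def HC assoc_mult_mat[OF Q(1) Pc block_carrier(1), symmetric] Q'
    by (rule left_mult_one_mat[OF block_carrier(1)])
  let ?d = "\<lambda>x. det (upper_block k (M x))"
  let ?I = "\<lambda>x. (1 / ?d x) \<cdot>\<^sub>m adj_mat (upper_block k (M x))"
  let ?Z = "\<lambda>x. lower_block k N (M x) * ?I x"
  obtain F e where F: "F \<in> R" "\<And>x. ?d x \<noteq> 0 \<Longrightarrow> F x = ?d x ^ e * f (?Z x)"
    using poly_fun_fraction[OF R mat_over_blocks[OF MR k] f(1)] by blast
  have dR: "?d \<in> R" by (rule det_over[OF R mat_over_blocks(1)[OF MR k]])
  have van: "d x * (?d x * F x) = 0" if x: "x \<in> T" for x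
  proof (rule ccontr)
    assume "d x * (?d x * F x) \<noteq> 0"
    then have dx: "d x \<noteq> 0" "?d x \<noteq> 0" "F x \<noteq> 0" by auto
    note I = det_nonzero_inverse[OF block_carrier(2)[of k "M x"] dx(2)]
    have Zc: "?Z x \<in> carrier_mat (N - k) k" by (rule mult_carrier_mat[OF block_carrier(3) I(1)])
    have "lower_block k N (M x) = ?Z x * upper_block k (M x)"
      using assoc_mult_mat[OF block_carrier(3) I(1) block_carrier(2)] I(3)
        right_mult_one_mat[OF block_carrier(3)] by simp
    then have gr: "gr_chart k P (?Z x) = col_image k (H x * C)"
      using gr_chart_iff[OF k P mat_overD(1)[OF MR] Zc] dx(2) unfolding PM by blast
    obtain L where L: "L \<in> Z" "col_image m (H x) \<subseteq> L" using Z(1)[OF x dx(1)] by blast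
    have sub: "gr_chart k P (?Z x) \<subseteq> L"
    proof
      fix v assume "v \<in> gr_chart k P (?Z x)"
      then obtain y where y: "y \<in> carrier_vec k" "v = H x * C *\<^sub>v y" unfolding gr col_image_def by blast
      have "v = H x *\<^sub>v (C *\<^sub>v y)" using assoc_mult_mat_vec[OF Hc C y(1)] y(2) by simp
      then have "v \<in> col_image m (H x)"
        unfolding col_image_def using mult_mat_vec_carrier[OF C y(1)] by blast
      then show "v \<in> L" using L(2) by blast
    qed
    have "gr_chart k P (?Z x) = L"
      by (rule grassmannian_subset_eq[OF gr_chart_in_grassmannian[OF k P Zc] _ sub])
        (use L(1) Z(2) in blast)
    then have "?Z x \<in> chart_preimage k N P Z" using L(1) Zc by (simp add: chart_preimage_def)
    then show False using f(2) F(2)[OF dx(2)] dx(3) by simp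
  qed
  have "(\<lambda>x. d x * (?d x * F x)) \<in> R"
    by (rule function_ringD(3)[OF R d(1) function_ringD(3)[OF R dR F(1)]])
  from T[OF this van] have "d x0 * (?d x0 * F x0) = 0" by simp
  moreover have d0: "?d x0 = 1" unfolding M0 using k by simp
  moreover have "?Z x0 = 0\<^sub>m (N - k) k"
    unfolding M0 lower_graph[OF k zero_carrier_mat] upper_graph[OF k]
    by (intro left_mult_zero_mat smult_carrier_mat adj_mat(1) one_carrier_mat)
  then have "F x0 = f (0\<^sub>m (N - k) k)" using F(2)[of x0] d0 by simp
  ultimately show ?thesis using d(2) by simp
qed

section \<open>The quadratic space and its Lagrangian subspaces\<close>

text \<open>The polar form, on a space of arbitrary even dimension.\<close>

definition bform :: "nat \<Rightarrow> complex vec \<Rightarrow> complex vec \<Rightarrow> complex" where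
  "bform n u v = (\<Sum>i<n. u $ i * v $ (n + i) + u $ (n + i) * v $ i)"

definition orth :: "nat \<Rightarrow> complex mat \<Rightarrow> bool" where
  "orth n P \<longleftrightarrow> P \<in> carrier_mat (n + n) (n + n) \<and>
     (\<forall>u\<in>carrier_vec (n + n). \<forall>v\<in>carrier_vec (n + n). bform n (P *\<^sub>v u) (P *\<^sub>v v) = bform n u v)"

text \<open>A Lagrangian is represented by an orthogonal frame \<open>P\<close>, which maps the span of the \<open>e\<^sub>i\<^sup>+\<close> to it.\<close>

definition lag :: "nat \<Rightarrow> complex mat \<Rightarrow> complex vec set" where
  "lag n P = {P *\<^sub>v (y @\<^sub>v 0\<^sub>v n) | y. y \<in> carrier_vec n}"

definition skew :: "nat \<Rightarrow> complex mat \<Rightarrow> bool" where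
  "skew n X \<longleftrightarrow> X \<in> carrier_mat n n \<and> (\<forall>i<n. \<forall>j<n. X $$ (i, j) = - X $$ (j, i))"

text \<open>A frame times this matrix is a frame of the point with coordinate \<open>X\<close> in its chart
  (\<open>gr_chart_eq_lag\<close>).\<close>

definition shear :: "nat \<Rightarrow> complex mat \<Rightarrow> complex mat" where
  "shear n X = four_block_mat (1\<^sub>m n) (0\<^sub>m n n) X (1\<^sub>m n)"

definition swap_idx :: "nat \<Rightarrow> nat set \<Rightarrow> nat \<Rightarrow> nat" where
  "swap_idx n S i = (if i < n then (if i \<in> S then n + i else i) else (if i - n \<in> S then i - n else i))"

text \<open>The orthogonal map exchanging \<open>e\<^sub>i\<^sup>+\<close> and \<open>e\<^sub>i\<^sup>-\<close> for \<open>i \<in> S\<close>.\<close>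

definition swap_mat :: "nat \<Rightarrow> nat set \<Rightarrow> complex mat" where
  "swap_mat n S = mat (n + n) (n + n) (\<lambda>(i, j). if j = swap_idx n S i then 1 else 0)"

lemma split_vec:
  fixes v :: "complex vec"
  assumes "v \<in> carrier_vec (n + m)"
  obtains y z where "y \<in> carrier_vec n" "z \<in> carrier_vec m" "v = y @\<^sub>v z"
proof
  show "v = vec n (\<lambda>i. v $ i) @\<^sub>v vec m (\<lambda>i. v $ (n + i))"
    using assms by (intro eq_vecI) (auto simp: not_less)
qed auto

lemma bform_append:
  assumes "y \<in> carrier_vec n" "z \<in> carrier_vec n" "y' \<in> carrier_vec n" "z' \<in> carrier_vec n"
  shows "bform n (y @\<^sub>v z) (y' @\<^sub>v z') = y \<bullet> z' + z \<bullet> y'"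
  using assms unfolding bform_def scalar_prod_def
  by (simp add: sum.distrib lessThan_atLeast0)

lemma bform_commute: "bform n u v = bform n v u"
  unfolding bform_def by (intro sum.cong) auto

lemma bform_unit_vec:
  assumes "i < n"
  shows "bform n u (unit_vec (n + n) i) = u $ (n + i)" "bform n u (unit_vec (n + n) (n + i)) = u $ i"
proof -
  have "bform n u (unit_vec (n + n) i) = (\<Sum>j<n. if j = i then u $ (n + j) else 0)"
    unfolding bform_def using assms by (intro sum.cong) auto
  then show "bform n u (unit_vec (n + n) i) = u $ (n + i)" using assms by simp
  have "bform n u (unit_vec (n + n) (n + i)) = (\<Sum>j<n. if j = i then u $ j else 0)"
    unfolding bform_def using assms by (intro sum.cong) auto
  then show "bform n u (unit_vec (n + n) (n + i)) = u $ i" using assms by simp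
qed

lemma bform_nondegenerate:
  assumes "u \<in> carrier_vec (n + n)" "\<And>v. v \<in> carrier_vec (n + n) \<Longrightarrow> bform n u v = 0"
  shows "u = 0\<^sub>v (n + n)"
proof (rule eq_vecI)
  fix i assume "i < dim_vec (0\<^sub>v (n + n) :: complex vec)"
  then have i: "i < n + n" by simp
  show "u $ i = 0\<^sub>v (n + n) $ i"
  proof (cases "i < n")
    case True
    then show ?thesis using bform_unit_vec(2)[of i n u] assms(2)[of "unit_vec (n + n) (n + i)"] i by simp
  next
    case False
    then show ?thesis
      using bform_unit_vec(1)[of "i - n" n u] assms(2)[of "unit_vec (n + n) (i - n)"] i by simp
  qed
qed (use assms in simp)

lemma orthD:
  assumes "orth n P"
  shows "P \<in> carrier_mat (n + n) (n + n)"
    "u \<in> carrier_vec (n + n) \<Longrightarrow> v \<in> carrier_vec (n + n) \<Longrightarrow> bform n (P *\<^sub>v u) (P *\<^sub>v v) = bform n u v"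
  using assms by (auto simp: orth_def)

lemma orth_inverse:
  assumes P: "orth n P"
  obtains Q where "orth n Q" "P * Q = 1\<^sub>m (n + n)" "Q * P = 1\<^sub>m (n + n)" "det P \<noteq> 0"
proof -
  note Pc = orthD(1)[OF P]
  have "inj_mat (n + n) (n + n) P"
    unfolding inj_mat_def
  proof (intro conjI Pc ballI impI)
    fix u assume u: "u \<in> carrier_vec (n + n)" "P *\<^sub>v u = 0\<^sub>v (n + n)"
    show "u = 0\<^sub>v (n + n)"
    proof (rule bform_nondegenerate[OF u(1)])
      fix v :: "complex vec" assume v: "v \<in> carrier_vec (n + n)"
      have "bform n u v = bform n (P *\<^sub>v u) (P *\<^sub>v v)" using orthD(2)[OF P u(1) v] by simp
      also have "\<dots> = 0" unfolding u(2) bform_def by (intro sum.neutral) simp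
      finally show "bform n u v = 0" .
    qed
  qed
  then have d: "det P \<noteq> 0" using inj_mat_det[OF Pc] by blast
  let ?Q = "(1 / det P) \<cdot>\<^sub>m adj_mat P"
  note I = det_nonzero_inverse[OF Pc d]
  have "orth n ?Q"
    unfolding orth_def
  proof (intro conjI I(1) ballI)
    fix u v :: "complex vec" assume u: "u \<in> carrier_vec (n + n)" and v: "v \<in> carrier_vec (n + n)"
    have c: "?Q *\<^sub>v w \<in> carrier_vec (n + n)" "P *\<^sub>v (?Q *\<^sub>v w) = w" if "w \<in> carrier_vec (n + n)" for w
      using mult_mat_vec_carrier[OF I(1) that] assoc_mult_mat_vec[OF Pc I(1) that] I(2) that by auto
    show "bform n (?Q *\<^sub>v u) (?Q *\<^sub>v v) = bform n u v"
      using orthD(2)[OF P c(1)[OF u] c(1)[OF v]] c(2)[OF u] c(2)[OF v] by simp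
  qed
  then show ?thesis using that I d by blast
qed

lemma orth_frames: "orth n P \<Longrightarrow> P \<in> frames (n + n)"
  using orth_inverse framesI orthD(1) by metis

lemma orth_mult:
  assumes "orth n P" "orth n Q"
  shows "orth n (P * Q)"
  unfolding orth_def
proof (intro conjI ballI)
  note Pc = orthD(1)[OF assms(1)] and Qc = orthD(1)[OF assms(2)]
  show "P * Q \<in> carrier_mat (n + n) (n + n)" by (rule mult_carrier_mat[OF Pc Qc])
  fix u v :: "complex vec" assume u: "u \<in> carrier_vec (n + n)" and v: "v \<in> carrier_vec (n + n)"
  show "bform n (P * Q *\<^sub>v u) (P * Q *\<^sub>v v) = bform n u v"
    unfolding assoc_mult_mat_vec[OF Pc Qc u] assoc_mult_mat_vec[OF Pc Qc v]
    using orthD(2)[OF assms(1) mult_mat_vec_carrier[OF Qc u] mult_mat_vec_carrier[OF Qc v]]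
      orthD(2)[OF assms(2) u v] by simp
qed

lemma skewD:
  assumes "skew n X"
  shows "X \<in> carrier_mat n n" "i < n \<Longrightarrow> j < n \<Longrightarrow> X $$ (i, j) = - X $$ (j, i)"
  using assms unfolding skew_def by blast+

lemma skew_diag: "skew n X \<Longrightarrow> i < n \<Longrightarrow> X $$ (i, i) = 0"
  using skewD(2)[of n X i i] by simp

lemma skew_transpose: "skew n X \<Longrightarrow> X\<^sup>T = - X"
proof (rule eq_matI)
  assume X: "skew n X"
  note Xc = skewD(1)[OF X]
  show "dim_row X\<^sup>T = dim_row (- X)" "dim_col X\<^sup>T = dim_col (- X)" using Xc by auto
  fix i j assume "i < dim_row (- X)" "j < dim_col (- X)"
  then have ij: "i < n" "j < n" using Xc by auto
  then show "X\<^sup>T $$ (i, j) = (- X) $$ (i, j)"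
    using Xc skewD(2)[OF X ij(2,1)] by simp
qed

lemma skew_scalar_prod:
  assumes X: "skew n X" and y: "y \<in> carrier_vec n" "y' \<in> carrier_vec n"
  shows "y \<bullet> (X *\<^sub>v y') = - ((X *\<^sub>v y) \<bullet> y')"
proof -
  note Xc = skewD(1)[OF X]
  have "y \<bullet> (X *\<^sub>v y') = (X\<^sup>T *\<^sub>v y) \<bullet> y'" using transpose_vec_mult_scalar[OF Xc y(2) y(1)] by simp
  also have "X\<^sup>T *\<^sub>v y = - (X *\<^sub>v y)" unfolding skew_transpose[OF X] using Xc y by simp
  finally show ?thesis using Xc y by simp
qed

lemma shear_carrier [simp]: "X \<in> carrier_mat n n \<Longrightarrow> shear n X \<in> carrier_mat (n + n) (n + n)"
  by (auto simp: shear_def)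

lemma zero_mat_mult_vec: "z \<in> carrier_vec k \<Longrightarrow> 0\<^sub>m r k *\<^sub>v z = (0\<^sub>v r :: complex vec)"
  by (intro eq_vecI) auto

lemma shear_mult_vec:
  assumes "X \<in> carrier_mat n n" "y \<in> carrier_vec n" "z \<in> carrier_vec n"
  shows "shear n X *\<^sub>v (y @\<^sub>v z) = y @\<^sub>v (X *\<^sub>v y + z)"
  unfolding shear_def
  using four_block_mat_mult_vec[OF one_carrier_mat zero_carrier_mat assms(1) one_carrier_mat assms(2,3)]
    zero_mat_mult_vec[OF assms(3), of n] assms by simp

lemma orth_shear:
  assumes X: "skew n X"
  shows "orth n (shear n X)"
  unfolding orth_def
proof (intro conjI ballI)
  note Xc = skewD(1)[OF X]
  show "shear n X \<in> carrier_mat (n + n) (n + n)" using Xc by simp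
  fix u v :: "complex vec" assume "u \<in> carrier_vec (n + n)" "v \<in> carrier_vec (n + n)"
  then obtain y z y' z' where s: "y \<in> carrier_vec n" "z \<in> carrier_vec n" "u = y @\<^sub>v z"
    "y' \<in> carrier_vec n" "z' \<in> carrier_vec n" "v = y' @\<^sub>v z'"
    using split_vec by metis
  have c: "X *\<^sub>v y \<in> carrier_vec n" "X *\<^sub>v y' \<in> carrier_vec n"
    using mult_mat_vec_carrier[OF Xc] s by auto
  have "bform n (shear n X *\<^sub>v u) (shear n X *\<^sub>v v) = y \<bullet> (X *\<^sub>v y' + z') + (X *\<^sub>v y + z) \<bullet> y'"
    unfolding s shear_mult_vec[OF Xc s(1,2)] shear_mult_vec[OF Xc s(4,5)]
    using s c by (intro bform_append) auto
  also have "\<dots> = y \<bullet> z' + z \<bullet> y'"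
    using scalar_prod_add_distrib[OF s(1) c(2) s(5)] add_scalar_prod_distrib[OF c(1) s(2) s(4)]
      skew_scalar_prod[OF X s(1) s(4)] by simp
  finally show "bform n (shear n X *\<^sub>v u) (shear n X *\<^sub>v v) = bform n u v"
    unfolding s using bform_append s by simp
qed

lemma det_shear:
  assumes "X \<in> carrier_mat n n"
  shows "det (shear n X) = 1"
  unfolding shear_def
  using det_four_block_mat_upper_right_zero[OF one_carrier_mat refl assms one_carrier_mat] by simp

lemma swap_idx_lt [simp]: "i < n + n \<Longrightarrow> swap_idx n S i < n + n"
  by (auto simp: swap_idx_def)

lemma swap_idx_idem [simp]: "i < n + n \<Longrightarrow> swap_idx n S (swap_idx n S i) = i"
  by (auto simp: swap_idx_def)

lemma swap_mat_carrier [simp]: "swap_mat n S \<in> carrier_mat (n + n) (n + n)"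
  by (simp add: swap_mat_def)

lemma swap_mat_vec:
  assumes "v \<in> carrier_vec (n + n)" "i < n + n"
  shows "(swap_mat n S *\<^sub>v v) $ i = v $ swap_idx n S i"
proof -
  have "row (swap_mat n S) i = unit_vec (n + n) (swap_idx n S i)"
    using assms by (intro eq_vecI) (auto simp: swap_mat_def)
  then show ?thesis using assms by (simp add: swap_mat_def)
qed

lemma swap_mat_swap_mat_vec:
  assumes "v \<in> carrier_vec (n + n)"
  shows "swap_mat n S *\<^sub>v (swap_mat n S *\<^sub>v v) = v"
proof (rule eq_vecI)
  fix i assume "i < dim_vec v"
  then have i: "i < n + n" using assms by simp
  show "(swap_mat n S *\<^sub>v (swap_mat n S *\<^sub>v v)) $ i = v $ i"
    using swap_mat_vec[OF mult_mat_vec_carrier[OF swap_mat_carrier assms] i]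
      swap_mat_vec[OF assms swap_idx_lt[OF i]] i by simp
qed (use assms in \<open>simp add: swap_mat_def\<close>)

lemma swap_mat_square: "swap_mat n S * swap_mat n S = 1\<^sub>m (n + n)"
proof (rule mat_eqI_vec[of _ "n + n" "n + n"])
  show "swap_mat n S * swap_mat n S \<in> carrier_mat (n + n) (n + n)"
    by (rule mult_carrier_mat[OF swap_mat_carrier swap_mat_carrier])
  fix y :: "complex vec" assume y: "y \<in> carrier_vec (n + n)"
  show "swap_mat n S * swap_mat n S *\<^sub>v y = 1\<^sub>m (n + n) *\<^sub>v y"
    unfolding assoc_mult_mat_vec[OF swap_mat_carrier swap_mat_carrier y] swap_mat_swap_mat_vec[OF y]
    using y by simp
qed simp

lemma orth_swap: "orth n (swap_mat n S)"
  unfolding orth_def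
proof (intro conjI ballI swap_mat_carrier)
  fix u v :: "complex vec" assume u: "u \<in> carrier_vec (n + n)" and v: "v \<in> carrier_vec (n + n)"
  show "bform n (swap_mat n S *\<^sub>v u) (swap_mat n S *\<^sub>v v) = bform n u v"
    unfolding bform_def
    by (intro sum.cong) (auto simp: swap_mat_vec[OF u] swap_mat_vec[OF v] swap_idx_def)
qed

lemma det_swap_mat:
  assumes "finite S" "S \<subseteq> {..<n}"
  shows "det (swap_mat n S) = (- 1) ^ card S"
  using assms
proof (induction S rule: finite_induct)
  case empty
  have "swap_mat n {} = 1\<^sub>m (n + n)"
    by (intro eq_matI) (auto simp: swap_mat_def swap_idx_def)
  then show ?case by simp
next
  case (insert m S)
  then have m: "m < n" "m \<notin> S" by auto
  have one: "swap_mat n {m} = swaprows_mat (n + n) m (n + m)"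
    using m by (intro eq_matI) (auto simp: swap_mat_def swap_idx_def swaprows_mat_def)
  have "swap_mat n (insert m S) = swap_mat n S * swap_mat n {m}"
  proof (rule mat_eqI_vec[of _ "n + n" "n + n"])
    show "swap_mat n S * swap_mat n {m} \<in> carrier_mat (n + n) (n + n)"
      by (rule mult_carrier_mat[OF swap_mat_carrier swap_mat_carrier])
    fix y :: "complex vec" assume y: "y \<in> carrier_vec (n + n)"
    show "swap_mat n (insert m S) *\<^sub>v y = swap_mat n S * swap_mat n {m} *\<^sub>v y"
      unfolding assoc_mult_mat_vec[OF swap_mat_carrier swap_mat_carrier y]
    proof (rule eq_vecI)
      fix i assume "i < dim_vec (swap_mat n S *\<^sub>v (swap_mat n {m} *\<^sub>v y))"
      then have i: "i < n + n" by (simp add: swap_mat_def)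
      show "(swap_mat n (insert m S) *\<^sub>v y) $ i = (swap_mat n S *\<^sub>v (swap_mat n {m} *\<^sub>v y)) $ i"
        using swap_mat_vec[OF mult_mat_vec_carrier[OF swap_mat_carrier y] i] m(2) i
        by (auto simp: swap_mat_vec[OF y] swap_mat_vec[OF y i] swap_idx_def)
    qed (simp add: swap_mat_def)
  qed simp
  moreover have "det (swap_mat n {m}) = - 1"
    unfolding one using m by (intro det_swaprows_mat) auto
  ultimately show ?case
    using det_mult[OF swap_mat_carrier[of n S] swap_mat_carrier[of n "{m}"]] insert by simp
qed

lemma lag_eq_gr_chart:
  "lag n P = gr_chart n P (0\<^sub>m n n)"
proof -
  have "0\<^sub>m n n *\<^sub>v y = 0\<^sub>v n" if "y \<in> carrier_vec n" for y :: "complex vec"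
    using that by (intro eq_vecI) auto
  then show ?thesis unfolding lag_def gr_chart_def by (auto; metis)
qed

lemma gr_chart_eq_lag:
  assumes P: "P \<in> carrier_mat (n + n) (n + n)" and X: "X \<in> carrier_mat n n"
  shows "gr_chart n P X = lag n (P * shear n X)"
proof -
  have "P * shear n X *\<^sub>v (y @\<^sub>v 0\<^sub>v n) = P *\<^sub>v (y @\<^sub>v (X *\<^sub>v y))" if "y \<in> carrier_vec n" for y
    using assoc_mult_mat_vec[OF P shear_carrier[OF X], of "y @\<^sub>v 0\<^sub>v n"] that
      shear_mult_vec[OF X that zero_carrier_vec] mult_mat_vec_carrier[OF X that] by simp
  then have "{P *\<^sub>v (y @\<^sub>v (X *\<^sub>v y)) | y. y \<in> carrier_vec n} =
      {P * shear n X *\<^sub>v (y @\<^sub>v 0\<^sub>v n) | y. y \<in> carrier_vec n}" by (metis (no_types, lifting))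
  then show ?thesis unfolding gr_chart_def lag_def .
qed

lemma lag_mult:
  assumes "P \<in> carrier_mat (n + n) (n + n)" "Q \<in> carrier_mat (n + n) (n + n)"
  shows "lag n (P * Q) = (\<lambda>v. P *\<^sub>v v) ` lag n Q"
proof -
  have "P * Q *\<^sub>v (y @\<^sub>v 0\<^sub>v n) = P *\<^sub>v (Q *\<^sub>v (y @\<^sub>v 0\<^sub>v n))" if "y \<in> carrier_vec n" for y
    using assoc_mult_mat_vec[OF assms, of "y @\<^sub>v 0\<^sub>v n"] that by simp
  then show ?thesis unfolding lag_def by (auto simp: image_iff; metis)
qed

lemma lag_carrier: "P \<in> carrier_mat (n + n) (n + n) \<Longrightarrow> lag n P \<subseteq> carrier_vec (n + n)"
  unfolding lag_def by auto

lemma lag_in_grassmannian: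
  assumes "orth n P"
  shows "lag n P \<in> grassmannian n (n + n)"
  unfolding lag_eq_gr_chart using gr_chart_in_grassmannian[OF _ orth_frames[OF assms], of n "0\<^sub>m n n"] by simp

lemma lag_isotropic:
  assumes "orth n P" "u \<in> lag n P" "v \<in> lag n P"
  shows "bform n u v = 0"
proof -
  obtain y y' where y: "y \<in> carrier_vec n" "y' \<in> carrier_vec n" "u = P *\<^sub>v (y @\<^sub>v 0\<^sub>v n)" "v = P *\<^sub>v (y' @\<^sub>v 0\<^sub>v n)"
    using assms by (auto simp: lag_def)
  then have "bform n u v = bform n (y @\<^sub>v 0\<^sub>v n) (y' @\<^sub>v 0\<^sub>v n)" using orthD(2)[OF assms(1)] by simp
  then show ?thesis using bform_append y by simp
qed

lemma lag_maximal:
  assumes P: "orth n P" and x: "x \<in> carrier_vec (n + n)" and ann: "\<And>u. u \<in> lag n P \<Longrightarrow> bform n x u = 0"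
  shows "x \<in> lag n P"
proof -
  obtain Q where Q: "orth n Q" "P * Q = 1\<^sub>m (n + n)" using orth_inverse[OF P] by metis
  note Pc = orthD(1)[OF P] and Qc = orthD(1)[OF Q(1)]
  have w: "Q *\<^sub>v x \<in> carrier_vec (n + n)" by (rule mult_mat_vec_carrier[OF Qc x])
  have Pw: "P *\<^sub>v (Q *\<^sub>v x) = x" using assoc_mult_mat_vec[OF Pc Qc x] Q(2) x by simp
  obtain y z where yz: "y \<in> carrier_vec n" "z \<in> carrier_vec n" "Q *\<^sub>v x = y @\<^sub>v z" using split_vec[OF w] by metis
  have "z $ i = 0" if i: "i < n" for i
  proof -
    have "P *\<^sub>v (unit_vec n i @\<^sub>v 0\<^sub>v n) \<in> lag n P" by (auto simp: lag_def)
    from ann[OF this] have "bform n (Q *\<^sub>v x) (unit_vec n i @\<^sub>v 0\<^sub>v n) = 0"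
      using orthD(2)[OF P w, of "unit_vec n i @\<^sub>v 0\<^sub>v n"] Pw by simp
    then show ?thesis unfolding yz(3) using bform_append[OF yz(1,2), of "unit_vec n i" "0\<^sub>v n"] yz i by simp
  qed
  then have "z = 0\<^sub>v n" using yz by (intro eq_vecI) auto
  then show ?thesis unfolding lag_def using Pw yz by auto
qed

lemma lag_subset_eq:
  assumes "orth n P" "orth n Q" "lag n P \<subseteq> lag n Q"
  shows "lag n P = lag n Q"
proof
  show "lag n Q \<subseteq> lag n P"
  proof
    fix x assume x: "x \<in> lag n Q"
    then have "x \<in> carrier_vec (n + n)" using lag_carrier[OF orthD(1)[OF assms(2)]] by blast
    then show "x \<in> lag n P"
      using lag_maximal[OF assms(1)] lag_isotropic[OF assms(2) x] assms(3) by blast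
  qed
qed (rule assms(3))

text \<open>The polar form of the vectors of the graph over \<open>y\<close> and \<open>y'\<close> is \<open>y \<bullet> X y' + X y \<bullet> y'\<close>.\<close>

lemma isotropic_chart_skew:
  assumes P: "orth n P" and X: "X \<in> carrier_mat n n"
    and iso: "\<And>u v. u \<in> gr_chart n P X \<Longrightarrow> v \<in> gr_chart n P X \<Longrightarrow> bform n u v = 0"
  shows "skew n X"
  unfolding skew_def
proof (intro conjI X allI impI)
  fix i j assume ij: "i < n" "j < n"
  let ?u = "\<lambda>i. unit_vec n i @\<^sub>v (X *\<^sub>v unit_vec n i)"
  have c: "X *\<^sub>v unit_vec n k \<in> carrier_vec n" for k by (rule mult_mat_vec_carrier[OF X unit_vec_carrier])
  have "P *\<^sub>v ?u i \<in> gr_chart n P X" "P *\<^sub>v ?u j \<in> gr_chart n P X" by (auto simp: gr_chart_def)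
  then have "bform n (?u i) (?u j) = 0"
    using iso orthD(2)[OF P, of "?u i" "?u j"] append_carrier_vec[OF unit_vec_carrier c] by metis
  then have "unit_vec n i \<bullet> (X *\<^sub>v unit_vec n j) + (X *\<^sub>v unit_vec n i) \<bullet> unit_vec n j = 0"
    using bform_append[OF unit_vec_carrier c unit_vec_carrier c] by simp
  moreover have "unit_vec n i \<bullet> (X *\<^sub>v unit_vec n j) = X $$ (i, j)"
    using ij X c[of j] mult_mat_unit_vec[OF X ij(2)] by simp
  moreover have "(X *\<^sub>v unit_vec n i) \<bullet> unit_vec n j = X $$ (j, i)"
    using ij X c[of i] mult_mat_unit_vec[OF X ij(1)] by simp
  ultimately show "X $$ (i, j) = - X $$ (j, i)" by (simp add: eq_neg_iff_add_eq_0)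
qed

text \<open>Every Lagrangian is transversal to a coordinate Lagrangian. The signs are chosen one by one: if
  neither \<open>e\<^sub>k\<^sup>+\<close> nor \<open>e\<^sub>k\<^sup>-\<close> could be added to the coordinate subspace built so far, \<open>L\<close> would contain
  two vectors pairing to a nonzero number.\<close>

lemma isotropic_avoids_coordinate:
  assumes car: "L \<subseteq> carrier_vec (n + n)" and iso: "\<And>u v. u \<in> L \<Longrightarrow> v \<in> L \<Longrightarrow> bform n u v = 0"
    and "k \<le> n"
  shows "\<exists>S\<subseteq>{..<k}. \<forall>v\<in>L. (\<forall>i<n. i \<ge> k \<longrightarrow> v $ i = 0 \<and> v $ (n + i) = 0) \<longrightarrow>
    (\<forall>i<k. (i \<in> S \<longrightarrow> v $ (n + i) = 0) \<and> (i \<notin> S \<longrightarrow> v $ i = 0)) \<longrightarrow> v = 0\<^sub>v (n + n)"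
  using assms(3)
proof (induction k)
  case 0
  have z: "v = 0\<^sub>v (n + n)" if "v \<in> L" "\<forall>i<n. v $ i = 0 \<and> v $ (n + i) = 0" for v
  proof (rule eq_vecI)
    fix i assume "i < dim_vec (0\<^sub>v (n + n) :: complex vec)"
    then have i: "i < n + n" by simp
    show "v $ i = 0\<^sub>v (n + n) $ i"
    proof (cases "i < n")
      case False
      then have "i - n < n" "n + (i - n) = i" using i by auto
      then show ?thesis using that(2) i by (metis index_zero_vec(1))
    qed (use that i in simp)
  qed (use that car in auto)
  show ?case
    by (rule exI[of _ "{}"], intro conjI ballI impI, simp, rule z) simp_all
next
  case (Suc k)
  then have k: "k < n" by simp
  let ?hi = "\<lambda>k v. \<forall>i<n. i \<ge> k \<longrightarrow> v $ i = 0 \<and> v $ (n + i) = (0::complex)"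
  let ?lo = "\<lambda>k S v. \<forall>i<k. (i \<in> S \<longrightarrow> v $ (n + i) = 0) \<and> (i \<notin> S \<longrightarrow> v $ i = (0::complex))"
  obtain S where S: "S \<subseteq> {..<k}" "\<And>v. v \<in> L \<Longrightarrow> ?hi k v \<Longrightarrow> ?lo k S v \<Longrightarrow> v = 0\<^sub>v (n + n)"
    using Suc.IH k by (metis (no_types, lifting) less_imp_le)
  show ?case
  proof (rule ccontr)
    assume neg: "\<not> ?case"
    have ex: "\<exists>x\<in>L. ?hi (Suc k) x \<and> ?lo (Suc k) T x \<and> x \<noteq> 0\<^sub>v (n + n)" if "T \<subseteq> {..<Suc k}" for T
      using neg that by blast
    obtain x where x: "x \<in> L" "?hi (Suc k) x" "?lo (Suc k) S x" "x \<noteq> 0\<^sub>v (n + n)"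
      using ex[of S] S(1) by force
    obtain x' where x': "x' \<in> L" "?hi (Suc k) x'" "?lo (Suc k) (insert k S) x'" "x' \<noteq> 0\<^sub>v (n + n)"
      using ex[of "insert k S"] S(1) by force
    have kS: "k \<notin> S" using S(1) by auto
    have xk: "x $ k = 0" using x(3)[rule_format, of k] kS by simp
    have hi: "?hi k v" if "?hi (Suc k) v" "v $ k = 0" "v $ (n + k) = 0" for v
    proof (intro allI impI)
      fix i assume "i < n" "k \<le> i"
      then show "v $ i = 0 \<and> v $ (n + i) = 0" using that by (cases "i = k") auto
    qed
    have "?lo k S x" using x(3) less_SucI by blast
    then have "x $ (n + k) \<noteq> 0" using S(2)[OF x(1)] hi[OF x(2) xk] x(4) by blast
    have x'k: "x' $ (n + k) = 0" using x'(3)[rule_format, of k] by simp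
    have lo': "?lo k S x'"
    proof (intro allI impI)
      fix i assume "i < k"
      then show "(i \<in> S \<longrightarrow> x' $ (n + i) = 0) \<and> (i \<notin> S \<longrightarrow> x' $ i = 0)"
        using x'(3)[rule_format, of i] by auto
    qed
    have "x' $ k \<noteq> 0" using S(2)[OF x'(1)] hi[OF x'(2) _ x'k] lo' x'(4) by blast
    have "x $ i * x' $ (n + i) + x $ (n + i) * x' $ i = (if i = k then x $ (n + k) * x' $ k else 0)"
      if "i < n" for i
    proof (cases i k rule: linorder_cases)
      case less
      then show ?thesis using x(3)[rule_format, of i] lo'[rule_format, of i] by (cases "i \<in> S") auto
    next
      case greater
      then show ?thesis using x(2)[rule_format, of i] x'(2)[rule_format, of i] that by auto
    qed (use xk in simp)
    then have "bform n x x' = x $ (n + k) * x' $ k" unfolding bform_def using k by simp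
    then show False using iso[OF x(1) x'(1)] \<open>x $ (n + k) \<noteq> 0\<close> \<open>x' $ k \<noteq> 0\<close> by simp
  qed
qed

lemma isotropic_eq_chart:
  assumes L: "L \<in> grassmannian n (n + n)" and iso: "\<And>u v. u \<in> L \<Longrightarrow> v \<in> L \<Longrightarrow> bform n u v = 0"
  shows "\<exists>S X. S \<subseteq> {..<n} \<and> skew n X \<and> L = gr_chart n (swap_mat n S) X"
proof -
  obtain A where A: "inj_mat (n + n) n A" "L = col_image n A" using L unfolding grassmannian_iff by blast
  then have Ac: "A \<in> carrier_mat (n + n) n" by (simp add: inj_mat_def)
  have "L \<subseteq> carrier_vec (n + n)" unfolding A(2) col_image_def using Ac by auto
  from isotropic_avoids_coordinate[OF this iso order_refl]
  obtain S where S: "S \<subseteq> {..<n}" and av: "\<And>v. v \<in> L \<Longrightarrow>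
      (\<forall>i<n. (i \<in> S \<longrightarrow> v $ (n + i) = 0) \<and> (i \<notin> S \<longrightarrow> v $ i = 0)) \<Longrightarrow> v = 0\<^sub>v (n + n)"
    by auto
  let ?P = "swap_mat n S" and ?M = "swap_mat n S * A"
  have Mc: "?M \<in> carrier_mat (n + n) n" by (rule mult_carrier_mat[OF swap_mat_carrier Ac])
  have PM: "?P * ?M = A"
    unfolding assoc_mult_mat[OF swap_mat_carrier swap_mat_carrier Ac, symmetric] swap_mat_square
    by (rule left_mult_one_mat[OF Ac])
  let ?U = "upper_block n ?M"
  have "inj_mat n n ?U"
    unfolding inj_mat_def
  proof (intro conjI block_carrier ballI impI)
    fix y assume y: "y \<in> carrier_vec n" "?U *\<^sub>v y = 0\<^sub>v n"
    have Ay: "A *\<^sub>v y \<in> carrier_vec (n + n)" by (rule mult_mat_vec_carrier[OF Ac y(1)])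
    have My: "?M *\<^sub>v y = ?P *\<^sub>v (A *\<^sub>v y)" by (rule assoc_mult_mat_vec[OF swap_mat_carrier Ac y(1)])
    have "?M *\<^sub>v y = 0\<^sub>v n @\<^sub>v (lower_block n (n + n) ?M *\<^sub>v y)"
      using block_mult_vec[OF _ Mc y(1)] y(2) by simp
    then have z: "(?M *\<^sub>v y) $ i = 0" if "i < n" for i using that by simp
    have "(A *\<^sub>v y) $ swap_idx n S i = 0" if "i < n" for i
      using z[OF that] swap_mat_vec[OF Ay, of i S] that unfolding My by simp
    then have "\<forall>i<n. (i \<in> S \<longrightarrow> (A *\<^sub>v y) $ (n + i) = 0) \<and> (i \<notin> S \<longrightarrow> (A *\<^sub>v y) $ i = 0)"
      by (metis swap_idx_def)
    moreover have "A *\<^sub>v y \<in> L" unfolding A(2) col_image_def using y(1) by blast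
    ultimately have "A *\<^sub>v y = 0\<^sub>v (n + n)" using av by blast
    then show "y = 0\<^sub>v n" using A(1) y(1) by (simp add: inj_mat_def)
  qed
  then have d: "det ?U \<noteq> 0" using inj_mat_det[OF block_carrier(2)] by blast
  note I = det_nonzero_inverse[OF block_carrier(2) d]
  let ?X = "lower_block n (n + n) ?M * ((1 / det ?U) \<cdot>\<^sub>m adj_mat ?U)"
  have Xc: "?X \<in> carrier_mat (n + n - n) n" by (rule mult_carrier_mat[OF block_carrier(3) I(1)])
  have "lower_block n (n + n) ?M = ?X * ?U"
    unfolding assoc_mult_mat[OF block_carrier(3) I(1) block_carrier(2)] I(3)
    by (rule right_mult_one_mat[OF block_carrier(3), symmetric])
  then have "col_image n (?P * ?M) = gr_chart n ?P ?X"
    using gr_chart_iff[OF _ orth_frames[OF orth_swap] Mc Xc] d by simp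
  then have LX: "L = gr_chart n ?P ?X" unfolding PM A(2) .
  have "skew n ?X"
    by (rule isotropic_chart_skew[OF orth_swap]) (use Xc iso LX in auto)
  then show ?thesis using S LX by blast
qed

lemma isotropic_eq_lag:
  assumes "L \<in> grassmannian n (n + n)" "\<And>u v. u \<in> L \<Longrightarrow> v \<in> L \<Longrightarrow> bform n u v = 0"
  shows "\<exists>P. orth n P \<and> L = lag n P"
proof -
  obtain S X where "skew n X" "L = gr_chart n (swap_mat n S) X" using isotropic_eq_chart[OF assms] by blast
  then show ?thesis
    using gr_chart_eq_lag[OF swap_mat_carrier skewD(1)] orth_mult[OF orth_swap orth_shear] by metis
qed

lemma four_blocks:
  fixes R :: "complex mat"
  assumes "R \<in> carrier_mat (n + n) (n + n)"
  obtains a b c d where "a \<in> carrier_mat n n" "b \<in> carrier_mat n n" "c \<in> carrier_mat n n" "d \<in> carrier_mat n n"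
    "R = four_block_mat a b c d"
proof
  show "R = four_block_mat (mat n n (\<lambda>(i, j). R $$ (i, j))) (mat n n (\<lambda>(i, j). R $$ (i, n + j)))
      (mat n n (\<lambda>(i, j). R $$ (n + i, j))) (mat n n (\<lambda>(i, j). R $$ (n + i, n + j)))"
    using assms by (intro eq_matI) (auto simp: not_less)
qed auto

text \<open>An orthogonal map that stabilises the base Lagrangian is block triangular with blocks \<open>a\<close> and
  \<open>(a\<^sup>T)\<inverse>\<close> on the diagonal, hence has determinant \<open>1\<close>.\<close>

lemma same_lag_blocks:
  assumes P: "orth n P" and Q: "orth n Q" and eq: "lag n P = lag n Q"
  obtains a c d where "a \<in> carrier_mat n n" "c \<in> carrier_mat n n" "d \<in> carrier_mat n n"
    "a\<^sup>T * d = 1\<^sub>m n" "P = Q * four_block_mat a c (0\<^sub>m n n) d" "orth n (four_block_mat a c (0\<^sub>m n n) d)"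
    "det P = det Q"
proof -
  obtain Q' where Q': "orth n Q'" "Q * Q' = 1\<^sub>m (n + n)" "Q' * Q = 1\<^sub>m (n + n)"
    using orth_inverse[OF Q] by metis
  note Pc = orthD(1)[OF P] and Qc = orthD(1)[OF Q] and Qc' = orthD(1)[OF Q'(1)]
  define R where "R = Q' * P"
  have R: "orth n R" unfolding R_def by (rule orth_mult[OF Q'(1) P])
  note Rc = orthD(1)[OF R]
  have QR: "P = Q * R"
    unfolding R_def assoc_mult_mat[OF Qc Qc' Pc, symmetric] Q'(2) using Pc by simp
  obtain a b c d where abcd: "a \<in> carrier_mat n n" "b \<in> carrier_mat n n" "c \<in> carrier_mat n n" "d \<in> carrier_mat n n"
    "R = four_block_mat a b c d" using four_blocks[OF Rc] by metis
  note mv = four_block_mat_mult_vec[OF abcd(1-4)]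
  have c0: "c *\<^sub>v y = 0\<^sub>v n" if y: "y \<in> carrier_vec n" for y
  proof -
    have "P *\<^sub>v (y @\<^sub>v 0\<^sub>v n) \<in> lag n Q" using eq y by (auto simp: lag_def)
    then obtain y' where y': "y' \<in> carrier_vec n" "P *\<^sub>v (y @\<^sub>v 0\<^sub>v n) = Q *\<^sub>v (y' @\<^sub>v 0\<^sub>v n)"
      by (auto simp: lag_def)
    have "Q *\<^sub>v (R *\<^sub>v (y @\<^sub>v 0\<^sub>v n)) = Q *\<^sub>v (y' @\<^sub>v 0\<^sub>v n)"
      using y'(2) assoc_mult_mat_vec[OF Qc Rc, of "y @\<^sub>v 0\<^sub>v n"] y unfolding QR by simp
    then have "R *\<^sub>v (y @\<^sub>v 0\<^sub>v n) = y' @\<^sub>v 0\<^sub>v n"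
      by (rule frames_inj[OF orth_frames[OF Q], rotated 2]) (use y y'(1) Rc in auto)
    then have "(a *\<^sub>v y + b *\<^sub>v 0\<^sub>v n) @\<^sub>v (c *\<^sub>v y + d *\<^sub>v 0\<^sub>v n) = y' @\<^sub>v 0\<^sub>v n"
      unfolding abcd(5) mv[OF y zero_carrier_vec] .
    then have "c *\<^sub>v y + d *\<^sub>v 0\<^sub>v n = 0\<^sub>v n"
      using append_vec_eq[of "a *\<^sub>v y + b *\<^sub>v 0\<^sub>v n" n y'] abcd y y'(1) by simp
    then show ?thesis using abcd y mult_mat_0_vec[OF abcd(4)] by simp
  qed
  have "c = 0\<^sub>m n n"
    by (rule mat_eqI_vec[OF abcd(3) zero_carrier_mat]) (use c0 in auto)
  then have Rb: "R = four_block_mat a b (0\<^sub>m n n) d" using abcd(5) by simp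
  have ad: "a\<^sup>T * d = 1\<^sub>m n"
  proof (rule eq_matI)
    fix i j assume "i < dim_row (1\<^sub>m n :: complex mat)" "j < dim_col (1\<^sub>m n :: complex mat)"
    then have ij: "i < n" "j < n" by auto
    let ?u = "unit_vec n i @\<^sub>v 0\<^sub>v n" and ?v = "0\<^sub>v n @\<^sub>v unit_vec n j"
    have cc: "col a i \<in> carrier_vec n" "col d j \<in> carrier_vec n" "col b j \<in> carrier_vec n"
      using abcd ij by auto
    have "R *\<^sub>v ?u = (a *\<^sub>v unit_vec n i + b *\<^sub>v 0\<^sub>v n) @\<^sub>v (0\<^sub>m n n *\<^sub>v unit_vec n i + d *\<^sub>v 0\<^sub>v n)"
      unfolding Rb by (rule four_block_mat_mult_vec[OF abcd(1,2) zero_carrier_mat abcd(4)]) auto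
    also have "\<dots> = col a i @\<^sub>v 0\<^sub>v n"
      using mult_mat_unit_vec[OF abcd(1) ij(1)] mult_mat_0_vec[OF abcd(2)] mult_mat_0_vec[OF abcd(4)]
        mult_mat_unit_vec[OF zero_carrier_mat[of n n] ij(1)] cc(1) ij by auto
    finally have u: "R *\<^sub>v ?u = col a i @\<^sub>v 0\<^sub>v n" .
    have "R *\<^sub>v ?v = (a *\<^sub>v 0\<^sub>v n + b *\<^sub>v unit_vec n j) @\<^sub>v (0\<^sub>m n n *\<^sub>v 0\<^sub>v n + d *\<^sub>v unit_vec n j)"
      unfolding Rb by (rule four_block_mat_mult_vec[OF abcd(1,2) zero_carrier_mat abcd(4)]) auto
    also have "\<dots> = col b j @\<^sub>v col d j"
      using mult_mat_unit_vec[OF abcd(2) ij(2)] mult_mat_unit_vec[OF abcd(4) ij(2)] mult_mat_0_vec[OF abcd(1)]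
        mult_mat_0_vec[OF zero_carrier_mat[of n n]] cc by auto
    finally have v: "R *\<^sub>v ?v = col b j @\<^sub>v col d j" .
    have "bform n ?u ?v = bform n (R *\<^sub>v ?u) (R *\<^sub>v ?v)"
      by (rule orthD(2)[OF R, symmetric]) auto
    also have "\<dots> = col a i \<bullet> col d j + 0\<^sub>v n \<bullet> col b j"
      unfolding u v by (rule bform_append) (use cc in auto)
    also have "\<dots> = col a i \<bullet> col d j" using cc by simp
    finally have "col a i \<bullet> col d j = bform n ?u ?v" by simp
    also have "\<dots> = unit_vec n i \<bullet> unit_vec n j + 0\<^sub>v n \<bullet> 0\<^sub>v n" by (rule bform_append) auto
    finally have "col a i \<bullet> col d j = (if i = j then 1 else 0)" using ij by simp
    then show "(a\<^sup>T * d) $$ (i, j) = 1\<^sub>m n $$ (i, j)" using abcd ij by simp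
  qed (use abcd in auto)
  have "det a * det d = det (a\<^sup>T * d)" using det_mult[of "a\<^sup>T" n d] det_transpose[OF abcd(1)] abcd by simp
  then have "det a * det d = 1" unfolding ad by simp
  then have "det R = 1"
    unfolding Rb using det_four_block_mat_lower_left_zero[OF abcd(1,2) _ abcd(4), of "0\<^sub>m n n"] by simp
  then have "det P = det Q" unfolding QR using det_mult[OF Qc Rc] by simp
  then show ?thesis using that[OF abcd(1,2,4) ad] QR R unfolding Rb by blast
qed

section \<open>Skew-symmetric matrices of corank one\<close>

definition kernel_line :: "nat \<Rightarrow> complex mat \<Rightarrow> complex vec \<Rightarrow> bool" where
  "kernel_line n w v \<longleftrightarrow> v \<in> carrier_vec n \<and> v \<noteq> 0\<^sub>v n \<and> w *\<^sub>v v = 0\<^sub>v n \<and>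
     (\<forall>x\<in>carrier_vec n. w *\<^sub>v x = 0\<^sub>v n \<longrightarrow> (\<exists>s. x = s \<cdot>\<^sub>v v))"

definition outer :: "nat \<Rightarrow> complex vec \<Rightarrow> complex mat" where
  "outer n c = mat n n (\<lambda>(i, j). c $ i * c $ j)"

lemma kernel_lineD:
  assumes "kernel_line n w v"
  shows "v \<in> carrier_vec n" "v \<noteq> 0\<^sub>v n" "w *\<^sub>v v = 0\<^sub>v n"
    "x \<in> carrier_vec n \<Longrightarrow> w *\<^sub>v x = 0\<^sub>v n \<Longrightarrow> \<exists>s. x = s \<cdot>\<^sub>v v"
  using assms unfolding kernel_line_def by blast+

lemma nonzero_entry:
  assumes "v \<in> carrier_vec n" "v \<noteq> (0\<^sub>v n :: complex vec)"
  obtains i where "i < n" "v $ i \<noteq> 0"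
proof -
  have "\<not> (\<forall>i<n. v $ i = 0)"
  proof
    assume "\<forall>i<n. v $ i = 0"
    then have "v = 0\<^sub>v n" using assms(1) by (intro eq_vecI) auto
    then show False using assms(2) by simp
  qed
  then show ?thesis using that by blast
qed

lemma zero_smult_vec: "c \<in> carrier_vec n \<Longrightarrow> 0 \<cdot>\<^sub>v c = (0\<^sub>v n :: complex vec)"
  by (intro eq_vecI) auto

lemma outer_carrier [simp]: "outer n c \<in> carrier_mat n n"
  by (simp add: outer_def)

lemma outer_mult_vec:
  assumes "c \<in> carrier_vec n" "x \<in> carrier_vec n"
  shows "outer n c *\<^sub>v x = (c \<bullet> x) \<cdot>\<^sub>v c"
proof (rule eq_vecI)
  fix i assume "i < dim_vec ((c \<bullet> x) \<cdot>\<^sub>v c)"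
  then have i: "i < n" using assms by simp
  then have "row (outer n c) i = c $ i \<cdot>\<^sub>v c" using assms by (intro eq_vecI) (auto simp: outer_def)
  then show "(outer n c *\<^sub>v x) $ i = ((c \<bullet> x) \<cdot>\<^sub>v c) $ i"
    using i assms by (simp add: outer_def)
qed (use assms in \<open>simp add: outer_def\<close>)

lemma add_outer_mult_vec:
  assumes "w \<in> carrier_mat n n" "c \<in> carrier_vec n" "x \<in> carrier_vec n"
  shows "(w + outer n c) *\<^sub>v x = w *\<^sub>v x + (c \<bullet> x) \<cdot>\<^sub>v c"
  using add_mult_distrib_mat_vec[OF assms(1) outer_carrier assms(3)] outer_mult_vec[OF assms(2,3)] by simp

text \<open>If \<open>(w + c c\<^sup>T) x = 0\<close>, the product with \<open>v\<close> gives \<open>c \<bullet> x = 0\<close>, because the image of \<open>w\<close> is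
  orthogonal to \<open>v\<close>. Then \<open>w x = 0\<close>, so \<open>x\<close> is a multiple of \<open>v\<close> that is orthogonal to \<open>c\<close>.\<close>

lemma kernel_line_det_add_outer:
  assumes w: "skew n w" and v: "kernel_line n w v" and c: "c \<in> carrier_vec n" "c \<bullet> v \<noteq> 0"
  shows "det (w + outer n c) \<noteq> 0"
proof -
  note wc = skewD(1)[OF w]
  have Nc: "w + outer n c \<in> carrier_mat n n" using wc by simp
  have "inj_mat n n (w + outer n c)"
    unfolding inj_mat_def
  proof (intro conjI Nc ballI impI)
    fix x assume x: "x \<in> carrier_vec n" "(w + outer n c) *\<^sub>v x = 0\<^sub>v n"
    note vD = kernel_lineD[OF v]
    have wx: "w *\<^sub>v x \<in> carrier_vec n" by (rule mult_mat_vec_carrier[OF wc x(1)])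
    have e: "w *\<^sub>v x + (c \<bullet> x) \<cdot>\<^sub>v c = 0\<^sub>v n" using x(2) add_outer_mult_vec[OF wc c(1) x(1)] by simp
    have "v \<bullet> (w *\<^sub>v x + (c \<bullet> x) \<cdot>\<^sub>v c) = 0" unfolding e using vD(1) by simp
    moreover have "v \<bullet> (w *\<^sub>v x + (c \<bullet> x) \<cdot>\<^sub>v c) = v \<bullet> (w *\<^sub>v x) + (c \<bullet> x) * (v \<bullet> c)"
      using scalar_prod_add_distrib[OF vD(1) wx, of "(c \<bullet> x) \<cdot>\<^sub>v c"] c vD(1) by simp
    moreover have "v \<bullet> (w *\<^sub>v x) = 0" using skew_scalar_prod[OF w vD(1) x(1)] vD(3) x(1) by simp
    moreover have "v \<bullet> c = c \<bullet> v" by (rule comm_scalar_prod[OF vD(1) c(1)])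
    ultimately have cx: "c \<bullet> x = 0" using c(2) by simp
    have "w *\<^sub>v x = 0\<^sub>v n" using e wx unfolding cx zero_smult_vec[OF c(1)] by simp
    then obtain s where s: "x = s \<cdot>\<^sub>v v" using vD(4)[OF x(1)] by blast
    have "s * (c \<bullet> v) = 0" using cx vD(1) c(1) unfolding s by simp
    then have "s = 0" using c(2) by simp
    then show "x = 0\<^sub>v n" unfolding s using vD(1) by auto
  qed
  then show ?thesis using inj_mat_det[OF Nc] by blast
qed

text \<open>A kernel vector \<open>x\<close> of \<open>w\<close> satisfies \<open>(w + c c\<^sup>T) x = (c \<bullet> x) c\<close>. This makes the kernel polynomial
  in the entries of \<open>w\<close>.\<close>

lemma kernel_line_adj:
  assumes w: "skew n w" "det w = 0" and c: "c \<in> carrier_vec n" and d: "det (w + outer n c) \<noteq> 0"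
  shows "kernel_line n w (adj_mat (w + outer n c) *\<^sub>v c)"
proof -
  note wc = skewD(1)[OF w(1)]
  let ?N = "w + outer n c"
  have Nc: "?N \<in> carrier_mat n n" using wc by simp
  note adj = adj_mat[OF Nc]
  define v where "v = adj_mat ?N *\<^sub>v c"
  have vc: "v \<in> carrier_vec n" unfolding v_def by (rule mult_mat_vec_carrier[OF adj(1) c])
  have ker: "x = ((c \<bullet> x) / det ?N) \<cdot>\<^sub>v v" if x: "x \<in> carrier_vec n" "w *\<^sub>v x = 0\<^sub>v n" for x
  proof -
    have "?N *\<^sub>v x = (c \<bullet> x) \<cdot>\<^sub>v c" using add_outer_mult_vec[OF wc c x(1)] x c by simp
    then have "adj_mat ?N *\<^sub>v (?N *\<^sub>v x) = (c \<bullet> x) \<cdot>\<^sub>v v"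
      unfolding v_def using mult_mat_vec[OF adj(1) c] by simp
    moreover have "adj_mat ?N *\<^sub>v (?N *\<^sub>v x) = det ?N \<cdot>\<^sub>v x"
      unfolding assoc_mult_mat_vec[OF adj(1) Nc x(1), symmetric] adj(3)
      using x(1) by (intro eq_vecI) auto
    ultimately have e: "det ?N \<cdot>\<^sub>v x = (c \<bullet> x) \<cdot>\<^sub>v v" by simp
    show ?thesis
    proof (rule eq_vecI)
      fix i assume "i < dim_vec (((c \<bullet> x) / det ?N) \<cdot>\<^sub>v v)"
      then have i: "i < n" using vc by simp
      then have "det ?N * x $ i = (c \<bullet> x) * v $ i" using arg_cong[OF e, of "\<lambda>z. z $ i"] x(1) vc by simp
      then show "x $ i = (((c \<bullet> x) / det ?N) \<cdot>\<^sub>v v) $ i" using i vc d by (simp add: field_simps)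
    qed (use x vc in simp)
  qed
  obtain v0 where v0: "v0 \<in> carrier_vec n" "v0 \<noteq> 0\<^sub>v n" "w *\<^sub>v v0 = 0\<^sub>v n"
    using det_0_iff_vec_prod_zero_field[OF wc] w(2) by blast
  define s where "s = (c \<bullet> v0) / det ?N"
  have s: "v0 = s \<cdot>\<^sub>v v" using ker[OF v0(1,3)] by (simp add: s_def)
  have "s \<noteq> 0" using v0(2) vc unfolding s by auto
  have "s \<cdot>\<^sub>v (w *\<^sub>v v) = 0\<^sub>v n" using v0(3) mult_mat_vec[OF wc vc] unfolding s by simp
  then have "(1 / s) \<cdot>\<^sub>v (s \<cdot>\<^sub>v (w *\<^sub>v v)) = 0\<^sub>v n" by auto
  then have "w *\<^sub>v v = 0\<^sub>v n" using \<open>s \<noteq> 0\<close> by (simp add: smult_smult_assoc)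
  moreover have "v \<noteq> 0\<^sub>v n" using v0(2) unfolding s by auto
  ultimately show ?thesis unfolding kernel_line_def v_def[symmetric] using vc ker by blast
qed

lemma skew_odd_det:
  assumes "skew n w" "odd n"
  shows "det w = 0"
proof -
  note wc = skewD(1)[OF assms(1)]
  have "- w = (-1) \<cdot>\<^sub>m w" using wc by (intro eq_matI) auto
  then have "det (- w) = (- 1) ^ n * det w" using wc by simp
  also have "\<dots> = - det w" using assms(2) by simp
  finally have "det w = - det w" using det_transpose[OF wc] skew_transpose[OF assms(1)] by simp
  then show ?thesis by simp
qed

lemma kernel_line_image:
  assumes w: "skew n w" and v: "kernel_line n w v" and y: "y \<in> carrier_vec n"
  shows "y \<bullet> v = 0 \<longleftrightarrow> (\<exists>x\<in>carrier_vec n. y = w *\<^sub>v x)"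
proof
  note wc = skewD(1)[OF w] and vD = kernel_lineD[OF v]
  assume "\<exists>x\<in>carrier_vec n. y = w *\<^sub>v x"
  then obtain x where x: "x \<in> carrier_vec n" "y = w *\<^sub>v x" by blast
  have "x \<bullet> (w *\<^sub>v v) = 0" using vD x by simp
  then show "y \<bullet> v = 0" using skew_scalar_prod[OF w x(1) vD(1)] x by simp
next
  note wc = skewD(1)[OF w] and vD = kernel_lineD[OF v]
  assume yv: "y \<bullet> v = 0"
  obtain i where i: "i < n" "v $ i \<noteq> 0" using nonzero_entry[OF vD(1,2)] by blast
  let ?c = "unit_vec n i :: complex vec"
  have cv: "?c \<bullet> v \<noteq> 0" using i vD(1) by simp
  let ?N = "w + outer n ?c"
  have Nc: "?N \<in> carrier_mat n n" using wc by simp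
  note I = det_nonzero_inverse[OF Nc kernel_line_det_add_outer[OF w v unit_vec_carrier cv]]
  let ?I = "(1 / det ?N) \<cdot>\<^sub>m adj_mat ?N"
  define x where "x = ?I *\<^sub>v y"
  have x: "x \<in> carrier_vec n" unfolding x_def by (rule mult_mat_vec_carrier[OF I(1) y])
  have wx: "w *\<^sub>v x \<in> carrier_vec n" by (rule mult_mat_vec_carrier[OF wc x])
  have "?N *\<^sub>v x = y" unfolding x_def assoc_mult_mat_vec[OF Nc I(1) y, symmetric] I(2) using y by simp
  then have e: "y = w *\<^sub>v x + (?c \<bullet> x) \<cdot>\<^sub>v ?c" using add_outer_mult_vec[OF wc unit_vec_carrier x] by simp
  have "y \<bullet> v = (w *\<^sub>v x) \<bullet> v + (?c \<bullet> x) * (?c \<bullet> v)"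
    unfolding e using add_scalar_prod_distrib[OF wx _ vD(1), of "(?c \<bullet> x) \<cdot>\<^sub>v ?c"] vD(1)
      smult_scalar_prod_distrib[OF unit_vec_carrier vD(1)] by simp
  moreover have "(w *\<^sub>v x) \<bullet> v = 0" using skew_scalar_prod[OF w x vD(1)] vD x by simp
  ultimately have "?c \<bullet> x = 0" using yv cv by simp
  then have "y = w *\<^sub>v x" using e wx zero_smult_vec[of ?c n] by simp
  then show "\<exists>x\<in>carrier_vec n. y = w *\<^sub>v x" using x by blast
qed

section \<open>The Lagrangian attached to a hyperplane of a Lagrangian\<close>

text \<open>The Lagrangian \<open>v\<^sup>\<bottom> \<oplus> \<langle>v\<rangle>\<close>, where \<open>v\<^sup>\<bottom>\<close> lies in the span of the \<open>e\<^sub>i\<^sup>+\<close> and \<open>v\<close> in the span of the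
  \<open>e\<^sub>i\<^sup>-\<close>. Besides the span of the \<open>e\<^sub>i\<^sup>+\<close> it is the only Lagrangian that contains \<open>v\<^sup>\<bottom>\<close>.\<close>

definition dual_lag :: "nat \<Rightarrow> complex vec \<Rightarrow> complex vec set" where
  "dual_lag n v = {y @\<^sub>v (s \<cdot>\<^sub>v v) | y s. y \<in> carrier_vec n \<and> y \<bullet> v = 0}"

text \<open>The coordinate of \<open>dual_lag n v\<close> in the chart centred at the coordinate Lagrangian in which \<open>e\<^sub>m\<^sup>+\<close> is
  replaced by \<open>e\<^sub>m\<^sup>-\<close>.\<close>

definition flip_chart :: "nat \<Rightarrow> nat \<Rightarrow> complex vec \<Rightarrow> complex mat" where
  "flip_chart n m v = mat n n (\<lambda>(i, j). if j = m \<and> i \<noteq> m then v $ i / v $ m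
     else if i = m \<and> j \<noteq> m then - (v $ j / v $ m) else 0)"

lemma skew_flip_chart: "skew n (flip_chart n m v)"
  unfolding skew_def by (auto simp: flip_chart_def)

lemma swap_single_append:
  assumes "y \<in> carrier_vec n" "z \<in> carrier_vec n" "m < n"
  shows "swap_mat n {m} *\<^sub>v (y @\<^sub>v z) =
    vec n (\<lambda>i. if i = m then z $ m else y $ i) @\<^sub>v vec n (\<lambda>i. if i = m then y $ m else z $ i)"
proof (rule eq_vecI)
  fix i assume "i < dim_vec (vec n (\<lambda>i. if i = m then z $ m else y $ i) @\<^sub>v vec n (\<lambda>i. if i = m then y $ m else z $ i))"
  then have i: "i < n + n" by simp
  have yz: "y @\<^sub>v z \<in> carrier_vec (n + n)" using assms by simp
  show "(swap_mat n {m} *\<^sub>v (y @\<^sub>v z)) $ i =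
      (vec n (\<lambda>i. if i = m then z $ m else y $ i) @\<^sub>v vec n (\<lambda>i. if i = m then y $ m else z $ i)) $ i"
    unfolding swap_mat_vec[OF yz i] using i assms by (auto simp: swap_idx_def not_less)
qed (simp add: swap_mat_def)

lemma flip_chart_mult_vec:
  assumes y: "y \<in> carrier_vec n" and v: "v \<in> carrier_vec n" and m: "m < n" and i: "i < n"
  shows "(flip_chart n m v *\<^sub>v y) $ i =
    (if i = m then - (\<Sum>j\<in>{..<n} - {m}. y $ j * v $ j) / v $ m else v $ i / v $ m * y $ m)"
proof -
  have e: "(flip_chart n m v *\<^sub>v y) $ i = (\<Sum>j<n. flip_chart n m v $$ (i, j) * y $ j)"
    using y i by (simp add: scalar_prod_def flip_chart_def lessThan_atLeast0)
  show ?thesis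
  proof (cases "i = m")
    case True
    have "(\<Sum>j<n. flip_chart n m v $$ (i, j) * y $ j) =
        (\<Sum>j\<in>{..<n} - {m}. - (y $ j * v $ j) / v $ m)"
      using True m by (intro sum.mono_neutral_cong_right) (auto simp: flip_chart_def)
    also have "\<dots> = - (\<Sum>j\<in>{..<n} - {m}. y $ j * v $ j) / v $ m"
      by (simp add: sum_divide_distrib sum_negf)
    finally show ?thesis using e True by simp
  next
    case False
    have "(\<Sum>j<n. flip_chart n m v $$ (i, j) * y $ j) = (\<Sum>j\<in>{m}. v $ i / v $ m * y $ j)"
      using False m i by (intro sum.mono_neutral_cong_right) (auto simp: flip_chart_def)
    then show ?thesis using e False by simp
  qed
qed

text \<open>For \<open>y\<close> in \<open>v\<^sup>\<bottom>\<close> the entry \<open>y\<^sub>m\<close> is determined by the others, and a multiple \<open>z\<close> of \<open>v\<close> is determined by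
  its entry \<open>z\<^sub>m\<close>. The chart takes the other entries of \<open>y\<close>, and \<open>z\<^sub>m\<close>, as parameters.\<close>

lemma dual_lag_eq_chart:
  assumes v: "v \<in> carrier_vec n" and m: "m < n" "v $ m \<noteq> 0"
  shows "dual_lag n v = gr_chart n (swap_mat n {m}) (flip_chart n m v)"
proof -
  let ?X = "flip_chart n m v"
  note Xc = skewD(1)[OF skew_flip_chart[of n m v]]
  define g where "g = (\<lambda>y. vec n (\<lambda>i. if i = m then (?X *\<^sub>v y) $ m else y $ i))"
  have dotsum: "x \<bullet> v = x $ m * v $ m + (\<Sum>j\<in>{..<n} - {m}. x $ j * v $ j)" if "x \<in> carrier_vec n" for x
    using that v m by (simp add: scalar_prod_def lessThan_atLeast0 sum.remove[of _ m])
  have act: "swap_mat n {m} *\<^sub>v (y @\<^sub>v (?X *\<^sub>v y)) = g y @\<^sub>v ((y $ m / v $ m) \<cdot>\<^sub>v v)"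
    if y: "y \<in> carrier_vec n" for y
  proof -
    have c: "?X *\<^sub>v y \<in> carrier_vec n" by (rule mult_mat_vec_carrier[OF Xc y])
    have "vec n (\<lambda>i. if i = m then y $ m else (?X *\<^sub>v y) $ i) = (y $ m / v $ m) \<cdot>\<^sub>v v"
      using v m flip_chart_mult_vec[OF y v m(1)] by (intro eq_vecI) auto
    then show ?thesis unfolding swap_single_append[OF y c m(1)] g_def by simp
  qed
  have gc: "g y \<in> carrier_vec n" for y by (simp add: g_def)
  have gv: "g y \<bullet> v = 0" if y: "y \<in> carrier_vec n" for y
  proof -
    have "(\<Sum>j\<in>{..<n} - {m}. g y $ j * v $ j) = (\<Sum>j\<in>{..<n} - {m}. y $ j * v $ j)"
      by (intro sum.cong) (auto simp: g_def)
    moreover have "g y $ m = - (\<Sum>j\<in>{..<n} - {m}. y $ j * v $ j) / v $ m"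
      using m flip_chart_mult_vec[OF y v m(1) m(1)] by (simp add: g_def)
    ultimately show ?thesis using dotsum[OF gc] m by simp
  qed
  show ?thesis
  proof
    show "gr_chart n (swap_mat n {m}) ?X \<subseteq> dual_lag n v"
    proof
      fix x assume "x \<in> gr_chart n (swap_mat n {m}) ?X"
      then obtain y where y: "y \<in> carrier_vec n" "x = swap_mat n {m} *\<^sub>v (y @\<^sub>v (?X *\<^sub>v y))"
        by (auto simp: gr_chart_def)
      then show "x \<in> dual_lag n v" unfolding y(2) act[OF y(1)] dual_lag_def using gc gv[OF y(1)] by blast
    qed
    show "dual_lag n v \<subseteq> gr_chart n (swap_mat n {m}) ?X"
    proof
      fix x assume "x \<in> dual_lag n v"
      then obtain z s where z: "z \<in> carrier_vec n" "z \<bullet> v = 0" "x = z @\<^sub>v (s \<cdot>\<^sub>v v)"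
        by (auto simp: dual_lag_def)
      define y where "y = vec n (\<lambda>i. if i = m then s * v $ m else z $ i)"
      have y: "y \<in> carrier_vec n" by (simp add: y_def)
      have "g y = z"
      proof (rule eq_vecI)
        fix i assume "i < dim_vec z"
        then have i: "i < n" using z by simp
        show "g y $ i = z $ i"
        proof (cases "i = m")
          case True
          have "(\<Sum>j\<in>{..<n} - {m}. y $ j * v $ j) = (\<Sum>j\<in>{..<n} - {m}. z $ j * v $ j)"
            by (intro sum.cong) (auto simp: y_def)
          also have "\<dots> = - (z $ m * v $ m)" using dotsum[OF z(1)] z(2) by (simp add: eq_neg_iff_add_eq_0 add.commute)
          finally show ?thesis
            using True i m flip_chart_mult_vec[OF y v m(1) m(1)] by (simp add: g_def)
        qed (use i in \<open>simp add: g_def y_def\<close>)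
      qed (use z in \<open>simp add: g_def\<close>)
      moreover have "y $ m / v $ m = s" using m by (simp add: y_def)
      ultimately have "x = swap_mat n {m} *\<^sub>v (y @\<^sub>v (?X *\<^sub>v y))" unfolding act[OF y] z(3) by simp
      then show "x \<in> gr_chart n (swap_mat n {m}) ?X" unfolding gr_chart_def using y by blast
    qed
  qed
qed

lemma dual_lag_eq_lag:
  assumes v: "v \<in> carrier_vec n" "v \<noteq> 0\<^sub>v n"
  obtains T where "orth n T" "det T = - 1" "dual_lag n v = lag n T"
proof -
  obtain m where m: "m < n" "v $ m \<noteq> 0" using nonzero_entry[OF v] by blast
  let ?T = "swap_mat n {m} * shear n (flip_chart n m v)"
  note sk = skew_flip_chart[of n m v]
  have "orth n ?T" by (rule orth_mult[OF orth_swap orth_shear[OF sk]])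
  moreover have "det ?T = - 1"
    using det_mult[OF swap_mat_carrier shear_carrier[OF skewD(1)[OF sk]]] det_swap_mat[of "{m}" n] m
      det_shear[OF skewD(1)[OF sk]] by simp
  moreover have "dual_lag n v = lag n ?T"
    unfolding dual_lag_eq_chart[OF v(1) m] by (rule gr_chart_eq_lag[OF swap_mat_carrier skewD(1)[OF sk]])
  ultimately show ?thesis using that by blast
qed

text \<open>The block \<open>a\<close> maps the orthogonal complement of \<open>v\<close> to that of \<open>d v\<close>, because \<open>a\<^sup>T d = 1\<close>. So
  the construction does not depend on the frame chosen for the Lagrangian.\<close>

lemma dual_lag_change_frame:
  assumes a: "a \<in> carrier_mat n n" and c: "c \<in> carrier_mat n n" and d: "d \<in> carrier_mat n n"
    and ad: "a\<^sup>T * d = 1\<^sub>m n" and R: "orth n (four_block_mat a c (0\<^sub>m n n) d)"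
    and v: "v \<in> carrier_vec n" "v \<noteq> 0\<^sub>v n"
  shows "(\<lambda>x. four_block_mat a c (0\<^sub>m n n) d *\<^sub>v x) ` dual_lag n v = dual_lag n (d *\<^sub>v v)"
proof -
  let ?R = "four_block_mat a c (0\<^sub>m n n) d"
  have aT: "a\<^sup>T \<in> carrier_mat n n" using a by simp
  have atd: "a\<^sup>T *\<^sub>v (d *\<^sub>v x) = x" if "x \<in> carrier_vec n" for x
    unfolding assoc_mult_mat_vec[OF aT d that, symmetric] ad using that by simp
  have dv: "d *\<^sub>v v \<in> carrier_vec n" by (rule mult_mat_vec_carrier[OF d v(1)])
  have dv0: "d *\<^sub>v v \<noteq> 0\<^sub>v n" using atd[OF v(1)] mult_mat_0_vec[OF aT] v(2) by metis
  obtain T where T: "orth n T" "dual_lag n v = lag n T" using dual_lag_eq_lag[OF v] by metis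
  obtain T' where T': "orth n T'" "dual_lag n (d *\<^sub>v v) = lag n T'" using dual_lag_eq_lag[OF dv dv0] by metis
  have act: "?R *\<^sub>v (y @\<^sub>v z) = (a *\<^sub>v y + c *\<^sub>v z) @\<^sub>v (d *\<^sub>v z)"
    if "y \<in> carrier_vec n" "z \<in> carrier_vec n" for y z
  proof -
    have "?R *\<^sub>v (y @\<^sub>v z) = (a *\<^sub>v y + c *\<^sub>v z) @\<^sub>v (0\<^sub>m n n *\<^sub>v y + d *\<^sub>v z)"
      by (rule four_block_mat_mult_vec[OF a c zero_carrier_mat d that])
    then show ?thesis using zero_mat_mult_vec[OF that(1), of n] mult_mat_vec_carrier[OF d that(2)] by simp
  qed
  have cv: "c *\<^sub>v v \<in> carrier_vec n" by (rule mult_mat_vec_carrier[OF c v(1)])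
  have cd: "(c *\<^sub>v v) \<bullet> (d *\<^sub>v v) = 0"
  proof -
    have z: "0\<^sub>v n @\<^sub>v v \<in> carrier_vec (n + n)" using v by simp
    have "bform n (?R *\<^sub>v (0\<^sub>v n @\<^sub>v v)) (?R *\<^sub>v (0\<^sub>v n @\<^sub>v v)) = bform n (0\<^sub>v n @\<^sub>v v) (0\<^sub>v n @\<^sub>v v)"
      by (rule orthD(2)[OF R z z])
    also have "\<dots> = 0" using bform_append[of "0\<^sub>v n" n v "0\<^sub>v n" v] v by simp
    also have "?R *\<^sub>v (0\<^sub>v n @\<^sub>v v) = c *\<^sub>v v @\<^sub>v d *\<^sub>v v"
      using act[of "0\<^sub>v n" v] v mult_mat_0_vec[OF a] cv by simp
    also have "bform n (c *\<^sub>v v @\<^sub>v d *\<^sub>v v) (c *\<^sub>v v @\<^sub>v d *\<^sub>v v) = 2 * ((c *\<^sub>v v) \<bullet> (d *\<^sub>v v))"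
      using bform_append[OF cv dv cv dv] comm_scalar_prod[OF cv dv] by simp
    finally show ?thesis by simp
  qed
  have "(\<lambda>x. ?R *\<^sub>v x) ` dual_lag n v \<subseteq> dual_lag n (d *\<^sub>v v)"
  proof
    fix x assume "x \<in> (\<lambda>x. ?R *\<^sub>v x) ` dual_lag n v"
    then obtain y s where y: "y \<in> carrier_vec n" "y \<bullet> v = 0" "x = ?R *\<^sub>v (y @\<^sub>v (s \<cdot>\<^sub>v v))"
      by (auto simp: dual_lag_def)
    have ay: "a *\<^sub>v y \<in> carrier_vec n" by (rule mult_mat_vec_carrier[OF a y(1)])
    have "x = (a *\<^sub>v y + s \<cdot>\<^sub>v (c *\<^sub>v v)) @\<^sub>v (s \<cdot>\<^sub>v (d *\<^sub>v v))"
      unfolding y(3) using act[OF y(1), of "s \<cdot>\<^sub>v v"] v mult_mat_vec[OF c v(1)] mult_mat_vec[OF d v(1)] by simp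
    moreover have "(a *\<^sub>v y) \<bullet> (d *\<^sub>v v) = 0"
    proof -
      have "(d *\<^sub>v v) \<bullet> (a *\<^sub>v y) = (a\<^sup>T *\<^sub>v (d *\<^sub>v v)) \<bullet> y"
        using transpose_vec_mult_scalar[OF a y(1) dv] by simp
      also have "\<dots> = 0" unfolding atd[OF v(1)] using y v comm_scalar_prod[OF v(1) y(1)] by simp
      finally show ?thesis using comm_scalar_prod[OF ay dv] by simp
    qed
    then have "(a *\<^sub>v y + s \<cdot>\<^sub>v (c *\<^sub>v v)) \<bullet> (d *\<^sub>v v) = 0"
      using add_scalar_prod_distrib[OF ay _ dv, of "s \<cdot>\<^sub>v (c *\<^sub>v v)"] cd cv dv
        smult_scalar_prod_distrib[OF cv dv, of s] by simp
    moreover have "a *\<^sub>v y + s \<cdot>\<^sub>v (c *\<^sub>v v) \<in> carrier_vec n" using ay cv by simp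
    ultimately show "x \<in> dual_lag n (d *\<^sub>v v)" unfolding dual_lag_def by blast
  qed
  moreover have "(\<lambda>x. ?R *\<^sub>v x) ` dual_lag n v = lag n (?R * T)"
    unfolding T(2) by (rule lag_mult[OF orthD(1)[OF R] orthD(1)[OF T(1)], symmetric])
  ultimately show ?thesis using lag_subset_eq[OF orth_mult[OF R T(1)] T'(1)] T'(2) by simp
qed

text \<open>The columns of this matrix span \<open>v\<^sup>\<bottom> \<oplus> \<langle>v\<rangle>\<close>, where \<open>v\<close> spans the kernel of \<open>w\<close>. Its entries are
  polynomials in the entries of \<open>w\<close>.\<close>

definition gen_mat :: "nat \<Rightarrow> complex vec \<Rightarrow> complex mat \<Rightarrow> complex mat" where
  "gen_mat n c w = four_block_mat w (0\<^sub>m n 1) (0\<^sub>m n n) (adj_mat (w + outer n c) * mat n 1 (\<lambda>(i, _). c $ i))"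

lemma col_image_gen_mat:
  assumes w: "skew n w" "det w = 0" and c: "c \<in> carrier_vec n" and d: "det (w + outer n c) \<noteq> 0"
  shows "col_image (n + 1) (gen_mat n c w) = dual_lag n (adj_mat (w + outer n c) *\<^sub>v c)"
proof -
  note wc = skewD(1)[OF w(1)]
  have Nc: "w + outer n c \<in> carrier_mat n n" using wc by simp
  note adj = adj_mat(1)[OF Nc]
  define v where "v = adj_mat (w + outer n c) *\<^sub>v c"
  have v: "kernel_line n w v" unfolding v_def by (rule kernel_line_adj[OF w c d])
  note vD = kernel_lineD[OF v]
  let ?c = "mat n 1 (\<lambda>(i, _). c $ i) :: complex mat"
  have cc: "?c \<in> carrier_mat n 1" by simp
  have V: "adj_mat (w + outer n c) * ?c \<in> carrier_mat n 1" by (rule mult_carrier_mat[OF adj cc])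
  have cs: "?c *\<^sub>v t = t $ 0 \<cdot>\<^sub>v c" if "t \<in> carrier_vec 1" for t
    using that c by (intro eq_vecI) (auto simp: scalar_prod_def)
  have Vt: "(adj_mat (w + outer n c) * ?c) *\<^sub>v t = t $ 0 \<cdot>\<^sub>v v" if "t \<in> carrier_vec 1" for t
    unfolding assoc_mult_mat_vec[OF adj cc that] cs[OF that] v_def by (rule mult_mat_vec[OF adj c])
  have act: "gen_mat n c w *\<^sub>v (x @\<^sub>v t) = (w *\<^sub>v x) @\<^sub>v (t $ 0 \<cdot>\<^sub>v v)"
    if xt: "x \<in> carrier_vec n" "t \<in> carrier_vec 1" for x t
  proof -
    have "gen_mat n c w *\<^sub>v (x @\<^sub>v t) = (w *\<^sub>v x + 0\<^sub>m n 1 *\<^sub>v t) @\<^sub>v (0\<^sub>m n n *\<^sub>v x + (adj_mat (w + outer n c) * ?c) *\<^sub>v t)"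
      unfolding gen_mat_def by (rule four_block_mat_mult_vec[OF wc zero_carrier_mat zero_carrier_mat V xt])
    then show ?thesis
      unfolding Vt[OF xt(2)] zero_mat_mult_vec[OF xt(1)] zero_mat_mult_vec[OF xt(2)]
      using mult_mat_vec_carrier[OF wc xt(1)] vD(1) by simp
  qed
  show ?thesis
    unfolding v_def[symmetric]
  proof
    show "col_image (n + 1) (gen_mat n c w) \<subseteq> dual_lag n v"
    proof
      fix u assume "u \<in> col_image (n + 1) (gen_mat n c w)"
      then obtain y where y: "y \<in> carrier_vec (n + 1)" "u = gen_mat n c w *\<^sub>v y" unfolding col_image_def by blast
      obtain x t where xt: "x \<in> carrier_vec n" "t \<in> carrier_vec 1" "y = x @\<^sub>v t" using split_vec[OF y(1)] by metis
      have "w *\<^sub>v x \<in> carrier_vec n" by (rule mult_mat_vec_carrier[OF wc xt(1)])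
      moreover from this have "(w *\<^sub>v x) \<bullet> v = 0" using kernel_line_image[OF w(1) v] xt(1) by blast
      ultimately show "u \<in> dual_lag n v" unfolding y(2) xt(3) act[OF xt(1,2)] dual_lag_def by blast
    qed
    show "dual_lag n v \<subseteq> col_image (n + 1) (gen_mat n c w)"
    proof
      fix u assume "u \<in> dual_lag n v"
      then obtain y s where y: "y \<in> carrier_vec n" "y \<bullet> v = 0" "u = y @\<^sub>v (s \<cdot>\<^sub>v v)" by (auto simp: dual_lag_def)
      obtain x where x: "x \<in> carrier_vec n" "y = w *\<^sub>v x" using kernel_line_image[OF w(1) v y(1)] y(2) by blast
      let ?t = "vec 1 (\<lambda>_. s)"
      have "u = gen_mat n c w *\<^sub>v (x @\<^sub>v ?t)" unfolding y(3) x(2) using act[OF x(1), of ?t] by simp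
      moreover have "x @\<^sub>v ?t \<in> carrier_vec (n + 1)" by (rule append_carrier_vec[OF x(1) vec_carrier])
      ultimately show "u \<in> col_image (n + 1) (gen_mat n c w)" unfolding col_image_def by blast
    qed
  qed
qed

lemma mat_over_gen_mat:
  assumes R: "function_ring R" and w: "mat_over R n n w" and c: "c \<in> carrier_vec n"
  shows "mat_over R (n + n) (n + 1) (\<lambda>x. gen_mat n c (w x))"
  unfolding gen_mat_def
  by (rule mat_over_four_block[OF w mat_over_const[OF R zero_carrier_mat] mat_over_const[OF R zero_carrier_mat]
      mat_over_mult[OF R adj_mat_over[OF R mat_over_add[OF R w mat_over_const[OF R outer_carrier]]]
        mat_over_const[OF R mat_carrier]]])

section \<open>Sign patterns\<close>

text \<open>A sign sequence is given by the set \<open>S\<close> of its minus signs, with positions counted from \<open>0\<close>. The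
  skew matrices supported on the pairs whose smaller member lies in \<open>S\<close> are the coordinates of the
  Schubert cell of \<open>S\<close>, and those supported on the other pairs are its conormal space.\<close>

definition cell :: "nat \<Rightarrow> nat set \<Rightarrow> complex mat set" where
  "cell n S = {X. skew n X \<and> (\<forall>i j. i < j \<longrightarrow> j < n \<longrightarrow> i \<notin> S \<longrightarrow> X $$ (i, j) = 0)}"

definition toggle :: "nat set \<Rightarrow> nat \<Rightarrow> nat set" where
  "toggle S m = (if m \<in> S then S - {m} else insert m S)"

lemma swap_mat_toggle:
  assumes "m < n"
  shows "swap_mat n (toggle S m) = swap_mat n S * swap_mat n {m}"
proof (rule mat_eqI_vec[of _ "n + n" "n + n"])
  show "swap_mat n S * swap_mat n {m} \<in> carrier_mat (n + n) (n + n)"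
    by (rule mult_carrier_mat[OF swap_mat_carrier swap_mat_carrier])
  fix y :: "complex vec" assume y: "y \<in> carrier_vec (n + n)"
  show "swap_mat n (toggle S m) *\<^sub>v y = swap_mat n S * swap_mat n {m} *\<^sub>v y"
    unfolding assoc_mult_mat_vec[OF swap_mat_carrier swap_mat_carrier y]
  proof (rule eq_vecI)
    fix i assume "i < dim_vec (swap_mat n S *\<^sub>v (swap_mat n {m} *\<^sub>v y))"
    then have i: "i < n + n" by (simp add: swap_mat_def)
    have "swap_idx n (toggle S m) i = swap_idx n {m} (swap_idx n S i)"
    proof (cases "i < n")
      case True
      then show ?thesis
        using assms by (cases "i = m"; cases "i \<in> S") (simp_all add: swap_idx_def toggle_def)
    next
      case False
      then obtain l where l: "i = n + l" by (metis le_add_diff_inverse not_less)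
      then show ?thesis
        using assms i by (cases "l = m"; cases "l \<in> S") (simp_all add: swap_idx_def toggle_def)
    qed
    then show "(swap_mat n (toggle S m) *\<^sub>v y) $ i = (swap_mat n S *\<^sub>v (swap_mat n {m} *\<^sub>v y)) $ i"
      using swap_mat_vec[OF mult_mat_vec_carrier[OF swap_mat_carrier y] i]
        swap_mat_vec[OF y i] swap_mat_vec[OF y swap_idx_lt[OF i]] by simp
  qed (simp add: swap_mat_def)
qed simp

lemma cellD:
  assumes "X \<in> cell n S"
  shows "skew n X" "i < j \<Longrightarrow> j < n \<Longrightarrow> i \<notin> S \<Longrightarrow> X $$ (i, j) = 0"
    "i < j \<Longrightarrow> j < n \<Longrightarrow> i \<notin> S \<Longrightarrow> X $$ (j, i) = 0"
proof -
  have *: "skew n X" "\<And>i j. i < j \<Longrightarrow> j < n \<Longrightarrow> i \<notin> S \<Longrightarrow> X $$ (i, j) = 0"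
    using assms unfolding cell_def by blast+
  show "skew n X" by (rule *(1))
  show "X $$ (i, j) = 0" if "i < j" "j < n" "i \<notin> S" using *(2) that by blast
  show "X $$ (j, i) = 0" if "i < j" "j < n" "i \<notin> S"
    using skewD(2)[OF *(1), of j i] *(2)[OF that] that by simp
qed

lemma conormal_entry_0:
  assumes w: "w \<in> cell n (- S)" and "k < n" "j < n" "j \<in> S" "k \<in> S \<or> j < k"
  shows "w $$ (k, j) = 0"
proof (cases k j rule: linorder_cases)
  case less
  then show ?thesis using cellD(2)[OF w less] assms by auto
next
  case equal
  then show ?thesis using skew_diag[OF cellD(1)[OF w]] assms by simp
next
  case greater
  then show ?thesis using cellD(3)[OF w greater] assms by auto
qed

lemma mult_vec_index_sum:
  assumes "A \<in> carrier_mat r k" "x \<in> carrier_vec k" "i < r"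
  shows "(A *\<^sub>v x) $ i = (\<Sum>j<k. A $$ (i, j) * x $ j)"
  using assms by (simp add: scalar_prod_def lessThan_atLeast0)

text \<open>The minus signs before position \<open>k\<close> can only be joined to earlier plus signs. So a vector
  supported on minus signs below \<open>k\<close> is in the kernel as soon as it is killed by the rows of the plus
  signs below \<open>k\<close>.\<close>

lemma conormal_kernel_vec:
  assumes w: "w \<in> cell n (- S)" and k: "k \<le> n" and M: "M \<subseteq> S \<inter> {..<k}"
    and u: "\<And>i. i \<notin> M \<Longrightarrow> u i = 0" and eqs: "\<And>a. a \<in> {..<k} - S \<Longrightarrow> (\<Sum>i\<in>M. w $$ (a, i) * u i) = 0"
  shows "w *\<^sub>v vec n u = 0\<^sub>v n"
proof (rule eq_vecI)
  note wc = skewD(1)[OF cellD(1)[OF w]]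
  fix i assume "i < dim_vec (0\<^sub>v n :: complex vec)"
  then have i: "i < n" by simp
  have Mn: "M \<subseteq> {..<n}" using M k by auto
  have "(w *\<^sub>v vec n u) $ i = (\<Sum>j<n. w $$ (i, j) * u j)"
    using mult_vec_index_sum[OF wc vec_carrier i, of u] by simp
  also have "\<dots> = (\<Sum>j\<in>M. w $$ (i, j) * u j)"
    using Mn u by (intro sum.mono_neutral_right) auto
  also have "\<dots> = 0"
  proof (cases "i \<in> {..<k} - S")
    case False
    have "w $$ (i, j) = 0" if "j \<in> M" for j
      by (rule conormal_entry_0[OF w i]) (use that M k False in auto)
    then show ?thesis by simp
  qed (rule eqs)
  finally show "(w *\<^sub>v vec n u) $ i = 0\<^sub>v n $ i" using i by simp
qed (use skewD(1)[OF cellD(1)[OF w]] in simp)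

text \<open>Even together with the equation \<open>c \<bullet> x = 0\<close>, the equations for vectors supported on the first
  minus signs are fewer than the unknowns. Such a solution is a kernel vector of \<open>w\<close> and of \<open>c c\<^sup>T\<close>.\<close>

lemma conormal_degenerate:
  assumes w: "w \<in> cell n (- S)" and k: "k \<le> n" and card: "card ({..<k} - S) + 2 \<le> card (S \<inter> {..<k})"
    and c: "c \<in> carrier_vec n"
  shows "det (w + outer n c) = 0"
proof -
  note wc = skewD(1)[OF cellD(1)[OF w]]
  have Nc: "w + outer n c \<in> carrier_mat n n" using wc by simp
  let ?M = "S \<inter> {..<k}" and ?A = "insert None (Some ` ({..<k} - S))"
  define e where "e = (\<lambda>a i. case a of None \<Rightarrow> c $ i | Some a \<Rightarrow> w $$ (a, i))"
  have "card ?A < card ?M" using card by (simp add: card_insert_if card_image)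
  from underdetermined_system[OF _ _ this, of e] obtain u where u: "\<exists>i\<in>?M. u i \<noteq> 0" "\<And>i. i \<notin> ?M \<Longrightarrow> u i = 0"
    "\<And>a. a \<in> ?A \<Longrightarrow> (\<Sum>i\<in>?M. e a i * u i) = 0" by auto
  have wu: "w *\<^sub>v vec n u = 0\<^sub>v n"
  proof (rule conormal_kernel_vec[OF w k subset_refl u(2)])
    fix a assume "a \<in> {..<k} - S"
    then show "(\<Sum>i\<in>?M. w $$ (a, i) * u i) = 0" using u(3)[of "Some a"] by (simp add: e_def)
  qed
  have "c \<bullet> vec n u = (\<Sum>i<n. c $ i * u i)" by (simp add: scalar_prod_def lessThan_atLeast0)
  also have "\<dots> = (\<Sum>i\<in>?M. c $ i * u i)" using k u(2) by (intro sum.mono_neutral_right) auto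
  also have "\<dots> = 0" using u(3)[of None] by (simp add: e_def)
  finally have cu: "c \<bullet> vec n u = 0" .
  have "(w + outer n c) *\<^sub>v vec n u = 0\<^sub>v n"
    unfolding add_outer_mult_vec[OF wc c vec_carrier] wu cu zero_smult_vec[OF c] by simp
  moreover have "vec n u \<noteq> 0\<^sub>v n"
  proof
    assume e: "vec n u = 0\<^sub>v n"
    obtain i where "i \<in> ?M" "u i \<noteq> 0" using u(1) by blast
    then have i: "i < n" "u i \<noteq> 0" using k by auto
    then show False using arg_cong[OF e, of "\<lambda>x. x $ i"] by simp
  qed
  ultimately show ?thesis using det_0_iff_vec_prod_zero_field[OF Nc] vec_carrier by blast
qed

text \<open>If the support of \<open>v\<close> were larger, the equations for vectors supported on the minus signs below
  \<open>m\<close> (or up to \<open>m\<close>) would have a solution that is not a multiple of \<open>v\<close>, because \<open>v\<^sub>m \<noteq> 0\<close> and the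
  plus and minus signs below \<open>m\<close> balance.\<close>

lemma conormal_kernel_support:
  assumes w: "w \<in> cell n (- S)" and v: "kernel_line n w v" and m: "m < n" "v $ m \<noteq> 0"
    and bal: "card ({..<m} - S) = card (S \<inter> {..<m})"
  shows "i < m \<Longrightarrow> i \<notin> S \<Longrightarrow> v $ i = 0" "m \<in> S \<Longrightarrow> m < i \<Longrightarrow> i < n \<Longrightarrow> v $ i = 0"
proof -
  note wc = skewD(1)[OF cellD(1)[OF w]] and vD = kernel_lineD[OF v]
  have multiple: "\<exists>s. s \<noteq> 0 \<and> (\<forall>i<n. u i = s * v $ i)"
    if u: "w *\<^sub>v vec n u = 0\<^sub>v n" "j < n" "u j \<noteq> 0" for u j
  proof -
    obtain s where s: "vec n u = s \<cdot>\<^sub>v v" using vD(4)[OF vec_carrier u(1)] by blast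
    have e: "u i = s * v $ i" if "i < n" for i using arg_cong[OF s, of "\<lambda>x. x $ i"] that vD(1) by simp
    have "s \<noteq> 0" using e[OF u(2)] u(3) by auto
    then show ?thesis using e by blast
  qed
  {
    assume i: "i < m" "i \<notin> S"
    show "v $ i = 0"
    proof (rule ccontr)
      assume vi: "v $ i \<noteq> 0"
      let ?M = "S \<inter> {..<m}" and ?A = "{..<m} - S"
      have "card (?A - {i}) < card ?A" using i by (intro card_Diff1_less) auto
      then have "card (?A - {i}) < card ?M" using bal by simp
      from underdetermined_system[OF _ _ this, of "\<lambda>a j. w $$ (a, j)"]
      obtain u where u: "\<exists>j\<in>?M. u j \<noteq> 0" "\<And>j. j \<notin> ?M \<Longrightarrow> u j = 0"
        "\<And>a. a \<in> ?A - {i} \<Longrightarrow> (\<Sum>j\<in>?M. w $$ (a, j) * u j) = 0" by auto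
      \<comment> \<open>The remaining equation is a combination of the others, with the entries of \<open>v\<close> as coefficients.\<close>
      have col: "(\<Sum>a\<in>?A. v $ a * w $$ (a, j)) = 0" if j: "j \<in> ?M" for j
      proof -
        have jn: "j < n" using j m by auto
        have "(\<Sum>a\<in>?A. v $ a * w $$ (a, j)) = - (\<Sum>a\<in>?A. w $$ (j, a) * v $ a)"
          unfolding sum_negf[symmetric]
        proof (rule sum.cong[OF refl])
          fix a assume "a \<in> ?A"
          then have "a < n" using m by auto
          then show "v $ a * w $$ (a, j) = - (w $$ (j, a) * v $ a)"
            using skewD(2)[OF cellD(1)[OF w], of a j] jn by simp
        qed
        also have "(\<Sum>a\<in>?A. w $$ (j, a) * v $ a) = (\<Sum>a<n. w $$ (j, a) * v $ a)"
        proof (rule sum.mono_neutral_left)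
          show "?A \<subseteq> {..<n}" using m by auto
          show "\<forall>a\<in>{..<n} - ?A. w $$ (j, a) * v $ a = 0"
          proof
            fix a assume a: "a \<in> {..<n} - ?A"
            have "w $$ (a, j) = 0" by (rule conormal_entry_0[OF w]) (use a j m in auto)
            then show "w $$ (j, a) * v $ a = 0" using skewD(2)[OF cellD(1)[OF w], of j a] a jn by simp
          qed
        qed simp
        also have "\<dots> = (w *\<^sub>v v) $ j" using mult_vec_index_sum[OF wc vD(1) jn] by simp
        finally show ?thesis using vD(3) jn by simp
      qed
      have "(\<Sum>a\<in>?A. v $ a * (\<Sum>j\<in>?M. w $$ (a, j) * u j)) = (\<Sum>j\<in>?M. \<Sum>a\<in>?A. v $ a * w $$ (a, j) * u j)"
        unfolding sum_distrib_left by (subst sum.swap) (simp add: mult.assoc)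
      also have "\<dots> = (\<Sum>j\<in>?M. (\<Sum>a\<in>?A. v $ a * w $$ (a, j)) * u j)" by (simp add: sum_distrib_right)
      also have "\<dots> = 0" using col by simp
      finally have "(\<Sum>a\<in>?A. v $ a * (\<Sum>j\<in>?M. w $$ (a, j) * u j)) = 0" .
      moreover have "(\<Sum>a\<in>?A. v $ a * (\<Sum>j\<in>?M. w $$ (a, j) * u j)) =
          v $ i * (\<Sum>j\<in>?M. w $$ (i, j) * u j) + (\<Sum>a\<in>?A - {i}. v $ a * (\<Sum>j\<in>?M. w $$ (a, j) * u j))"
        using i by (intro sum.remove) auto
      ultimately have "(\<Sum>j\<in>?M. w $$ (i, j) * u j) = 0" using u(3) vi by simp
      then have eqs: "(\<Sum>j\<in>?M. w $$ (a, j) * u j) = 0" if "a \<in> ?A" for a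
        using u(3)[of a] that by (cases "a = i") auto
      have "w *\<^sub>v vec n u = 0\<^sub>v n"
        by (rule conormal_kernel_vec[OF w less_imp_le[OF m(1)] subset_refl u(2) eqs])
      moreover obtain j where j: "j \<in> ?M" "u j \<noteq> 0" using u(1) by blast
      ultimately obtain s where s: "s \<noteq> 0" "\<forall>i<n. u i = s * v $ i" using multiple[of u j] m by auto
      have "u m = 0" by (rule u(2)) simp
      then show False using s m by simp
    qed
  }
  {
    assume i: "m \<in> S" "m < i" "i < n"
    let ?M = "S \<inter> {..<Suc m}" and ?A = "{..<m} - S"
    have "?M = insert m (S \<inter> {..<m})" using i by auto
    then have "card ?A < card ?M" using bal by simp
    from underdetermined_system[OF _ _ this, of "\<lambda>a j. w $$ (a, j)"]
    obtain u where u: "\<exists>j\<in>?M. u j \<noteq> 0" "\<And>j. j \<notin> ?M \<Longrightarrow> u j = 0"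
      "\<And>a. a \<in> ?A \<Longrightarrow> (\<Sum>j\<in>?M. w $$ (a, j) * u j) = 0" by auto
    have A: "{..<Suc m} - S = ?A" using i by (auto simp: less_Suc_eq)
    have "w *\<^sub>v vec n u = 0\<^sub>v n"
      by (rule conormal_kernel_vec[OF w Suc_leI[OF m(1)] subset_refl u(2)]) (use u(3) A in auto)
    moreover obtain j where j: "j \<in> ?M" "u j \<noteq> 0" using u(1) by blast
    ultimately obtain s where s: "s \<noteq> 0" "\<forall>i<n. u i = s * v $ i" using multiple[of u j] m by auto
    have "u i = 0" by (rule u(2)) (use i in simp)
    then show "v $ i = 0" using s i by simp
  }
qed

text \<open>The support of \<open>v\<close> is exactly what places the entries \<open>v\<^sub>i / v\<^sub>m\<close> of the coordinate at pairs of the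
  cell of \<open>toggle S m\<close>.\<close>

lemma flip_chart_in_cell:
  assumes "w \<in> cell n (- S)" "kernel_line n w v" "m < n" "v $ m \<noteq> 0"
    "card ({..<m} - S) = card (S \<inter> {..<m})"
  shows "flip_chart n m v \<in> cell n (toggle S m)"
  unfolding cell_def mem_Collect_eq
proof (intro conjI skew_flip_chart allI impI)
  note sup = conormal_kernel_support[OF assms]
  fix i j assume ij: "i < j" "j < n" "i \<notin> toggle S m"
  consider "j = m" | "i = m" | "i \<noteq> m" "j \<noteq> m" by blast
  then show "flip_chart n m v $$ (i, j) = 0"
  proof cases
    case 1
    then have "i \<notin> S" using ij by (auto simp: toggle_def split: if_splits)
    then show ?thesis using 1 ij sup(1)[of i] by (simp add: flip_chart_def)
  next
    case 2
    then have "m \<in> S" using ij by (auto simp: toggle_def split: if_splits)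
    then show ?thesis using 2 ij sup(2)[of j] by (simp add: flip_chart_def)
  next
    case 3
    then show ?thesis using ij by (simp add: flip_chart_def)
  qed
qed

text \<open>Join the first minus sign to some earlier plus sign, or two plus signs if no minus sign is left.
  The remaining signs still form a ballot sequence.\<close>

lemma ballot_matching:
  assumes "finite D" "even (card D)"
    and "\<And>k. card {i\<in>D. i < k \<and> i \<in> S} \<le> card {i\<in>D. i < k \<and> i \<notin> S}"
  shows "\<exists>\<mu>::nat \<Rightarrow> nat. \<forall>i\<in>D. \<mu> i \<in> D \<and> \<mu> (\<mu> i) = i \<and> \<mu> i \<noteq> i \<and> (i < \<mu> i \<longrightarrow> i \<notin> S)"
  using assms
proof (induction "card D" arbitrary: D rule: less_induct)
  case less
  show ?case
  proof (cases "D = {}")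
    case False
    have "\<exists>i\<in>D. \<exists>j\<in>D. i < j \<and> i \<notin> S \<and> (\<forall>k. card {x\<in>D - {i, j}. x < k \<and> x \<in> S} \<le> card {x\<in>D - {i, j}. x < k \<and> x \<notin> S})"
    proof (cases "D \<inter> S = {}")
      case True
      have "card D \<noteq> 0" "card D \<noteq> 1" using less.prems(1,2) False by auto
      then obtain a b where ab: "a \<in> D" "b \<in> D" "a \<noteq> b"
        by (metis card_1_singletonE card_eq_0_iff is_singletonI' is_singleton_altdef less.prems(1) False)
      have e: "{x\<in>D - {i, j}. x < k \<and> x \<in> S} = {}" for i j k using True by auto
      have bal: "\<forall>k. card {x\<in>D - {i, j}. x < k \<and> x \<in> S} \<le> card {x\<in>D - {i, j}. x < k \<and> x \<notin> S}" for i j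
        unfolding e by simp
      have "a \<notin> S" "b \<notin> S" using True ab by auto
      moreover have "a < b \<or> b < a" using ab(3) by auto
      ultimately show ?thesis using ab bal by metis
    next
      case nonempty: False
      define j where "j = (LEAST j. j \<in> D \<inter> S)"
      have j: "j \<in> D" "j \<in> S" using LeastI_ex[of "\<lambda>j. j \<in> D \<inter> S"] nonempty unfolding j_def by blast+
      have jmin: "x \<notin> S" if "x \<in> D" "x < j" for x
        using not_less_Least[of x "\<lambda>j. j \<in> D \<inter> S"] that unfolding j_def by blast
      have "{x\<in>D. x < Suc j \<and> x \<in> S} = {j}" using j jmin by (auto simp: less_Suc_eq)
      then have "1 \<le> card {x\<in>D. x < Suc j \<and> x \<notin> S}" using less.prems(3)[of "Suc j"] by simp
      then have "{x\<in>D. x < Suc j \<and> x \<notin> S} \<noteq> {}" by (metis card.empty not_one_le_zero)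
      then obtain i where i: "i \<in> D" "i < Suc j" "i \<notin> S" by blast
      then have ij: "i < j" using j by (cases "i = j") auto
      have "card {x\<in>D - {i, j}. x < k \<and> x \<in> S} \<le> card {x\<in>D - {i, j}. x < k \<and> x \<notin> S}" for k
      proof (cases "j < k")
        case True
        have m: "{x\<in>D. x < k \<and> x \<in> S} = insert j {x\<in>D - {i, j}. x < k \<and> x \<in> S}" using True j i by auto
        have p: "{x\<in>D. x < k \<and> x \<notin> S} = insert i {x\<in>D - {i, j}. x < k \<and> x \<notin> S}" using True ij j i by auto
        have "card {x\<in>D. x < k \<and> x \<in> S} = Suc (card {x\<in>D - {i, j}. x < k \<and> x \<in> S})"
          unfolding m using less.prems(1) by (intro card_insert_disjoint) auto
        moreover have "card {x\<in>D. x < k \<and> x \<notin> S} = Suc (card {x\<in>D - {i, j}. x < k \<and> x \<notin> S})"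
          unfolding p using less.prems(1) by (intro card_insert_disjoint) auto
        ultimately show ?thesis using less.prems(3)[of k] by simp
      next
        case False
        then have e: "{x\<in>D - {i, j}. x < k \<and> x \<in> S} = {}" using jmin by fastforce
        show ?thesis unfolding e by simp
      qed
      then show ?thesis using i j ij by blast
    qed
    then obtain i j where ij: "i \<in> D" "j \<in> D" "i < j" "i \<notin> S"
      "\<And>k. card {x\<in>D - {i, j}. x < k \<and> x \<in> S} \<le> card {x\<in>D - {i, j}. x < k \<and> x \<notin> S}" by blast
    have "card {i, j} \<le> card D" using less.prems(1) ij by (intro card_mono) auto
    moreover have "card (D - {i, j}) = card D - card {i, j}" using ij by (intro card_Diff_subset) auto
    ultimately have c: "card (D - {i, j}) < card D" "even (card (D - {i, j}))"
      using ij(3) less.prems(2) by auto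
    obtain \<mu> where mu: "\<And>x. x \<in> D - {i, j} \<Longrightarrow> \<mu> x \<in> D - {i, j} \<and> \<mu> (\<mu> x) = x \<and> \<mu> x \<noteq> x \<and> (x < \<mu> x \<longrightarrow> x \<notin> S)"
      using less.hyps[OF c(1) _ c(2) ij(5)] less.prems(1) by blast
    have "\<forall>x\<in>D. (\<mu>(i := j, j := i)) x \<in> D \<and> (\<mu>(i := j, j := i)) ((\<mu>(i := j, j := i)) x) = x \<and>
        (\<mu>(i := j, j := i)) x \<noteq> x \<and> (x < (\<mu>(i := j, j := i)) x \<longrightarrow> x \<notin> S)"
    proof
      fix x assume x: "x \<in> D"
      consider "x = i" | "x = j" | "x \<in> D - {i, j}" using x by blast
      then show "(\<mu>(i := j, j := i)) x \<in> D \<and> (\<mu>(i := j, j := i)) ((\<mu>(i := j, j := i)) x) = x \<and>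
        (\<mu>(i := j, j := i)) x \<noteq> x \<and> (x < (\<mu>(i := j, j := i)) x \<longrightarrow> x \<notin> S)"
      proof cases
        case 3
        then show ?thesis using mu[OF 3] by auto
      qed (use ij in auto)
    qed
    then show ?thesis by blast
  qed simp
qed

text \<open>The alternating form of a perfect matching of the indices different from \<open>m\<close>.\<close>

lemma matching_form:
  assumes m: "m < n" and odd: "odd n"
    and ballot: "\<And>k. k \<le> n \<Longrightarrow> card (({..<k} \<inter> S) - {m}) \<le> card ({..<k} - S - {m})"
  shows "\<exists>w\<in>cell n (- S). kernel_line n w (unit_vec n m)"
proof -
  define D where "D = {..<n} - {m}"
  have "card {i\<in>D. i < k \<and> i \<in> S} \<le> card {i\<in>D. i < k \<and> i \<notin> S}" for k
  proof -
    have "{i\<in>D. i < k \<and> i \<in> S} = ({..<min k n} \<inter> S) - {m}" "{i\<in>D. i < k \<and> i \<notin> S} = {..<min k n} - S - {m}"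
      unfolding D_def by auto
    then show ?thesis using ballot[of "min k n"] by simp
  qed
  moreover have "finite D" "even (card D)" using m odd unfolding D_def by auto
  ultimately obtain \<mu> :: "nat \<Rightarrow> nat" where
    mu: "\<And>i. i \<in> D \<Longrightarrow> \<mu> i \<in> D \<and> \<mu> (\<mu> i) = i \<and> \<mu> i \<noteq> i \<and> (i < \<mu> i \<longrightarrow> i \<notin> S)"
    using ballot_matching[of D S] by blast
  define w where "w = mat n n (\<lambda>(i, j). if i \<in> D \<and> j = \<mu> i then (if i < j then 1 else - 1) else (0::complex))"
  have wc: "w \<in> carrier_mat n n" by (simp add: w_def)
  have sk: "skew n w"
    unfolding skew_def
  proof (intro conjI wc allI impI)
    fix i j assume ij: "i < n" "j < n"
    have "i \<in> D \<and> j = \<mu> i \<longleftrightarrow> j \<in> D \<and> i = \<mu> j" using mu by metis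
    moreover have "i \<noteq> j" if "i \<in> D" "j = \<mu> i" using mu that by metis
    ultimately show "w $$ (i, j) = - w $$ (j, i)" using ij unfolding w_def by auto
  qed
  have "w \<in> cell n (- S)"
    unfolding cell_def mem_Collect_eq
  proof (intro conjI sk allI impI)
    fix i j assume ij: "i < j" "j < n" "i \<notin> - S"
    then have "\<not> (i \<in> D \<and> j = \<mu> i)" using mu by blast
    then show "w $$ (i, j) = 0" using ij by (simp add: w_def)
  qed
  moreover have "kernel_line n w (unit_vec n m)"
    unfolding kernel_line_def
  proof (intro conjI ballI impI)
    have row: "(w *\<^sub>v x) $ i = (if i \<in> D then (if i < \<mu> i then x $ \<mu> i else - x $ \<mu> i) else 0)"
      if x: "x \<in> carrier_vec n" and i: "i < n" for x i
    proof -
      have "(w *\<^sub>v x) $ i = (\<Sum>j<n. w $$ (i, j) * x $ j)" by (rule mult_vec_index_sum[OF wc x i])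
      also have "\<dots> = (if i \<in> D then (if i < \<mu> i then x $ \<mu> i else - x $ \<mu> i) else 0)"
      proof (cases "i \<in> D")
        case True
        then have "\<mu> i < n" using mu D_def by blast
        then have "(\<Sum>j<n. w $$ (i, j) * x $ j) = (\<Sum>j\<in>{\<mu> i}. w $$ (i, j) * x $ j)"
          using i True by (intro sum.mono_neutral_right) (auto simp: w_def)
        then show ?thesis using True i \<open>\<mu> i < n\<close> by (simp add: w_def)
      next
        case False
        then have "(\<Sum>j<n. w $$ (i, j) * x $ j) = 0" using i by (intro sum.neutral) (auto simp: w_def)
        then show ?thesis using False by simp
      qed
      finally show ?thesis .
    qed
    show "unit_vec n m \<in> carrier_vec n" by simp
    show "unit_vec n m \<noteq> (0\<^sub>v n :: complex vec)" using m by simp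
    show "w *\<^sub>v unit_vec n m = 0\<^sub>v n"
    proof (rule eq_vecI)
      fix i assume "i < dim_vec (0\<^sub>v n :: complex vec)"
      then have i: "i < n" by simp
      have "unit_vec n m $ \<mu> i = (0 :: complex)" if "i \<in> D" using mu[OF that] m unfolding D_def by auto
      then show "(w *\<^sub>v unit_vec n m) $ i = 0\<^sub>v n $ i" using row[OF unit_vec_carrier i] i by auto
    qed (use wc in simp)
    fix x assume x: "x \<in> carrier_vec n" "w *\<^sub>v x = 0\<^sub>v n"
    have "x $ j = 0" if j: "j \<in> D" for j
    proof -
      have "\<mu> j \<in> D" "\<mu> (\<mu> j) = j" using mu[OF j] by auto
      moreover from this have "\<mu> j < n" unfolding D_def by simp
      ultimately have "(if \<mu> j < j then x $ j else - x $ j) = 0"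
        using row[OF x(1), of "\<mu> j"] x(2) by (simp only: index_zero_vec if_True)
      then show ?thesis by (cases "\<mu> j < j") simp_all
    qed
    then have x0: "x $ j = 0" if "j < n" "j \<noteq> m" for j using that unfolding D_def by simp
    have "x = x $ m \<cdot>\<^sub>v unit_vec n m"
    proof (rule eq_vecI)
      fix i assume "i < dim_vec (x $ m \<cdot>\<^sub>v unit_vec n m)"
      then have "i < n" by simp
      then show "x $ i = (x $ m \<cdot>\<^sub>v unit_vec n m) $ i" using x0[of i] m by (cases "i = m") simp_all
    qed (use x(1) in simp)
    then show "\<exists>s. x = s \<cdot>\<^sub>v unit_vec n m" by blast
  qed
  ultimately show ?thesis by blast
qed

section \<open>The two families of Lagrangians\<close>

definition iso_gr :: "nat \<Rightarrow> complex vec set set" where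
  "iso_gr n = {L \<in> grassmannian n (n + n). \<forall>u\<in>L. \<forall>v\<in>L. bform n u v = 0}"

definition lags :: "nat \<Rightarrow> complex \<Rightarrow> complex vec set set" where
  "lags n e = {lag n P | P. orth n P \<and> det P = e}"

abbreviation lag_topology :: "nat \<Rightarrow> complex vec set set \<Rightarrow> complex vec set topology" where
  "lag_topology n A \<equiv> subtopology (zariski_gr n (n + n)) A"

lemmas chart_open = openin_zariski_gr_chart[of n "n + n" for n, unfolded add_diff_cancel_left']
lemmas closure_chartD = closure_of_chartD[of n "n + n" for n, unfolded add_diff_cancel_left']
lemmas closure_chartI = closure_of_chartI[of n "n + n" for n, unfolded add_diff_cancel_left']
lemmas family_limit' = family_limit[of n "n + n" for n, unfolded add_diff_cancel_left']

lemma iso_gr_eq_lag: "iso_gr n = {lag n P | P. orth n P}"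
proof
  show "iso_gr n \<subseteq> {lag n P | P. orth n P}"
    unfolding iso_gr_def using isotropic_eq_lag by blast
  show "{lag n P | P. orth n P} \<subseteq> iso_gr n"
    unfolding iso_gr_def using lag_in_grassmannian lag_isotropic by blast
qed

lemma iso_gr_chart:
  assumes "L \<in> iso_gr n"
  obtains S X where "S \<subseteq> {..<n}" "skew n X" "L = gr_chart n (swap_mat n S) X"
  using isotropic_eq_chart[of L n] assms unfolding iso_gr_def by blast

lemma skew_chart_in_lags:
  assumes "orth n P" "skew n X"
  shows "gr_chart n P X \<in> lags n (det P)"
proof -
  note Xc = skewD(1)[OF assms(2)]
  have "det (P * shear n X) = det P"
    using det_mult[OF orthD(1)[OF assms(1)] shear_carrier[OF Xc]] det_shear[OF Xc] by simp
  then show ?thesis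
    unfolding lags_def gr_chart_eq_lag[OF orthD(1)[OF assms(1)] Xc]
    using orth_mult[OF assms(1) orth_shear[OF assms(2)]] by blast
qed

lemma lags_subset: "lags n e \<subseteq> iso_gr n"
  unfolding iso_gr_eq_lag lags_def by blast

lemma lag_in_lags_iff: "orth n P \<Longrightarrow> lag n P \<in> lags n e \<longleftrightarrow> det P = e"
proof
  assume P: "orth n P" and "lag n P \<in> lags n e"
  then obtain Q where Q: "orth n Q" "det Q = e" "lag n P = lag n Q" unfolding lags_def by blast
  show "det P = e" using same_lag_blocks[OF P Q(1,3)] Q(2) by metis
next
  assume "orth n P" "det P = e"
  then show "lag n P \<in> lags n e" unfolding lags_def by blast
qed

lemma iso_gr_eq_lags: "iso_gr n = lags n 1 \<union> lags n (- 1)"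
proof
  show "lags n 1 \<union> lags n (- 1) \<subseteq> iso_gr n" using lags_subset by blast
  show "iso_gr n \<subseteq> lags n 1 \<union> lags n (- 1)"
  proof
    fix L assume "L \<in> iso_gr n"
    then obtain S X where S: "S \<subseteq> {..<n}" "skew n X" "L = gr_chart n (swap_mat n S) X" by (rule iso_gr_chart)
    have "finite S" using S(1) finite_subset by blast
    then have "det (swap_mat n S) = 1 \<or> det (swap_mat n S) = - 1"
      using det_swap_mat[OF _ S(1)] by (simp add: minus_one_power_iff)
    then show "L \<in> lags n 1 \<union> lags n (- 1)" using skew_chart_in_lags[OF orth_swap S(2), of S] S(3) by auto
  qed
qed

text \<open>Both families are open, since all Lagrangians in an orthogonal chart are obtained from its
  centre by shears, which have determinant \<open>1\<close>.\<close>

lemma openin_lags: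
  "openin (lag_topology n (iso_gr n)) (lags n e)"
proof -
  have "\<exists>T. openin (lag_topology n (iso_gr n)) T \<and> L \<in> T \<and> T \<subseteq> lags n e" if "L \<in> lags n e" for L
  proof -
    obtain P where P: "orth n P" "det P = e" "L = lag n P" using \<open>L \<in> lags n e\<close> unfolding lags_def by blast
    let ?U = "{gr_chart n P X | X. X \<in> carrier_mat n n \<and> (1::complex) \<noteq> 0}"
    have "openin (zariski_gr n (n + n)) ?U"
      by (rule chart_open[OF _ orth_frames[OF P(1)] poly_fun.const]) simp
    then have op: "openin (lag_topology n (iso_gr n)) (?U \<inter> iso_gr n)" by (rule openin_subtopology_Int)
    have "L \<in> ?U"
      unfolding P(3) lag_eq_gr_chart mem_Collect_eq
      by (rule exI[of _ "0\<^sub>m n n"]) simp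
    then have LU: "L \<in> ?U \<inter> iso_gr n" using that lags_subset by blast
    have "?U \<inter> iso_gr n \<subseteq> lags n e"
    proof
      fix M assume "M \<in> ?U \<inter> iso_gr n"
      then obtain X where X: "X \<in> carrier_mat n n" "M = gr_chart n P X" "M \<in> iso_gr n" by blast
      have "skew n X"
        by (rule isotropic_chart_skew[OF P(1) X(1)]) (use X(2,3) in \<open>auto simp: iso_gr_def\<close>)
      then show "M \<in> lags n e" using skew_chart_in_lags[OF P(1)] X(2) P(2) by blast
    qed
    then show ?thesis using op LU by (intro exI[of _ "?U \<inter> iso_gr n"] conjI)
  qed
  then show ?thesis by (subst openin_subopen) (rule ballI)
qed

text \<open>A Lagrangian is joined to the centre of a coordinate chart by an affine line. A polynomial in
  one variable vanishes only at finitely many points, so the line is connected.\<close>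

lemma connected_chart_line:
  assumes P: "orth n P" and X: "skew n X"
  shows "connected_component_of (lag_topology n (iso_gr n)) (lag n P) (gr_chart n P X)"
proof -
  define \<gamma> where "\<gamma> = (\<lambda>t. gr_chart n P (t \<cdot>\<^sub>m X))"
  note Xc = skewD(1)[OF X]
  have tX: "t \<cdot>\<^sub>m X \<in> carrier_mat n n" for t using Xc by simp
  have sk: "skew n (t \<cdot>\<^sub>m X)" for t
    unfolding skew_def
  proof (intro conjI tX allI impI)
    fix i j assume "i < n" "j < n"
    then show "(t \<cdot>\<^sub>m X) $$ (i, j) = - (t \<cdot>\<^sub>m X) $$ (j, i)" using Xc skewD(2)[OF X, of i j] by simp
  qed
  have iso: "\<gamma> t \<in> iso_gr n" for t
    unfolding \<gamma>_def using skew_chart_in_lags[OF P sk] lags_subset by blast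
  have top: "topspace (lag_topology n (iso_gr n)) = iso_gr n"
    unfolding topspace_subtopology using topspace_zariski_gr[of n "n + n"] by (auto simp: iso_gr_def)
  have over: "mat_over line_ring n n (\<lambda>t. t \<cdot>\<^sub>m X)"
    by (rule mat_over_smult[OF function_ring_line id_in_line_ring mat_over_const[OF function_ring_line Xc]])
  \<comment> \<open>Each open set meeting the line contains all but finitely many of its points.\<close>
  have cofin: "\<exists>q. q \<noteq> 0 \<and> (\<forall>t. poly q t \<noteq> 0 \<longrightarrow> \<gamma> t \<in> E)"
    if E: "openin (lag_topology n (iso_gr n)) E" "\<gamma> s \<in> E" for E s
  proof -
    obtain U where U: "openin (zariski_gr n (n + n)) U" "E = U \<inter> iso_gr n"
      using E(1) unfolding openin_subtopology by blast
    have "openin (zariski_affine (n + n - n) n) (chart_preimage n (n + n) P U)"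
      using U(1) orth_frames[OF P] unfolding openin_zariski_gr by blast
    moreover have "s \<cdot>\<^sub>m X \<in> chart_preimage n (n + n) P U"
      using E(2) U(2) tX unfolding chart_preimage_def \<gamma>_def by simp
    ultimately obtain f where f: "f \<in> poly_fun (n + n - n) n" "f (s \<cdot>\<^sub>m X) \<noteq> 0"
      "{Y \<in> carrier_mat (n + n - n) n. f Y \<noteq> 0} \<subseteq> chart_preimage n (n + n) P U"
      using openin_zariski_affineD by blast
    have "(\<lambda>t. f (t \<cdot>\<^sub>m X)) \<in> line_ring"
      using poly_fun_comp[OF function_ring_line over, of f] f(1) by simp
    then obtain q where q: "(\<lambda>t. f (t \<cdot>\<^sub>m X)) = poly q" unfolding line_ring_def by blast
    have "q \<noteq> 0" using f(2) fun_cong[OF q, of s] by auto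
    moreover have "\<gamma> t \<in> E" if "poly q t \<noteq> 0" for t
    proof -
      have "f (t \<cdot>\<^sub>m X) \<noteq> 0" using that fun_cong[OF q, of t] by simp
      then have "t \<cdot>\<^sub>m X \<in> chart_preimage n (n + n) P U" using f(3) tX by auto
      then show ?thesis unfolding U(2) using iso by (simp add: chart_preimage_def \<gamma>_def)
    qed
    ultimately show ?thesis by blast
  qed
  have "connectedin (lag_topology n (iso_gr n)) (range \<gamma>)"
    unfolding connectedin top
  proof (intro conjI notI)
    show "range \<gamma> \<subseteq> iso_gr n" using iso by blast
    assume "\<exists>E1 E2. openin (lag_topology n (iso_gr n)) E1 \<and> openin (lag_topology n (iso_gr n)) E2 \<and>
      range \<gamma> \<subseteq> E1 \<union> E2 \<and> E1 \<inter> E2 \<inter> range \<gamma> = {} \<and> E1 \<inter> range \<gamma> \<noteq> {} \<and> E2 \<inter> range \<gamma> \<noteq> {}"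
    then obtain E1 E2 s1 s2 where E: "openin (lag_topology n (iso_gr n)) E1" "\<gamma> s1 \<in> E1"
      "openin (lag_topology n (iso_gr n)) E2" "\<gamma> s2 \<in> E2" "E1 \<inter> E2 \<inter> range \<gamma> = {}" by blast
    obtain q1 q2 where q: "q1 \<noteq> 0" "\<And>t. poly q1 t \<noteq> 0 \<Longrightarrow> \<gamma> t \<in> E1" "q2 \<noteq> 0" "\<And>t. poly q2 t \<noteq> 0 \<Longrightarrow> \<gamma> t \<in> E2"
      using cofin[OF E(1,2)] cofin[OF E(3,4)] by blast
    have "q1 * q2 \<noteq> 0" using q by simp
    then have "finite {t. poly (q1 * q2) t = 0}" by (rule poly_roots_finite)
    then obtain t where "poly (q1 * q2) t \<noteq> 0"
      using infinite_UNIV_char_0[where 'a = complex] by (metis (mono_tags, lifting) UNIV_I finite_subset mem_Collect_eq subsetI)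
    then have "poly q1 t \<noteq> 0" "poly q2 t \<noteq> 0" by auto
    then show False using q(2,4) E(5) by blast
  qed
  moreover have "\<gamma> 0 = lag n P"
  proof -
    have "0 \<cdot>\<^sub>m X = 0\<^sub>m n n" using Xc by (intro eq_matI) auto
    then show ?thesis unfolding \<gamma>_def lag_eq_gr_chart by simp
  qed
  moreover have "\<gamma> 1 = gr_chart n P X"
  proof -
    have "1 \<cdot>\<^sub>m X = X" using Xc by (intro eq_matI) auto
    then show ?thesis unfolding \<gamma>_def by simp
  qed
  ultimately show ?thesis unfolding connected_component_of_def by (metis rangeI)
qed

text \<open>The two families are open and complementary, so no connected set meets both.\<close>

lemma connected_component_same_lags:
  assumes "connected_component_of (lag_topology n (iso_gr n)) L M" "L \<in> lags n e" "e = 1 \<or> e = - 1"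
  shows "M \<in> lags n e"
proof (rule ccontr)
  assume M: "M \<notin> lags n e"
  obtain T where T: "connectedin (lag_topology n (iso_gr n)) T" "L \<in> T" "M \<in> T"
    using assms(1) unfolding connected_component_of_def by blast
  have Ti: "T \<subseteq> iso_gr n" using connectedin_subset_topspace[OF T(1)] unfolding topspace_subtopology by blast
  have "lags n e \<inter> lags n (- e) = {}"
  proof -
    have "e \<noteq> - e" using assms(3) by auto
    then show ?thesis unfolding lags_def[of n e] using lag_in_lags_iff by blast
  qed
  moreover have un: "iso_gr n = lags n e \<union> lags n (- e)" 
  proof (cases "e = 1")
    case False
    then have "e = - 1" using assms(3) by blast
    then show ?thesis using iso_gr_eq_lags[of n] Un_commute[of "lags n 1"] by simp
  qed (use iso_gr_eq_lags[of n] in simp)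
  moreover have "lags n e \<inter> T \<noteq> {}" using assms(2) T(2) by blast
  moreover have "lags n (- e) \<inter> T \<noteq> {}" using M T(3) Ti un by blast
  ultimately have "\<exists>E1 E2. openin (lag_topology n (iso_gr n)) E1 \<and> openin (lag_topology n (iso_gr n)) E2 \<and>
      T \<subseteq> E1 \<union> E2 \<and> E1 \<inter> E2 \<inter> T = {} \<and> E1 \<inter> T \<noteq> {} \<and> E2 \<inter> T \<noteq> {}"
    using Ti openin_lags[of n e] openin_lags[of n "- e"]
    by (intro exI[of _ "lags n e"] exI[of _ "lags n (- e)"] conjI) simp_all
  then show False using conjunct2[OF T(1)[unfolded connectedin]] by (rule notE[rotated])
qed

section \<open>Schubert cells\<close>

definition flag_sub :: "nat \<Rightarrow> nat \<Rightarrow> complex vec set" where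
  "flag_sub n l = {v \<in> carrier_vec (n + n). \<forall>j<n + n. l \<le> j \<longrightarrow> v $ j = 0}"

definition borel :: "nat \<Rightarrow> complex mat set" where
  "borel n = {g. orth n g \<and> det g = 1 \<and> (\<forall>l\<in>{1..n}. (\<lambda>v. g *\<^sub>v v) ` flag_sub n l = flag_sub n l)}"

definition orbit :: "nat \<Rightarrow> nat set \<Rightarrow> complex vec set set" where
  "orbit n S = {lag n (g * swap_mat n S) | g. g \<in> borel n}"

lemma borelD:
  assumes "g \<in> borel n"
  shows "orth n g" "det g = 1" "1 \<le> l \<Longrightarrow> l \<le> n \<Longrightarrow> (\<lambda>v. g *\<^sub>v v) ` flag_sub n l = flag_sub n l"
  using assms unfolding borel_def by auto

lemma borel_mult:
  assumes g: "g \<in> borel n" and h: "h \<in> borel n"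
  shows "g * h \<in> borel n"
proof -
  note gc = orthD(1)[OF borelD(1)[OF g]] and hc = orthD(1)[OF borelD(1)[OF h]]
  have "(\<lambda>v. g * h *\<^sub>v v) ` flag_sub n l = flag_sub n l" if l: "1 \<le> l" "l \<le> n" for l
  proof -
    have "(\<lambda>v. g * h *\<^sub>v v) ` flag_sub n l = (\<lambda>v. g *\<^sub>v v) ` (\<lambda>v. h *\<^sub>v v) ` flag_sub n l"
      unfolding image_image
      by (intro image_cong refl assoc_mult_mat_vec[OF gc hc]) (auto simp: flag_sub_def)
    then show ?thesis using borelD(3)[OF g l] borelD(3)[OF h l] by simp
  qed
  moreover have "det (g * h) = 1" using det_mult[OF gc hc] borelD(2)[OF g] borelD(2)[OF h] by simp
  ultimately show ?thesis unfolding borel_def using orth_mult[OF borelD(1)[OF g] borelD(1)[OF h]] by simp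
qed

lemma one_in_borel: "1\<^sub>m (n + n) \<in> borel n"
proof -
  have "(\<lambda>v. 1\<^sub>m (n + n) *\<^sub>v v) ` flag_sub n l = flag_sub n l" for l
  proof -
    have "(\<lambda>v. 1\<^sub>m (n + n) *\<^sub>v v) ` flag_sub n l = (\<lambda>v. v) ` flag_sub n l"
      by (intro image_cong) (auto simp: flag_sub_def)
    then show ?thesis by simp
  qed
  then show ?thesis unfolding borel_def orth_def by simp
qed

text \<open>The conditions say that \<open>x\<close> is orthogonal to the \<open>l\<close>-th subspace of the flag, which is stable
  under \<open>g\<close>.\<close>

lemma borel_annihilator:
  assumes g: "g \<in> borel n" and x: "x \<in> carrier_vec (n + n)" and l: "l \<le> n"
  shows "(\<forall>i<l. (g *\<^sub>v x) $ (n + i) = 0) \<longleftrightarrow> (\<forall>i<l. x $ (n + i) = 0)"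
proof (cases "l = 0")
  case False
  have ann: "(\<forall>i<l. y $ (n + i) = 0) \<longleftrightarrow> (\<forall>u\<in>flag_sub n l. bform n u y = 0)" for y
  proof
    assume y: "\<forall>i<l. y $ (n + i) = 0"
    show "\<forall>u\<in>flag_sub n l. bform n u y = 0"
    proof
      fix u assume u: "u \<in> flag_sub n l"
      have "u $ i * y $ (n + i) + u $ (n + i) * y $ i = 0" if i: "i < n" for i
        using u y l i unfolding flag_sub_def by (cases "i < l") auto
      then show "bform n u y = 0" unfolding bform_def by (intro sum.neutral) auto
    qed
  next
    assume y: "\<forall>u\<in>flag_sub n l. bform n u y = 0"
    show "\<forall>i<l. y $ (n + i) = 0"
    proof (intro allI impI)
      fix i assume i: "i < l"
      then have "unit_vec (n + n) i \<in> flag_sub n l" using l by (auto simp: flag_sub_def)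
      then have "bform n (unit_vec (n + n) i) y = 0" using y by blast
      then show "y $ (n + i) = 0" using bform_unit_vec(1)[of i n y] bform_commute[of n y] i l by simp
    qed
  qed
  have fc: "u \<in> carrier_vec (n + n)" if "u \<in> flag_sub n l" for u using that by (simp add: flag_sub_def)
  have "(\<forall>u\<in>flag_sub n l. bform n u (g *\<^sub>v x) = 0) \<longleftrightarrow>
      (\<forall>u\<in>(\<lambda>v. g *\<^sub>v v) ` flag_sub n l. bform n u (g *\<^sub>v x) = 0)"
    using borelD(3)[OF g, of l] False l by simp
  also have "\<dots> \<longleftrightarrow> (\<forall>u\<in>flag_sub n l. bform n u x = 0)"
    using orthD(2)[OF borelD(1)[OF g] fc x] by simp
  finally show ?thesis unfolding ann .
qed simp

text \<open>The least \<open>l\<close> such that the coordinate of a vector at \<open>e\<^sub>l\<^sup>-\<close> is not \<open>0\<close> is preserved by Borel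
  elements. For a vector of the coordinate Lagrangian of \<open>S\<close> it belongs to \<open>S\<close>, whereas a nonzero
  entry \<open>X\<^sub>i\<^sub>j\<close> with \<open>i < j\<close> and \<open>i \<notin> S\<close> produces a vector for which it does not.\<close>

lemma orbit_chart_in_cell:
  assumes b: "b \<in> borel n" and X: "X \<in> carrier_mat n n" and O: "gr_chart n (b * swap_mat n S) X \<in> orbit n S"
  shows "X \<in> cell n S"
  unfolding cell_def mem_Collect_eq
proof (intro conjI allI impI)
  obtain g where g: "g \<in> borel n" "gr_chart n (b * swap_mat n S) X = lag n (g * swap_mat n S)"
    using O unfolding orbit_def by blast
  note bc = orthD(1)[OF borelD(1)[OF b]] and gc = orthD(1)[OF borelD(1)[OF g(1)]]
  have ob: "orth n (b * swap_mat n S)" and og: "orth n (g * swap_mat n S)"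
    using orth_mult[OF _ orth_swap] borelD(1) b g(1) by auto
  show "skew n X"
    by (rule isotropic_chart_skew[OF ob X]) (use lag_isotropic[OF og] g(2) in auto)
  fix i j assume ij: "i < j" "j < n" "i \<notin> S"
  show "X $$ (i, j) = 0"
  proof (rule ccontr)
    assume Xij: "X $$ (i, j) \<noteq> 0"
    let ?z = "X *\<^sub>v unit_vec n j"
    have z: "?z \<in> carrier_vec n" by (rule mult_mat_vec_carrier[OF X unit_vec_carrier])
    have zi: "?z $ l = X $$ (l, j)" if "l < n" for l
      using that ij X mult_mat_unit_vec[OF X ij(2)] by simp
    let ?e = "unit_vec n j @\<^sub>v ?z"
    have e: "?e \<in> carrier_vec (n + n)" by (rule append_carrier_vec[OF unit_vec_carrier z])
    define x where "x = swap_mat n S *\<^sub>v ?e"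
    have x: "x \<in> carrier_vec (n + n)" unfolding x_def by (rule mult_mat_vec_carrier[OF swap_mat_carrier e])
    have "b *\<^sub>v x \<in> lag n (g * swap_mat n S)"
      unfolding x_def assoc_mult_mat_vec[OF bc swap_mat_carrier e, symmetric] g(2)[symmetric] gr_chart_def
      by auto
    then obtain y where y: "y \<in> carrier_vec n" "b *\<^sub>v x = g * swap_mat n S *\<^sub>v (y @\<^sub>v 0\<^sub>v n)"
      unfolding lag_def by blast
    have y0: "y @\<^sub>v 0\<^sub>v n \<in> carrier_vec (n + n)" by (rule append_carrier_vec[OF y(1) zero_carrier_vec])
    define v where "v = swap_mat n S *\<^sub>v (y @\<^sub>v 0\<^sub>v n)"
    have v: "v \<in> carrier_vec (n + n)" unfolding v_def by (rule mult_mat_vec_carrier[OF swap_mat_carrier y0])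
    have bxgv: "b *\<^sub>v x = g *\<^sub>v v"
      unfolding y(2) v_def by (rule assoc_mult_mat_vec[OF gc swap_mat_carrier y0])
    have same: "(\<forall>i<l. x $ (n + i) = 0) \<longleftrightarrow> (\<forall>i<l. v $ (n + i) = 0)" if "l \<le> n" for l
      using borel_annihilator[OF b x that] borel_annihilator[OF g(1) v that] bxgv by simp
    have xl: "x $ (n + l) = (if l \<in> S then unit_vec n j $ l else X $$ (l, j))" if l: "l < n" for l
    proof -
      have "?e $ (n + l) = ?z $ l" "?e $ l = unit_vec n j $ l"
        using l z carrier_vecD[OF z] by auto
      moreover have "x $ (n + l) = ?e $ (if l \<in> S then l else n + l)"
        unfolding x_def using swap_mat_vec[OF e, of "n + l" S] l by (simp add: swap_idx_def)
      ultimately show ?thesis using zi[OF l] by simp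
    qed
    have vl: "v $ (n + l) = (if l \<in> S then y $ l else 0)" if l: "l < n" for l
      unfolding v_def using swap_mat_vec[OF y0, of "n + l" S] l y(1) by (simp add: swap_idx_def)
    define l where "l = (LEAST l. x $ (n + l) \<noteq> 0)"
    have "x $ (n + i) \<noteq> 0" using xl[of i] ij Xij by simp
    then have xl0: "x $ (n + l) \<noteq> 0" and li: "l \<le> i"
      unfolding l_def by (rule LeastI, rule Least_le)
    have lmin: "x $ (n + k) = 0" if "k < l" for k using not_less_Least[of k] that unfolding l_def by blast
    have ln: "l < n" "l \<noteq> j" using li ij by auto
    have lS: "l \<notin> S" using xl[OF ln(1)] xl0 ln ij by auto
    have "\<forall>k<l. v $ (n + k) = 0" using same[of l] lmin ln by simp
    then have "\<forall>k<Suc l. v $ (n + k) = 0" using vl[OF ln(1)] lS by (auto simp: less_Suc_eq)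
    then have "x $ (n + l) = 0" using same[of "Suc l"] ln by simp
    then show False using xl0 by simp
  qed
qed

text \<open>Conversely, the whole cell belongs to the orbit: in the coordinates of \<open>S\<close>, the shears by its
  elements are Borel elements.\<close>

lemma shear_conj_flag:
  assumes X: "X \<in> cell n S" and x: "x \<in> flag_sub n l" and l: "l \<le> n"
  shows "swap_mat n S * shear n X * swap_mat n S *\<^sub>v x \<in> flag_sub n l"
proof -
  note Xc = skewD(1)[OF cellD(1)[OF X]]
  have xc: "x \<in> carrier_vec (n + n)" and x0: "\<And>j. j < n + n \<Longrightarrow> l \<le> j \<Longrightarrow> x $ j = 0"
    using x by (auto simp: flag_sub_def)
  have sc: "swap_mat n S *\<^sub>v x \<in> carrier_vec (n + n)" by (rule mult_mat_vec_carrier[OF swap_mat_carrier xc])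
  obtain y z where yz: "y \<in> carrier_vec n" "z \<in> carrier_vec n" "swap_mat n S *\<^sub>v x = y @\<^sub>v z"
    using split_vec[OF sc] by metis
  have yi: "y $ i = (if i \<in> S then x $ (n + i) else x $ i)" if "i < n" for i
    using swap_mat_vec[OF xc, of i S] that yz by (simp add: swap_idx_def split: if_splits)
  have zi: "z $ i = (if i \<in> S then x $ i else x $ (n + i))" if "i < n" for i
    using swap_mat_vec[OF xc, of "n + i" S] that yz by (simp add: swap_idx_def split: if_splits)
  have Xy: "X *\<^sub>v y \<in> carrier_vec n" by (rule mult_mat_vec_carrier[OF Xc yz(1)])
  let ?u = "y @\<^sub>v (X *\<^sub>v y + z)"
  have u: "?u \<in> carrier_vec (n + n)" using yz Xy by simp
  have e: "swap_mat n S * shear n X * swap_mat n S *\<^sub>v x = swap_mat n S *\<^sub>v ?u"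
  proof -
    have c: "swap_mat n S * shear n X \<in> carrier_mat (n + n) (n + n)"
      by (rule mult_carrier_mat[OF swap_mat_carrier shear_carrier[OF Xc]])
    show ?thesis
      unfolding assoc_mult_mat_vec[OF c swap_mat_carrier xc]
        assoc_mult_mat_vec[OF swap_mat_carrier shear_carrier[OF Xc] sc]
      unfolding yz(3) shear_mult_vec[OF Xc yz(1,2)] ..
  qed
  have Xyi: "(X *\<^sub>v y) $ i = 0" if i: "i < n" "i \<notin> S \<or> l \<le> i" for i
  proof -
    have "X $$ (i, j) * y $ j = 0" if j: "j < n" for j
    proof (cases "j \<in> S \<or> l \<le> j")
      case True
      then have "y $ j = 0" using yi[OF j] x0[of j] x0[of "n + j"] j l by auto
      then show ?thesis by simp
    next
      case False
      have "X $$ (i, j) = 0"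
      proof (cases i j rule: linorder_cases)
        case less
        then show ?thesis using cellD(2)[OF X less j] i False by auto
      next
        case equal
        then show ?thesis using skew_diag[OF cellD(1)[OF X] i(1)] by simp
      next
        case greater
        then show ?thesis using cellD(3)[OF X greater i(1)] False by auto
      qed
      then show ?thesis by simp
    qed
    then show ?thesis unfolding mult_vec_index_sum[OF Xc yz(1) i(1)] by (intro sum.neutral) auto
  qed
  have "(swap_mat n S *\<^sub>v ?u) $ k = 0" if k: "k < n + n" "l \<le> k" for k
  proof (cases "k < n")
    case True
    then show ?thesis
      unfolding swap_mat_vec[OF u k(1)]
      using Xyi[of k] zi[of k] yi[of k] x0[of k] yz Xy k by (simp add: swap_idx_def)
  next
    case False
    then obtain i where i: "k = n + i" by (metis le_add_diff_inverse not_less)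
    then show ?thesis
      unfolding swap_mat_vec[OF u k(1)]
      using Xyi[of i] zi[of i] yi[of i] x0[of k] yz Xy k by (simp add: swap_idx_def)
  qed
  then show ?thesis
    unfolding e flag_sub_def using mult_mat_vec_carrier[OF swap_mat_carrier u, of S] by auto
qed

lemma shear_inverse:
  assumes "X \<in> carrier_mat n n"
  shows "shear n X * shear n (- X) = 1\<^sub>m (n + n)"
proof (rule mat_eqI_vec[of _ "n + n" "n + n"])
  have m: "- X \<in> carrier_mat n n" using assms by simp
  show "shear n X * shear n (- X) \<in> carrier_mat (n + n) (n + n)"
    by (rule mult_carrier_mat[OF shear_carrier[OF assms] shear_carrier[OF m]])
  fix v :: "complex vec" assume v: "v \<in> carrier_vec (n + n)"
  then obtain y z where yz: "y \<in> carrier_vec n" "z \<in> carrier_vec n" "v = y @\<^sub>v z" using split_vec by metis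
  have c: "X *\<^sub>v y \<in> carrier_vec n" by (rule mult_mat_vec_carrier[OF assms yz(1)])
  have mc: "- X *\<^sub>v y + z \<in> carrier_vec n" using mult_mat_vec_carrier[OF m yz(1)] yz by simp
  have "X *\<^sub>v y + (- X *\<^sub>v y + z) = z"
    using c yz assms by (intro eq_vecI) auto
  then show "shear n X * shear n (- X) *\<^sub>v v = 1\<^sub>m (n + n) *\<^sub>v v"
    unfolding assoc_mult_mat_vec[OF shear_carrier[OF assms] shear_carrier[OF m] v]
    unfolding yz(3) shear_mult_vec[OF m yz(1,2)] shear_mult_vec[OF assms yz(1) mc] using v yz by simp
qed simp

lemma cell_uminus: "X \<in> cell n S \<Longrightarrow> - X \<in> cell n S"
proof -
  assume X: "X \<in> cell n S"
  note Xc = skewD(1)[OF cellD(1)[OF X]]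
  have e: "(- X) $$ (i, j) = - X $$ (i, j)" if "i < n" "j < n" for i j using Xc that by simp
  show "- X \<in> cell n S"
    unfolding cell_def mem_Collect_eq skew_def
  proof (intro conjI allI impI)
    show "- X \<in> carrier_mat n n" using Xc by simp
    fix i j assume ij: "i < n" "j < n"
    show "(- X) $$ (i, j) = - (- X) $$ (j, i)"
      unfolding e[OF ij] e[OF ij(2,1)] using skewD(2)[OF cellD(1)[OF X] ij] by simp
  next
    fix i j assume ij: "i < j" "j < n" "i \<notin> S"
    then have "i < n" by simp
    show "(- X) $$ (i, j) = 0" unfolding e[OF \<open>i < n\<close> ij(2)] using cellD(2)[OF X ij] by simp
  qed
qed

lemma shear_conj_in_borel:
  assumes X: "X \<in> cell n S"
  shows "swap_mat n S * shear n X * swap_mat n S \<in> borel n"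
proof -
  note Xc = skewD(1)[OF cellD(1)[OF X]]
  let ?s = "swap_mat n S" and ?u = "\<lambda>X. swap_mat n S * shear n X * swap_mat n S"
  have m: "- X \<in> carrier_mat n n" using Xc by simp
  have o: "orth n (?u X)"
    by (rule orth_mult[OF orth_mult[OF orth_swap orth_shear[OF cellD(1)[OF X]]] orth_swap])
  have dd: "det ?s * det ?s = 1"
    using det_mult[OF swap_mat_carrier[of n S] swap_mat_carrier[of n S]] swap_mat_square[of n S] by simp
  have sX: "?s * shear n Z \<in> carrier_mat (n + n) (n + n)" if "Z \<in> carrier_mat n n" for Z
    by (rule mult_carrier_mat[OF swap_mat_carrier shear_carrier[OF that]])
  have uc: "?u Z \<in> carrier_mat (n + n) (n + n)" if "Z \<in> carrier_mat n n" for Z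
    by (rule mult_carrier_mat[OF sX[OF that] swap_mat_carrier])
  have d: "det (?u X) = 1"
    using det_mult[OF sX[OF Xc] swap_mat_carrier] det_mult[OF swap_mat_carrier shear_carrier[OF Xc]]
      det_shear[OF Xc] dd by simp
  have inv: "?u X * ?u (- X) = 1\<^sub>m (n + n)"
  proof -
    have "?u X * ?u (- X) = (?u X * (?s * shear n (- X))) * ?s"
      by (rule assoc_mult_mat[OF uc[OF Xc] sX[OF m] swap_mat_carrier, symmetric])
    also have "?u X * (?s * shear n (- X)) = (?u X * ?s) * shear n (- X)"
      by (rule assoc_mult_mat[OF uc[OF Xc] swap_mat_carrier shear_carrier[OF m], symmetric])
    also have "?u X * ?s = ?s * shear n X * (?s * ?s)"
      by (rule assoc_mult_mat[OF sX[OF Xc] swap_mat_carrier swap_mat_carrier])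
    also have "\<dots> = ?s * shear n X" unfolding swap_mat_square by (rule right_mult_one_mat[OF sX[OF Xc]])
    also have "?s * shear n X * shear n (- X) = ?s * (shear n X * shear n (- X))"
      by (rule assoc_mult_mat[OF swap_mat_carrier shear_carrier[OF Xc] shear_carrier[OF m]])
    also have "\<dots> = ?s" unfolding shear_inverse[OF Xc] by (rule right_mult_one_mat[OF swap_mat_carrier])
    finally show ?thesis unfolding swap_mat_square .
  qed
  have "(\<lambda>v. ?u X *\<^sub>v v) ` flag_sub n l = flag_sub n l" if l: "l \<le> n" for l
  proof
    show "(\<lambda>v. ?u X *\<^sub>v v) ` flag_sub n l \<subseteq> flag_sub n l" using shear_conj_flag[OF X _ l] by blast
    show "flag_sub n l \<subseteq> (\<lambda>v. ?u X *\<^sub>v v) ` flag_sub n l"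
    proof
      fix x assume x: "x \<in> flag_sub n l"
      then have xc: "x \<in> carrier_vec (n + n)" by (simp add: flag_sub_def)
      have "?u X *\<^sub>v (?u (- X) *\<^sub>v x) = x"
        unfolding assoc_mult_mat_vec[OF uc[OF Xc] uc[OF m] xc, symmetric] inv using xc by simp
      then show "x \<in> (\<lambda>v. ?u X *\<^sub>v v) ` flag_sub n l"
        using shear_conj_flag[OF cell_uminus[OF X] x l] by (metis image_eqI)
    qed
  qed
  then show ?thesis unfolding borel_def using o d by simp
qed

lemma cell_chart_in_orbit:
  assumes b: "b \<in> borel n" and X: "X \<in> cell n S"
  shows "gr_chart n (b * swap_mat n S) X \<in> orbit n S"
proof -
  note Xc = skewD(1)[OF cellD(1)[OF X]] and bc = orthD(1)[OF borelD(1)[OF b]]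
  let ?s = "swap_mat n S"
  note u = shear_conj_in_borel[OF X]
  note uc = orthD(1)[OF borelD(1)[OF u]]
  have sX: "?s * shear n X \<in> carrier_mat (n + n) (n + n)"
    by (rule mult_carrier_mat[OF swap_mat_carrier shear_carrier[OF Xc]])
  have us: "?s * shear n X * ?s * ?s = ?s * shear n X"
    unfolding assoc_mult_mat[OF sX swap_mat_carrier swap_mat_carrier] swap_mat_square by (rule right_mult_one_mat[OF sX])
  have "b * ?s * shear n X = b * (?s * shear n X * ?s * ?s)"
    unfolding us by (rule assoc_mult_mat[OF bc swap_mat_carrier shear_carrier[OF Xc]])
  also have "\<dots> = b * (?s * shear n X * ?s) * ?s"
    by (rule assoc_mult_mat[OF bc uc swap_mat_carrier, symmetric])
  finally have "gr_chart n (b * ?s) X = lag n (b * (?s * shear n X * ?s) * ?s)"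
    using gr_chart_eq_lag[OF mult_carrier_mat[OF bc swap_mat_carrier] Xc] by simp
  then show ?thesis unfolding orbit_def using borel_mult[OF b u] by blast
qed

lemma orbit_subset_lags: "orbit n S \<subseteq> lags n (det (swap_mat n S))"
proof
  fix L assume "L \<in> orbit n S"
  then obtain g where g: "g \<in> borel n" "L = lag n (g * swap_mat n S)" unfolding orbit_def by blast
  have "det (g * swap_mat n S) = det (swap_mat n S)"
    using det_mult[OF orthD(1)[OF borelD(1)[OF g(1)]] swap_mat_carrier] borelD(2)[OF g(1)] by simp
  then show "L \<in> lags n (det (swap_mat n S))"
    unfolding lags_def using orth_mult[OF borelD(1)[OF g(1)] orth_swap] g(2) by blast
qed

definition schubert :: "nat \<Rightarrow> nat set \<Rightarrow> complex vec set set" where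
  "schubert n S = lag_topology n (lags n (det (swap_mat n S))) closure_of orbit n S"

lemma orbit_subset_schubert: "orbit n S \<subseteq> schubert n S"
proof -
  have "orbit n S \<subseteq> topspace (lag_topology n (lags n (det (swap_mat n S))))"
    unfolding topspace_subtopology using topspace_zariski_gr[of n "n + n"] orbit_subset_lags[of n S]
      lags_subset[of n "det (swap_mat n S)"] by (auto simp: iso_gr_def)
  then show ?thesis unfolding schubert_def by (rule closure_of_subset)
qed

lemma schubert_subset_lags: "schubert n S \<subseteq> lags n (det (swap_mat n S))"
  unfolding schubert_def using closure_of_subset_topspace[of "lag_topology n (lags n (det (swap_mat n S)))"]
  by (force simp: topspace_subtopology)

text \<open>A linear subspace of a chart is closed there, so the Schubert variety does not have more points
  in the chart than its open cell.\<close>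

lemma schubert_chart:
  assumes b: "b \<in> borel n"
  shows "chart_preimage n (n + n) (b * swap_mat n S) (schubert n S) = cell n S"
proof
  let ?Q = "b * swap_mat n S"
  have Q: "orth n ?Q" by (rule orth_mult[OF borelD(1)[OF b] orth_swap])
  show "cell n S \<subseteq> chart_preimage n (n + n) ?Q (schubert n S)"
  proof
    fix X assume X: "X \<in> cell n S"
    then show "X \<in> chart_preimage n (n + n) ?Q (schubert n S)"
      using subsetD[OF orbit_subset_schubert cell_chart_in_orbit[OF b X]] skewD(1)[OF cellD(1)[OF X]]
      unfolding chart_preimage_def by simp
  qed
  show "chart_preimage n (n + n) ?Q (schubert n S) \<subseteq> cell n S"
  proof
    fix X assume "X \<in> chart_preimage n (n + n) ?Q (schubert n S)"
    then have X: "X \<in> carrier_mat n n" "gr_chart n ?Q X \<in> schubert n S" by (auto simp: chart_preimage_def)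
    have van: "f X = 0" if f: "f \<in> poly_fun n n" "\<And>Y. Y \<in> cell n S \<Longrightarrow> f Y = 0" for f
    proof (rule closure_chartD[OF _ orth_frames[OF Q] f(1) X(1) X(2)[unfolded schubert_def]])
      fix Y assume "Y \<in> chart_preimage n (n + n) ?Q (orbit n S)"
      then have "Y \<in> carrier_mat n n" "gr_chart n ?Q Y \<in> orbit n S" by (auto simp: chart_preimage_def)
      then show "f Y = 0" using f(2) orbit_chart_in_cell[OF b] by blast
    qed simp
    show "X \<in> cell n S"
      unfolding cell_def mem_Collect_eq skew_def
    proof (intro conjI X(1) allI impI)
      fix i j assume ij: "i < n" "j < n"
      have "(\<lambda>X. X $$ (i, j) + X $$ (j, i)) \<in> poly_fun n n"
        by (intro poly_fun.add poly_fun.entry ij)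
      moreover have "Y $$ (i, j) + Y $$ (j, i) = 0" if "Y \<in> cell n S" for Y
        using skewD(2)[OF cellD(1)[OF that] ij] by simp
      ultimately have "X $$ (i, j) + X $$ (j, i) = 0" by (rule van)
      then show "X $$ (i, j) = - X $$ (j, i)" by (simp add: eq_neg_iff_add_eq_0)
    next
      fix i j assume ij: "i < j" "j < n" "i \<notin> S"
      show "X $$ (i, j) = 0"
        by (rule van[OF poly_fun.entry]) (use ij cellD(2) in auto)
    qed
  qed
qed

section \<open>Conormal vectors as gradients\<close>

text \<open>The chain rule makes the family \<open>G\<close> of partial derivatives usable along every curve.\<close>

definition gradient :: "nat \<Rightarrow> (complex mat \<Rightarrow> complex) \<Rightarrow> (nat \<Rightarrow> nat \<Rightarrow> complex mat \<Rightarrow> complex) \<Rightarrow> bool" where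
  "gradient n g G \<longleftrightarrow> (\<forall>i<n. \<forall>j<n. G i j \<in> poly_fun n n) \<and>
     (\<forall>\<gamma> D. (\<forall>i<n. \<forall>j<n. ((\<lambda>t. \<gamma> t $$ (i, j)) has_field_derivative D i j) (at 0)) \<longrightarrow>
       ((\<lambda>t. g (\<gamma> t)) has_field_derivative (\<Sum>i<n. \<Sum>j<n. G i j (\<gamma> 0) * D i j)) (at 0))"

lemma gradientD:
  assumes "gradient n g G"
  shows "i < n \<Longrightarrow> j < n \<Longrightarrow> G i j \<in> poly_fun n n"
    "(\<And>i j. i < n \<Longrightarrow> j < n \<Longrightarrow> ((\<lambda>t. \<gamma> t $$ (i, j)) has_field_derivative D i j) (at 0)) \<Longrightarrow>
     ((\<lambda>t. g (\<gamma> t)) has_field_derivative (\<Sum>i<n. \<Sum>j<n. G i j (\<gamma> 0) * D i j)) (at 0)"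
  using assms unfolding gradient_def by blast+

lemma gradientI:
  assumes "\<And>i j. i < n \<Longrightarrow> j < n \<Longrightarrow> G i j \<in> poly_fun n n"
    and "\<And>\<gamma> D. (\<And>i j. i < n \<Longrightarrow> j < n \<Longrightarrow> ((\<lambda>t. \<gamma> t $$ (i, j)) has_field_derivative D i j) (at 0)) \<Longrightarrow>
     ((\<lambda>t. g (\<gamma> t)) has_field_derivative (\<Sum>i<n. \<Sum>j<n. G i j (\<gamma> 0) * D i j)) (at 0)"
  shows "gradient n g G"
  using assms unfolding gradient_def by auto

lemma gradient_add:
  assumes f: "gradient n f F" and g: "gradient n g G"
  shows "gradient n (\<lambda>X. f X + g X) (\<lambda>i j X. F i j X + G i j X)"
proof (rule gradientI)
  fix i j assume "i < n" "j < n"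
  then show "(\<lambda>X. F i j X + G i j X) \<in> poly_fun n n"
    by (intro poly_fun.add gradientD(1)[OF f] gradientD(1)[OF g])
next
  fix \<gamma> :: "complex \<Rightarrow> complex mat" and D
  assume D: "\<And>i j. i < n \<Longrightarrow> j < n \<Longrightarrow> ((\<lambda>t. \<gamma> t $$ (i, j)) has_field_derivative D i j) (at 0)"
  have e: "(\<Sum>i<n. \<Sum>j<n. (F i j (\<gamma> 0) + G i j (\<gamma> 0)) * D i j) =
      (\<Sum>i<n. \<Sum>j<n. F i j (\<gamma> 0) * D i j) + (\<Sum>i<n. \<Sum>j<n. G i j (\<gamma> 0) * D i j)"
    by (simp add: distrib_right sum.distrib)
  show "((\<lambda>t. f (\<gamma> t) + g (\<gamma> t)) has_field_derivative
      (\<Sum>i<n. \<Sum>j<n. (F i j (\<gamma> 0) + G i j (\<gamma> 0)) * D i j)) (at 0)"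
    unfolding e by (intro DERIV_add gradientD(2)[OF f D] gradientD(2)[OF g D])
qed

lemma gradient_mult:
  assumes f: "f \<in> poly_fun n n" "gradient n f F" and g: "g \<in> poly_fun n n" "gradient n g G"
  shows "gradient n (\<lambda>X. f X * g X) (\<lambda>i j X. F i j X * g X + f X * G i j X)"
proof (rule gradientI)
  fix i j assume "i < n" "j < n"
  then show "(\<lambda>X. F i j X * g X + f X * G i j X) \<in> poly_fun n n"
    by (intro poly_fun.add poly_fun.mult gradientD(1)[OF f(2)] gradientD(1)[OF g(2)] f(1) g(1))
next
  fix \<gamma> :: "complex \<Rightarrow> complex mat" and D
  assume D: "\<And>i j. i < n \<Longrightarrow> j < n \<Longrightarrow> ((\<lambda>t. \<gamma> t $$ (i, j)) has_field_derivative D i j) (at 0)"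
  have e: "(\<Sum>i<n. \<Sum>j<n. (F i j (\<gamma> 0) * g (\<gamma> 0) + f (\<gamma> 0) * G i j (\<gamma> 0)) * D i j) =
      (\<Sum>i<n. \<Sum>j<n. F i j (\<gamma> 0) * D i j) * g (\<gamma> 0) + (\<Sum>i<n. \<Sum>j<n. G i j (\<gamma> 0) * D i j) * f (\<gamma> 0)"
    unfolding sum_distrib_right sum.distrib[symmetric]
    by (intro sum.cong refl) (simp add: algebra_simps)
  show "((\<lambda>t. f (\<gamma> t) * g (\<gamma> t)) has_field_derivative
      (\<Sum>i<n. \<Sum>j<n. (F i j (\<gamma> 0) * g (\<gamma> 0) + f (\<gamma> 0) * G i j (\<gamma> 0)) * D i j)) (at 0)"
    unfolding e by (rule DERIV_mult[OF gradientD(2)[OF f(2) D] gradientD(2)[OF g(2) D]])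
qed

lemma gradient_const: "gradient n (\<lambda>_. a) (\<lambda>_ _ _. 0)"
  by (rule gradientI) (auto intro: poly_fun.const)

lemma gradient_exists:
  assumes "f \<in> poly_fun n n"
  shows "\<exists>F. gradient n f F"
  using assms
proof (induction rule: poly_fun.induct)
  case (const a)
  show ?case using gradient_const by blast
next
  case (entry i j)
  have "gradient n (\<lambda>X. X $$ (i, j)) (\<lambda>k l _. if k = i \<and> l = j then 1 else 0)"
  proof (rule gradientI)
    fix k l assume "k < n" "l < n"
    show "(\<lambda>_. if k = i \<and> l = j then 1 else 0) \<in> poly_fun n n" by (rule poly_fun.const)
  next
    fix \<gamma> :: "complex \<Rightarrow> complex mat" and D
    assume D: "\<And>i j. i < n \<Longrightarrow> j < n \<Longrightarrow> ((\<lambda>t. \<gamma> t $$ (i, j)) has_field_derivative D i j) (at 0)"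
    have "(\<Sum>k<n. \<Sum>l<n. (if k = i \<and> l = j then 1 else 0) * D k l) = (\<Sum>k<n. if k = i then D i j else 0)"
    proof (rule sum.cong[OF refl])
      fix k
      show "(\<Sum>l<n. (if k = i \<and> l = j then 1 else 0) * D k l) = (if k = i then D i j else 0)"
      proof (cases "k = i")
        case True
        have "(\<Sum>l<n. (if k = i \<and> l = j then 1 else 0) * D k l) = (\<Sum>l<n. if l = j then D i l else 0)"
          using True by (intro sum.cong) auto
        then show ?thesis using True entry by simp
      qed simp
    qed
    then have e: "(\<Sum>k<n. \<Sum>l<n. (if k = i \<and> l = j then 1 else 0) * D k l) = D i j"
      using entry by simp
    show "((\<lambda>t. \<gamma> t $$ (i, j)) has_field_derivative
        (\<Sum>k<n. \<Sum>l<n. (if k = i \<and> l = j then 1 else 0) * D k l)) (at 0)"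
      unfolding e by (rule D[OF entry])
  qed
  then show ?case by blast
next
  case (add f g)
  then show ?case using gradient_add by blast
next
  case (mult f g)
  then show ?case using gradient_mult by blast
qed

lemma gradient_has_differential:
  assumes g: "gradient n g G" and S: "S \<in> carrier_mat n n"
  shows "has_differential g S (\<Sum>i<n. \<Sum>j<n. G i j (0\<^sub>m n n) * S $$ (i, j))"
proof -
  have z: "0 \<cdot>\<^sub>m S = 0\<^sub>m n n" using S by (intro eq_matI) auto
  have "((\<lambda>t. g (t \<cdot>\<^sub>m S)) has_field_derivative (\<Sum>i<n. \<Sum>j<n. G i j (0 \<cdot>\<^sub>m S) * S $$ (i, j))) (at 0)"
  proof (rule gradientD(2)[OF g])
    fix i j assume ij: "i < n" "j < n"
    have e: "(\<lambda>t. (t \<cdot>\<^sub>m S) $$ (i, j)) = (\<lambda>t. t * S $$ (i, j))" using S ij by auto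
    show "((\<lambda>t. (t \<cdot>\<^sub>m S) $$ (i, j)) has_field_derivative S $$ (i, j)) (at 0)"
      unfolding e by (auto intro!: derivative_eq_intros)
  qed
  then show ?thesis unfolding has_differential_def z .
qed

text \<open>A covector that annihilates the Zariski tangent space is the differential of a single polynomial
  of the vanishing ideal. This polynomial extends it to a family of conormal vectors at all points of
  the chart.\<close>

lemma conormal_eq_gradient:
  assumes con: "\<And>S. S \<in> chart_tangent n (n + n) P A \<Longrightarrow> (\<Sum>i<n. \<Sum>j<n. w $$ (j, i) * S $$ (i, j)) = 0"
  obtains g G where "g \<in> poly_fun n n" "gradient n g G"
    "\<And>Y. Y \<in> chart_preimage n (n + n) P A \<Longrightarrow> g Y = 0"
    "\<And>i j. i < n \<Longrightarrow> j < n \<Longrightarrow> G i j (0\<^sub>m n n) = w $$ (j, i)"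
proof -
  define Id where "Id = {g \<in> poly_fun n n. \<forall>Y\<in>chart_preimage n (n + n) P A. g Y = 0}"
  define V where "V = {(\<lambda>(i, j). G i j (0\<^sub>m n n)) | g G. g \<in> Id \<and> gradient n g G}"
  let ?I = "{..<n} \<times> {..<n}"
  have "\<exists>v\<in>V. \<forall>ij\<in>?I. v ij = (case ij of (i, j) \<Rightarrow> w $$ (j, i))"
  proof (rule double_annihilator)
    show "finite ?I" by simp
    have "(\<lambda>_. 0) \<in> Id" unfolding Id_def using poly_fun.const[of 0 n n] by simp
    moreover have "(\<lambda>_. 0) = (\<lambda>(i::nat, j::nat). (0::complex))" by auto
    ultimately show "(\<lambda>_. 0) \<in> V"
      unfolding V_def mem_Collect_eq
      by (intro exI[of _ "\<lambda>_. 0"] exI[of _ "\<lambda>_ _ _. 0"] conjI gradient_const)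
  next
    fix u v assume "u \<in> V" "v \<in> V"
    then obtain f F g G where fg: "f \<in> Id" "gradient n f F" "u = (\<lambda>(i, j). F i j (0\<^sub>m n n))"
      "g \<in> Id" "gradient n g G" "v = (\<lambda>(i, j). G i j (0\<^sub>m n n))" unfolding V_def by blast
    have "(\<lambda>X. f X + g X) \<in> Id" using fg(1,4) unfolding Id_def by (auto intro: poly_fun.add)
    moreover have "(\<lambda>i. u i + v i) = (\<lambda>(i, j). F i j (0\<^sub>m n n) + G i j (0\<^sub>m n n))" unfolding fg by auto
    ultimately show "(\<lambda>i. u i + v i) \<in> V"
      unfolding V_def mem_Collect_eq
      by (intro exI[of _ "\<lambda>X. f X + g X"] exI[of _ "\<lambda>i j X. F i j X + G i j X"] conjI gradient_add fg)
  next
    fix c u assume "u \<in> V"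
    then obtain f F where f: "f \<in> Id" "gradient n f F" "u = (\<lambda>(i, j). F i j (0\<^sub>m n n))" unfolding V_def by blast
    have fp: "f \<in> poly_fun n n" using f(1) by (simp add: Id_def)
    have "(\<lambda>X. c * f X) \<in> Id"
      using f(1) poly_fun.mult[OF poly_fun.const[of c n n] fp] unfolding Id_def by simp
    moreover have "(\<lambda>i. c * u i) = (\<lambda>(i, j). 0 * f (0\<^sub>m n n) + c * F i j (0\<^sub>m n n))" unfolding f by auto
    ultimately show "(\<lambda>i. c * u i) \<in> V"
      unfolding V_def mem_Collect_eq
      by (intro exI[of _ "\<lambda>X. c * f X"] exI[of _ "\<lambda>i j X. 0 * f X + c * F i j X"] conjI
          gradient_mult[OF poly_fun.const gradient_const fp f(2)])
  next
    fix s :: "nat \<times> nat \<Rightarrow> complex"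
    assume s: "\<forall>v\<in>V. (\<Sum>ij\<in>?I. s ij * v ij) = 0"
    define S where "S = mat n n s"
    have S: "S \<in> carrier_mat n n" by (simp add: S_def)
    have "S \<in> chart_tangent n (n + n) P A"
      unfolding chart_tangent_def mem_Collect_eq add_diff_cancel_left'
    proof (intro conjI S ballI impI)
      fix f assume f: "f \<in> poly_fun n n" "\<forall>Y\<in>chart_preimage n (n + n) P A. f Y = 0"
      obtain F where F: "gradient n f F" using gradient_exists[OF f(1)] by blast
      have "(\<lambda>(i, j). F i j (0\<^sub>m n n)) \<in> V" unfolding V_def Id_def using f F by blast
      then have "(\<Sum>ij\<in>?I. s ij * (case ij of (i, j) \<Rightarrow> F i j (0\<^sub>m n n))) = 0" using s by blast
      moreover have "(\<Sum>ij\<in>?I. s ij * (case ij of (i, j) \<Rightarrow> F i j (0\<^sub>m n n))) =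
          (\<Sum>i<n. \<Sum>j<n. F i j (0\<^sub>m n n) * S $$ (i, j))"
        unfolding sum.cartesian_product by (intro sum.cong) (auto simp: S_def)
      ultimately show "has_differential f S 0" using gradient_has_differential[OF F S] by simp
    qed
    then have "(\<Sum>i<n. \<Sum>j<n. w $$ (j, i) * S $$ (i, j)) = 0" by (rule con)
    moreover have "(\<Sum>i<n. \<Sum>j<n. w $$ (j, i) * S $$ (i, j)) =
        (\<Sum>ij\<in>?I. s ij * (case ij of (i, j) \<Rightarrow> w $$ (j, i)))"
      unfolding sum.cartesian_product by (intro sum.cong) (auto simp: S_def)
    ultimately show "(\<Sum>ij\<in>?I. s ij * (case ij of (i, j) \<Rightarrow> w $$ (j, i))) = 0" by simp
  qed
  then obtain v where v: "v \<in> V" "\<forall>ij\<in>?I. v ij = (case ij of (i, j) \<Rightarrow> w $$ (j, i))" by blast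
  then obtain g G where g: "g \<in> Id" "gradient n g G" "v = (\<lambda>(i, j). G i j (0\<^sub>m n n))" unfolding V_def by blast
  have "G i j (0\<^sub>m n n) = w $$ (j, i)" if "i < n" "j < n" for i j
    using v(2) that unfolding g(3) by force
  then show ?thesis using that[OF _ g(2)] g(1) unfolding Id_def by blast
qed

section \<open>Conormal vectors along the open cell\<close>

lemma mult_index_sum:
  fixes A B :: "complex mat"
  assumes "A \<in> carrier_mat r k" "B \<in> carrier_mat k c" "i < r" "j < c"
  shows "(A * B) $$ (i, j) = (\<Sum>l<k. A $$ (i, l) * B $$ (l, j))"
  using assms by (simp add: scalar_prod_def lessThan_atLeast0)

text \<open>A change of frame that fixes the centre changes the coordinate to \<open>X = d Z (a + c Z)\<inverse>\<close>.\<close>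

lemma gr_chart_transition:
  assumes Q: "Q \<in> frames (n + n)" and P: "P \<in> frames (n + n)"
    and R: "P = Q * four_block_mat a c (0\<^sub>m n n) d"
    and car: "a \<in> carrier_mat n n" "c \<in> carrier_mat n n" "d \<in> carrier_mat n n"
      "Z \<in> carrier_mat n n" "X \<in> carrier_mat n n"
    and eq: "d * Z = X * (a + c * Z)"
  shows "gr_chart n P Z = gr_chart n Q X"
proof (rule grassmannian_subset_eq)
  show "gr_chart n P Z \<in> grassmannian n (n + n)" "gr_chart n Q X \<in> grassmannian n (n + n)"
    using gr_chart_in_grassmannian[OF _ P, of n Z] gr_chart_in_grassmannian[OF _ Q, of n X] car by auto
  have Qc: "Q \<in> carrier_mat (n + n) (n + n)" using Q by (simp add: frames_def)
  let ?R = "four_block_mat a c (0\<^sub>m n n) d"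
  have Rc: "?R \<in> carrier_mat (n + n) (n + n)" using car by simp
  show "gr_chart n P Z \<subseteq> gr_chart n Q X"
  proof
    fix x assume "x \<in> gr_chart n P Z"
    then obtain y where y: "y \<in> carrier_vec n" "x = P *\<^sub>v (y @\<^sub>v (Z *\<^sub>v y))" by (auto simp: gr_chart_def)
    have Zy: "Z *\<^sub>v y \<in> carrier_vec n" by (rule mult_mat_vec_carrier[OF car(4) y(1)])
    have yZ: "y @\<^sub>v (Z *\<^sub>v y) \<in> carrier_vec (n + n)" by (rule append_carrier_vec[OF y(1) Zy])
    define y' where "y' = (a + c * Z) *\<^sub>v y"
    have cZ: "c * Z \<in> carrier_mat n n" by (rule mult_carrier_mat[OF car(2,4)])
    have acZ: "a + c * Z \<in> carrier_mat n n" using car(1) cZ by simp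
    have y': "y' \<in> carrier_vec n" unfolding y'_def by (rule mult_mat_vec_carrier[OF acZ y(1)])
    have 1: "a *\<^sub>v y + c *\<^sub>v (Z *\<^sub>v y) = y'"
      unfolding y'_def add_mult_distrib_mat_vec[OF car(1) cZ y(1)] assoc_mult_mat_vec[OF car(2,4) y(1)] ..
    have 2: "d *\<^sub>v (Z *\<^sub>v y) = X *\<^sub>v y'"
      unfolding y'_def assoc_mult_mat_vec[OF car(3,4) y(1), symmetric] eq
      by (rule assoc_mult_mat_vec[OF car(5) acZ y(1)])
    have "?R *\<^sub>v (y @\<^sub>v (Z *\<^sub>v y)) = (a *\<^sub>v y + c *\<^sub>v (Z *\<^sub>v y)) @\<^sub>v (0\<^sub>m n n *\<^sub>v y + d *\<^sub>v (Z *\<^sub>v y))"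
      by (rule four_block_mat_mult_vec[OF car(1,2) zero_carrier_mat car(3) y(1) Zy])
    also have "\<dots> = y' @\<^sub>v (X *\<^sub>v y')"
      unfolding 1 2 zero_mat_mult_vec[OF y(1)] using mult_mat_vec_carrier[OF car(5) y'] by simp
    finally have "x = Q *\<^sub>v (y' @\<^sub>v (X *\<^sub>v y'))"
      unfolding y(2) R using assoc_mult_mat_vec[OF Qc Rc yZ] by simp
    then show "x \<in> gr_chart n Q X" unfolding gr_chart_def using y' by blast
  qed
qed

lemma gr_chart_shear:
  assumes P: "P \<in> carrier_mat (n + n) (n + n)" and Y: "Y \<in> carrier_mat n n" and Z: "Z \<in> carrier_mat n n"
  shows "gr_chart n (P * shear n Y) Z = gr_chart n P (Y + Z)"
proof -
  have "P * shear n Y *\<^sub>v (y @\<^sub>v (Z *\<^sub>v y)) = P *\<^sub>v (y @\<^sub>v ((Y + Z) *\<^sub>v y))" if y: "y \<in> carrier_vec n" for y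
  proof -
    have Zy: "Z *\<^sub>v y \<in> carrier_vec n" by (rule mult_mat_vec_carrier[OF Z y])
    show ?thesis
      unfolding assoc_mult_mat_vec[OF P shear_carrier[OF Y] append_carrier_vec[OF y Zy]]
        shear_mult_vec[OF Y y Zy] add_mult_distrib_mat_vec[OF Y Z y] ..
  qed
  then show ?thesis unfolding gr_chart_def by (metis (no_types, lifting))
qed

lemma isCont_line_ring: "f \<in> line_ring \<Longrightarrow> isCont f x"
  unfolding line_ring_def by auto

text \<open>The skew part of the gradient, with the index order of cotangent vectors.\<close>

definition skew_gradient :: "nat \<Rightarrow> (nat \<Rightarrow> nat \<Rightarrow> complex mat \<Rightarrow> complex) \<Rightarrow> complex mat \<Rightarrow> complex mat" where
  "skew_gradient n G Y = mat n n (\<lambda>(i, j). (G j i Y - G i j Y) / 2)"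

lemma skew_skew_gradient: "skew n (skew_gradient n G Y)"
  unfolding skew_def
proof (intro conjI allI impI)
  fix i j assume "i < n" "j < n"
  then show "skew_gradient n G Y $$ (i, j) = - skew_gradient n G Y $$ (j, i)"
    by (simp add: skew_gradient_def diff_divide_distrib)
qed (simp add: skew_gradient_def)

text \<open>At a point of the orbit the gradient annihilates the velocities of all affine lines in the cell.
  In the frame \<open>Q\<close> these lines are \<open>t X\<close>, and \<open>Z(t) = t (d - t X c)\<inverse> X a\<close> is the same line in the
  frame \<open>P\<close>; its velocity is \<open>a\<^sup>T X a\<close>.\<close>

lemma gradient_annihilates_cell:
  assumes Q: "orth n Q" and P: "orth n P" and Y: "skew n Y"
    and R: "P * shear n Y = Q * four_block_mat a c (0\<^sub>m n n) d"
    and car: "a \<in> carrier_mat n n" "c \<in> carrier_mat n n" "d \<in> carrier_mat n n" and ad: "a\<^sup>T * d = 1\<^sub>m n"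
    and X: "X \<in> carrier_mat n n" and line: "\<And>t. gr_chart n Q (t \<cdot>\<^sub>m X) \<in> A"
    and g: "gradient n g G" "\<And>Y. Y \<in> chart_preimage n (n + n) P A \<Longrightarrow> g Y = 0"
  shows "(\<Sum>i<n. \<Sum>j<n. G i j Y * (a\<^sup>T * X * a) $$ (i, j)) = 0"
proof -
  note Yc = skewD(1)[OF Y]
  have aT: "a\<^sup>T \<in> carrier_mat n n" using car by simp
  have da: "d * a\<^sup>T = 1\<^sub>m n" by (rule mat_mult_left_right_inverse[OF aT car(3) ad])
  have det_d: "det d \<noteq> 0"
  proof
    assume "det d = 0"
    then have "det (a\<^sup>T * d) = 0" using det_mult[OF aT car(3)] by simp
    then show False unfolding ad by simp
  qed
  have Xc: "X * c \<in> carrier_mat n n" and Xa: "X * a \<in> carrier_mat n n"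
    using mult_carrier_mat[OF X car(2)] mult_carrier_mat[OF X car(1)] by auto
  define D where "D = (\<lambda>t. d + t \<cdot>\<^sub>m (- (X * c)))"
  have mXc: "- (X * c) \<in> carrier_mat n n" using Xc by simp
  have Dc: "D t \<in> carrier_mat n n" for t unfolding D_def using car(3) mXc by simp
  define K where "K = (\<lambda>t. ((1 / det (D t)) \<cdot>\<^sub>m adj_mat (D t)) * (X * a))"
  have adjc: "adj_mat (D t) \<in> carrier_mat n n" for t by (rule adj_mat(1)[OF Dc])
  have Kc: "K t \<in> carrier_mat n n" for t
    unfolding K_def by (rule mult_carrier_mat[OF smult_carrier_mat[OF adjc] Xa])
  define Z where "Z = (\<lambda>t. t \<cdot>\<^sub>m K t)"
  have Zc: "Z t \<in> carrier_mat n n" for t unfolding Z_def using Kc by simp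
  have over: "mat_over line_ring n n D"
    unfolding D_def
    by (rule mat_over_add[OF function_ring_line mat_over_const[OF function_ring_line car(3)]
          mat_over_smult[OF function_ring_line id_in_line_ring mat_over_const[OF function_ring_line mXc]]])
  have detD: "(\<lambda>t. det (D t)) \<in> line_ring" by (rule det_over[OF function_ring_line over])
  have num: "mat_over line_ring n n (\<lambda>t. adj_mat (D t) * (X * a))"
    by (rule mat_over_mult[OF function_ring_line adj_mat_over[OF function_ring_line over]
          mat_over_const[OF function_ring_line Xa]])
  have "0 \<cdot>\<^sub>m (- (X * c)) = 0\<^sub>m n n"
    by (rule eq_matI) (use carrier_matD[OF mXc] in \<open>simp_all only: index_smult_mat index_zero_mat mult_zero_left\<close>)
  then have D0: "D 0 = d" unfolding D_def by (simp only: right_add_zero_mat[OF car(3)])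
  have Kij: "K t $$ (i, j) = (adj_mat (D t) * (X * a)) $$ (i, j) / det (D t)" if "i < n" "j < n" for t i j
  proof -
    have "K t = (1 / det (D t)) \<cdot>\<^sub>m (adj_mat (D t) * (X * a))"
      unfolding K_def by (rule mult_smult_assoc_mat[OF adjc Xa])
    then show ?thesis using that mult_carrier_mat[OF adjc Xa, of t] by (simp only: index_smult_mat carrier_matD) simp
  qed
  have contK: "isCont (\<lambda>t. K t $$ (i, j)) 0" if "i < n" "j < n" for i j
    unfolding Kij[OF that]
    by (intro continuous_divide isCont_line_ring[OF mat_overD(2)[OF num that]] isCont_line_ring[OF detD])
      (use det_d D0 in simp)
  have K0: "K 0 = a\<^sup>T * X * a"
  proof -
    note I = det_nonzero_inverse[OF car(3) det_d]
    have "(1 / det d) \<cdot>\<^sub>m adj_mat d = (a\<^sup>T * d) * ((1 / det d) \<cdot>\<^sub>m adj_mat d)"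
      unfolding ad by (rule left_mult_one_mat[OF I(1), symmetric])
    also have "\<dots> = a\<^sup>T" unfolding assoc_mult_mat[OF aT car(3) I(1)] I(2) by (rule right_mult_one_mat[OF aT])
    finally have "(1 / det d) \<cdot>\<^sub>m adj_mat d = a\<^sup>T" .
    then show ?thesis unfolding K_def D0 using assoc_mult_mat[OF aT X car(1)] by simp
  qed
  have DK: "D t * K t = X * a" if "det (D t) \<noteq> 0" for t
    unfolding K_def
      assoc_mult_mat[OF Dc det_nonzero_inverse(1)[OF Dc that] Xa, symmetric] det_nonzero_inverse(2)[OF Dc that]
    by (rule left_mult_one_mat[OF Xa])
  have van: "g (Y + Z t) = 0" if t: "det (D t) \<noteq> 0" for t
  proof (rule g(2))
    have cK: "c * K t \<in> carrier_mat n n" and dK: "d * K t \<in> carrier_mat n n"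
      using mult_carrier_mat[OF car(2) Kc] mult_carrier_mat[OF car(3) Kc] by auto
    have tX: "t \<cdot>\<^sub>m X \<in> carrier_mat n n" using X by simp
    have XcK: "X * (c * K t) \<in> carrier_mat n n" by (rule mult_carrier_mat[OF X cK])
    have "X * a = d * K t + (t \<cdot>\<^sub>m (- (X * c))) * K t"
      using DK[OF t] unfolding D_def using add_mult_distrib_mat[OF car(3) _ Kc, of "t \<cdot>\<^sub>m (- (X * c))" t] mXc by simp
    also have "(t \<cdot>\<^sub>m (- (X * c))) * K t = t \<cdot>\<^sub>m (- (X * (c * K t)))"
    proof -
      have "(t \<cdot>\<^sub>m (- (X * c))) * K t = t \<cdot>\<^sub>m (- (X * c) * K t)" by (rule mult_smult_assoc_mat[OF mXc Kc])
      also have "- (X * c) * K t = - (X * c * K t)"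
        by (rule uminus_mult_left_mat) (use Xc Kc[of t] in auto)
      also have "X * c * K t = X * (c * K t)" by (rule assoc_mult_mat[OF X car(2) Kc])
      finally show ?thesis .
    qed
    finally have e: "X * a = d * K t + t \<cdot>\<^sub>m (- (X * (c * K t)))" .
    have dZ: "d * Z t = t \<cdot>\<^sub>m (d * K t)" unfolding Z_def by (rule mult_smult_distrib[OF car(3) Kc])
    have cZ: "c * Z t = t \<cdot>\<^sub>m (c * K t)" unfolding Z_def by (rule mult_smult_distrib[OF car(2) Kc])
    have "(t \<cdot>\<^sub>m X) * (a + c * Z t) = (t \<cdot>\<^sub>m X) * a + (t \<cdot>\<^sub>m X) * (c * Z t)"
      by (rule mult_add_distrib_mat[OF tX car(1)]) (use cZ cK in simp)
    also have "(t \<cdot>\<^sub>m X) * a = t \<cdot>\<^sub>m (X * a)" by (rule mult_smult_assoc_mat[OF X car(1)])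
    also have "(t \<cdot>\<^sub>m X) * (c * Z t) = t \<cdot>\<^sub>m (t \<cdot>\<^sub>m (X * (c * K t)))"
      unfolding cZ mult_smult_assoc_mat[OF X smult_carrier_mat[OF cK]] mult_smult_distrib[OF X cK] ..
    also have "t \<cdot>\<^sub>m (X * a) + t \<cdot>\<^sub>m (t \<cdot>\<^sub>m (X * (c * K t))) = d * Z t"
    proof -
      have "t \<cdot>\<^sub>m (U + t \<cdot>\<^sub>m (- V)) + t \<cdot>\<^sub>m (t \<cdot>\<^sub>m V) = t \<cdot>\<^sub>m U"
        if "U \<in> carrier_mat n n" "V \<in> carrier_mat n n" for U V
        using that by (intro eq_matI) (auto simp: algebra_simps)
      then show ?thesis unfolding e dZ using dK XcK by blast
    qed
    finally have eq: "d * Z t = (t \<cdot>\<^sub>m X) * (a + c * Z t)" by simp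
    have "gr_chart n P (Y + Z t) = gr_chart n (P * shear n Y) (Z t)"
      by (rule gr_chart_shear[OF orthD(1)[OF P] Yc Zc, symmetric])
    also have "\<dots> = gr_chart n Q (t \<cdot>\<^sub>m X)"
      by (rule gr_chart_transition[OF orth_frames[OF Q] orth_frames[OF orth_mult[OF P orth_shear[OF Y]]] R car Zc tX eq])
    finally have "gr_chart n P (Y + Z t) \<in> A" using line by simp
    moreover have "Y + Z t \<in> carrier_mat n n" using Yc Zc by simp
    ultimately show "Y + Z t \<in> chart_preimage n (n + n) P A" by (simp add: chart_preimage_def)
  qed
  have der: "((\<lambda>t. g (Y + Z t)) has_field_derivative (\<Sum>i<n. \<Sum>j<n. G i j (Y + Z 0) * (a\<^sup>T * X * a) $$ (i, j))) (at 0)"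
  proof (rule gradientD(2)[OF g(1)])
    fix i j assume ij: "i < n" "j < n"
    have e: "(Y + Z t) $$ (i, j) = Y $$ (i, j) + t * K t $$ (i, j)" for t
      unfolding Z_def using Yc Kc[of t] ij by simp
    show "((\<lambda>t. (Y + Z t) $$ (i, j)) has_field_derivative (a\<^sup>T * X * a) $$ (i, j)) (at 0)"
      unfolding CARAT_DERIV
      by (rule exI[of _ "\<lambda>t. K t $$ (i, j)"]) (use contK[OF ij] in \<open>simp add: e K0\<close>)
  qed
  have Y0: "Y + Z 0 = Y" unfolding Z_def using Yc Kc[of 0] by (intro eq_matI) auto
  have "((\<lambda>t. g (Y + Z t)) has_field_derivative 0) (at 0)"
  proof -
    have "isCont (\<lambda>t. det (D t)) 0" by (rule isCont_line_ring[OF detD])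
    then have "((\<lambda>t. det (D t)) \<longlongrightarrow> det (D 0)) (nhds 0)"
      unfolding isCont_def tendsto_at_iff_tendsto_nhds[of "\<lambda>t. det (D t)" 0] .
    then have "\<forall>\<^sub>F t in nhds 0. det (D t) \<noteq> 0"
      using det_d unfolding D0 by (rule tendsto_imp_eventually_ne)
    then have ev: "\<forall>\<^sub>F t in nhds 0. g (Y + Z t) = 0" by (rule eventually_mono) (rule van)
    show ?thesis by (rule iffD2[OF DERIV_cong_ev[OF refl ev refl]]) simp
  qed
  from DERIV_unique[OF der[unfolded Y0] this] show ?thesis .
qed

text \<open>The cell contains the elementary skew matrices of the pairs \<open>i < j\<close> with \<open>i \<in> S\<close>. For such a
  matrix \<open>X\<close>, the pairing with \<open>a\<^sup>T X a\<close> is, up to a factor, the entry of \<open>a w a\<^sup>T\<close> at \<open>i, j\<close>.\<close>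

lemma skew_gradient_in_cell:
  assumes b: "b \<in> borel n" and P: "orth n P" and Y: "skew n Y"
    and R: "P * shear n Y = b * swap_mat n S * four_block_mat a c (0\<^sub>m n n) d"
    and car: "a \<in> carrier_mat n n" "c \<in> carrier_mat n n" "d \<in> carrier_mat n n" and ad: "a\<^sup>T * d = 1\<^sub>m n"
    and g: "gradient n g G" "\<And>Y. Y \<in> chart_preimage n (n + n) P (orbit n S) \<Longrightarrow> g Y = 0"
  shows "a * skew_gradient n G Y * a\<^sup>T \<in> cell n (- S)"
proof -
  let ?w = "skew_gradient n G Y"
  note wsk = skew_skew_gradient[of n G Y]
  note wc = skewD(1)[OF wsk]
  have aT: "a\<^sup>T \<in> carrier_mat n n" using car by simp
  have aw: "a * ?w \<in> carrier_mat n n" by (rule mult_carrier_mat[OF car(1) wc])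
  have awa: "a * ?w * a\<^sup>T \<in> carrier_mat n n" by (rule mult_carrier_mat[OF aw aT])
  have entry: "(a * ?w * a\<^sup>T) $$ (i, j) = (\<Sum>k<n. \<Sum>l<n. a $$ (i, k) * ?w $$ (k, l) * a $$ (j, l))"
    if ij: "i < n" "j < n" for i j
  proof -
    have "(a * ?w * a\<^sup>T) $$ (i, j) = (\<Sum>l<n. (a * ?w) $$ (i, l) * a $$ (j, l))"
      using mult_index_sum[OF aw aT ij] ij car by simp
    also have "\<dots> = (\<Sum>l<n. \<Sum>k<n. a $$ (i, k) * ?w $$ (k, l) * a $$ (j, l))"
      using mult_index_sum[OF car(1) wc ij(1)] by (intro sum.cong refl) (simp add: sum_distrib_right)
    finally show ?thesis by (subst sum.swap)
  qed
  have sk: "skew n (a * ?w * a\<^sup>T)"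
    unfolding skew_def
  proof (intro conjI awa allI impI)
    fix i j assume ij: "i < n" "j < n"
    have "(\<Sum>k<n. \<Sum>l<n. a $$ (i, k) * ?w $$ (k, l) * a $$ (j, l)) =
        (\<Sum>k<n. \<Sum>l<n. - (a $$ (j, l) * ?w $$ (l, k) * a $$ (i, k)))"
    proof (intro sum.cong refl)
      fix k l assume "k \<in> {..<n}" "l \<in> {..<n}"
      then show "a $$ (i, k) * ?w $$ (k, l) * a $$ (j, l) = - (a $$ (j, l) * ?w $$ (l, k) * a $$ (i, k))"
        using skewD(2)[OF wsk, of k l] by simp
    qed
    also have "\<dots> = - (\<Sum>l<n. \<Sum>k<n. a $$ (j, l) * ?w $$ (l, k) * a $$ (i, k))"
      by (subst sum.swap) (simp add: sum_negf)
    finally show "(a * ?w * a\<^sup>T) $$ (i, j) = - (a * ?w * a\<^sup>T) $$ (j, i)"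
      unfolding entry[OF ij] entry[OF ij(2,1)] .
  qed
  show ?thesis
    unfolding cell_def mem_Collect_eq
  proof (intro conjI sk allI impI)
    fix i j assume ij: "i < j" "j < n" "i \<notin> - S"
    then have i: "i < n" "i \<noteq> j" by auto
    define X where "X = mat n n (\<lambda>(k, l). if k = i \<and> l = j then 1 else if k = j \<and> l = i then - 1 else (0::complex))"
    have X: "X \<in> carrier_mat n n" by (simp add: X_def)
    have tX: "t \<cdot>\<^sub>m X \<in> cell n S" for t
      unfolding cell_def skew_def X_def using ij i by auto
    have Xe: "(a\<^sup>T * X * a) $$ (k, l) = a $$ (i, k) * a $$ (j, l) - a $$ (j, k) * a $$ (i, l)"
      if kl: "k < n" "l < n" for k l
    proof -
      have r: "(a\<^sup>T * X) $$ (k, q) = (if q = j then a $$ (i, k) else if q = i then - a $$ (j, k) else 0)" if q: "q < n" for q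
      proof -
        have "(a\<^sup>T * X) $$ (k, q) = (\<Sum>p<n. a $$ (p, k) * X $$ (p, q))"
          using mult_index_sum[OF aT X kl(1) q] kl car by simp
        also have "\<dots> = (\<Sum>p\<in>{i, j}. a $$ (p, k) * X $$ (p, q))"
          using ij i q by (intro sum.mono_neutral_right) (auto simp: X_def)
        also have "\<dots> = a $$ (i, k) * X $$ (i, q) + a $$ (j, k) * X $$ (j, q)" using i by simp
        finally show ?thesis using ij i q by (auto simp: X_def)
      qed
      have "(a\<^sup>T * X * a) $$ (k, l) = (\<Sum>q<n. (a\<^sup>T * X) $$ (k, q) * a $$ (q, l))"
        by (rule mult_index_sum[OF mult_carrier_mat[OF aT X] car(1) kl])
      also have "\<dots> = (\<Sum>q\<in>{i, j}. (a\<^sup>T * X) $$ (k, q) * a $$ (q, l))"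
        using ij i r by (intro sum.mono_neutral_right) auto
      also have "\<dots> = (a\<^sup>T * X) $$ (k, i) * a $$ (i, l) + (a\<^sup>T * X) $$ (k, j) * a $$ (j, l)" using i by simp
      finally show ?thesis using r[OF i(1)] r[OF ij(2)] i by simp
    qed
    have "(\<Sum>k<n. \<Sum>l<n. G k l Y * (a\<^sup>T * X * a) $$ (k, l)) = 0"
      by (rule gradient_annihilates_cell[OF orth_mult[OF borelD(1)[OF b] orth_swap] P Y R car ad X _ g])
        (rule cell_chart_in_orbit[OF b tX])
    then have "(\<Sum>k<n. \<Sum>l<n. G k l Y * (a $$ (i, k) * a $$ (j, l) - a $$ (j, k) * a $$ (i, l))) = 0"
      using Xe by simp
    then have "0 = (\<Sum>k<n. \<Sum>l<n. G k l Y * (a $$ (i, k) * a $$ (j, l))) -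
        (\<Sum>k<n. \<Sum>l<n. G k l Y * (a $$ (j, k) * a $$ (i, l)))"
      by (simp add: right_diff_distrib sum_subtractf)
    also have "(\<Sum>k<n. \<Sum>l<n. G k l Y * (a $$ (j, k) * a $$ (i, l))) =
        (\<Sum>k<n. \<Sum>l<n. G l k Y * (a $$ (j, l) * a $$ (i, k)))" by (rule sum.swap)
    also have "(\<Sum>k<n. \<Sum>l<n. G k l Y * (a $$ (i, k) * a $$ (j, l))) - \<dots> =
        (\<Sum>k<n. \<Sum>l<n. - 2 * (a $$ (i, k) * ?w $$ (k, l) * a $$ (j, l)))"
      unfolding sum_subtractf[symmetric]
      by (intro sum.cong refl) (simp add: skew_gradient_def field_simps)
    also have "\<dots> = - 2 * (a * ?w * a\<^sup>T) $$ (i, j)"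
      unfolding entry[OF i(1) ij(2)] by (simp add: sum_distrib_left)
    finally show "(a * ?w * a\<^sup>T) $$ (i, j) = 0" by simp
  qed
qed

section \<open>Limits of dual Lagrangians\<close>

lemma kernel_line_congruence:
  assumes w: "w \<in> carrier_mat n n" and a: "a \<in> carrier_mat n n" and d: "d \<in> carrier_mat n n"
    and ad: "a\<^sup>T * d = 1\<^sub>m n" and v: "kernel_line n w v"
  shows "kernel_line n (a * w * a\<^sup>T) (d *\<^sub>v v)"
proof -
  have aT: "a\<^sup>T \<in> carrier_mat n n" and dT: "d\<^sup>T \<in> carrier_mat n n" using a d by auto
  note vD = kernel_lineD[OF v]
  have aw: "a * w \<in> carrier_mat n n" by (rule mult_carrier_mat[OF a w])
  have dv: "d *\<^sub>v v \<in> carrier_vec n" by (rule mult_mat_vec_carrier[OF d vD(1)])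
  have atd: "a\<^sup>T *\<^sub>v (d *\<^sub>v x) = x" if "x \<in> carrier_vec n" for x
    unfolding assoc_mult_mat_vec[OF aT d that, symmetric] ad using that by simp
  have dat: "d *\<^sub>v (a\<^sup>T *\<^sub>v x) = x" if "x \<in> carrier_vec n" for x
    unfolding assoc_mult_mat_vec[OF d aT that, symmetric] mat_mult_left_right_inverse[OF aT d ad] using that by simp
  have dta: "d\<^sup>T * a = 1\<^sub>m n" using transpose_mult[OF aT d] ad by (simp add: transpose_one)
  have act: "(a * w * a\<^sup>T) *\<^sub>v x = a *\<^sub>v (w *\<^sub>v (a\<^sup>T *\<^sub>v x))" if x: "x \<in> carrier_vec n" for x
    unfolding assoc_mult_mat_vec[OF aw aT x] by (rule assoc_mult_mat_vec[OF a w mult_mat_vec_carrier[OF aT x]])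
  show ?thesis
    unfolding kernel_line_def
  proof (intro conjI dv ballI impI)
    show "d *\<^sub>v v \<noteq> 0\<^sub>v n" using atd[OF vD(1)] mult_mat_0_vec[OF aT] vD(2) by metis
    show "(a * w * a\<^sup>T) *\<^sub>v (d *\<^sub>v v) = 0\<^sub>v n"
      unfolding act[OF dv] atd[OF vD(1)] vD(3) by (rule mult_mat_0_vec[OF a])
    fix x assume x: "x \<in> carrier_vec n" "(a * w * a\<^sup>T) *\<^sub>v x = 0\<^sub>v n"
    have ax: "a\<^sup>T *\<^sub>v x \<in> carrier_vec n" by (rule mult_mat_vec_carrier[OF aT x(1)])
    have wax: "w *\<^sub>v (a\<^sup>T *\<^sub>v x) \<in> carrier_vec n" by (rule mult_mat_vec_carrier[OF w ax])
    have "w *\<^sub>v (a\<^sup>T *\<^sub>v x) = d\<^sup>T *\<^sub>v (a *\<^sub>v (w *\<^sub>v (a\<^sup>T *\<^sub>v x)))"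
      unfolding assoc_mult_mat_vec[OF dT a wax, symmetric] dta using wax by simp
    also have "\<dots> = 0\<^sub>v n" using x(2) unfolding act[OF x(1)] by (simp only: mult_mat_0_vec[OF dT])
    finally obtain s where s: "a\<^sup>T *\<^sub>v x = s \<cdot>\<^sub>v v" using vD(4)[OF ax] by blast
    have "x = s \<cdot>\<^sub>v (d *\<^sub>v v)" using dat[OF x(1)] unfolding s mult_mat_vec[OF d vD(1)] by simp
    then show "\<exists>s. x = s \<cdot>\<^sub>v (d *\<^sub>v v)" by blast
  qed
qed

lemma dual_lag_smult:
  assumes "v \<in> carrier_vec n" "s \<noteq> 0"
  shows "dual_lag n (s \<cdot>\<^sub>v v) = dual_lag n v"
proof
  show "dual_lag n (s \<cdot>\<^sub>v v) \<subseteq> dual_lag n v"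
    unfolding dual_lag_def using assms by (auto simp: smult_smult_assoc)
  show "dual_lag n v \<subseteq> dual_lag n (s \<cdot>\<^sub>v v)"
  proof
    fix x assume "x \<in> dual_lag n v"
    then obtain y r where y: "y \<in> carrier_vec n" "y \<bullet> v = 0" "x = y @\<^sub>v (r \<cdot>\<^sub>v v)" by (auto simp: dual_lag_def)
    have "x = y @\<^sub>v ((r / s) \<cdot>\<^sub>v (s \<cdot>\<^sub>v v))" using y assms by (simp add: smult_smult_assoc)
    moreover have "y \<bullet> (s \<cdot>\<^sub>v v) = 0" using y assms by simp
    ultimately show "x \<in> dual_lag n (s \<cdot>\<^sub>v v)" unfolding dual_lag_def using y(1) by blast
  qed
qed

lemma dual_lag_kernel_unique:
  assumes "kernel_line n w v" "kernel_line n w v'"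
  shows "dual_lag n v = dual_lag n v'"
proof -
  obtain s where s: "v' = s \<cdot>\<^sub>v v" using kernel_lineD(4)[OF assms(1) kernel_lineD(1,3)[OF assms(2)]] by blast
  have "s \<noteq> 0" using kernel_lineD(2)[OF assms(2)] zero_smult_vec[OF kernel_lineD(1)[OF assms(1)]] s by auto
  then show ?thesis unfolding s using dual_lag_smult[OF kernel_lineD(1)[OF assms(1)]] by simp
qed

lemma col_image_mult:
  assumes "Q \<in> carrier_mat N N" "A \<in> carrier_mat N k"
  shows "col_image k (Q * A) = (\<lambda>x. Q *\<^sub>v x) ` col_image k A"
  unfolding col_image_def image_image using assoc_mult_mat_vec[OF assms] by (intro image_cong) auto

lemma orth_image_dual_lag:
  assumes Q: "orth n Q" and v: "v \<in> carrier_vec n" "v \<noteq> 0\<^sub>v n"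
  obtains P where "orth n P" "det P = - det Q" "(\<lambda>x. Q *\<^sub>v x) ` dual_lag n v = lag n P"
proof -
  obtain T where T: "orth n T" "det T = - 1" "dual_lag n v = lag n T" by (rule dual_lag_eq_lag[OF v])
  have "det (Q * T) = - det Q" using det_mult[OF orthD(1)[OF Q] orthD(1)[OF T(1)]] T(2) by simp
  then show ?thesis
    using that[OF orth_mult[OF Q T(1)]] lag_mult[OF orthD(1)[OF Q] orthD(1)[OF T(1)]] T(3) by simp
qed

lemma det_swap_toggle:
  assumes "m < n"
  shows "det (swap_mat n (toggle S m)) = - det (swap_mat n S)"
proof -
  have "det (swap_mat n {m}) = - 1" using det_swap_mat[of "{m}" n] assms by simp
  then show ?thesis
    unfolding swap_mat_toggle[OF assms] using det_mult[OF swap_mat_carrier[of n S] swap_mat_carrier[of n "{m}"]] by simp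
qed

text \<open>The dual Lagrangian has the coordinate \<open>flip_chart n m v\<close> in a chart centred at a point of the orbit
  of \<open>toggle S m\<close>, and this coordinate belongs to the cell.\<close>

lemma dual_lag_in_orbit:
  assumes b: "b \<in> borel n" and w: "w \<in> cell n (- S)" and v: "kernel_line n w v" and m: "m < n" "v $ m \<noteq> 0"
    and bal: "card ({..<m} - S) = card (S \<inter> {..<m})"
  shows "(\<lambda>x. b * swap_mat n S *\<^sub>v x) ` dual_lag n v \<in> orbit n (toggle S m)"
proof -
  let ?s = "swap_mat n S" and ?X = "flip_chart n m v"
  note bc = orthD(1)[OF borelD(1)[OF b]] and Xc = skewD(1)[OF skew_flip_chart[of n m v]]
  have Qc: "b * ?s \<in> carrier_mat (n + n) (n + n)" by (rule mult_carrier_mat[OF bc swap_mat_carrier])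
  have sX: "swap_mat n {m} * shear n ?X \<in> carrier_mat (n + n) (n + n)"
    by (rule mult_carrier_mat[OF swap_mat_carrier shear_carrier[OF Xc]])
  have "(\<lambda>x. b * ?s *\<^sub>v x) ` dual_lag n v = lag n (b * ?s * (swap_mat n {m} * shear n ?X))"
    unfolding dual_lag_eq_chart[OF kernel_lineD(1)[OF v] m] gr_chart_eq_lag[OF swap_mat_carrier Xc]
    by (rule lag_mult[OF Qc sX, symmetric])
  also have "b * ?s * (swap_mat n {m} * shear n ?X) = b * ?s * swap_mat n {m} * shear n ?X"
    by (rule assoc_mult_mat[OF Qc swap_mat_carrier shear_carrier[OF Xc], symmetric])
  also have "b * ?s * swap_mat n {m} = b * swap_mat n (toggle S m)"
    unfolding swap_mat_toggle[OF m(1)] by (rule assoc_mult_mat[OF bc swap_mat_carrier swap_mat_carrier])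
  also have "lag n (b * swap_mat n (toggle S m) * shear n ?X) = gr_chart n (b * swap_mat n (toggle S m)) ?X"
    by (rule gr_chart_eq_lag[OF mult_carrier_mat[OF bc swap_mat_carrier] Xc, symmetric])
  finally show ?thesis
    using cell_chart_in_orbit[OF b flip_chart_in_cell[OF w v m bal]] by simp
qed

text \<open>For an arbitrary conormal form of corank one at a point of the orbit, the dual Lagrangian lies in
  the closure of the orbit of \<open>toggle S m\<close>: join the form by a line to the form of a perfect matching,
  for which the \<open>m\<close>-th coordinate of the kernel does not vanish.\<close>

lemma dual_lag_in_schubert:
  assumes b: "b \<in> borel n" and odd: "odd n" and w: "w \<in> cell n (- S)" and v: "kernel_line n w v" and m: "m < n"
    and bal: "card ({..<m} - S) = card (S \<inter> {..<m})"
    and w1: "w1 \<in> cell n (- S)" "kernel_line n w1 (unit_vec n m)"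
  shows "(\<lambda>x. b * swap_mat n S *\<^sub>v x) ` dual_lag n v \<in> schubert n (toggle S m)"
proof -
  let ?Q = "b * swap_mat n S"
  have Q: "orth n ?Q" by (rule orth_mult[OF borelD(1)[OF b] orth_swap])
  note Qc = orthD(1)[OF Q] and vD = kernel_lineD[OF v]
  note wc = skewD(1)[OF cellD(1)[OF w]] and w1c = skewD(1)[OF cellD(1)[OF w1(1)]]
  \<comment> \<open>Adding \<open>c c\<^sup>T\<close> has to make both ends of the line invertible.\<close>
  obtain c :: "complex vec" where c: "c \<in> carrier_vec n" "c \<bullet> v \<noteq> 0" "c \<bullet> unit_vec n m \<noteq> 0"
  proof (cases "v $ m = 0")
    case False
    then show ?thesis using that[of "unit_vec n m"] vD(1) m by simp
  next
    case True
    obtain j where j: "j < n" "v $ j \<noteq> 0" using nonzero_entry[OF vD(1,2)] by blast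
    let ?c = "unit_vec n j + unit_vec n m :: complex vec"
    have "j \<noteq> m" using j True by auto
    have "?c \<bullet> x = x $ j + x $ m" if "x \<in> carrier_vec n" for x
      using add_scalar_prod_distrib[OF unit_vec_carrier unit_vec_carrier that] that j m by simp
    then show ?thesis using that[of ?c] vD(1) j True m \<open>j \<noteq> m\<close> by simp
  qed
  define W where "W = (\<lambda>t. (1 + (- 1) * t) \<cdot>\<^sub>m w + t \<cdot>\<^sub>m w1)"
  have Wc: "W t \<in> carrier_mat n n" for t unfolding W_def using wc w1c by simp
  have Wij: "W t $$ (i, j) = (1 - t) * w $$ (i, j) + t * w1 $$ (i, j)" if "i < n" "j < n" for i j t
    unfolding W_def using wc w1c that by simp
  have Wcell: "W t \<in> cell n (- S)" for t
    unfolding cell_def mem_Collect_eq skew_def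
  proof (intro conjI Wc allI impI)
    fix i j assume ij: "i < n" "j < n"
    show "W t $$ (i, j) = - W t $$ (j, i)"
      unfolding Wij[OF ij] Wij[OF ij(2,1)]
      using skewD(2)[OF cellD(1)[OF w] ij] skewD(2)[OF cellD(1)[OF w1(1)] ij] by simp
  next
    fix i j assume ij: "i < j" "j < n" "i \<notin> - S"
    then have "i < n" by simp
    show "W t $$ (i, j) = 0"
      unfolding Wij[OF \<open>i < n\<close> ij(2)] using cellD(2)[OF w ij] cellD(2)[OF w1(1) ij] by simp
  qed
  have W0: "W 0 = w" using Wc[of 0] wc Wij[of _ _ 0] by (intro eq_matI) auto
  have W1: "W 1 = w1" using Wc[of 1] w1c Wij[of _ _ 1] by (intro eq_matI) auto
  note L = function_ring_line
  have lin: "(\<lambda>t. 1 + (- 1) * t) \<in> line_ring"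
    by (rule function_ringD(2)[OF L function_ringD(1)[OF L] function_ringD(3)[OF L function_ringD(1)[OF L] id_in_line_ring]])
  have Wover: "mat_over line_ring n n W"
    unfolding W_def
    by (rule mat_over_add[OF L mat_over_smult[OF L lin mat_over_const[OF L wc]]
          mat_over_smult[OF L id_in_line_ring mat_over_const[OF L w1c]]])
  let ?N = "\<lambda>t. W t + outer n c"
  have Nover: "mat_over line_ring n n ?N" by (rule mat_over_add[OF L Wover mat_over_const[OF L outer_carrier]])
  define u where "u = (\<lambda>t. adj_mat (?N t) *\<^sub>v c)"
  have adjc: "adj_mat (?N t) \<in> carrier_mat n n" for t by (rule adj_mat(1)) (use Wc in simp)
  have um: "(\<lambda>t. u t $ m) \<in> line_ring"
  proof -
    have e: "(\<lambda>t. u t $ m) = (\<lambda>t. \<Sum>j<n. adj_mat (?N t) $$ (m, j) * c $ j)"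
      unfolding u_def using mult_vec_index_sum[OF adjc c(1) m] by blast
    show ?thesis unfolding e
      by (rule function_ring_sum[OF L finite_lessThan], rule function_ringD(3)[OF L _ function_ringD(1)[OF L]])
        (use mat_overD(2)[OF adj_mat_over[OF L Nover] m] in simp)
  qed
  have det0: "det (W t) = 0" for t by (rule skew_odd_det[OF cellD(1)[OF Wcell] odd])
  have ker: "kernel_line n (W t) (u t)" if "det (?N t) \<noteq> 0" for t
    unfolding u_def by (rule kernel_line_adj[OF cellD(1)[OF Wcell] det0 c(1) that])
  define \<delta> where "\<delta> = (\<lambda>t. det (?N t) * u t $ m)"
  have d: "\<delta> \<in> line_ring" unfolding \<delta>_def by (rule function_ringD(3)[OF L det_over[OF L Nover] um])
  have d1: "\<delta> 1 \<noteq> 0"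
  proof -
    have N1: "det (?N 1) \<noteq> 0"
      unfolding W1 by (rule kernel_line_det_add_outer[OF cellD(1)[OF w1(1)] w1(2) c(1,3)])
    note k1 = ker[OF N1]
    obtain s where s: "u 1 = s \<cdot>\<^sub>v unit_vec n m"
      using kernel_lineD(4)[OF w1(2)] kernel_lineD(1,3)[OF k1] unfolding W1 by blast
    have "s \<noteq> 0" using kernel_lineD(2)[OF k1] zero_smult_vec[OF unit_vec_carrier[of n m]] s by auto
    then have "u 1 $ m \<noteq> 0" unfolding s using m by simp
    then show ?thesis unfolding \<delta>_def using N1 by simp
  qed
  have d0: "det (?N 0) \<noteq> 0"
    unfolding W0 by (rule kernel_line_det_add_outer[OF cellD(1)[OF w] v c(1,2)])
  have gc: "gen_mat n c (W t) \<in> carrier_mat (n + n) (n + 1)" for t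
    by (rule mat_overD(1)[OF mat_over_gen_mat[OF L Wover c(1)]])
  have H: "mat_over line_ring (n + n) (n + 1) (\<lambda>t. ?Q * gen_mat n c (W t))"
    by (rule mat_over_mult[OF L mat_over_const[OF L Qc] mat_over_gen_mat[OF L Wover c(1)]])
  have Him: "col_image (n + 1) (?Q * gen_mat n c (W t)) = (\<lambda>x. ?Q *\<^sub>v x) ` dual_lag n (u t)"
    if "det (?N t) \<noteq> 0" for t
    unfolding col_image_mult[OF Qc gc] col_image_gen_mat[OF cellD(1)[OF Wcell] det0 c(1) that] u_def ..
  obtain P where P: "orth n P" "det P = - det ?Q" "(\<lambda>x. ?Q *\<^sub>v x) ` dual_lag n v = lag n P"
    by (rule orth_image_dual_lag[OF Q vD(1,2)])
  have detQ: "det ?Q = det (swap_mat n S)"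
    using det_mult[OF orthD(1)[OF borelD(1)[OF b]] swap_mat_carrier] borelD(2)[OF b] by simp
  have lim: "col_image (n + 1) (?Q * gen_mat n c (W 0)) = gr_chart n P (0\<^sub>m n n)"
    unfolding Him[OF d0] lag_eq_gr_chart[symmetric] P(3)[symmetric]
    using dual_lag_kernel_unique[OF v] ker[OF d0] unfolding W0 by simp
  have orbgr: "orbit n (toggle S m) \<subseteq> grassmannian n (n + n)"
    using orbit_subset_lags lags_subset unfolding iso_gr_def by blast
  show ?thesis
    unfolding P(3) lag_eq_gr_chart schubert_def
  proof (rule closure_chartI[OF _ orth_frames[OF P(1)] zero_carrier_mat])
    show "gr_chart n P (0\<^sub>m n n) \<in> lags n (det (swap_mat n (toggle S m)))"
      unfolding lag_eq_gr_chart[symmetric] lag_in_lags_iff[OF P(1)] P(2) detQ det_swap_toggle[OF m] ..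
    show "orbit n (toggle S m) \<subseteq> lags n (det (swap_mat n (toggle S m)))" by (rule orbit_subset_lags)
    fix f assume f: "f \<in> poly_fun n n" "\<And>Y. Y \<in> chart_preimage n (n + n) P (orbit n (toggle S m)) \<Longrightarrow> f Y = 0"
    show "f (0\<^sub>m n n) = 0"
    proof (rule family_limit'[OF _ L H _ function_ringD(1)[OF L, of 1] _ _ orbgr orth_frames[OF P(1)] lim f])
      \<comment> \<open>A polynomial vanishing off the finitely many zeros of \<open>\<delta>\<close> is zero.\<close>
      fix F assume F: "F \<in> line_ring" "\<And>t. t \<in> {t. \<delta> t \<noteq> 0} \<Longrightarrow> F t = 0"
      obtain p q where pq: "F = poly p" "\<delta> = poly q" using F(1) d unfolding line_ring_def by blast
      have "poly (p * q) t = 0" for t using F(2)[of t] unfolding pq by auto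
      then have "p * q = 0" using poly_all_0_iff_0 by blast
      moreover have "q \<noteq> 0" using d1 unfolding pq by auto
      ultimately show "F 0 = 0" unfolding pq by simp
    next
      fix t assume "t \<in> {t. \<delta> t \<noteq> 0}"
      then have t: "det (?N t) \<noteq> 0" "u t $ m \<noteq> 0" unfolding \<delta>_def by auto
      show "\<exists>L\<in>orbit n (toggle S m). col_image (n + 1) (?Q * gen_mat n c (W t)) \<subseteq> L"
        using dual_lag_in_orbit[OF b Wcell ker[OF t(1)] m t(2) bal] unfolding Him[OF t(1)] by blast
    qed simp_all
  qed simp
qed

section \<open>From arbitrary smooth points to the open cell\<close>

text \<open>A conormal form at any point of the Schubert variety is a value of a polynomial family of forms
  which at the points of the orbit are congruent to elements of \<open>cell n (- S)\<close>.\<close>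

lemma conormal_family:
  assumes P: "orth n P" and w: "skew n w"
    and con: "\<And>M. M \<in> chart_tangent n (n + n) P (schubert n S) \<Longrightarrow> (\<Sum>i<n. \<Sum>j<n. w $$ (j, i) * M $$ (i, j)) = 0"
  obtains G where "\<And>i j. i < n \<Longrightarrow> j < n \<Longrightarrow> G i j \<in> poly_fun n n" "skew_gradient n G (0\<^sub>m n n) = w"
    "\<And>Y. Y \<in> chart_preimage n (n + n) P (orbit n S) \<Longrightarrow> \<exists>b\<in>borel n. \<exists>a c d.
      skew n Y \<and> a \<in> carrier_mat n n \<and> c \<in> carrier_mat n n \<and> d \<in> carrier_mat n n \<and> a\<^sup>T * d = 1\<^sub>m n \<and>
      P * shear n Y = b * swap_mat n S * four_block_mat a c (0\<^sub>m n n) d \<and>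
      orth n (four_block_mat a c (0\<^sub>m n n) d) \<and> a * skew_gradient n G Y * a\<^sup>T \<in> cell n (- S)"
proof -
  obtain g G where g: "g \<in> poly_fun n n" "gradient n g G"
    "\<And>Y. Y \<in> chart_preimage n (n + n) P (schubert n S) \<Longrightarrow> g Y = 0"
    "\<And>i j. i < n \<Longrightarrow> j < n \<Longrightarrow> G i j (0\<^sub>m n n) = w $$ (j, i)"
    using conormal_eq_gradient[OF con] by metis
  have van: "g Y = 0" if "Y \<in> chart_preimage n (n + n) P (orbit n S)" for Y
    using g(3)[of Y] that subsetD[OF orbit_subset_schubert] unfolding chart_preimage_def by blast
  show ?thesis
  proof (rule that[of G])
    show "G i j \<in> poly_fun n n" if "i < n" "j < n" for i j by (rule gradientD(1)[OF g(2) that])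
  next
    show "skew_gradient n G (0\<^sub>m n n) = w"
    proof (rule eq_matI)
      fix i j assume "i < dim_row w" "j < dim_col w"
      then have ij: "i < n" "j < n" using skewD(1)[OF w] by auto
      then show "skew_gradient n G (0\<^sub>m n n) $$ (i, j) = w $$ (i, j)"
        using skewD(2)[OF w ij(2,1)] by (simp add: skew_gradient_def g(4))
    qed (use skewD(1)[OF w] in \<open>auto simp: skew_gradient_def\<close>)
  next
    fix Y assume Y: "Y \<in> chart_preimage n (n + n) P (orbit n S)"
    then have Yc: "Y \<in> carrier_mat n n" and YO: "gr_chart n P Y \<in> orbit n S" by (auto simp: chart_preimage_def)
    obtain b where b: "b \<in> borel n" "gr_chart n P Y = lag n (b * swap_mat n S)" using YO unfolding orbit_def by blast
    have Q: "orth n (b * swap_mat n S)" by (rule orth_mult[OF borelD(1)[OF b(1)] orth_swap])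
    have Ys: "skew n Y"
      by (rule isotropic_chart_skew[OF P Yc]) (use lag_isotropic[OF Q] b(2) in auto)
    have PY: "orth n (P * shear n Y)" by (rule orth_mult[OF P orth_shear[OF Ys]])
    have eq: "lag n (P * shear n Y) = lag n (b * swap_mat n S)"
      using gr_chart_eq_lag[OF orthD(1)[OF P] Yc] b(2) by simp
    obtain a c d where acd: "a \<in> carrier_mat n n" "c \<in> carrier_mat n n" "d \<in> carrier_mat n n" "a\<^sup>T * d = 1\<^sub>m n"
      "P * shear n Y = b * swap_mat n S * four_block_mat a c (0\<^sub>m n n) d" "orth n (four_block_mat a c (0\<^sub>m n n) d)"
      by (rule same_lag_blocks[OF PY Q eq])
    have "a * skew_gradient n G Y * a\<^sup>T \<in> cell n (- S)"
      by (rule skew_gradient_in_cell[OF b(1) P Ys acd(5) acd(1-4) g(2) van])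
    then show "\<exists>b\<in>borel n. \<exists>a c d. skew n Y \<and> a \<in> carrier_mat n n \<and> c \<in> carrier_mat n n \<and> d \<in> carrier_mat n n \<and>
      a\<^sup>T * d = 1\<^sub>m n \<and> P * shear n Y = b * swap_mat n S * four_block_mat a c (0\<^sub>m n n) d \<and>
      orth n (four_block_mat a c (0\<^sub>m n n) d) \<and> a * skew_gradient n G Y * a\<^sup>T \<in> cell n (- S)"
      using b(1) acd Ys by blast
  qed
qed

lemma mat_over_skew_gradient:
  assumes "\<And>i j. i < n \<Longrightarrow> j < n \<Longrightarrow> G i j \<in> poly_fun n n"
  shows "mat_over (poly_fun n n) n n (skew_gradient n G)"
proof (rule mat_overI)
  fix i j assume ij: "i < n" "j < n"
  have "(\<lambda>Y. (1 / 2) * G j i Y + (- 1 / 2) * G i j Y) \<in> poly_fun n n"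
    by (intro poly_fun.add poly_fun.mult poly_fun.const assms ij)
  moreover have "skew_gradient n G Y $$ (i, j) = (1 / 2) * G j i Y + (- 1 / 2) * G i j Y" for Y
    using ij by (simp add: skew_gradient_def diff_divide_distrib)
  ultimately show "(\<lambda>Y. skew_gradient n G Y $$ (i, j)) \<in> poly_fun n n" by simp
qed (simp add: skew_gradient_def)

lemma schubert_base_closure:
  assumes P: "orth n P" and L: "lag n P \<in> schubert n S"
    and F: "F \<in> poly_fun n n" "\<And>Y. Y \<in> chart_preimage n (n + n) P (orbit n S) \<Longrightarrow> F Y = 0"
  shows "F (0\<^sub>m n n) = 0"
  by (rule closure_chartD[OF _ orth_frames[OF P] F(1) zero_carrier_mat L[unfolded lag_eq_gr_chart schubert_def] F(2)])
    simp

text \<open>The first matrix is \<open>a (w + c c\<^sup>T) a\<^sup>T\<close>, so \<open>a\<^sup>T\<close> maps its null vectors to null vectors of the second.\<close>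

lemma det_add_outer_congruence:
  assumes w: "w \<in> carrier_mat n n" and a: "a \<in> carrier_mat n n" and d: "d \<in> carrier_mat n n" and ad: "a\<^sup>T * d = 1\<^sub>m n"
    and c: "c \<in> carrier_vec n" and det: "det (a * w * a\<^sup>T + outer n (a *\<^sub>v c)) = 0"
  shows "det (w + outer n c) = 0"
proof -
  have aT: "a\<^sup>T \<in> carrier_mat n n" and dT: "d\<^sup>T \<in> carrier_mat n n" using a d by auto
  have aw: "a * w \<in> carrier_mat n n" by (rule mult_carrier_mat[OF a w])
  have awa: "a * w * a\<^sup>T \<in> carrier_mat n n" by (rule mult_carrier_mat[OF aw aT])
  have ac: "a *\<^sub>v c \<in> carrier_vec n" by (rule mult_mat_vec_carrier[OF a c])
  have da: "d * a\<^sup>T = 1\<^sub>m n" by (rule mat_mult_left_right_inverse[OF aT d ad])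
  have dta: "d\<^sup>T * a = 1\<^sub>m n" using transpose_mult[OF aT d] ad by (simp add: transpose_one)
  obtain x where x: "x \<in> carrier_vec n" "x \<noteq> 0\<^sub>v n" "(a * w * a\<^sup>T + outer n (a *\<^sub>v c)) *\<^sub>v x = 0\<^sub>v n"
    using det det_0_iff_vec_prod_zero_field[of "a * w * a\<^sup>T + outer n (a *\<^sub>v c)" n] awa by auto
  define y where "y = a\<^sup>T *\<^sub>v x"
  have y: "y \<in> carrier_vec n" unfolding y_def by (rule mult_mat_vec_carrier[OF aT x(1)])
  have wy: "w *\<^sub>v y \<in> carrier_vec n" by (rule mult_mat_vec_carrier[OF w y])
  have "(a *\<^sub>v c) \<bullet> x = x \<bullet> (a *\<^sub>v c)" by (rule comm_scalar_prod[OF ac x(1)])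
  also have "\<dots> = y \<bullet> c" unfolding y_def using transpose_vec_mult_scalar[OF a c x(1)] by simp
  also have "\<dots> = c \<bullet> y" by (rule comm_scalar_prod[OF y c])
  finally have cx: "(a *\<^sub>v c) \<bullet> x = c \<bullet> y" .
  have "a * w * a\<^sup>T *\<^sub>v x = a *\<^sub>v (w *\<^sub>v y)"
    unfolding assoc_mult_mat_vec[OF aw aT x(1)] y_def[symmetric] by (rule assoc_mult_mat_vec[OF a w y])
  then have "0\<^sub>v n = a *\<^sub>v (w *\<^sub>v y) + (c \<bullet> y) \<cdot>\<^sub>v (a *\<^sub>v c)"
    using x(3) add_outer_mult_vec[OF awa ac x(1)] cx by simp
  also have "\<dots> = a *\<^sub>v (w *\<^sub>v y + (c \<bullet> y) \<cdot>\<^sub>v c)"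
    using mult_add_distrib_mat_vec[OF a wy, of "(c \<bullet> y) \<cdot>\<^sub>v c"] mult_mat_vec[OF a c] c by simp
  finally have e: "a *\<^sub>v ((w + outer n c) *\<^sub>v y) = 0\<^sub>v n" using add_outer_mult_vec[OF w c y] by simp
  have Nc: "w + outer n c \<in> carrier_mat n n" using w by simp
  have Ny: "(w + outer n c) *\<^sub>v y \<in> carrier_vec n" by (rule mult_mat_vec_carrier[OF Nc y])
  have "(w + outer n c) *\<^sub>v y = d\<^sup>T *\<^sub>v (a *\<^sub>v ((w + outer n c) *\<^sub>v y))"
    unfolding assoc_mult_mat_vec[OF dT a Ny, symmetric] dta using Ny by simp
  then have "(w + outer n c) *\<^sub>v y = 0\<^sub>v n" unfolding e mult_mat_0_vec[OF dT] .
  moreover have "y \<noteq> 0\<^sub>v n"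
  proof
    assume "y = 0\<^sub>v n"
    then have "d *\<^sub>v y = 0\<^sub>v n" using mult_mat_0_vec[OF d] by simp
    then show False using x unfolding y_def assoc_mult_mat_vec[OF d aT x(1), symmetric] da by simp
  qed
  ultimately show ?thesis using det_0_iff_vec_prod_zero_field[OF Nc] y by blast
qed

text \<open>If all forms in \<open>cell n (- S)\<close> drop rank at least twice, so do the conormal forms at the other
  points, because dropping rank is a closed condition.\<close>

lemma conormal_not_generic:
  assumes P: "orth n P" and L: "lag n P \<in> schubert n S" and w: "skew n w"
    and con: "\<And>M. M \<in> chart_tangent n (n + n) P (schubert n S) \<Longrightarrow> (\<Sum>i<n. \<Sum>j<n. w $$ (j, i) * M $$ (i, j)) = 0"
    and deg: "\<And>w c. w \<in> cell n (- S) \<Longrightarrow> c \<in> carrier_vec n \<Longrightarrow> det (w + outer n c) = 0"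
  shows "\<not> kernel_line n w v"
proof
  assume v: "kernel_line n w v"
  obtain i where i: "i < n" "v $ i \<noteq> 0" using nonzero_entry[OF kernel_lineD(1,2)[OF v]] by blast
  let ?c = "unit_vec n i :: complex vec"
  obtain G where G: "\<And>i j. i < n \<Longrightarrow> j < n \<Longrightarrow> G i j \<in> poly_fun n n" "skew_gradient n G (0\<^sub>m n n) = w"
    "\<And>Y. Y \<in> chart_preimage n (n + n) P (orbit n S) \<Longrightarrow> \<exists>b\<in>borel n. \<exists>a c d.
      skew n Y \<and> a \<in> carrier_mat n n \<and> c \<in> carrier_mat n n \<and> d \<in> carrier_mat n n \<and> a\<^sup>T * d = 1\<^sub>m n \<and>
      P * shear n Y = b * swap_mat n S * four_block_mat a c (0\<^sub>m n n) d \<and>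
      orth n (four_block_mat a c (0\<^sub>m n n) d) \<and> a * skew_gradient n G Y * a\<^sup>T \<in> cell n (- S)"
    using conormal_family[OF P w con] by metis
  note R = function_ring_poly_fun[of n n]
  have FR: "(\<lambda>Y. det (skew_gradient n G Y + outer n ?c)) \<in> poly_fun n n"
    by (rule det_over[OF R mat_over_add[OF R mat_over_skew_gradient[OF G(1)] mat_over_const[OF R outer_carrier]]])
  have "det (skew_gradient n G (0\<^sub>m n n) + outer n ?c) = 0"
  proof (rule schubert_base_closure[OF P L FR])
    fix Y assume "Y \<in> chart_preimage n (n + n) P (orbit n S)"
    then obtain a d where ad: "a \<in> carrier_mat n n" "d \<in> carrier_mat n n" "a\<^sup>T * d = 1\<^sub>m n"
      "a * skew_gradient n G Y * a\<^sup>T \<in> cell n (- S)" using G(3) by blast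
    show "det (skew_gradient n G Y + outer n ?c) = 0"
      by (rule det_add_outer_congruence[OF skewD(1)[OF skew_skew_gradient] ad(1-3) unit_vec_carrier])
        (rule deg[OF ad(4) mult_mat_vec_carrier[OF ad(1) unit_vec_carrier]])
  qed
  moreover have "?c \<bullet> v \<noteq> 0" using i kernel_lineD(1)[OF v] by simp
  ultimately show False using kernel_line_det_add_outer[OF w v unit_vec_carrier] unfolding G(2) by blast
qed

lemma mat_over_shear:
  assumes R: "function_ring R" and X: "mat_over R n n X"
  shows "mat_over R (n + n) (n + n) (\<lambda>x. shear n (X x))"
  unfolding shear_def
  by (rule mat_over_four_block[OF mat_over_const[OF R one_carrier_mat] mat_over_const[OF R zero_carrier_mat]
        X mat_over_const[OF R one_carrier_mat]])

lemma schubert_subset_grassmannian: "schubert n S \<subseteq> grassmannian n (n + n)"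
  using schubert_subset_lags lags_subset unfolding iso_gr_def by blast

text \<open>Likewise the dual Lagrangian of a conormal form of corank one, at any point, is a limit of dual
  Lagrangians at points of the orbit.\<close>

lemma conormal_dual_in_schubert:
  assumes P: "orth n P" and L: "lag n P \<in> schubert n S" and w: "skew n w" and odd: "odd n"
    and con: "\<And>M. M \<in> chart_tangent n (n + n) P (schubert n S) \<Longrightarrow> (\<Sum>i<n. \<Sum>j<n. w $$ (j, i) * M $$ (i, j)) = 0"
    and v: "kernel_line n w v" and m: "m < n" and bal: "card ({..<m} - S) = card (S \<inter> {..<m})"
    and w1: "w1 \<in> cell n (- S)" "kernel_line n w1 (unit_vec n m)"
  shows "(\<lambda>x. P *\<^sub>v x) ` dual_lag n v \<in> schubert n (toggle S m)"
proof -
  note vD = kernel_lineD[OF v] and Pc = orthD(1)[OF P]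
  obtain i where i: "i < n" "v $ i \<noteq> 0" using nonzero_entry[OF vD(1,2)] by blast
  let ?c = "unit_vec n i :: complex vec"
  have cv: "?c \<bullet> v \<noteq> 0" using i vD(1) by simp
  obtain G where G: "\<And>i j. i < n \<Longrightarrow> j < n \<Longrightarrow> G i j \<in> poly_fun n n" "skew_gradient n G (0\<^sub>m n n) = w"
    "\<And>Y. Y \<in> chart_preimage n (n + n) P (orbit n S) \<Longrightarrow> \<exists>b\<in>borel n. \<exists>a c d.
      skew n Y \<and> a \<in> carrier_mat n n \<and> c \<in> carrier_mat n n \<and> d \<in> carrier_mat n n \<and> a\<^sup>T * d = 1\<^sub>m n \<and>
      P * shear n Y = b * swap_mat n S * four_block_mat a c (0\<^sub>m n n) d \<and>
      orth n (four_block_mat a c (0\<^sub>m n n) d) \<and> a * skew_gradient n G Y * a\<^sup>T \<in> cell n (- S)"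
    using conormal_family[OF P w con] by metis
  let ?R = "poly_fun n n" and ?W = "skew_gradient n G"
  note R = function_ring_poly_fun[of n n]
  note Wover = mat_over_skew_gradient[OF G(1)]
  have Wsk: "skew n (?W Y)" for Y by (rule skew_skew_gradient)
  have det0: "det (?W Y) = 0" for Y by (rule skew_odd_det[OF Wsk odd])
  let ?d = "\<lambda>Y. det (?W Y + outer n ?c)"
  have dR: "?d \<in> ?R" by (rule det_over[OF R mat_over_add[OF R Wover mat_over_const[OF R outer_carrier]]])
  have d0: "?d (0\<^sub>m n n) \<noteq> 0" unfolding G(2) by (rule kernel_line_det_add_outer[OF w v unit_vec_carrier cv])
  \<comment> \<open>Cutting \<open>Y\<close> to its format gives the family matrices of the same format at all arguments.\<close>
  define T where "T = (\<lambda>Y. P * shear n (mat n n (\<lambda>ij. Y $$ ij)))"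
  have T: "T Y = P * shear n Y" if "Y \<in> carrier_mat n n" for Y
  proof -
    have "mat n n (\<lambda>ij. Y $$ ij) = Y" using that by (intro eq_matI) auto
    then show ?thesis unfolding T_def by simp
  qed
  have Tover: "mat_over ?R (n + n) (n + n) T"
    unfolding T_def by (rule mat_over_mult[OF R mat_over_const[OF R Pc] mat_over_shear[OF R mat_over_extend]])
  have gover: "mat_over ?R (n + n) (n + 1) (\<lambda>Y. gen_mat n ?c (?W Y))"
    by (rule mat_over_gen_mat[OF R Wover unit_vec_carrier])
  have H: "mat_over ?R (n + n) (n + 1) (\<lambda>Y. T Y * gen_mat n ?c (?W Y))" by (rule mat_over_mult[OF R Tover gover])
  have Him: "col_image (n + 1) (T Y * gen_mat n ?c (?W Y)) = (\<lambda>x. T Y *\<^sub>v x) ` dual_lag n (adj_mat (?W Y + outer n ?c) *\<^sub>v ?c)"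
    if "?d Y \<noteq> 0" for Y
    unfolding col_image_mult[OF mat_overD(1)[OF Tover] mat_overD(1)[OF gover]]
      col_image_gen_mat[OF Wsk det0 unit_vec_carrier that] ..
  obtain P' where P': "orth n P'" "det P' = - det P" "(\<lambda>x. P *\<^sub>v x) ` dual_lag n v = lag n P'"
    by (rule orth_image_dual_lag[OF P vD(1,2)])
  have detP: "det P = det (swap_mat n S)"
    using L schubert_subset_lags[of n S] lag_in_lags_iff[OF P] by blast
  have lim: "col_image (n + 1) (T (0\<^sub>m n n) * gen_mat n ?c (?W (0\<^sub>m n n))) = gr_chart n P' (0\<^sub>m n n)"
  proof -
    have "shear n (0\<^sub>m n n) = 1\<^sub>m (n + n)" unfolding shear_def by simp
    then have T0: "T (0\<^sub>m n n) = P" using T[OF zero_carrier_mat] Pc by simp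
    have "kernel_line n w (adj_mat (w + outer n ?c) *\<^sub>v ?c)"
      using kernel_line_adj[OF w _ unit_vec_carrier, of i] d0 det0[of "0\<^sub>m n n"] unfolding G(2) by blast
    from dual_lag_kernel_unique[OF this v] show ?thesis
      unfolding Him[OF d0] unfolding T0 G(2) lag_eq_gr_chart[symmetric] P'(3)[symmetric] by (simp only:)
  qed
  have step: "\<exists>M\<in>schubert n (toggle S m). col_image (n + 1) (T Y * gen_mat n ?c (?W Y)) \<subseteq> M"
    if Y: "Y \<in> chart_preimage n (n + n) P (orbit n S)" "?d Y \<noteq> 0" for Y
  proof -
    obtain b a c d where b: "b \<in> borel n" and Ys: "skew n Y"
      and acd: "a \<in> carrier_mat n n" "c \<in> carrier_mat n n" "d \<in> carrier_mat n n" "a\<^sup>T * d = 1\<^sub>m n"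
      and PY: "P * shear n Y = b * swap_mat n S * four_block_mat a c (0\<^sub>m n n) d"
      and Ro: "orth n (four_block_mat a c (0\<^sub>m n n) d)" and cell: "a * ?W Y * a\<^sup>T \<in> cell n (- S)"
      using G(3)[OF Y(1)] by blast
    let ?v = "adj_mat (?W Y + outer n ?c) *\<^sub>v ?c"
    have ker: "kernel_line n (?W Y) ?v" by (rule kernel_line_adj[OF Wsk det0 unit_vec_carrier Y(2)])
    have bc: "b * swap_mat n S \<in> carrier_mat (n + n) (n + n)"
      by (rule mult_carrier_mat[OF orthD(1)[OF borelD(1)[OF b]] swap_mat_carrier])
    have "(\<lambda>x. T Y *\<^sub>v x) ` dual_lag n ?v =
        (\<lambda>x. b * swap_mat n S *\<^sub>v x) ` (\<lambda>x. four_block_mat a c (0\<^sub>m n n) d *\<^sub>v x) ` dual_lag n ?v"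
    proof -
      have "dual_lag n ?v \<subseteq> carrier_vec (n + n)"
        using kernel_lineD(1)[OF ker] unfolding dual_lag_def by auto
      then show ?thesis
        unfolding T[OF skewD(1)[OF Ys]] PY image_image
        using assoc_mult_mat_vec[OF bc orthD(1)[OF Ro]] by (intro image_cong) auto
    qed
    also have "\<dots> = (\<lambda>x. b * swap_mat n S *\<^sub>v x) ` dual_lag n (d *\<^sub>v ?v)"
      unfolding dual_lag_change_frame[OF acd Ro kernel_lineD(1,2)[OF ker]] ..
    also have "\<dots> \<in> schubert n (toggle S m)"
      by (rule dual_lag_in_schubert[OF b odd cell kernel_line_congruence[OF skewD(1)[OF Wsk] acd(1,3,4) ker] m bal w1])
    finally show ?thesis unfolding Him[OF Y(2)] by blast
  qed
  show ?thesis
    unfolding P'(3) lag_eq_gr_chart schubert_def[of n "toggle S m"]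
  proof (rule closure_chartI[OF _ orth_frames[OF P'(1)] zero_carrier_mat])
    show "gr_chart n P' (0\<^sub>m n n) \<in> lags n (det (swap_mat n (toggle S m)))"
      unfolding lag_eq_gr_chart[symmetric] lag_in_lags_iff[OF P'(1)] P'(2) detP det_swap_toggle[OF m] ..
    show "orbit n (toggle S m) \<subseteq> lags n (det (swap_mat n (toggle S m)))" by (rule orbit_subset_lags)
    fix f assume f: "f \<in> poly_fun n n" "\<And>Y. Y \<in> chart_preimage n (n + n) P' (orbit n (toggle S m)) \<Longrightarrow> f Y = 0"
    have f': "f X = 0" if X: "X \<in> chart_preimage n (n + n) P' (schubert n (toggle S m))" for X
    proof (rule closure_chartD[OF _ orth_frames[OF P'(1)] f(1)])
      show "X \<in> carrier_mat n n" using X by (simp add: chart_preimage_def)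
      show "gr_chart n P' X \<in> lag_topology n (lags n (det (swap_mat n (toggle S m)))) closure_of orbit n (toggle S m)"
        using X unfolding schubert_def[symmetric] by (simp add: chart_preimage_def)
    qed (use f(2) in auto)
    show "f (0\<^sub>m n n) = 0"
    proof (rule family_limit'[OF _ R H _ dR d0 step schubert_subset_grassmannian orth_frames[OF P'(1)] lim f(1) f'])
      fix F assume "F \<in> ?R" "\<And>Y. Y \<in> chart_preimage n (n + n) P (orbit n S) \<Longrightarrow> F Y = 0"
      then show "F (0\<^sub>m n n) = 0" by (rule schubert_base_closure[OF P L])
    qed simp_all
  qed simp
qed

section \<open>Smoothness and tangent vectors along the open cell\<close>

text \<open>The linear equations \<open>X\<^sub>i\<^sub>j + X\<^sub>j\<^sub>i = 0\<close> for \<open>j \<le> i\<close> and \<open>X\<^sub>i\<^sub>j = 0\<close> for \<open>i < j\<close>, \<open>i \<notin> S\<close> are independent.\<close>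

lemma smooth_at_cell:
  assumes Q: "orth n Q" and A: "chart_preimage n (n + n) Q A = cell n S" and L: "lag n Q \<in> A"
  shows "smooth_point n (n + n) A (lag n Q)"
proof -
  define E where "E = {(i, j). i < n \<and> j < n \<and> (j \<le> i \<or> i \<notin> S)}"
  define f :: "nat \<times> nat \<Rightarrow> complex mat \<Rightarrow> complex" where
    "f = (\<lambda>(i, j) X. if j \<le> i then X $$ (i, j) + X $$ (j, i) else X $$ (i, j))"
  have "E \<subseteq> {..<n} \<times> {..<n}" unfolding E_def by auto
  then have "finite E" using finite_subset by blast
  then obtain h where h: "bij_betw h {0..<card E} E" using ex_bij_betw_nat_finite by blast
  then have hE: "h k \<in> E" if "k < card E" for k using that bij_betwE by fastforce
  have fp: "f e \<in> poly_fun n n" if "e \<in> E" for e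
  proof -
    obtain i j where e: "e = (i, j)" "i < n" "j < n" using \<open>e \<in> E\<close> unfolding E_def by (cases e) auto
    have "(\<lambda>X. X $$ (i, j) + X $$ (j, i)) \<in> poly_fun n n" "(\<lambda>X. X $$ (i, j)) \<in> poly_fun n n"
      by (intro poly_fun.add poly_fun.entry e)+
    then show ?thesis unfolding f_def e by (cases "j \<le> i") auto
  qed
  have cell: "X \<in> cell n S \<longleftrightarrow> X \<in> carrier_mat n n \<and> (\<forall>e\<in>E. f e X = 0)" for X
  proof
    assume X: "X \<in> cell n S"
    have "f (i, j) X = 0" if "(i, j) \<in> E" for i j
    proof -
      have ij: "i < n" "j < n" "j \<le> i \<or> i \<notin> S" using that unfolding E_def by auto
      show ?thesis
      proof (cases "j \<le> i")
        case True
        then show ?thesis using skewD(2)[OF cellD(1)[OF X] ij(1,2)] by (simp add: f_def)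
      next
        case False
        then show ?thesis using cellD(2)[OF X _ ij(2)] ij by (simp add: f_def)
      qed
    qed
    then show "X \<in> carrier_mat n n \<and> (\<forall>e\<in>E. f e X = 0)" using skewD(1)[OF cellD(1)[OF X]] by auto
  next
    assume X: "X \<in> carrier_mat n n \<and> (\<forall>e\<in>E. f e X = 0)"
    have z: "f (i, j) X = 0" if "i < n" "j < n" "j \<le> i \<or> i \<notin> S" for i j using X that unfolding E_def by blast
    show "X \<in> cell n S"
      unfolding cell_def skew_def mem_Collect_eq
    proof (intro conjI allI impI)
      show "X \<in> carrier_mat n n" using X by blast
      fix i j assume ij: "i < n" "j < n"
      have "X $$ (i, j) + X $$ (j, i) = 0"
      proof (cases "j \<le> i")
        case True
        then show ?thesis using z[OF ij] by (simp add: f_def)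
      next
        case False
        then show ?thesis using z[OF ij(2,1)] by (simp add: f_def add.commute)
      qed
      then show "X $$ (i, j) = - X $$ (j, i)" by (simp add: eq_neg_iff_add_eq_0)
    next
      fix i j assume ij: "i < j" "j < n" "i \<notin> S"
      then show "X $$ (i, j) = 0" using z[of i j] by (simp add: f_def)
    qed
  qed
  have ind: "\<exists>M\<in>carrier_mat n n. \<forall>k<card E. has_differential (f (h k)) M (d k)" for d :: "nat \<Rightarrow> complex"
  proof -
    define \<delta> where "\<delta> = (\<lambda>e. d (the_inv_into {0..<card E} h e))"
    have dk: "\<delta> (h k) = d k" if "k < card E" for k
      unfolding \<delta>_def using h that by (simp add: bij_betw_def the_inv_into_f_f)
    \<comment> \<open>The equation of the diagonal entry \<open>i, i\<close> is \<open>2 X\<^sub>i\<^sub>i = 0\<close>, whence the factor \<open>1 / 2\<close>.\<close>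
    define up where "up = (\<lambda>i j. if i \<in> S then 0 else \<delta> (i, j))"
    define M where "M = mat n n (\<lambda>(i, j). if i < j then up i j else if j < i then \<delta> (i, j) - up j i else \<delta> (i, j) / 2)"
    have M: "M \<in> carrier_mat n n" by (simp add: M_def)
    have fM: "f e M = \<delta> e" if "e \<in> E" for e
    proof -
      obtain i j where e: "e = (i, j)" "i < n" "j < n" "j \<le> i \<or> i \<notin> S"
        using \<open>e \<in> E\<close> unfolding E_def by (cases e) auto
      show ?thesis
        unfolding e(1) using e(2-4) by (cases i j rule: linorder_cases) (auto simp: f_def M_def up_def)
    qed
    have lin: "f e (t \<cdot>\<^sub>m M) = t * f e M" if "e \<in> E" for e t
    proof -
      obtain i j where e: "e = (i, j)" "i < n" "j < n" using \<open>e \<in> E\<close> unfolding E_def by (cases e) auto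
      then show ?thesis using M by (simp add: f_def distrib_left)
    qed
    have "has_differential (f (h k)) M (d k)" if k: "k < card E" for k
    proof -
      have "((\<lambda>t. t * d k) has_field_derivative d k) (at 0)" by (auto intro!: derivative_eq_intros)
      then show ?thesis unfolding has_differential_def lin[OF hE[OF k]] fM[OF hE[OF k]] dk[OF k] .
    qed
    then show ?thesis using M by blast
  qed
  have eqs: "cell n S \<inter> carrier_mat n n = {Y \<in> carrier_mat n n. \<forall>k<card E. f (h k) Y = 0}"
  proof -
    have "(\<forall>e\<in>E. f e X = 0) \<longleftrightarrow> (\<forall>k<card E. f (h k) X = 0)" for X
    proof -
      have "E = h ` {0..<card E}" using h by (simp add: bij_betw_def)
      then have "(\<forall>e\<in>E. f e X = 0) \<longleftrightarrow> (\<forall>e\<in>h ` {0..<card E}. f e X = 0)" by simp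
      then show ?thesis by auto
    qed
    then show ?thesis using cell by auto
  qed
  have Qf: "Q \<in> frames_at n (n + n) (lag n Q)"
    unfolding frames_at_def using orth_frames[OF Q] lag_eq_gr_chart[of n Q] by simp
  show ?thesis
    unfolding smooth_point_def add_diff_cancel_left'
    by (intro conjI L bexI[OF _ Qf] exI[of _ "card E"] exI[of _ "\<lambda>k. f (h k)"] exI[of _ "carrier_mat n n"] allI impI)
      (use fp hE openin_zariski_affine_carrier zero_carrier_mat A eqs ind in \<open>simp_all add: A\<close>)
qed

lemma bform_minus_left:
  assumes "u \<in> carrier_vec (n + n)" "v \<in> carrier_vec (n + n)"
  shows "bform n (u - v) x = bform n u x - bform n v x"
  unfolding bform_def sum_subtractf[symmetric]
  using assms by (intro sum.cong refl) (auto simp: algebra_simps)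

text \<open>A linear equation of the cell in the orthogonal chart \<open>Q\<close> is transported to an arbitrary chart
  \<open>P\<close> with the same centre, where it becomes, after clearing denominators, a polynomial equation with
  the corresponding differential.\<close>

lemma tangent_endo_linear_equation:
  assumes Q: "orth n Q" and lin: "\<And>X. X \<in> chart_preimage n (n + n) Q A \<Longrightarrow> (\<Sum>i<n. \<Sum>j<n. w $$ (j, i) * X $$ (i, j)) = 0"
    and P: "P \<in> frames (n + n)" "gr_chart n P (0\<^sub>m n n) = lag n Q" and V: "V \<in> chart_tangent n (n + n) P A"
    and M: "M \<in> carrier_mat (n + n) (n + n)"
    and MV: "\<And>y. y \<in> carrier_vec n \<Longrightarrow> M *\<^sub>v (P *\<^sub>v (y @\<^sub>v 0\<^sub>v n)) - P *\<^sub>v (0\<^sub>v n @\<^sub>v (V *\<^sub>v y)) \<in> lag n Q"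
  shows "(\<Sum>i<n. \<Sum>j<n. w $$ (j, i) * bform n (M *\<^sub>v (Q *\<^sub>v (unit_vec n j @\<^sub>v 0\<^sub>v n))) (Q *\<^sub>v (unit_vec n i @\<^sub>v 0\<^sub>v n))) = 0"
proof -
  have Vc: "V \<in> carrier_mat n n" using V unfolding chart_tangent_def by simp
  have Pc: "P \<in> carrier_mat (n + n) (n + n)" using P by (simp add: frames_def)
  have Qc: "Q \<in> carrier_mat (n + n) (n + n)" by (rule orthD(1)[OF Q])
  obtain Q' where Q': "orth n Q'" "Q * Q' = 1\<^sub>m (n + n)" using orth_inverse[OF Q] by metis
  note Qc' = orthD(1)[OF Q'(1)]
  have QR: "P = Q * (Q' * P)"
    unfolding assoc_mult_mat[OF Qc Qc' Pc, symmetric] Q'(2) using Pc by simp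
  have Rc: "Q' * P \<in> carrier_mat (n + n) (n + n)" by (rule mult_carrier_mat[OF Qc' Pc])
  obtain a b c d where abcd: "a \<in> carrier_mat n n" "b \<in> carrier_mat n n" "c \<in> carrier_mat n n" "d \<in> carrier_mat n n"
    "Q' * P = four_block_mat a b c d" using four_blocks[OF Rc] by metis
  have act: "P *\<^sub>v (y @\<^sub>v z) = Q *\<^sub>v ((a *\<^sub>v y + b *\<^sub>v z) @\<^sub>v (c *\<^sub>v y + d *\<^sub>v z))"
    if "y \<in> carrier_vec n" "z \<in> carrier_vec n" for y z
  proof -
    have "P *\<^sub>v (y @\<^sub>v z) = Q *\<^sub>v (Q' * P *\<^sub>v (y @\<^sub>v z))"
      by (subst QR, rule assoc_mult_mat_vec[OF Qc Rc append_carrier_vec[OF that]])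
    then show ?thesis unfolding abcd(5) four_block_mat_mult_vec[OF abcd(1-4) that] .
  qed
  have mvc: "X *\<^sub>v y \<in> carrier_vec n" if "X \<in> carrier_mat n n" "y \<in> carrier_vec n" for X :: "complex mat" and y
    by (rule mult_mat_vec_carrier[OF that])
  have act0: "P *\<^sub>v (y @\<^sub>v 0\<^sub>v n) = Q *\<^sub>v ((a *\<^sub>v y) @\<^sub>v (c *\<^sub>v y))" if "y \<in> carrier_vec n" for y
    using act[OF that zero_carrier_vec] mult_mat_0_vec[OF abcd(2)] mult_mat_0_vec[OF abcd(4)]
      mvc[OF abcd(1) that] mvc[OF abcd(3) that] by simp
  have lagP: "lag n P = lag n Q" using P(2) unfolding lag_eq_gr_chart[of n P] .
  have c0: "c *\<^sub>v y = 0\<^sub>v n" if y: "y \<in> carrier_vec n" for y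
  proof -
    have "P *\<^sub>v (y @\<^sub>v 0\<^sub>v n) \<in> lag n Q" using y lagP unfolding lag_def by blast
    then obtain y' where y': "y' \<in> carrier_vec n" "P *\<^sub>v (y @\<^sub>v 0\<^sub>v n) = Q *\<^sub>v (y' @\<^sub>v 0\<^sub>v n)" unfolding lag_def by blast
    have "(a *\<^sub>v y) @\<^sub>v (c *\<^sub>v y) = y' @\<^sub>v 0\<^sub>v n"
      by (rule frames_inj[OF orth_frames[OF Q]])
        (use act0[OF y] y' mvc[OF abcd(1) y] mvc[OF abcd(3) y] in auto)
    then show ?thesis using append_vec_eq[OF mvc[OF abcd(1) y] y'(1)] by simp
  qed
  have cz: "c = 0\<^sub>m n n"
    by (rule mat_eqI_vec[OF abcd(3) zero_carrier_mat]) (use c0 zero_mat_mult_vec in auto)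
  have R: "P = Q * four_block_mat a b (0\<^sub>m n n) d" using QR abcd(5) cz by simp
  have "\<exists>y\<in>carrier_vec n. a *\<^sub>v y = x" if x: "x \<in> carrier_vec n" for x
  proof -
    have "Q *\<^sub>v (x @\<^sub>v 0\<^sub>v n) \<in> lag n P" using x lagP unfolding lag_def[of n Q] by blast
    then obtain y where y: "y \<in> carrier_vec n" "Q *\<^sub>v (x @\<^sub>v 0\<^sub>v n) = P *\<^sub>v (y @\<^sub>v 0\<^sub>v n)" unfolding lag_def by blast
    have "x @\<^sub>v 0\<^sub>v n = (a *\<^sub>v y) @\<^sub>v (c *\<^sub>v y)"
      by (rule frames_inj[OF orth_frames[OF Q]])
        (use act0[OF y(1)] y x mvc[OF abcd(1) y(1)] mvc[OF abcd(3) y(1)] in auto)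
    then show ?thesis using append_vec_eq[OF x mvc[OF abcd(1) y(1)]] y(1) by auto
  qed
  then have det_a: "det a \<noteq> 0" by (rule surj_imp_det_nonzero[OF abcd(1)])
  note I = det_nonzero_inverse[OF abcd(1) det_a]
  define ai where "ai = (1 / det a) \<cdot>\<^sub>m adj_mat a"
  have ai: "ai \<in> carrier_mat n n" "a * ai = 1\<^sub>m n" using I by (auto simp: ai_def)
  define U where "U = (\<lambda>Y. a + b * Y)"
  have Uc: "U Y \<in> carrier_mat n n" if "Y \<in> carrier_mat n n" for Y
    unfolding U_def using abcd(1) mult_carrier_mat[OF abcd(2) that] by simp
  define ext :: "complex mat \<Rightarrow> complex mat" where "ext = (\<lambda>Y. mat n n (\<lambda>ij. Y $$ ij))"
  have ext: "ext Y = Y" if "Y \<in> carrier_mat n n" for Y unfolding ext_def using that by (intro eq_matI) auto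
  let ?l = "\<lambda>X. \<Sum>i<n. \<Sum>j<n. w $$ (j, i) * X $$ (i, j)"
  have l_smult: "?l (s \<cdot>\<^sub>m X) = s * ?l X" if "X \<in> carrier_mat n n" for s X
  proof -
    have "?l (s \<cdot>\<^sub>m X) = (\<Sum>i<n. \<Sum>j<n. s * (w $$ (j, i) * X $$ (i, j)))"
      using that by (intro sum.cong refl) simp
    then show ?thesis by (simp add: sum_distrib_left)
  qed
  \<comment> \<open>The point with coordinate \<open>Y\<close> for \<open>P\<close> has the coordinate \<open>d Y (a + b Y)\<inverse>\<close> for \<open>Q\<close>. The factor \<open>det\<close>
    makes \<open>F\<close> vanish at all points of \<open>A\<close>, also at those outside the chart of \<open>Q\<close>.\<close>
  define F where "F = (\<lambda>Y. det (U (ext Y)) * ?l (d * ext Y * adj_mat (U (ext Y))))"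
  have FR: "F \<in> poly_fun n n"
  proof -
    note R = function_ring_poly_fun[of n n]
    have e: "mat_over (poly_fun n n) n n ext" unfolding ext_def by (rule mat_over_extend)
    have u: "mat_over (poly_fun n n) n n (\<lambda>Y. U (ext Y))"
      unfolding U_def
      by (rule mat_over_add[OF R mat_over_const[OF R abcd(1)] mat_over_mult[OF R mat_over_const[OF R abcd(2)] e]])
    have q: "mat_over (poly_fun n n) n n (\<lambda>Y. d * ext Y * adj_mat (U (ext Y)))"
      by (rule mat_over_mult[OF R mat_over_mult[OF R mat_over_const[OF R abcd(4)] e] adj_mat_over[OF R u]])
    have "(\<lambda>Y. ?l (d * ext Y * adj_mat (U (ext Y)))) \<in> poly_fun n n"
      by (rule function_ring_sum[OF R finite_lessThan], rule function_ring_sum[OF R finite_lessThan],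
          rule function_ringD(3)[OF R function_ringD(1)[OF R]], rule mat_overD(2)[OF q]) auto
    then show ?thesis unfolding F_def by (rule function_ringD(3)[OF R det_over[OF R u]])
  qed
  have van: "F Y = 0" if Y: "Y \<in> chart_preimage n (n + n) P A" for Y
  proof (cases "det (U (ext Y)) = 0")
    case False
    have Yc: "Y \<in> carrier_mat n n" "gr_chart n P Y \<in> A" using Y by (auto simp: chart_preimage_def)
    note UI = det_nonzero_inverse[OF Uc[OF Yc(1)]]
    have du: "det (U Y) \<noteq> 0" using False ext[OF Yc(1)] by simp
    have adjc: "adj_mat (U Y) \<in> carrier_mat n n" by (rule adj_mat(1)[OF Uc[OF Yc(1)]])
    have dY: "d * Y \<in> carrier_mat n n" by (rule mult_carrier_mat[OF abcd(4) Yc(1)])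
    have dYadj: "d * Y * adj_mat (U Y) \<in> carrier_mat n n" by (rule mult_carrier_mat[OF dY adjc])
    define X where "X = d * Y * ((1 / det (U Y)) \<cdot>\<^sub>m adj_mat (U Y))"
    have X: "X \<in> carrier_mat n n" unfolding X_def by (rule mult_carrier_mat[OF dY UI(1)[OF du]])
    have "X * U Y = d * Y"
      unfolding X_def assoc_mult_mat[OF dY UI(1)[OF du] Uc[OF Yc(1)]] UI(3)[OF du] by (rule right_mult_one_mat[OF dY])
    then have "gr_chart n P Y = gr_chart n Q X"
      by (intro gr_chart_transition[OF orth_frames[OF Q] P(1) R abcd(1,2,4) Yc(1) X]) (simp add: U_def)
    then have "X \<in> chart_preimage n (n + n) Q A" using X Yc(2) by (simp add: chart_preimage_def)
    then have "?l X = 0" by (rule lin)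
    moreover have "X = (1 / det (U Y)) \<cdot>\<^sub>m (d * Y * adj_mat (U Y))"
      unfolding X_def by (rule mult_smult_distrib[OF dY adjc])
    ultimately have "?l (d * Y * adj_mat (U Y)) = 0" using l_smult[OF dYadj] du by simp
    then show ?thesis unfolding F_def ext[OF Yc(1)] by simp
  qed (simp add: F_def)
  have "has_differential F V 0" using V FR van unfolding chart_tangent_def by simp
  then have der0: "((\<lambda>t. F (t \<cdot>\<^sub>m V)) has_field_derivative 0) (at 0)" unfolding has_differential_def .
  have tV: "t \<cdot>\<^sub>m V \<in> carrier_mat n n" for t using Vc by simp
  \<comment> \<open>\<open>K\<close> is \<open>F (t V) / t\<close>, so \<open>K 0\<close> is the differential of \<open>F\<close> at \<open>V\<close>.\<close>
  define K where "K = (\<lambda>t. det (U (t \<cdot>\<^sub>m V)) * ?l (d * V * adj_mat (U (t \<cdot>\<^sub>m V))))"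
  have KR: "K \<in> line_ring"
  proof -
    note L = function_ring_line
    have u: "mat_over line_ring n n (\<lambda>t. U (t \<cdot>\<^sub>m V))"
      unfolding U_def
      by (rule mat_over_add[OF L mat_over_const[OF L abcd(1)] mat_over_mult[OF L mat_over_const[OF L abcd(2)]
            mat_over_smult[OF L id_in_line_ring mat_over_const[OF L Vc]]]])
    have q: "mat_over line_ring n n (\<lambda>t. d * V * adj_mat (U (t \<cdot>\<^sub>m V)))"
      by (rule mat_over_mult[OF L mat_over_const[OF L mult_carrier_mat[OF abcd(4) Vc]] adj_mat_over[OF L u]])
    have "(\<lambda>t. ?l (d * V * adj_mat (U (t \<cdot>\<^sub>m V)))) \<in> line_ring"
      by (rule function_ring_sum[OF L finite_lessThan], rule function_ring_sum[OF L finite_lessThan],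
          rule function_ringD(3)[OF L function_ringD(1)[OF L]], rule mat_overD(2)[OF q]) auto
    then show ?thesis unfolding K_def by (rule function_ringD(3)[OF L det_over[OF L u]])
  qed
  have dV: "d * V \<in> carrier_mat n n" by (rule mult_carrier_mat[OF abcd(4) Vc])
  have FK: "F (t \<cdot>\<^sub>m V) = t * K t" for t
  proof -
    have adjc: "adj_mat (U (t \<cdot>\<^sub>m V)) \<in> carrier_mat n n" by (rule adj_mat(1)[OF Uc[OF tV]])
    have "d * (t \<cdot>\<^sub>m V) * adj_mat (U (t \<cdot>\<^sub>m V)) = t \<cdot>\<^sub>m (d * V * adj_mat (U (t \<cdot>\<^sub>m V)))"
      unfolding mult_smult_distrib[OF abcd(4) Vc] by (rule mult_smult_assoc_mat[OF dV adjc])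
    then show ?thesis
      unfolding F_def K_def ext[OF tV] using l_smult[OF mult_carrier_mat[OF dV adjc]] by simp
  qed
  have "K 0 = 0"
  proof -
    obtain k where k: "K = poly k" using KR unfolding line_ring_def by blast
    have "((\<lambda>t. t * K t) has_field_derivative 1 * K 0 + poly (pderiv k) 0 * 0) (at 0)"
      unfolding k by (rule DERIV_mult[OF DERIV_ident poly_DERIV])
    then have "((\<lambda>t. F (t \<cdot>\<^sub>m V)) has_field_derivative K 0) (at 0)" unfolding FK by simp
    from DERIV_unique[OF this der0] show ?thesis .
  qed
  have z: "0 \<cdot>\<^sub>m V = 0\<^sub>m n n" using Vc by (intro eq_matI) auto
  have U0: "U (0 \<cdot>\<^sub>m V) = a" unfolding z U_def using abcd(1,2) by simp
  have adja: "adj_mat a \<in> carrier_mat n n" by (rule adj_mat(1)[OF abcd(1)])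
  have dVadj: "d * V * adj_mat a \<in> carrier_mat n n" by (rule mult_carrier_mat[OF dV adja])
  have "?l (d * V * adj_mat a) = 0" using \<open>K 0 = 0\<close> det_a unfolding K_def U0 by simp
  moreover have "d * V * ai = (1 / det a) \<cdot>\<^sub>m (d * V * adj_mat a)"
    unfolding ai_def by (rule mult_smult_distrib[OF dV adja])
  ultimately have l0: "?l (d * V * ai) = 0" using l_smult[OF dVadj] by simp
  have "bform n (M *\<^sub>v (Q *\<^sub>v (unit_vec n j @\<^sub>v 0\<^sub>v n))) (Q *\<^sub>v (unit_vec n i @\<^sub>v 0\<^sub>v n)) = (d * V * ai) $$ (i, j)"
    if ij: "i < n" "j < n" for i j
  proof -
    define y where "y = ai *\<^sub>v unit_vec n j"
    have y: "y \<in> carrier_vec n" unfolding y_def by (rule mvc[OF ai(1) unit_vec_carrier])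
    have ay: "a *\<^sub>v y = unit_vec n j"
      unfolding y_def assoc_mult_mat_vec[OF abcd(1) ai(1) unit_vec_carrier, symmetric] ai(2) by simp
    have Vy: "V *\<^sub>v y \<in> carrier_vec n" by (rule mvc[OF Vc y])
    have Py: "P *\<^sub>v (y @\<^sub>v 0\<^sub>v n) = Q *\<^sub>v (unit_vec n j @\<^sub>v 0\<^sub>v n)" unfolding act0[OF y] ay c0[OF y] ..
    let ?e = "Q *\<^sub>v (unit_vec n i @\<^sub>v 0\<^sub>v n)" and ?x = "M *\<^sub>v (Q *\<^sub>v (unit_vec n j @\<^sub>v 0\<^sub>v n))"
      and ?z = "P *\<^sub>v (0\<^sub>v n @\<^sub>v (V *\<^sub>v y))"
    have e: "?e \<in> lag n Q" unfolding lag_def using unit_vec_carrier by blast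
    have xc: "?x \<in> carrier_vec (n + n)" using M Qc by auto
    have zc: "?z \<in> carrier_vec (n + n)"
      by (rule mult_mat_vec_carrier[OF Pc append_carrier_vec[OF zero_carrier_vec Vy]])
    have "bform n (?x - ?z) ?e = 0" using lag_isotropic[OF Q MV[OF y] e] unfolding Py .
    then have "bform n ?x ?e = bform n ?z ?e" using bform_minus_left[OF xc zc] by simp
    also have "?z = Q *\<^sub>v ((b *\<^sub>v (V *\<^sub>v y)) @\<^sub>v (d *\<^sub>v (V *\<^sub>v y)))"
      unfolding act[OF zero_carrier_vec Vy]
      using mult_mat_0_vec[OF abcd(1)] mult_mat_0_vec[OF abcd(3)] mvc[OF abcd(2) Vy] mvc[OF abcd(4) Vy] by simp
    also have "bform n \<dots> ?e = bform n ((b *\<^sub>v (V *\<^sub>v y)) @\<^sub>v (d *\<^sub>v (V *\<^sub>v y))) (unit_vec n i @\<^sub>v 0\<^sub>v n)"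
      by (rule orthD(2)[OF Q]) (use mvc[OF abcd(2) Vy] mvc[OF abcd(4) Vy] in auto)
    also have "\<dots> = (d *\<^sub>v (V *\<^sub>v y)) $ i"
      using bform_append[OF mvc[OF abcd(2) Vy] mvc[OF abcd(4) Vy] unit_vec_carrier zero_carrier_vec]
        mvc[OF abcd(2) Vy] mvc[OF abcd(4) Vy] ij by simp
    also have "d *\<^sub>v (V *\<^sub>v y) = (d * V * ai) *\<^sub>v unit_vec n j"
      unfolding y_def assoc_mult_mat_vec[OF dV ai(1) unit_vec_carrier]
      by (rule assoc_mult_mat_vec[OF abcd(4) Vc mvc[OF ai(1) unit_vec_carrier], symmetric])
    also have "((d * V * ai) *\<^sub>v unit_vec n j) $ i = (d * V * ai) $$ (i, j)"
      unfolding mult_mat_unit_vec[OF mult_carrier_mat[OF dV ai(1)] ij(2)]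
      by (rule index_col) (use ij carrier_matD[OF mult_carrier_mat[OF dV ai(1)]] in \<open>simp_all only:\<close>)
    finally show ?thesis .
  qed
  then show ?thesis using l0 by simp
qed

section \<open>Identification with the spinor varieties\<close>

lemma ambient_dim: "(n :: nat) = 2 * p + 1 \<Longrightarrow> 4 * p + 2 = n + n"
  by linarith

lemma quad_form_eq: "n = 2 * p + 1 \<Longrightarrow> quad_form p v = (\<Sum>i<n. v $ i * v $ (n + i))"
  unfolding quad_form_def by simp

lemma bform_self:
  assumes n: "n = 2 * p + 1"
  shows "bform n v v = 2 * quad_form p v"
  unfolding bform_def quad_form_eq[OF n] sum_distrib_left by (intro sum.cong) auto

lemma polar_form_eq:
  assumes n: "n = 2 * p + 1" and uv: "u \<in> carrier_vec (n + n)" "v \<in> carrier_vec (n + n)"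
  shows "polar_form p u v = bform n u v"
  unfolding polar_form_def bform_def quad_form_eq[OF n] sum_subtractf[symmetric]
  using uv by (intro sum.cong refl) (auto simp: algebra_simps)

lemma isotropic_gr_eq:
  assumes n: "n = 2 * p + 1"
  shows "isotropic_gr p = iso_gr n"
proof
  show "iso_gr n \<subseteq> isotropic_gr p"
  proof
    fix L assume L: "L \<in> iso_gr n"
    then have "quad_form p v = 0" if "v \<in> L" for v
      using bform_self[OF n, of v] that unfolding iso_gr_def by simp
    then show "L \<in> isotropic_gr p"
      using L unfolding isotropic_gr_def iso_gr_def ambient_dim[OF n] n[symmetric] by blast
  qed
  show "isotropic_gr p \<subseteq> iso_gr n"
  proof
    fix L assume "L \<in> isotropic_gr p"
    then have L: "L \<in> grassmannian n (n + n)" and q: "\<And>v. v \<in> L \<Longrightarrow> quad_form p v = 0"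
      unfolding isotropic_gr_def ambient_dim[OF n] n[symmetric] by blast+
    have sub: "lin_subspace (n + n) L" using L by (simp add: grassmannian_def)
    have "bform n u v = 0" if uv: "u \<in> L" "v \<in> L" for u v
      using polar_form_eq[OF n, of u v] q[OF uv(1)] q[OF uv(2)] q[OF lin_subspaceD(3)[OF sub uv]]
        lin_subspaceD(1)[OF sub] uv unfolding polar_form_def by auto
    then show "L \<in> iso_gr n" unfolding iso_gr_def using L by blast
  qed
qed

lemma lin_span_unit_vecs:
  assumes I: "I \<subseteq> {..<N}"
  shows "lin_span N (unit_vec N ` I) = {v \<in> carrier_vec N. \<forall>i<N. i \<notin> I \<longrightarrow> v $ i = 0}"
proof
  interpret vec_space "TYPE(complex)" N .
  let ?W = "{v \<in> carrier_vec N. \<forall>i<N. i \<notin> I \<longrightarrow> v $ i = (0 :: complex)}"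
  have "lin_subspace N ?W" by (rule lin_subspaceI) auto
  then have W: "submodule class_ring ?W (module_vec TYPE(complex) N)" by (simp only: VectorSpace.subspace_def)
  have "unit_vec N ` I \<subseteq> ?W" using I by auto
  then show "lin_span N (unit_vec N ` I) \<subseteq> ?W" using W by (rule span_is_subset)
  have Uc: "unit_vec N ` I \<subseteq> carrier_vec N" by auto
  have "lin_subspace N (lin_span N (unit_vec N ` I))"
    by (rule span_is_subspace) (use Uc in \<open>simp add: module_vec_simps\<close>)
  note S = lin_subspaceD[OF this]
  show "?W \<subseteq> lin_span N (unit_vec N ` I)"
  proof
    fix v assume v: "v \<in> ?W"
    have "vec N (\<lambda>i. if i < k then v $ i else 0) \<in> lin_span N (unit_vec N ` I)" if "k \<le> N" for k
      using that
    proof (induction k)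
      case 0
      have "vec N (\<lambda>i. if i < 0 then v $ i else 0) = 0\<^sub>v N" by (intro eq_vecI) auto
      then show ?case using S(2) by simp
    next
      case (Suc k)
      have e: "vec N (\<lambda>i. if i < Suc k then v $ i else 0) = vec N (\<lambda>i. if i < k then v $ i else 0) + v $ k \<cdot>\<^sub>v unit_vec N k"
        using Suc.prems by (intro eq_vecI) (auto simp: less_Suc_eq)
      have "v $ k \<cdot>\<^sub>v unit_vec N k \<in> lin_span N (unit_vec N ` I)"
      proof (cases "k \<in> I")
        case True
        then have "unit_vec N k \<in> lin_span N (unit_vec N ` I)"
          using in_own_span[of "unit_vec N ` I"] Uc by (metis image_eqI module_vec_simps(3) subsetD)
        then show ?thesis by (rule S(4))
      next
        case False
        then have "v $ k = 0" using v Suc.prems by simp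
        then have "v $ k \<cdot>\<^sub>v unit_vec N k = 0\<^sub>v N" by (intro eq_vecI) auto
        then show ?thesis using S(2) by simp
      qed
      then show ?case unfolding e using S(3) Suc by simp
    qed
    from this[OF order_refl] have "vec N (\<lambda>i. if i < N then v $ i else 0) \<in> lin_span N (unit_vec N ` I)" .
    moreover have "vec N (\<lambda>i. if i < N then v $ i else 0) = v" using v by (intro eq_vecI) auto
    ultimately show "v \<in> lin_span N (unit_vec N ` I)" by simp
  qed
qed

definition minus_set :: "nat \<Rightarrow> (nat \<Rightarrow> sign) \<Rightarrow> nat set" where
  "minus_set p \<eta> = {i. i < 2 * p + 1 \<and> \<eta> (Suc i) = Minus}"

lemma sign_neq: "s \<noteq> Minus \<longleftrightarrow> s = Plus"
  by (cases s) auto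

lemma coord_subspace_eq:
  assumes n: "n = 2 * p + 1"
  shows "coord_subspace p \<eta> = lag n (swap_mat n (minus_set p \<eta>))"
proof -
  let ?S = "minus_set p \<eta>"
  define I where "I = {k. k < n + n \<and> swap_idx n ?S k < n}"
  have "{basis_vec p (\<eta> i) i | i. i \<in> {1..2 * p + 1}} = unit_vec (n + n) ` I"
  proof
    show "{basis_vec p (\<eta> i) i | i. i \<in> {1..2 * p + 1}} \<subseteq> unit_vec (n + n) ` I"
    proof
      fix x assume "x \<in> {basis_vec p (\<eta> i) i | i. i \<in> {1..2 * p + 1}}"
      then obtain i where i: "x = basis_vec p (\<eta> i) i" "1 \<le> i" "i \<le> n" using n by auto
      then obtain k where k: "i = Suc k" "k < n" by (cases i) auto
      show "x \<in> unit_vec (n + n) ` I"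
      proof (cases "\<eta> i")
        case Plus
        then have "k \<in> I" using k unfolding I_def swap_idx_def minus_set_def by auto
        moreover have "x = unit_vec (n + n) k"
          using Plus k i unfolding basis_vec_def ambient_dim[OF n] by simp
        ultimately show ?thesis by blast
      next
        case Minus
        then have "n + k \<in> I" using k n unfolding I_def swap_idx_def minus_set_def by auto
        moreover have "x = unit_vec (n + n) (n + k)"
          using Minus k i unfolding basis_vec_def ambient_dim[OF n] n[symmetric] by simp
        ultimately show ?thesis by blast
      qed
    qed
    show "unit_vec (n + n) ` I \<subseteq> {basis_vec p (\<eta> i) i | i. i \<in> {1..2 * p + 1}}"
    proof
      fix x assume "x \<in> (unit_vec (n + n) ` I :: complex vec set)"
      then obtain k where k: "x = unit_vec (n + n) k" "k < n + n" "swap_idx n ?S k < n" unfolding I_def by blast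
      show "x \<in> {basis_vec p (\<eta> i) i | i. i \<in> {1..2 * p + 1}}"
      proof (cases "k < n")
        case True
        then have "\<eta> (Suc k) = Plus" using k(3) n sign_neq unfolding swap_idx_def minus_set_def by (auto split: if_splits)
        then have "x = basis_vec p (\<eta> (Suc k)) (Suc k)" unfolding basis_vec_def ambient_dim[OF n] k(1) by simp
        then show ?thesis using True n by auto
      next
        case False
        then obtain l where l: "k = n + l" by (metis le_add_diff_inverse not_less)
        then have "l < n" "\<eta> (Suc l) = Minus" using k(2,3) unfolding swap_idx_def minus_set_def by (auto split: if_splits)
        then have "x = basis_vec p (\<eta> (Suc l)) (Suc l)"
          unfolding basis_vec_def ambient_dim[OF n] n[symmetric] k(1) l by simp
        then show ?thesis using \<open>l < n\<close> n by auto
      qed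
    qed
  qed
  moreover have "I \<subseteq> {..<n + n}" unfolding I_def by auto
  ultimately have c: "coord_subspace p \<eta> = {v \<in> carrier_vec (n + n). \<forall>i<n + n. i \<notin> I \<longrightarrow> v $ i = 0}"
    unfolding coord_subspace_def ambient_dim[OF n] using lin_span_unit_vecs by simp
  show ?thesis
    unfolding c
  proof
    show "lag n (swap_mat n ?S) \<subseteq> {v \<in> carrier_vec (n + n). \<forall>i<n + n. i \<notin> I \<longrightarrow> v $ i = 0}"
    proof
      fix x assume "x \<in> lag n (swap_mat n ?S)"
      then obtain y where y: "y \<in> carrier_vec n" "x = swap_mat n ?S *\<^sub>v (y @\<^sub>v 0\<^sub>v n)" unfolding lag_def by blast
      have yc: "y @\<^sub>v 0\<^sub>v n \<in> carrier_vec (n + n)" using y by simp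
      have "x $ i = 0" if i: "i < n + n" "i \<notin> I" for i
      proof -
        have k: "swap_idx n ?S i < n + n" "\<not> swap_idx n ?S i < n" using swap_idx_lt[OF i(1), of ?S] i unfolding I_def by auto
        then have "swap_idx n ?S i - n < n" by linarith
        then show ?thesis unfolding y(2) swap_mat_vec[OF yc i(1)] using k y(1) by simp
      qed
      then show "x \<in> {v \<in> carrier_vec (n + n). \<forall>i<n + n. i \<notin> I \<longrightarrow> v $ i = 0}"
        using mult_mat_vec_carrier[OF swap_mat_carrier yc] y(2) by blast
    qed
    show "{v \<in> carrier_vec (n + n). \<forall>i<n + n. i \<notin> I \<longrightarrow> v $ i = 0} \<subseteq> lag n (swap_mat n ?S)"
    proof
      fix x assume "x \<in> {v \<in> carrier_vec (n + n). \<forall>i<n + n. i \<notin> I \<longrightarrow> v $ i = (0::complex)}"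
      then have x: "x \<in> carrier_vec (n + n)" "\<And>i. i < n + n \<Longrightarrow> i \<notin> I \<Longrightarrow> x $ i = 0" by auto
      have sx: "swap_mat n ?S *\<^sub>v x \<in> carrier_vec (n + n)" by (rule mult_mat_vec_carrier[OF swap_mat_carrier x(1)])
      obtain y z where yz: "y \<in> carrier_vec n" "z \<in> carrier_vec n" "swap_mat n ?S *\<^sub>v x = y @\<^sub>v z"
        using split_vec[OF sx] by metis
      have "z $ i = 0" if i: "i < n" for i
      proof -
        have k: "n + i < n + n" using i by simp
        have "z $ i = (swap_mat n ?S *\<^sub>v x) $ (n + i)" unfolding yz(3) using yz i by simp
        also have "\<dots> = x $ swap_idx n ?S (n + i)" by (rule swap_mat_vec[OF x(1) k])
        also have "\<dots> = 0" by (rule x(2)) (use swap_idx_idem[OF k, of ?S] k in \<open>simp_all add: I_def\<close>)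
        finally show ?thesis .
      qed
      then have "z = 0\<^sub>v n" using yz by (intro eq_vecI) auto
      then have "x = swap_mat n ?S *\<^sub>v (y @\<^sub>v 0\<^sub>v n)" using swap_mat_swap_mat_vec[OF x(1), of ?S] yz by simp
      then show "x \<in> lag n (swap_mat n ?S)" unfolding lag_def using yz(1) by blast
    qed
  qed
qed

lemma flag_eq:
  assumes n: "n = 2 * p + 1" and l: "l \<le> n"
  shows "flag p l = flag_sub n l"
proof -
  have "{basis_vec p Plus j | j. j \<in> {1..l}} = unit_vec (n + n) ` {..<l}"
  proof
    show "{basis_vec p Plus j | j. j \<in> {1..l}} \<subseteq> unit_vec (n + n) ` {..<l}"
    proof
      fix x assume "x \<in> {basis_vec p Plus j | j. j \<in> {1..l}}"
      then obtain j where j: "x = basis_vec p Plus j" "1 \<le> j" "j \<le> l" by auto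
      then have "x = unit_vec (n + n) (j - 1)" "j - 1 < l" unfolding basis_vec_def ambient_dim[OF n] by auto
      then show "x \<in> unit_vec (n + n) ` {..<l}" by blast
    qed
    show "unit_vec (n + n) ` {..<l} \<subseteq> {basis_vec p Plus j | j. j \<in> {1..l}}"
    proof
      fix x assume "x \<in> (unit_vec (n + n) ` {..<l} :: complex vec set)"
      then obtain k where k: "x = unit_vec (n + n) k" "k < l" by blast
      then have "x = basis_vec p Plus (Suc k)" "Suc k \<in> {1..l}" unfolding basis_vec_def ambient_dim[OF n] by auto
      then show "x \<in> {basis_vec p Plus j | j. j \<in> {1..l}}" by blast
    qed
  qed
  moreover have "{..<l} \<subseteq> {..<n + n}" using l by auto
  ultimately show ?thesis
    unfolding flag_def ambient_dim[OF n] flag_sub_def using lin_span_unit_vecs[of "{..<l}" "n + n"] by (simp add: not_less)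
qed

lemma special_orthogonal_eq:
  assumes n: "n = 2 * p + 1"
  shows "special_orthogonal p = {g. orth n g \<and> det g = 1}"
proof
  show "special_orthogonal p \<subseteq> {g. orth n g \<and> det g = 1}"
  proof
    fix g assume "g \<in> special_orthogonal p"
    then have g: "g \<in> carrier_mat (n + n) (n + n)" "det g = 1"
      "\<And>v. v \<in> carrier_vec (n + n) \<Longrightarrow> quad_form p (g *\<^sub>v v) = quad_form p v"
      unfolding special_orthogonal_def ambient_dim[OF n] by blast+
    have "bform n (g *\<^sub>v u) (g *\<^sub>v v) = bform n u v"
      if uv: "u \<in> carrier_vec (n + n)" "v \<in> carrier_vec (n + n)" for u v
    proof -
      have c: "g *\<^sub>v u \<in> carrier_vec (n + n)" "g *\<^sub>v v \<in> carrier_vec (n + n)"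
        using mult_mat_vec_carrier[OF g(1)] uv by auto
      have "g *\<^sub>v u + g *\<^sub>v v = g *\<^sub>v (u + v)" using mult_add_distrib_mat_vec[OF g(1) uv] by simp
      then show ?thesis
        using polar_form_eq[OF n c] polar_form_eq[OF n uv] g(3)[OF uv(1)] g(3)[OF uv(2)] g(3)[of "u + v"] uv
        unfolding polar_form_def by simp
    qed
    then show "g \<in> {g. orth n g \<and> det g = 1}" unfolding orth_def using g by blast
  qed
  show "{g. orth n g \<and> det g = 1} \<subseteq> special_orthogonal p"
  proof
    fix g assume "g \<in> {g. orth n g \<and> det g = 1}"
    then have g: "orth n g" "det g = 1" by auto
    have "quad_form p (g *\<^sub>v v) = quad_form p v" if "v \<in> carrier_vec (n + n)" for v
      using orthD(2)[OF g(1) that that] bform_self[OF n, of v] bform_self[OF n, of "g *\<^sub>v v"] by simp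
    then show "g \<in> special_orthogonal p"
      unfolding special_orthogonal_def ambient_dim[OF n] using g orthD(1)[OF g(1)] by blast
  qed
qed

lemma borel_group_eq:
  assumes n: "n = 2 * p + 1"
  shows "borel_group p = borel n"
  unfolding borel_group_def borel_def special_orthogonal_eq[OF n] n[symmetric] using flag_eq[OF n] by auto

lemma borel_orbit_eq:
  assumes n: "n = 2 * p + 1"
  shows "borel_orbit p (coord_subspace p \<eta>) = orbit n (minus_set p \<eta>)"
proof -
  have e: "(\<lambda>v. g *\<^sub>v v) ` lag n (swap_mat n S) = lag n (g * swap_mat n S)" if "g \<in> borel n" for g S
    by (rule lag_mult[OF orthD(1)[OF borelD(1)[OF that]] swap_mat_carrier, symmetric])
  show ?thesis
    unfolding borel_orbit_def borel_group_eq[OF n] coord_subspace_eq[OF n] orbit_def using e by metis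
qed

lemma zariski_iso_eq:
  assumes n: "n = 2 * p + 1"
  shows "zariski_iso p = lag_topology n (iso_gr n)"
  unfolding zariski_iso_def isotropic_gr_eq[OF n] ambient_dim[OF n] n[symmetric] ..

definition sign_det :: "sign \<Rightarrow> complex" where
  "sign_det s = (case s of Plus \<Rightarrow> 1 | Minus \<Rightarrow> - 1)"

lemma odd_sign_iff:
  assumes n: "n = 2 * p + 1"
  shows "odd_sign p s \<eta> \<longleftrightarrow> det (swap_mat n (minus_set p \<eta>)) = sign_det s"
proof -
  let ?S = "minus_set p \<eta>"
  have S: "?S \<subseteq> {..<n}" "finite ?S" unfolding minus_set_def using n by auto
  have mi: "{j \<in> {1..2 * p + 1}. \<eta> j = Minus} = Suc ` ?S"
  proof
    show "{j \<in> {1..2 * p + 1}. \<eta> j = Minus} \<subseteq> Suc ` ?S"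
    proof
      fix j assume j: "j \<in> {j \<in> {1..2 * p + 1}. \<eta> j = Minus}"
      then obtain k where "j = Suc k" by (cases j) auto
      then show "j \<in> Suc ` ?S" using j unfolding minus_set_def by auto
    qed
  qed (auto simp: minus_set_def)
  have "card {j \<in> {1..2 * p + 1}. \<eta> j = Minus} = card ?S" unfolding mi by (rule card_image) simp
  moreover have "card {j \<in> {1..2 * p + 1}. \<eta> j = Plus} + card {j \<in> {1..2 * p + 1}. \<eta> j = Minus} = 2 * p + 1"
  proof -
    have "{j \<in> {1..m}. \<eta> j = Plus} \<union> {j \<in> {1..m}. \<eta> j = Minus} = {1..m}" for m
      using sign_neq by blast
    moreover have "card ({j \<in> {1..m}. \<eta> j = Plus} \<union> {j \<in> {1..m}. \<eta> j = Minus}) =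
        card {j \<in> {1..m}. \<eta> j = Plus} + card {j \<in> {1..m}. \<eta> j = Minus}" for m
      by (rule card_Un_disjoint) auto
    ultimately show ?thesis by (metis card_atLeastAtMost diff_Suc_1 Suc_eq_plus1)
  qed
  ultimately have c: "card {j \<in> {1..2 * p + 1}. \<eta> j = Plus} + card ?S = 2 * p + 1"
    "card {j \<in> {1..2 * p + 1}. \<eta> j = Minus} = card ?S" by auto
  have det: "det (swap_mat n ?S) = (if even (card ?S) then 1 else - 1)"
    using det_swap_mat[OF S(2,1)] by (simp add: minus_one_power_iff)
  show ?thesis
  proof (cases s)
    case Plus
    have "odd (card {j \<in> {1..2 * p + 1}. \<eta> j = Plus}) \<longleftrightarrow> even (card ?S)"
      using arg_cong[OF c(1), of even] unfolding even_add by simp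
    then show ?thesis unfolding odd_sign_def Plus sign_det_def det by simp
  next
    case Minus
    then show ?thesis unfolding odd_sign_def Minus sign_det_def det c(2) by simp
  qed
qed

text \<open>Every Lagrangian is connected to the centre of a coordinate chart, and the determinants of the frames
  are constant on connected components.\<close>

lemma spinor_variety_eq:
  assumes n: "n = 2 * p + 1"
  shows "spinor_variety p s = lags n (sign_det s)"
proof
  have s: "sign_det s = 1 \<or> sign_det s = - 1" by (cases s) (auto simp: sign_det_def)
  show "spinor_variety p s \<subseteq> lags n (sign_det s)"
  proof
    fix L assume "L \<in> spinor_variety p s"
    then obtain \<eta> where eta: "odd_sign p s \<eta>"
      "connected_component_of (lag_topology n (iso_gr n)) (lag n (swap_mat n (minus_set p \<eta>))) L"
      unfolding spinor_variety_def zariski_iso_eq[OF n] coord_subspace_eq[OF n] by blast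
    show "L \<in> lags n (sign_det s)"
      by (rule connected_component_same_lags[OF eta(2) _ s])
        (use eta(1) in \<open>simp add: lag_in_lags_iff[OF orth_swap] odd_sign_iff[OF n]\<close>)
  qed
  show "lags n (sign_det s) \<subseteq> spinor_variety p s"
  proof
    fix L assume L: "L \<in> lags n (sign_det s)"
    then have "L \<in> iso_gr n" using lags_subset by blast
    then obtain S X where S: "S \<subseteq> {..<n}" "skew n X" "L = gr_chart n (swap_mat n S) X" by (rule iso_gr_chart)
    define \<eta> where "\<eta> = (\<lambda>i. if i - 1 \<in> S then Minus else Plus)"
    have e: "minus_set p \<eta> = S" unfolding minus_set_def \<eta>_def using S(1) n by auto
    have "connected_component_of (lag_topology n (iso_gr n)) (lag n (swap_mat n S)) L"
      unfolding S(3) by (rule connected_chart_line[OF orth_swap S(2)])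
    moreover have "lag n (swap_mat n S) \<in> lags n (sign_det s)"
    proof -
      have "L \<in> lags n (det (swap_mat n S))" unfolding S(3) by (rule skew_chart_in_lags[OF orth_swap S(2)])
      then obtain P Q where "orth n P" "det P = sign_det s" "L = lag n P" "orth n Q" "det Q = det (swap_mat n S)" "L = lag n Q"
        using L unfolding lags_def by blast
      then have "det (swap_mat n S) = sign_det s" using lag_in_lags_iff by metis
      then show ?thesis using lag_in_lags_iff[OF orth_swap] by blast
    qed
    then have "odd_sign p s \<eta>" unfolding odd_sign_iff[OF n] e lag_in_lags_iff[OF orth_swap] .
    ultimately show "L \<in> spinor_variety p s"
      unfolding spinor_variety_def zariski_iso_eq[OF n] coord_subspace_eq[OF n] using e by blast
  qed
qed

lemma zariski_spinor_eq:
  assumes n: "n = 2 * p + 1"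
  shows "zariski_spinor p s = lag_topology n (lags n (sign_det s))"
proof -
  have "iso_gr n \<inter> lags n (sign_det s) = lags n (sign_det s)" using lags_subset by blast
  then show ?thesis
    unfolding zariski_spinor_def zariski_iso_eq[OF n] spinor_variety_eq[OF n] subtopology_subtopology by simp
qed

lemma schubert_C_eq:
  assumes n: "n = 2 * p + 1" and "odd_sign p Plus \<eta>"
  shows "schubert_C p \<eta> = schubert n (minus_set p \<eta>)"
  unfolding schubert_C_def schubert_def zariski_spinor_eq[OF n] borel_orbit_eq[OF n]
  using assms(2) unfolding odd_sign_iff[OF n] by simp

lemma schubert_D_eq:
  assumes n: "n = 2 * p + 1" and "odd_sign p Minus \<eta>"
  shows "schubert_D p \<eta> = schubert n (minus_set p \<eta>)"
  unfolding schubert_D_def schubert_def zariski_spinor_eq[OF n] borel_orbit_eq[OF n]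
  using assms(2) unfolding odd_sign_iff[OF n] by simp

section \<open>Cotangent vectors as skew matrices\<close>

text \<open>This is \<open>P\<^sub>1 w P\<^sub>1\<^sup>T\<close> for the matrix \<open>P\<^sub>1\<close> of the first \<open>n\<close> columns of \<open>P\<close>, which are a basis of
  \<open>lag n P\<close>.\<close>

definition form_mat :: "nat \<Rightarrow> complex mat \<Rightarrow> complex mat \<Rightarrow> complex mat" where
  "form_mat n P w = mat (n + n) (n + n) (\<lambda>(i, j). \<Sum>k<n. \<Sum>l<n. P $$ (i, k) * w $$ (k, l) * P $$ (j, l))"

lemma form_mat_carrier [simp]: "form_mat n P w \<in> carrier_mat (n + n) (n + n)"
  by (simp add: form_mat_def)

lemma base_vec_index:
  assumes P: "P \<in> carrier_mat (n + n) (n + n)" and y: "y \<in> carrier_vec n" and i: "i < n + n"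
  shows "(P *\<^sub>v (y @\<^sub>v 0\<^sub>v n)) $ i = (\<Sum>k<n. P $$ (i, k) * y $ k)"
proof -
  have "(P *\<^sub>v (y @\<^sub>v 0\<^sub>v n)) $ i = (\<Sum>k<n + n. P $$ (i, k) * (y @\<^sub>v 0\<^sub>v n) $ k)"
    by (rule mult_vec_index_sum[OF P append_carrier_vec[OF y zero_carrier_vec] i])
  also have "\<dots> = (\<Sum>k<n. P $$ (i, k) * (y @\<^sub>v 0\<^sub>v n) $ k)"
    using y by (intro sum.mono_neutral_right) auto
  finally show ?thesis using y by simp
qed

lemma form_mat_mult_vec:
  assumes P: "P \<in> carrier_mat (n + n) (n + n)" and w: "w \<in> carrier_mat n n" and x: "x \<in> carrier_vec (n + n)"
  shows "form_mat n P w *\<^sub>v x = P *\<^sub>v ((w *\<^sub>v vec n (\<lambda>l. (P\<^sup>T *\<^sub>v x) $ l)) @\<^sub>v 0\<^sub>v n)"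
proof (rule eq_vecI)
  let ?t = "vec n (\<lambda>l. (P\<^sup>T *\<^sub>v x) $ l)"
  have PT: "P\<^sup>T \<in> carrier_mat (n + n) (n + n)" using P by simp
  have wt: "w *\<^sub>v ?t \<in> carrier_vec n" by (rule mult_mat_vec_carrier[OF w vec_carrier])
  show "dim_vec (form_mat n P w *\<^sub>v x) = dim_vec (P *\<^sub>v ((w *\<^sub>v ?t) @\<^sub>v 0\<^sub>v n))"
    using P by (simp add: form_mat_def)
  fix i assume "i < dim_vec (P *\<^sub>v ((w *\<^sub>v ?t) @\<^sub>v 0\<^sub>v n))"
  then have i: "i < n + n" using P by simp
  have t: "?t $ l = (\<Sum>j<n + n. P $$ (j, l) * x $ j)" if "l < n" for l
    using mult_vec_index_sum[OF PT x, of l] that P by simp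
  have "(form_mat n P w *\<^sub>v x) $ i = (\<Sum>j<n + n. (\<Sum>k<n. \<Sum>l<n. P $$ (i, k) * w $$ (k, l) * P $$ (j, l)) * x $ j)"
    using mult_vec_index_sum[OF form_mat_carrier x i, of P w] i by (simp add: form_mat_def)
  also have "\<dots> = (\<Sum>j<n + n. \<Sum>k<n. \<Sum>l<n. P $$ (i, k) * (w $$ (k, l) * (P $$ (j, l) * x $ j)))"
    by (simp add: sum_distrib_right mult.assoc)
  also have "\<dots> = (\<Sum>k<n. \<Sum>j<n + n. \<Sum>l<n. P $$ (i, k) * (w $$ (k, l) * (P $$ (j, l) * x $ j)))"
    by (rule sum.swap)
  also have "\<dots> = (\<Sum>k<n. \<Sum>l<n. \<Sum>j<n + n. P $$ (i, k) * (w $$ (k, l) * (P $$ (j, l) * x $ j)))"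
    by (rule sum.cong[OF refl], rule sum.swap)
  also have "\<dots> = (\<Sum>k<n. P $$ (i, k) * (\<Sum>l<n. w $$ (k, l) * ?t $ l))"
  proof (rule sum.cong[OF refl])
    fix k
    have "(\<Sum>l<n. w $$ (k, l) * ?t $ l) = (\<Sum>l<n. w $$ (k, l) * (\<Sum>j<n + n. P $$ (j, l) * x $ j))"
      using t by (intro sum.cong) auto
    then show "(\<Sum>l<n. \<Sum>j<n + n. P $$ (i, k) * (w $$ (k, l) * (P $$ (j, l) * x $ j))) =
        P $$ (i, k) * (\<Sum>l<n. w $$ (k, l) * ?t $ l)"
      by (simp add: sum_distrib_left)
  qed
  also have "\<dots> = (\<Sum>k<n. P $$ (i, k) * (w *\<^sub>v ?t) $ k)"
    using mult_vec_index_sum[OF w vec_carrier, of _ "\<lambda>l. (P\<^sup>T *\<^sub>v x) $ l"] by (intro sum.cong) auto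
  finally show "(form_mat n P w *\<^sub>v x) $ i = (P *\<^sub>v ((w *\<^sub>v ?t) @\<^sub>v 0\<^sub>v n)) $ i"
    unfolding base_vec_index[OF P wt i] .
qed

lemma form_mat_image:
  assumes P: "orth n P" and w: "w \<in> carrier_mat n n"
  shows "col_image (n + n) (form_mat n P w) = {P *\<^sub>v ((w *\<^sub>v x) @\<^sub>v 0\<^sub>v n) | x. x \<in> carrier_vec n}"
proof
  note Pc = orthD(1)[OF P]
  show "col_image (n + n) (form_mat n P w) \<subseteq> {P *\<^sub>v ((w *\<^sub>v x) @\<^sub>v 0\<^sub>v n) | x. x \<in> carrier_vec n}"
    unfolding col_image_def using form_mat_mult_vec[OF Pc w] vec_carrier by blast
  obtain Q where Q: "orth n Q" "Q * P = 1\<^sub>m (n + n)" using orth_inverse[OF P] by metis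
  have QT: "Q\<^sup>T \<in> carrier_mat (n + n) (n + n)" and PT: "P\<^sup>T \<in> carrier_mat (n + n) (n + n)"
    using orthD(1)[OF Q(1)] Pc by auto
  have PQ: "P\<^sup>T * Q\<^sup>T = 1\<^sub>m (n + n)"
    using transpose_mult[OF orthD(1)[OF Q(1)] Pc] Q(2) by (simp add: transpose_one)
  show "{P *\<^sub>v ((w *\<^sub>v x) @\<^sub>v 0\<^sub>v n) | x. x \<in> carrier_vec n} \<subseteq> col_image (n + n) (form_mat n P w)"
  proof
    fix u assume "u \<in> {P *\<^sub>v ((w *\<^sub>v x) @\<^sub>v 0\<^sub>v n) | x. x \<in> carrier_vec n}"
    then obtain x where x: "x \<in> carrier_vec n" "u = P *\<^sub>v ((w *\<^sub>v x) @\<^sub>v 0\<^sub>v n)" by blast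
    have x0: "x @\<^sub>v 0\<^sub>v n \<in> carrier_vec (n + n)" using x by simp
    define z where "z = Q\<^sup>T *\<^sub>v (x @\<^sub>v 0\<^sub>v n)"
    have z: "z \<in> carrier_vec (n + n)" unfolding z_def by (rule mult_mat_vec_carrier[OF QT x0])
    have "P\<^sup>T *\<^sub>v z = x @\<^sub>v 0\<^sub>v n"
      unfolding z_def assoc_mult_mat_vec[OF PT QT x0, symmetric] PQ using x0 by simp
    then have "vec n (\<lambda>l. (P\<^sup>T *\<^sub>v z) $ l) = x" using x(1) by (intro eq_vecI) auto
    then have "form_mat n P w *\<^sub>v z = u" unfolding form_mat_mult_vec[OF Pc w z] x(2) by simp
    then show "u \<in> col_image (n + n) (form_mat n P w)" unfolding col_image_def using z by blast
  qed
qed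

lemma module_mat_submoduleI:
  assumes "W \<subseteq> carrier_mat N N" "0\<^sub>m N N \<in> W" "\<And>A B. A \<in> W \<Longrightarrow> B \<in> W \<Longrightarrow> A + B \<in> W"
    "\<And>c A. A \<in> W \<Longrightarrow> c \<cdot>\<^sub>m A \<in> W"
  shows "submodule class_ring W (module_mat TYPE(complex) N N)"
proof -
  have "vectorspace class_ring (module_mat TYPE(complex) N N)" by (rule matrix_vs)
  then have "Module.module class_ring (module_mat TYPE(complex) N N)" by (simp only: vectorspace_def)
  then show ?thesis using assms by (auto simp: submodule_def module_mat_simps)
qed

lemma wedge_carrier [simp]: "wedge N u v \<in> carrier_mat N N"
  by (simp add: wedge_def)

lemma wedge2_subset:
  assumes "submodule class_ring W (module_mat TYPE(complex) N N)" "\<And>u v. u \<in> L \<Longrightarrow> v \<in> L \<Longrightarrow> wedge N u v \<in> W"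
  shows "wedge2 N L \<subseteq> W"
proof -
  interpret V: vectorspace class_ring "module_mat TYPE(complex) N N" by (rule matrix_vs)
  show ?thesis unfolding wedge2_def by (rule V.span_is_subset[OF _ assms(1)]) (use assms(2) in blast)
qed

lemma wedge2_closed:
  "0\<^sub>m N N \<in> wedge2 N L" "A \<in> wedge2 N L \<Longrightarrow> B \<in> wedge2 N L \<Longrightarrow> A + B \<in> wedge2 N L"
  "A \<in> wedge2 N L \<Longrightarrow> c \<cdot>\<^sub>m A \<in> wedge2 N L" "u \<in> L \<Longrightarrow> v \<in> L \<Longrightarrow> wedge N u v \<in> wedge2 N L"
proof -
  interpret V: vectorspace class_ring "module_mat TYPE(complex) N N" by (rule matrix_vs)
  let ?G = "{wedge N u w | u w. u \<in> L \<and> w \<in> L}"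
  have G: "?G \<subseteq> carrier (module_mat TYPE(complex) N N)" by (auto simp: module_mat_simps)
  have s: "submodule class_ring (wedge2 N L) (module_mat TYPE(complex) N N)"
    unfolding wedge2_def by (rule V.span_is_submodule[OF G])
  then show "0\<^sub>m N N \<in> wedge2 N L" "A \<in> wedge2 N L \<Longrightarrow> B \<in> wedge2 N L \<Longrightarrow> A + B \<in> wedge2 N L"
    "A \<in> wedge2 N L \<Longrightarrow> c \<cdot>\<^sub>m A \<in> wedge2 N L"
    unfolding submodule_def by (auto simp: module_mat_simps)
  show "wedge N u v \<in> wedge2 N L" if "u \<in> L" "v \<in> L"
    unfolding wedge2_def using V.in_own_span[OF G] that by blast
qed

lemma wedge2_lag:
  assumes P: "orth n P" and om: "\<omega> \<in> wedge2 (n + n) (lag n P)"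
  shows "\<exists>w. skew n w \<and> \<omega> = form_mat n P w"
proof -
  note Pc = orthD(1)[OF P]
  let ?W = "{form_mat n P w | w. skew n w}"
  have add: "form_mat n P w + form_mat n P w' = form_mat n P (w + w')" if "skew n w" "skew n w'" for w w'
  proof (rule eq_matI)
    fix i j assume "i < dim_row (form_mat n P (w + w'))" "j < dim_col (form_mat n P (w + w'))"
    then have ij: "i < n + n" "j < n + n" by (auto simp: form_mat_def)
    have "(\<Sum>k<n. \<Sum>l<n. P $$ (i, k) * w $$ (k, l) * P $$ (j, l)) + (\<Sum>k<n. \<Sum>l<n. P $$ (i, k) * w' $$ (k, l) * P $$ (j, l)) =
        (\<Sum>k<n. \<Sum>l<n. P $$ (i, k) * (w + w') $$ (k, l) * P $$ (j, l))"
      unfolding sum.distrib[symmetric]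
      using skewD(1)[OF that(1)] skewD(1)[OF that(2)]
      by (intro sum.cong refl) (simp add: distrib_left distrib_right)
    then show "(form_mat n P w + form_mat n P w') $$ (i, j) = form_mat n P (w + w') $$ (i, j)"
      using ij by (simp add: form_mat_def)
  qed (auto simp: form_mat_def)
  have smult: "c \<cdot>\<^sub>m form_mat n P w = form_mat n P (c \<cdot>\<^sub>m w)" if "skew n w" for c w
    using skewD(1)[OF that]
    by (intro eq_matI) (auto simp: form_mat_def sum_distrib_left algebra_simps)
  have skew0: "skew n (0\<^sub>m n n)" unfolding skew_def by auto
  have skew_add: "skew n (w + w')" if "skew n w" "skew n w'" for w w'
    unfolding skew_def
  proof (intro conjI allI impI)
    show "w + w' \<in> carrier_mat n n" using skewD(1)[OF that(1)] skewD(1)[OF that(2)] by simp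
    fix i j assume ij: "i < n" "j < n"
    then show "(w + w') $$ (i, j) = - (w + w') $$ (j, i)"
      using skewD(1)[OF that(1)] skewD(1)[OF that(2)] skewD(2)[OF that(1) ij] skewD(2)[OF that(2) ij] by simp
  qed
  have skew_smult: "skew n (c \<cdot>\<^sub>m w)" if "skew n w" for c w
    unfolding skew_def
  proof (intro conjI allI impI)
    show "c \<cdot>\<^sub>m w \<in> carrier_mat n n" using skewD(1)[OF that] by simp
    fix i j assume ij: "i < n" "j < n"
    then show "(c \<cdot>\<^sub>m w) $$ (i, j) = - (c \<cdot>\<^sub>m w) $$ (j, i)"
      using skewD(1)[OF that] skewD(2)[OF that ij] by simp
  qed
  have "wedge2 (n + n) (lag n P) \<subseteq> ?W"
  proof (rule wedge2_subset[OF module_mat_submoduleI])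
    show "?W \<subseteq> carrier_mat (n + n) (n + n)" by auto
    have "0\<^sub>m (n + n) (n + n) = form_mat n P (0\<^sub>m n n)" by (intro eq_matI) (auto simp: form_mat_def)
    then show "0\<^sub>m (n + n) (n + n) \<in> ?W" using skew0 by blast
    show "A + B \<in> ?W" if "A \<in> ?W" "B \<in> ?W" for A B using that add skew_add by blast
    show "c \<cdot>\<^sub>m A \<in> ?W" if "A \<in> ?W" for c A using that smult skew_smult by blast
    fix u v assume "u \<in> lag n P" "v \<in> lag n P"
    then obtain y z where yz: "y \<in> carrier_vec n" "z \<in> carrier_vec n" "u = P *\<^sub>v (y @\<^sub>v 0\<^sub>v n)" "v = P *\<^sub>v (z @\<^sub>v 0\<^sub>v n)"
      unfolding lag_def by blast
    let ?w = "mat n n (\<lambda>(k, l). y $ k * z $ l - z $ k * y $ l)"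
    have "skew n ?w" unfolding skew_def by auto
    moreover have "wedge (n + n) u v = form_mat n P ?w"
    proof (rule eq_matI)
      fix i j assume "i < dim_row (form_mat n P ?w)" "j < dim_col (form_mat n P ?w)"
      then have ij: "i < n + n" "j < n + n" by (auto simp: form_mat_def)
      let ?b = "\<lambda>y i. \<Sum>k<n. P $$ (i, k) * y $ k"
      have pr: "?b y i * ?b z j = (\<Sum>k<n. \<Sum>l<n. P $$ (i, k) * (y $ k * z $ l) * P $$ (j, l))" for y z
        unfolding sum_product by (intro sum.cong refl) (simp add: ac_simps)
      have "wedge (n + n) u v $$ (i, j) = ?b y i * ?b z j - ?b z i * ?b y j"
        using ij base_vec_index[OF Pc yz(1)] base_vec_index[OF Pc yz(2)] by (simp add: wedge_def yz(3,4))
      also have "\<dots> = (\<Sum>k<n. \<Sum>l<n. P $$ (i, k) * ?w $$ (k, l) * P $$ (j, l))"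
        unfolding pr sum_subtractf[symmetric]
        by (intro sum.cong refl) (simp add: left_diff_distrib right_diff_distrib)
      finally show "wedge (n + n) u v $$ (i, j) = form_mat n P ?w $$ (i, j)" using ij by (simp add: form_mat_def)
    qed (auto simp: form_mat_def wedge_def)
    ultimately show "wedge (n + n) u v \<in> ?W" by blast
  qed
  then show ?thesis using om by blast
qed

text \<open>If \<open>T w T\<^sup>T = w\<close>, the form of \<open>w\<close> is the sum of the terms \<open>w\<^sub>k\<^sub>l / 2\<close> times the wedge of the vectors
  given by the columns \<open>k\<close> and \<open>l\<close> of \<open>T\<close>.\<close>

lemma form_mat_in_wedge2:
  assumes P: "orth n P" and w: "skew n w" and T: "T \<in> carrier_mat n n" "T * w * T\<^sup>T = w"
    and K: "\<And>k. k < n \<Longrightarrow> P *\<^sub>v (col T k @\<^sub>v 0\<^sub>v n) \<in> K"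
  shows "form_mat n P w \<in> wedge2 (n + n) K"
proof -
  note Pc = orthD(1)[OF P] and wc = skewD(1)[OF w]
  define u where "u = (\<lambda>k. P *\<^sub>v (col T k @\<^sub>v 0\<^sub>v n))"
  have sums: "mat (n + n) (n + n) (\<lambda>ij. \<Sum>(k, l)\<in>I. (w $$ (k, l) / 2) * wedge (n + n) (u k) (u l) $$ ij) \<in> wedge2 (n + n) K"
    if "finite I" "I \<subseteq> {..<n} \<times> {..<n}" for I
    using that
  proof (induction I rule: finite_induct)
    case empty
    have "mat (n + n) (n + n) (\<lambda>ij. 0) = (0\<^sub>m (n + n) (n + n) :: complex mat)" by (intro eq_matI) auto
    then show ?case using wedge2_closed(1) by simp
  next
    case (insert kl I)
    obtain k l where kl: "kl = (k, l)" "k < n" "l < n" using insert.prems by (cases kl) auto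
    let ?S = "\<lambda>I. mat (n + n) (n + n) (\<lambda>ij. \<Sum>(k, l)\<in>I. (w $$ (k, l) / 2) * wedge (n + n) (u k) (u l) $$ ij)"
    have "?S (insert kl I) = (w $$ (k, l) / 2) \<cdot>\<^sub>m wedge (n + n) (u k) (u l) + ?S I"
      using insert.hyps by (intro eq_matI) (auto simp: kl(1) wedge_def)
    moreover have "(w $$ (k, l) / 2) \<cdot>\<^sub>m wedge (n + n) (u k) (u l) \<in> wedge2 (n + n) K"
      using K kl unfolding u_def by (intro wedge2_closed(3,4))
    ultimately show ?case using wedge2_closed(2) insert by simp
  qed
  have "form_mat n P w = mat (n + n) (n + n)
      (\<lambda>ij. \<Sum>(k, l)\<in>{..<n} \<times> {..<n}. (w $$ (k, l) / 2) * wedge (n + n) (u k) (u l) $$ ij)" (is "_ = ?M")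
  proof (rule eq_matI)
    fix i j assume "i < dim_row ?M" "j < dim_col ?M"
    then have ij: "i < n + n" "j < n + n" by auto
    have uk: "u k $ i = (\<Sum>q<n. P $$ (i, q) * T $$ (q, k))" if "k < n" "i < n + n" for k i
    proof -
      have "col T k \<in> carrier_vec n" using T(1) that by simp
      then have "u k $ i = (\<Sum>q<n. P $$ (i, q) * col T k $ q)" unfolding u_def using base_vec_index[OF Pc _ that(2)] by blast
      then show ?thesis using T(1) that by simp
    qed
    have sw: "(\<Sum>k<n. \<Sum>l<n. w $$ (k, l) * (u l $ i * u k $ j)) = - (\<Sum>k<n. \<Sum>l<n. w $$ (k, l) * (u k $ i * u l $ j))"
    proof -
      have "(\<Sum>k<n. \<Sum>l<n. w $$ (k, l) * (u l $ i * u k $ j)) = (\<Sum>l<n. \<Sum>k<n. w $$ (k, l) * (u l $ i * u k $ j))"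
        by (rule sum.swap)
      also have "\<dots> = (\<Sum>l<n. \<Sum>k<n. - (w $$ (l, k) * (u l $ i * u k $ j)))"
      proof (intro sum.cong refl)
        fix l k assume "l \<in> {..<n}" "k \<in> {..<n}"
        then show "w $$ (k, l) * (u l $ i * u k $ j) = - (w $$ (l, k) * (u l $ i * u k $ j))"
          using skewD(2)[OF w, of k l] by simp
      qed
      finally show ?thesis by (simp add: sum_negf)
    qed
    have "?M $$ (i, j) = (\<Sum>k<n. \<Sum>l<n. (w $$ (k, l) / 2) * (u k $ i * u l $ j - u l $ i * u k $ j))"
      using ij by (simp add: wedge_def sum.cartesian_product)
    also have "\<dots> = (\<Sum>k<n. \<Sum>l<n. (w $$ (k, l) * (u k $ i * u l $ j) - w $$ (k, l) * (u l $ i * u k $ j)) / 2)"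
      by (intro sum.cong refl) (simp add: algebra_simps diff_divide_distrib)
    also have "\<dots> = ((\<Sum>k<n. \<Sum>l<n. w $$ (k, l) * (u k $ i * u l $ j)) -
        (\<Sum>k<n. \<Sum>l<n. w $$ (k, l) * (u l $ i * u k $ j))) / 2"
      by (simp add: sum_subtractf sum_divide_distrib diff_divide_distrib)
    also have "\<dots> = (\<Sum>k<n. \<Sum>l<n. w $$ (k, l) * (u k $ i * u l $ j))" unfolding sw by simp
    also have "\<dots> = (\<Sum>k<n. \<Sum>l<n. \<Sum>q<n. \<Sum>r<n. P $$ (i, q) * (T $$ (q, k) * w $$ (k, l) * T $$ (r, l)) * P $$ (j, r))"
    proof (intro sum.cong refl)
      fix k l assume "k \<in> {..<n}" "l \<in> {..<n}"
      then have kl: "k < n" "l < n" by auto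
      show "w $$ (k, l) * (u k $ i * u l $ j) =
          (\<Sum>q<n. \<Sum>r<n. P $$ (i, q) * (T $$ (q, k) * w $$ (k, l) * T $$ (r, l)) * P $$ (j, r))"
        unfolding uk[OF kl(1) ij(1)] uk[OF kl(2) ij(2)] sum_product
        unfolding sum_distrib_left by (intro sum.cong refl) (simp add: ac_simps)
    qed
    also have "\<dots> = (\<Sum>k<n. \<Sum>q<n. \<Sum>l<n. \<Sum>r<n. P $$ (i, q) * (T $$ (q, k) * w $$ (k, l) * T $$ (r, l)) * P $$ (j, r))"
      by (rule sum.cong[OF refl], rule sum.swap)
    also have "\<dots> = (\<Sum>q<n. \<Sum>k<n. \<Sum>l<n. \<Sum>r<n. P $$ (i, q) * (T $$ (q, k) * w $$ (k, l) * T $$ (r, l)) * P $$ (j, r))"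
      by (rule sum.swap)
    also have "\<dots> = (\<Sum>q<n. \<Sum>k<n. \<Sum>r<n. \<Sum>l<n. P $$ (i, q) * (T $$ (q, k) * w $$ (k, l) * T $$ (r, l)) * P $$ (j, r))"
      by (rule sum.cong[OF refl], rule sum.cong[OF refl], rule sum.swap)
    also have "\<dots> = (\<Sum>q<n. \<Sum>r<n. \<Sum>k<n. \<Sum>l<n. P $$ (i, q) * (T $$ (q, k) * w $$ (k, l) * T $$ (r, l)) * P $$ (j, r))"
      by (rule sum.cong[OF refl], rule sum.swap)
    also have "\<dots> = (\<Sum>q<n. \<Sum>r<n. P $$ (i, q) * w $$ (q, r) * P $$ (j, r))"
    proof (intro sum.cong refl)
      fix q r assume qr: "q \<in> {..<n}" "r \<in> {..<n}"
      have Tw: "T * w \<in> carrier_mat n n" by (rule mult_carrier_mat[OF T(1) wc])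
      have TT: "T\<^sup>T \<in> carrier_mat n n" using T(1) by simp
      have "w $$ (q, r) = (\<Sum>l<n. (T * w) $$ (q, l) * T\<^sup>T $$ (l, r))"
        by (subst T(2)[symmetric], rule mult_index_sum[OF Tw TT]) (use qr in auto)
      also have "\<dots> = (\<Sum>l<n. (\<Sum>k<n. T $$ (q, k) * w $$ (k, l)) * T $$ (r, l))"
        using qr T(1) mult_index_sum[OF T(1) wc] by (intro sum.cong refl) simp
      also have "\<dots> = (\<Sum>l<n. \<Sum>k<n. T $$ (q, k) * w $$ (k, l) * T $$ (r, l))" by (simp add: sum_distrib_right)
      also have "\<dots> = (\<Sum>k<n. \<Sum>l<n. T $$ (q, k) * w $$ (k, l) * T $$ (r, l))" by (rule sum.swap)
      finally show "(\<Sum>k<n. \<Sum>l<n. P $$ (i, q) * (T $$ (q, k) * w $$ (k, l) * T $$ (r, l)) * P $$ (j, r)) =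
          P $$ (i, q) * w $$ (q, r) * P $$ (j, r)"
        by (simp add: sum_distrib_left sum_distrib_right)
    qed
    finally show "form_mat n P w $$ (i, j) = ?M $$ (i, j)" using ij by (simp add: form_mat_def)
  qed (auto simp: form_mat_def)
  then show ?thesis using sums[OF _ subset_refl] by simp
qed

text \<open>In the coordinates of the frame this is the orthogonal complement of \<open>v\<close> for the standard product.\<close>

definition hyper :: "nat \<Rightarrow> complex mat \<Rightarrow> complex vec \<Rightarrow> complex vec set" where
  "hyper n P v = {P *\<^sub>v (y @\<^sub>v 0\<^sub>v n) | y. y \<in> carrier_vec n \<and> y \<bullet> v = 0}"

lemma form_mat_image_hyper:
  assumes P: "orth n P" and w: "skew n w" and v: "kernel_line n w v"
  shows "col_image (n + n) (form_mat n P w) = hyper n P v"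
  unfolding form_mat_image[OF P skewD(1)[OF w]] hyper_def
  using kernel_line_image[OF w v] mult_mat_vec_carrier[OF skewD(1)[OF w]] by blast

text \<open>Every subspace \<open>K\<close> with \<open>\<omega> \<in> \<and>\<^sup>2 K\<close> contains the columns of \<open>\<omega>\<close>, hence the hyperplane. That the
  hyperplane itself is such a subspace is seen by means of a projection onto it.\<close>

lemma form_image_eq:
  assumes n: "n = 2 * p + 1" and P: "orth n P" and w: "skew n w" and v: "kernel_line n w v"
  shows "form_image p (lag n P) (form_mat n P w) = hyper n P v"
  unfolding form_image_def ambient_dim[OF n]
proof (rule Least_equality)
  note wc = skewD(1)[OF w] and vD = kernel_lineD[OF v] and Pc = orthD(1)[OF P]
  have sub: "lin_subspace (n + n) (hyper n P v)"
    unfolding form_mat_image_hyper[OF P w v, symmetric] by (rule subspace_col_image[OF form_mat_carrier])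
  have subL: "hyper n P v \<subseteq> lag n P" unfolding hyper_def lag_def by blast
  \<comment> \<open>The projection along the \<open>m\<close>-th unit vector onto the orthogonal complement of \<open>v\<close>.\<close>
  obtain m where m: "m < n" "v $ m \<noteq> 0" using nonzero_entry[OF vD(1,2)] by blast
  define T where "T = mat n n (\<lambda>(i, j). (if i = j then 1 else 0) - (if i = m then v $ j / v $ m else 0))"
  have Tc: "T \<in> carrier_mat n n" by (simp add: T_def)
  have Tx: "T *\<^sub>v x = x - (v \<bullet> x / v $ m) \<cdot>\<^sub>v unit_vec n m" if x: "x \<in> carrier_vec n" for x
  proof (rule eq_vecI)
    fix i assume "i < dim_vec (x - (v \<bullet> x / v $ m) \<cdot>\<^sub>v unit_vec n m)"
    then have i: "i < n" by simp
    have "(T *\<^sub>v x) $ i = (\<Sum>j<n. (if i = j then x $ j else 0) - (if i = m then v $ j * x $ j / v $ m else 0))"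
      unfolding mult_vec_index_sum[OF Tc x i] using i by (intro sum.cong) (auto simp: T_def algebra_simps)
    also have "\<dots> = x $ i - (if i = m then v \<bullet> x / v $ m else 0)"
      using i x vD(1) by (simp add: sum_subtractf scalar_prod_def lessThan_atLeast0 sum_divide_distrib)
    finally show "(T *\<^sub>v x) $ i = (x - (v \<bullet> x / v $ m) \<cdot>\<^sub>v unit_vec n m) $ i" using i x m by auto
  qed (use Tc x in auto)
  have Tid: "T *\<^sub>v x = x" if x: "x \<in> carrier_vec n" "x \<bullet> v = 0" for x
  proof -
    have "v \<bullet> x = 0" using comm_scalar_prod[OF vD(1) x(1)] x(2) by simp
    then show ?thesis unfolding Tx[OF x(1)] using x(1) by (intro eq_vecI) auto
  qed
  have Tw: "T * X = X" if X: "skew n X" "\<And>x. x \<in> carrier_vec n \<Longrightarrow> (X *\<^sub>v x) \<bullet> v = 0" for X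
  proof (rule mat_eqI_vec[OF mult_carrier_mat[OF Tc skewD(1)[OF X(1)]] skewD(1)[OF X(1)]])
    fix y :: "complex vec" assume y: "y \<in> carrier_vec n"
    show "T * X *\<^sub>v y = X *\<^sub>v y"
      unfolding assoc_mult_mat_vec[OF Tc skewD(1)[OF X(1)] y]
      by (rule Tid[OF mult_mat_vec_carrier[OF skewD(1)[OF X(1)] y] X(2)[OF y]])
  qed
  have wv: "(w *\<^sub>v x) \<bullet> v = 0" if x: "x \<in> carrier_vec n" for x
    using kernel_line_image[OF w v mult_mat_vec_carrier[OF wc x]] x by blast
  have TwT: "T * w * T\<^sup>T = w"
  proof -
    have Tww: "T * w = w" by (rule Tw[OF w wv])
    have TT: "T\<^sup>T \<in> carrier_mat n n" using Tc by simp
    have "(w * T\<^sup>T)\<^sup>T = T * w\<^sup>T" using transpose_mult[OF wc TT] by simp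
    also have "\<dots> = - (T * w)" unfolding skew_transpose[OF w] using Tc wc by simp
    also have "\<dots> = w\<^sup>T" by (simp only: Tww skew_transpose[OF w])
    finally have "w * T\<^sup>T = w" by (metis transpose_transpose)
    then show ?thesis unfolding Tww .
  qed
  have K: "P *\<^sub>v (col T k @\<^sub>v 0\<^sub>v n) \<in> hyper n P v" if k: "k < n" for k
  proof -
    have e: "col T k = T *\<^sub>v unit_vec n k" using mult_mat_unit_vec[OF Tc k] by simp
    have "col T k \<in> carrier_vec n" using Tc k by simp
    moreover have "col T k \<bullet> v = 0"
    proof -
      let ?c = "v \<bullet> unit_vec n k / v $ m"
      have d: "col T k \<bullet> v = unit_vec n k \<bullet> v - (?c \<cdot>\<^sub>v unit_vec n m) \<bullet> v"
        unfolding e Tx[OF unit_vec_carrier]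
        by (rule minus_scalar_prod_distrib[OF unit_vec_carrier smult_carrier_vec[THEN iffD2, OF unit_vec_carrier] vD(1)])
      have "(?c \<cdot>\<^sub>v unit_vec n m) \<bullet> v = ?c * v $ m"
        using vD(1) m(1) by simp
      then have "(?c \<cdot>\<^sub>v unit_vec n m) \<bullet> v = v $ k" using scalar_prod_right_unit[OF k, of v] m(2) by simp
      then have "col T k \<bullet> v = 0" using d scalar_prod_left_unit[OF vD(1) k] by simp
      then show ?thesis .
    qed
    ultimately show ?thesis unfolding hyper_def by blast
  qed
  have "form_mat n P w \<in> wedge2 (n + n) (hyper n P v)" by (rule form_mat_in_wedge2[OF P w Tc TwT K])
  then show "lin_subspace (n + n) (hyper n P v) \<and> hyper n P v \<subseteq> lag n P \<and> form_mat n P w \<in> wedge2 (n + n) (hyper n P v)"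
    using sub subL by blast
  fix K assume K: "lin_subspace (n + n) K \<and> K \<subseteq> lag n P \<and> form_mat n P w \<in> wedge2 (n + n) K"
  note KD = lin_subspaceD[OF conjunct1[OF K]]
  let ?W = "{A \<in> carrier_mat (n + n) (n + n). \<forall>x\<in>carrier_vec (n + n). A *\<^sub>v x \<in> K}"
  have "wedge2 (n + n) K \<subseteq> ?W"
  proof (rule wedge2_subset[OF module_mat_submoduleI])
    show "0\<^sub>m (n + n) (n + n) \<in> ?W" using KD(2) zero_mat_mult_vec by auto
    show "A + B \<in> ?W" if "A \<in> ?W" "B \<in> ?W" for A B
      using that KD(3) add_mult_distrib_mat_vec[of A "n + n" "n + n" B] by auto
    show "c \<cdot>\<^sub>m A \<in> ?W" if A: "A \<in> ?W" for c A
    proof -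
      have "(c \<cdot>\<^sub>m A) *\<^sub>v x = c \<cdot>\<^sub>v (A *\<^sub>v x)" if "x \<in> carrier_vec (n + n)" for x
        using A that by (intro eq_vecI) auto
      then show ?thesis using A KD(4) by auto
    qed
    fix u v assume uv: "u \<in> K" "v \<in> K"
    then have c: "u \<in> carrier_vec (n + n)" "v \<in> carrier_vec (n + n)" using KD(1) by auto
    have "wedge (n + n) u v *\<^sub>v x = (v \<bullet> x) \<cdot>\<^sub>v u + (- (u \<bullet> x)) \<cdot>\<^sub>v v" if x: "x \<in> carrier_vec (n + n)" for x
    proof (rule eq_vecI)
      fix i assume "i < dim_vec ((v \<bullet> x) \<cdot>\<^sub>v u + (- (u \<bullet> x)) \<cdot>\<^sub>v v)"
      then have i: "i < n + n" using c by simp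
      have "(wedge (n + n) u v *\<^sub>v x) $ i = (\<Sum>j<n + n. (u $ i * v $ j - v $ i * u $ j) * x $ j)"
        unfolding mult_vec_index_sum[OF wedge_carrier x i] using i by (intro sum.cong) (auto simp: wedge_def)
      also have "\<dots> = (\<Sum>j<n + n. u $ i * (v $ j * x $ j) - v $ i * (u $ j * x $ j))"
        by (intro sum.cong refl) (simp add: algebra_simps)
      also have "\<dots> = u $ i * (v \<bullet> x) - v $ i * (u \<bullet> x)"
        using x by (simp add: sum_subtractf sum_distrib_left scalar_prod_def lessThan_atLeast0)
      finally show "(wedge (n + n) u v *\<^sub>v x) $ i = ((v \<bullet> x) \<cdot>\<^sub>v u + (- (u \<bullet> x)) \<cdot>\<^sub>v v) $ i"
        using i c by (simp add: algebra_simps)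
    qed (use c in \<open>simp add: wedge_def\<close>)
    then show "wedge (n + n) u v \<in> ?W" using KD(3,4) uv by auto
  qed auto
  then have "col_image (n + n) (form_mat n P w) \<subseteq> K" using K unfolding col_image_def by blast
  then show "hyper n P v \<le> K" unfolding form_mat_image_hyper[OF P w v] .
qed

section \<open>Generic forms\<close>

lemma generic_form_iff:
  assumes n: "n = 2 * p + 1"
  shows "generic_form p (form_mat n P w) \<longleftrightarrow> col_image (n + n) (form_mat n P w) \<in> grassmannian (2 * p) (n + n)"
  unfolding generic_form_def ambient_dim[OF n] grassmannian_def
  using lin_dim_col_image[OF form_mat_carrier, of n P w] subspace_col_image[OF form_mat_carrier, of n P w] by simp

text \<open>A skew matrix of odd size is singular. If its kernel were more than a line, its image would be cut
  out by two independent equations, so a vector of the image would be determined by \<open>n - 2 = 2 p - 1\<close> of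
  its coordinates, which is impossible for an image of dimension \<open>2 p\<close>.\<close>

lemma generic_form_kernel_line:
  assumes n: "n = 2 * p + 1" and P: "orth n P" and w: "skew n w" and gen: "generic_form p (form_mat n P w)"
  shows "\<exists>v. kernel_line n w v"
proof -
  note wc = skewD(1)[OF w]
  obtain A where A: "inj_mat (n + n) (2 * p) A" "col_image (n + n) (form_mat n P w) = col_image (2 * p) A"
    using gen unfolding generic_form_iff[OF n] grassmannian_iff by blast
  have Ac: "A \<in> carrier_mat (n + n) (2 * p)" using A(1) by (simp add: inj_mat_def)
  obtain Q where Q: "orth n Q" "P * Q = 1\<^sub>m (n + n)" "Q * P = 1\<^sub>m (n + n)" using orth_inverse[OF P] by metis
  note Pc = orthD(1)[OF P] and Qc = orthD(1)[OF Q(1)]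
  have Ay: "\<exists>x\<in>carrier_vec n. Q *\<^sub>v (A *\<^sub>v u) = (w *\<^sub>v x) @\<^sub>v 0\<^sub>v n \<and> A *\<^sub>v u = P *\<^sub>v ((w *\<^sub>v x) @\<^sub>v 0\<^sub>v n)"
    if u: "u \<in> carrier_vec (2 * p)" for u
  proof -
    have "A *\<^sub>v u \<in> col_image (n + n) (form_mat n P w)" unfolding A(2) unfolding col_image_def using u by blast
    then obtain x where x: "x \<in> carrier_vec n" "A *\<^sub>v u = P *\<^sub>v ((w *\<^sub>v x) @\<^sub>v 0\<^sub>v n)"
      unfolding form_mat_image[OF P wc] by blast
    have c: "(w *\<^sub>v x) @\<^sub>v 0\<^sub>v n \<in> carrier_vec (n + n)" using wc x(1) by simp
    have "Q *\<^sub>v (A *\<^sub>v u) = (w *\<^sub>v x) @\<^sub>v 0\<^sub>v n"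
      unfolding x(2) assoc_mult_mat_vec[OF Qc Pc c, symmetric] Q(3) using c by simp
    then show ?thesis using x by blast
  qed
  have "det w = 0" by (rule skew_odd_det[OF w]) (simp add: n)
  then have "\<not> inj_mat n n w" using inj_mat_det[OF wc] by simp
  then obtain v where v: "v \<in> carrier_vec n" "w *\<^sub>v v = 0\<^sub>v n" "v \<noteq> 0\<^sub>v n" using wc unfolding inj_mat_def by blast
  obtain i where i: "i < n" "v $ i \<noteq> 0" using nonzero_entry[OF v(1,3)] by blast
  have "\<exists>s. x = s \<cdot>\<^sub>v v" if x: "x \<in> carrier_vec n" "w *\<^sub>v x = 0\<^sub>v n" for x
  proof -
    define s where "s = x $ i / v $ i"
    define x1 where "x1 = x - s \<cdot>\<^sub>v v"
    have sv: "s \<cdot>\<^sub>v v \<in> carrier_vec n" using v(1) by simp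
    have x1: "x1 \<in> carrier_vec n" "x1 $ i = 0" unfolding x1_def s_def using x v i by auto
    have "w *\<^sub>v x1 = w *\<^sub>v x - s \<cdot>\<^sub>v (w *\<^sub>v v)"
      unfolding x1_def mult_minus_distrib_mat_vec[OF wc x(1) sv] mult_mat_vec[OF wc v(1)] ..
    then have wx1: "w *\<^sub>v x1 = 0\<^sub>v n" unfolding x(2) v(2) by auto
    have "x1 = 0\<^sub>v n"
    proof (rule ccontr)
      assume "x1 \<noteq> 0\<^sub>v n"
      then obtain j where j: "j < n" "x1 $ j \<noteq> 0" using nonzero_entry[OF x1(1)] by blast
      then have ij: "i \<noteq> j" using x1(2) by auto
      have crd: "card ({..<n} - {i, j}) < card {..<2 * p}"
        using card_Diff_subset[of "{i, j}" "{..<n}"] i(1) j(1) ij n by simp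
      obtain u where u: "\<exists>l\<in>{..<2 * p}. u l \<noteq> 0"
        "\<forall>k\<in>{..<n} - {i, j}. (\<Sum>l<2 * p. (Q * A) $$ (k, l) * u l) = 0"
        using underdetermined_system[OF _ _ crd, of "\<lambda>k l. (Q * A) $$ (k, l)"] by auto
      let ?u = "vec (2 * p) u"
      have uc: "?u \<in> carrier_vec (2 * p)" by simp
      obtain z where z: "z \<in> carrier_vec n" "Q *\<^sub>v (A *\<^sub>v ?u) = (w *\<^sub>v z) @\<^sub>v 0\<^sub>v n" "A *\<^sub>v ?u = P *\<^sub>v ((w *\<^sub>v z) @\<^sub>v 0\<^sub>v n)"
        using Ay[OF uc] by blast
      have yc: "w *\<^sub>v z \<in> carrier_vec n" by (rule mult_mat_vec_carrier[OF wc z(1)])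
      have y0: "(w *\<^sub>v z) $ k = 0" if k: "k < n" "k \<noteq> i" "k \<noteq> j" for k
      proof -
        have QA: "Q * A \<in> carrier_mat (n + n) (2 * p)" by (rule mult_carrier_mat[OF Qc Ac])
        have "(w *\<^sub>v z) $ k = (Q *\<^sub>v (A *\<^sub>v ?u)) $ k" unfolding z(2) using k yc wc by simp
        also have "\<dots> = (\<Sum>l<2 * p. (Q * A) $$ (k, l) * ?u $ l)"
          unfolding assoc_mult_mat_vec[OF Qc Ac uc, symmetric] by (rule mult_vec_index_sum[OF QA uc]) (use k in simp)
        also have "\<dots> = (\<Sum>l<2 * p. (Q * A) $$ (k, l) * u l)" by (intro sum.cong) auto
        also have "\<dots> = 0" using u(2) k by blast
        finally show ?thesis .
      qed
      have two: "x \<bullet> (w *\<^sub>v z) = x $ i * (w *\<^sub>v z) $ i + x $ j * (w *\<^sub>v z) $ j"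
        if "x \<in> carrier_vec n" for x
      proof -
        have "x \<bullet> (w *\<^sub>v z) = (\<Sum>k\<in>{..<n}. x $ k * (w *\<^sub>v z) $ k)"
          by (simp only: scalar_prod_def carrier_vecD[OF yc] lessThan_atLeast0)
        also have "\<dots> = (\<Sum>k\<in>{i, j}. x $ k * (w *\<^sub>v z) $ k)"
          using y0 i(1) j(1) by (intro sum.mono_neutral_right) auto
        finally show ?thesis using ij by simp
      qed
      have zero: "x \<bullet> (w *\<^sub>v z) = 0" if "x \<in> carrier_vec n" "w *\<^sub>v x = 0\<^sub>v n" for x
        unfolding skew_scalar_prod[OF w that(1) z(1)] that(2) using z(1) by simp
      have "x1 $ j * (w *\<^sub>v z) $ j = 0" using two[OF x1(1)] zero[OF x1(1) wx1] x1(2) by simp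
      then have "(w *\<^sub>v z) $ j = 0" using j(2) by simp
      moreover then have "v $ i * (w *\<^sub>v z) $ i = 0" using two[OF v(1)] zero[OF v(1,2)] by simp
      then have "(w *\<^sub>v z) $ i = 0" using i(2) by simp
      ultimately have "(w *\<^sub>v z) $ k = 0" if "k < n" for k using y0[OF that] by blast
      then have "w *\<^sub>v z = 0\<^sub>v n" using yc by (intro eq_vecI) (simp_all del: index_mult_mat_vec dim_mult_mat_vec)
      then have "A *\<^sub>v ?u = P *\<^sub>v 0\<^sub>v (n + n)" unfolding z(3) by (intro arg_cong[where f = "\<lambda>x. P *\<^sub>v x"] eq_vecI) auto
      then have "A *\<^sub>v ?u = 0\<^sub>v (n + n)" unfolding mult_mat_0_vec[OF Pc] .
      then have "?u = 0\<^sub>v (2 * p)" using A(1) uc unfolding inj_mat_def by blast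
      then have "u l = 0" if "l < 2 * p" for l using that by (metis index_vec index_zero_vec(1))
      then show False using u(1) by auto
    qed
    then have "x $ k = (s \<cdot>\<^sub>v v) $ k" if "k < n" for k
      using that x(1) v(1) unfolding x1_def by (metis eq_iff_diff_eq_0 index_minus_vec(1) index_zero_vec(1) carrier_vecD sv)
    then show ?thesis using x(1) v(1) by (intro exI[of _ s] eq_vecI) auto
  qed
  then show ?thesis unfolding kernel_line_def using v by blast
qed

lemma kernel_unit_vec_generic_form:
  assumes n: "n = 2 * p + 1" and P: "orth n P" and w: "skew n w" and m: "m < n" and v: "kernel_line n w (unit_vec n m)"
  shows "generic_form p (form_mat n P w)"
proof -
  note Pc = orthD(1)[OF P]
  define skip where "skip = (\<lambda>l::nat. if l < m then l else Suc l)"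
  define E where "E = (mat (n + n) (2 * p) (\<lambda>(i, l). if i = skip l then 1 else 0) :: complex mat)"
  have Ec: "E \<in> carrier_mat (n + n) (2 * p)" by (simp add: E_def)
  have skip: "skip l < n" "skip l \<noteq> m" if "l < 2 * p" for l using that m n unfolding skip_def by auto
  have inj: "skip l = skip l' \<Longrightarrow> l = l'" for l l' unfolding skip_def by (auto split: if_splits)
  have surj: "\<exists>l<2 * p. i = skip l" if "i < n" "i \<noteq> m" for i
  proof (cases "i < m")
    case True
    then show ?thesis using m n by (intro exI[of _ i]) (auto simp: skip_def)
  next
    case False
    then show ?thesis using that n by (intro exI[of _ "i - 1"]) (auto simp: skip_def)
  qed
  have E1: "(E *\<^sub>v u) $ skip l = u $ l" if u: "u \<in> carrier_vec (2 * p)" and l: "l < 2 * p" for u l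
  proof -
    have k: "skip l < n + n" using skip(1)[OF l] by simp
    have "(E *\<^sub>v u) $ skip l = (\<Sum>j<2 * p. if j = l then u $ j else 0)"
      unfolding mult_vec_index_sum[OF Ec u k] using k inj by (intro sum.cong) (auto simp: E_def)
    then show ?thesis using l by simp
  qed
  have E0: "(E *\<^sub>v u) $ i = 0" if u: "u \<in> carrier_vec (2 * p)" and i: "i < n + n" "i = m \<or> n \<le> i" for u i
    unfolding mult_vec_index_sum[OF Ec u i(1)] using i skip by (intro sum.neutral) (fastforce simp: E_def)
  have "inj_mat (n + n) (2 * p) (P * E)"
    unfolding inj_mat_def
  proof (intro conjI ballI impI)
    show "P * E \<in> carrier_mat (n + n) (2 * p)" by (rule mult_carrier_mat[OF Pc Ec])
    fix u assume u: "u \<in> carrier_vec (2 * p)" "P * E *\<^sub>v u = 0\<^sub>v (n + n)"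
    have Eu: "E *\<^sub>v u \<in> carrier_vec (n + n)" by (rule mult_mat_vec_carrier[OF Ec u(1)])
    obtain Q where Q: "orth n Q" "Q * P = 1\<^sub>m (n + n)" using orth_inverse[OF P] by metis
    have "E *\<^sub>v u = Q *\<^sub>v (P *\<^sub>v (E *\<^sub>v u))"
      unfolding assoc_mult_mat_vec[OF orthD(1)[OF Q(1)] Pc Eu, symmetric] Q(2) using Eu by simp
    also have "\<dots> = 0\<^sub>v (n + n)"
      using u(2) unfolding assoc_mult_mat_vec[OF Pc Ec u(1)] by (simp add: mult_mat_0_vec[OF orthD(1)[OF Q(1)]])
    finally have "u $ l = 0" if "l < 2 * p" for l using E1[OF u(1) that] skip(1)[OF that] by simp
    then show "u = 0\<^sub>v (2 * p)" using u(1) by (intro eq_vecI) auto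
  qed
  moreover have "col_image (2 * p) (P * E) = hyper n P (unit_vec n m)"
  proof -
    have "(E *\<^sub>v u = y @\<^sub>v 0\<^sub>v n) \<Longrightarrow> y \<in> carrier_vec n \<Longrightarrow> u \<in> carrier_vec (2 * p) \<Longrightarrow> y \<bullet> unit_vec n m = 0" for u y
      using E0[of u m] m by simp
    moreover have "\<exists>y\<in>carrier_vec n. E *\<^sub>v u = y @\<^sub>v 0\<^sub>v n" if u: "u \<in> carrier_vec (2 * p)" for u
    proof (intro bexI[of _ "vec n (\<lambda>i. (E *\<^sub>v u) $ i)"] eq_vecI)
      fix i assume "i < dim_vec (vec n (\<lambda>i. (E *\<^sub>v u) $ i) @\<^sub>v (0\<^sub>v n :: complex vec))"
      then show "(E *\<^sub>v u) $ i = (vec n (\<lambda>i. (E *\<^sub>v u) $ i) @\<^sub>v 0\<^sub>v n) $ i" using E0[OF u, of i] by auto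
    qed (use Ec in auto)
    moreover have "\<exists>u\<in>carrier_vec (2 * p). E *\<^sub>v u = y @\<^sub>v 0\<^sub>v n" if y: "y \<in> carrier_vec n" "y \<bullet> unit_vec n m = 0" for y
    proof (intro bexI[of _ "vec (2 * p) (\<lambda>l. y $ skip l)"] eq_vecI)
      fix i assume "i < dim_vec (y @\<^sub>v (0\<^sub>v n :: complex vec))"
      then have i: "i < n + n" using y by simp
      show "(E *\<^sub>v vec (2 * p) (\<lambda>l. y $ skip l)) $ i = (y @\<^sub>v 0\<^sub>v n) $ i"
      proof (cases "i < n \<and> i \<noteq> m")
        case True
        then obtain l where l: "l < 2 * p" "i = skip l" using surj by blast
        then show ?thesis using E1[OF vec_carrier l(1), of "\<lambda>l. y $ skip l"] True y(1) by simp
      next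
        case False
        have "y $ m = 0" using y(2) m by simp
        then show ?thesis using E0[OF vec_carrier i, of "\<lambda>l. y $ skip l"] False i y(1) by auto
      qed
    qed (use Ec y in auto)
    ultimately have "col_image (2 * p) E = {y @\<^sub>v 0\<^sub>v n | y. y \<in> carrier_vec n \<and> y \<bullet> unit_vec n m = 0}"
      unfolding col_image_def by (auto simp: image_iff) metis+
    then show ?thesis unfolding col_image_mult[OF Pc Ec] hyper_def by auto
  qed
  ultimately show ?thesis
    unfolding generic_form_iff[OF n] form_mat_image_hyper[OF P w v] grassmannian_iff by metis
qed

section \<open>The conormal bundle in a frame\<close>

lemma sum_lessThan_add: "(\<Sum>i<n + m. f i) = (\<Sum>i<n. f i) + (\<Sum>i<m. f (n + i :: nat) :: complex)"
  by (induction m) (simp_all add: add.assoc)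

lemma bform_expand:
  assumes A: "A \<in> carrier_mat (n + n) (n + n)" and x: "x \<in> carrier_vec (n + n)"
  shows "bform n (A *\<^sub>v x) y =
    (\<Sum>i<n + n. \<Sum>j<n + n. x $ i * y $ j * bform n (A *\<^sub>v unit_vec (n + n) i) (unit_vec (n + n) j))"
proof -
  have e: "bform n u y = (\<Sum>j<n + n. y $ j * bform n u (unit_vec (n + n) j))" for u
    unfolding sum_lessThan_add bform_def[of n u y] sum.distrib
    by (simp add: bform_unit_vec mult.commute add.commute[of "sum f {..<n}" "sum g {..<n}" for f g])
  have l: "bform n (A *\<^sub>v x) (unit_vec (n + n) j) = (\<Sum>i<n + n. x $ i * bform n (A *\<^sub>v unit_vec (n + n) i) (unit_vec (n + n) j))"
    if j: "j < n + n" for j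
  proof -
    have "\<exists>k<n + n. \<forall>u. bform n u (unit_vec (n + n) j) = u $ k"
    proof (cases "j < n")
      case True
      then show ?thesis using bform_unit_vec(1)[OF True] by (intro exI[of _ "n + j"]) simp
    next
      case False
      then have jj: "j - n < n" "n + (j - n) = j" using j by auto
      show ?thesis using bform_unit_vec(2)[OF jj(1)] unfolding jj(2) using jj(1) by (intro exI[of _ "j - n"]) simp
    qed
    then obtain k where k: "k < n + n" "\<And>u. bform n u (unit_vec (n + n) j) = u $ k" by blast
    show ?thesis
      unfolding k(2) mult_vec_index_sum[OF A x k(1)]
      using A k(1) by (intro sum.cong refl) (simp add: mult_mat_unit_vec[OF A])
  qed
  have "bform n (A *\<^sub>v x) y = (\<Sum>j<n + n. y $ j * (\<Sum>i<n + n. x $ i * bform n (A *\<^sub>v unit_vec (n + n) i) (unit_vec (n + n) j)))"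
    unfolding e[of "A *\<^sub>v x"] using l by (intro sum.cong) auto
  also have "\<dots> = (\<Sum>j<n + n. \<Sum>i<n + n. x $ i * y $ j * bform n (A *\<^sub>v unit_vec (n + n) i) (unit_vec (n + n) j))"
    by (simp add: sum_distrib_left ac_simps)
  also have "\<dots> = (\<Sum>i<n + n. \<Sum>j<n + n. x $ i * y $ j * bform n (A *\<^sub>v unit_vec (n + n) i) (unit_vec (n + n) j))"
    by (rule sum.swap)
  finally show ?thesis .
qed

lemma cotangent_pairing_form_mat:
  assumes n: "n = 2 * p + 1" and P: "P \<in> carrier_mat (n + n) (n + n)" and A: "A \<in> carrier_mat (n + n) (n + n)"
  shows "cotangent_pairing p (form_mat n P w) A =
    (\<Sum>k<n. \<Sum>l<n. w $$ (k, l) * bform n (A *\<^sub>v (P *\<^sub>v (unit_vec n k @\<^sub>v 0\<^sub>v n))) (P *\<^sub>v (unit_vec n l @\<^sub>v 0\<^sub>v n)))"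
proof -
  let ?b = "\<lambda>i j. bform n (A *\<^sub>v unit_vec (n + n) i) (unit_vec (n + n) j)"
  let ?f = "\<lambda>i j k l. P $$ (i, k) * w $$ (k, l) * P $$ (j, l) * ?b i j"
  have col: "(P *\<^sub>v (unit_vec n k @\<^sub>v 0\<^sub>v n)) $ i = P $$ (i, k)" if "k < n" "i < n + n" for i k
  proof -
    have "(P *\<^sub>v (unit_vec n k @\<^sub>v 0\<^sub>v n)) $ i = (\<Sum>j<n. if j = k then P $$ (i, j) else 0)"
      unfolding base_vec_index[OF P unit_vec_carrier that(2)] using that by (intro sum.cong) auto
    then show ?thesis using that by simp
  qed
  have "cotangent_pairing p (form_mat n P w) A = (\<Sum>i<n + n. \<Sum>j<n + n. form_mat n P w $$ (i, j) * ?b i j)"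
    unfolding cotangent_pairing_def ambient_dim[OF n]
    using A by (intro sum.cong refl) (simp add: polar_form_eq[OF n])
  also have "\<dots> = (\<Sum>i<n + n. \<Sum>j<n + n. \<Sum>k<n. \<Sum>l<n. ?f i j k l)"
    by (intro sum.cong refl) (simp add: form_mat_def sum_distrib_right)
  also have "\<dots> = (\<Sum>i<n + n. \<Sum>k<n. \<Sum>j<n + n. \<Sum>l<n. ?f i j k l)"
    by (rule sum.cong[OF refl], rule sum.swap)
  also have "\<dots> = (\<Sum>k<n. \<Sum>i<n + n. \<Sum>j<n + n. \<Sum>l<n. ?f i j k l)" by (rule sum.swap)
  also have "\<dots> = (\<Sum>k<n. \<Sum>i<n + n. \<Sum>l<n. \<Sum>j<n + n. ?f i j k l)"
    by (rule sum.cong[OF refl], rule sum.cong[OF refl], rule sum.swap)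
  also have "\<dots> = (\<Sum>k<n. \<Sum>l<n. \<Sum>i<n + n. \<Sum>j<n + n. ?f i j k l)"
    by (rule sum.cong[OF refl], rule sum.swap)
  also have "\<dots> = (\<Sum>k<n. \<Sum>l<n. w $$ (k, l) * bform n (A *\<^sub>v (P *\<^sub>v (unit_vec n k @\<^sub>v 0\<^sub>v n))) (P *\<^sub>v (unit_vec n l @\<^sub>v 0\<^sub>v n)))"
  proof (intro sum.cong refl)
    fix k l assume "k \<in> {..<n}" "l \<in> {..<n}"
    then have kl: "k < n" "l < n" by auto
    have c: "P *\<^sub>v (unit_vec n k @\<^sub>v 0\<^sub>v n) \<in> carrier_vec (n + n)" by (rule mult_mat_vec_carrier[OF P]) simp
    show "(\<Sum>i<n + n. \<Sum>j<n + n. ?f i j k l) =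
        w $$ (k, l) * bform n (A *\<^sub>v (P *\<^sub>v (unit_vec n k @\<^sub>v 0\<^sub>v n))) (P *\<^sub>v (unit_vec n l @\<^sub>v 0\<^sub>v n))"
      unfolding bform_expand[OF A c] sum_distrib_left
    proof (intro sum.cong refl)
      fix i j assume "i \<in> {..<n + n}" "j \<in> {..<n + n}"
      then have ij: "i < n + n" "j < n + n" by auto
      show "?f i j k l = w $$ (k, l) * ((P *\<^sub>v (unit_vec n k @\<^sub>v 0\<^sub>v n)) $ i * (P *\<^sub>v (unit_vec n l @\<^sub>v 0\<^sub>v n)) $ j * ?b i j)"
        unfolding col[OF kl(1) ij(1)] col[OF kl(2) ij(2)] by (simp only: ac_simps)
    qed
  qed
  finally show ?thesis .
qed

text \<open>A tangent vector \<open>M\<close> in the chart of \<open>P\<close> is induced by the endomorphism that has the only block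
  \<open>M\<close>, from the span of the \<open>e\<^sub>i\<^sup>+\<close> to the span of the \<open>e\<^sub>i\<^sup>-\<close>, in the frame \<open>P\<close>.\<close>

lemma conormal_bundle_frame:
  assumes n: "n = 2 * p + 1" and L: "(L, \<omega>) \<in> conormal_bundle p C" and C: "C \<subseteq> lags n e"
  obtains P w where "orth n P" "det P = e" "lag n P \<in> C" "L = lag n P" "skew n w" "\<omega> = form_mat n P w"
    "\<And>M. M \<in> chart_tangent n (n + n) P C \<Longrightarrow> (\<Sum>i<n. \<Sum>j<n. w $$ (j, i) * M $$ (i, j)) = 0"
proof -
  have L': "L \<in> C" "\<omega> \<in> wedge2 (n + n) L"
    "\<And>A. A \<in> tangent_endos n (n + n) C L \<Longrightarrow> cotangent_pairing p \<omega> A = 0"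
    using L unfolding conormal_bundle_def smooth_point_def ambient_dim[OF n] n[symmetric] by auto
  obtain P where P: "orth n P" "det P = e" "L = lag n P" using L'(1) C unfolding lags_def by blast
  obtain w where w: "skew n w" "\<omega> = form_mat n P w" using wedge2_lag[OF P(1)] L'(2) unfolding P(3) by blast
  have "(\<Sum>i<n. \<Sum>j<n. w $$ (j, i) * M $$ (i, j)) = 0" if M: "M \<in> chart_tangent n (n + n) P C" for M
  proof -
    have Mc: "M \<in> carrier_mat n n" using M unfolding chart_tangent_def by simp
    obtain Q where Q: "orth n Q" "P * Q = 1\<^sub>m (n + n)" "Q * P = 1\<^sub>m (n + n)" using orth_inverse[OF P(1)] by metis
    note Pc = orthD(1)[OF P(1)] and Qc = orthD(1)[OF Q(1)]
    define N where "N = four_block_mat (0\<^sub>m n n) (0\<^sub>m n n) M (0\<^sub>m n n)"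
    have Nc: "N \<in> carrier_mat (n + n) (n + n)" unfolding N_def using Mc by simp
    define A where "A = P * N * Q"
    have PN: "P * N \<in> carrier_mat (n + n) (n + n)" by (rule mult_carrier_mat[OF Pc Nc])
    have Ac: "A \<in> carrier_mat (n + n) (n + n)" unfolding A_def by (rule mult_carrier_mat[OF PN Qc])
    have AP: "A *\<^sub>v (P *\<^sub>v (y @\<^sub>v 0\<^sub>v n)) = P *\<^sub>v (0\<^sub>v n @\<^sub>v (M *\<^sub>v y))" if y: "y \<in> carrier_vec n" for y
    proof -
      have yc: "y @\<^sub>v 0\<^sub>v n \<in> carrier_vec (n + n)" using y by simp
      have Pyc: "P *\<^sub>v (y @\<^sub>v 0\<^sub>v n) \<in> carrier_vec (n + n)" by (rule mult_mat_vec_carrier[OF Pc yc])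
      have "A *\<^sub>v (P *\<^sub>v (y @\<^sub>v 0\<^sub>v n)) = P * N *\<^sub>v (Q *\<^sub>v (P *\<^sub>v (y @\<^sub>v 0\<^sub>v n)))"
        unfolding A_def by (rule assoc_mult_mat_vec[OF PN Qc Pyc])
      also have "Q *\<^sub>v (P *\<^sub>v (y @\<^sub>v 0\<^sub>v n)) = y @\<^sub>v 0\<^sub>v n"
        unfolding assoc_mult_mat_vec[OF Qc Pc yc, symmetric] Q(3) using yc by simp
      also have "P * N *\<^sub>v (y @\<^sub>v 0\<^sub>v n) = P *\<^sub>v (N *\<^sub>v (y @\<^sub>v 0\<^sub>v n))" by (rule assoc_mult_mat_vec[OF Pc Nc yc])
      also have "N *\<^sub>v (y @\<^sub>v 0\<^sub>v n) = (0\<^sub>m n n *\<^sub>v y + 0\<^sub>m n n *\<^sub>v 0\<^sub>v n) @\<^sub>v (M *\<^sub>v y + 0\<^sub>m n n *\<^sub>v 0\<^sub>v n)"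
        unfolding N_def by (rule four_block_mat_mult_vec) (use Mc y in auto)
      also have "\<dots> = 0\<^sub>v n @\<^sub>v (M *\<^sub>v y)" using Mc y by (simp add: zero_mat_mult_vec)
      finally show ?thesis .
    qed
    have diff: "A *\<^sub>v (P *\<^sub>v (y @\<^sub>v 0\<^sub>v (n + n - n))) - P *\<^sub>v (0\<^sub>v n @\<^sub>v (M *\<^sub>v y)) \<in> L"
      if y: "y \<in> carrier_vec n" for y
    proof -
      have c: "P *\<^sub>v (0\<^sub>v n @\<^sub>v (M *\<^sub>v y)) \<in> carrier_vec (n + n)" by (rule mult_mat_vec_carrier[OF Pc]) (use Mc y in simp)
      have "0\<^sub>v (n + n) \<in> L"
        using lag_in_grassmannian[OF P(1)] lin_subspaceD(2) unfolding P(3) grassmannian_def by blast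
      then show ?thesis using AP[OF y] c by simp
    qed
    have "P \<in> frames_at n (n + n) L" unfolding frames_at_def using orth_frames[OF P(1)] P(3) lag_eq_gr_chart by simp
    then have "A \<in> tangent_endos n (n + n) C L" unfolding tangent_endos_def using Ac M diff by blast
    then have "0 = cotangent_pairing p \<omega> A" using L'(3) by simp
    also have "\<dots> = (\<Sum>k<n. \<Sum>l<n. w $$ (k, l) * bform n (A *\<^sub>v (P *\<^sub>v (unit_vec n k @\<^sub>v 0\<^sub>v n))) (P *\<^sub>v (unit_vec n l @\<^sub>v 0\<^sub>v n)))"
      unfolding w(2) by (rule cotangent_pairing_form_mat[OF n Pc Ac])
    also have "\<dots> = (\<Sum>k<n. \<Sum>l<n. w $$ (k, l) * M $$ (l, k))"
    proof (intro sum.cong refl)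
      fix k l assume "k \<in> {..<n}" "l \<in> {..<n}"
      then have kl: "k < n" "l < n" by auto
      have Mk: "M *\<^sub>v unit_vec n k \<in> carrier_vec n" using Mc by simp
      have c: "0\<^sub>v n @\<^sub>v (M *\<^sub>v unit_vec n k) \<in> carrier_vec (n + n)" "unit_vec n l @\<^sub>v 0\<^sub>v n \<in> carrier_vec (n + n)"
        using Mk by auto
      have "bform n (A *\<^sub>v (P *\<^sub>v (unit_vec n k @\<^sub>v 0\<^sub>v n))) (P *\<^sub>v (unit_vec n l @\<^sub>v 0\<^sub>v n)) =
          bform n (0\<^sub>v n @\<^sub>v (M *\<^sub>v unit_vec n k)) (unit_vec n l @\<^sub>v 0\<^sub>v n)"
        unfolding AP[OF unit_vec_carrier] by (rule orthD(2)[OF P(1) c])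
      also have "\<dots> = 0\<^sub>v n \<bullet> 0\<^sub>v n + (M *\<^sub>v unit_vec n k) \<bullet> unit_vec n l"
        by (rule bform_append[OF zero_carrier_vec Mk unit_vec_carrier zero_carrier_vec])
      also have "\<dots> = M $$ (l, k)" using kl Mc mult_mat_unit_vec[OF Mc kl(1)] by simp
      finally show "w $$ (k, l) * bform n (A *\<^sub>v (P *\<^sub>v (unit_vec n k @\<^sub>v 0\<^sub>v n))) (P *\<^sub>v (unit_vec n l @\<^sub>v 0\<^sub>v n)) =
          w $$ (k, l) * M $$ (l, k)" by simp
    qed
    also have "\<dots> = (\<Sum>i<n. \<Sum>j<n. w $$ (j, i) * M $$ (i, j))" by (rule sum.swap)
    finally show ?thesis by simp
  qed
  then show thesis using that[OF P(1,2) _ P(3) w] L'(1) P(3) by blast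
qed

text \<open>In the chart of this frame the Schubert variety is the linear space \<open>cell n S\<close>, which \<open>cell n (- S)\<close>
  annihilates.\<close>

lemma cell_in_conormal_bundle:
  assumes n: "n = 2 * p + 1" and b: "b \<in> borel n" and w: "w \<in> cell n (- S)"
  shows "(lag n (b * swap_mat n S), form_mat n (b * swap_mat n S) w) \<in> conormal_bundle p (schubert n S)"
proof -
  let ?Q = "b * swap_mat n S"
  let ?C = "schubert n S"
  have Q: "orth n ?Q" by (rule orth_mult[OF borelD(1)[OF b] orth_swap])
  note Qc = orthD(1)[OF Q]
  have "lag n ?Q \<in> orbit n S" unfolding orbit_def using b by blast
  then have L: "lag n ?Q \<in> ?C" using orbit_subset_schubert by blast
  have sm: "smooth_point n (n + n) ?C (lag n ?Q)" by (rule smooth_at_cell[OF Q schubert_chart[OF b] L])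
  have ws: "skew n w" by (rule cellD(1)[OF w])
  have wc: "w \<in> carrier_mat n n" by (rule skewD(1)[OF ws])
  have wedge: "form_mat n ?Q w \<in> wedge2 (n + n) (lag n ?Q)"
  proof (rule form_mat_in_wedge2[OF Q ws one_carrier_mat])
    show "1\<^sub>m n * w * (1\<^sub>m n)\<^sup>T = w" using wc by simp
    show "?Q *\<^sub>v (col (1\<^sub>m n) k @\<^sub>v 0\<^sub>v n) \<in> lag n ?Q" if "k < n" for k
      unfolding lag_def using that by (auto intro!: exI[of _ "unit_vec n k"])
  qed
  have lin: "(\<Sum>i<n. \<Sum>j<n. w $$ (j, i) * X $$ (i, j)) = 0" if "X \<in> chart_preimage n (n + n) ?Q ?C" for X
  proof (intro sum.neutral ballI)
    fix i j assume "i \<in> {..<n}" "j \<in> {..<n}"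
    then have ij: "i < n" "j < n" by auto
    have X: "X \<in> cell n S" using that unfolding schubert_chart[OF b] .
    have diag: "w $$ (i, i) = 0" using skew_diag[OF ws ij(1)] .
    consider "i < j" | "j < i" | "i = j" by linarith
    then show "w $$ (j, i) * X $$ (i, j) = 0"
    proof cases
      case 1
      then show ?thesis using cellD(3)[OF w 1 ij(2)] cellD(2)[OF X 1 ij(2)] by (cases "i \<in> S") auto
    next
      case 2
      then show ?thesis using cellD(2)[OF w 2 ij(1)] cellD(3)[OF X 2 ij(1)] by (cases "j \<in> S") auto
    next
      case 3
      then show ?thesis using diag by simp
    qed
  qed
  have "cotangent_pairing p (form_mat n ?Q w) A = 0" if A: "A \<in> tangent_endos n (n + n) ?C (lag n ?Q)" for A
  proof -
    obtain P V where PV: "A \<in> carrier_mat (n + n) (n + n)" "P \<in> frames_at n (n + n) (lag n ?Q)" "V \<in> chart_tangent n (n + n) P ?C"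
      "\<And>y. y \<in> carrier_vec n \<Longrightarrow> A *\<^sub>v (P *\<^sub>v (y @\<^sub>v 0\<^sub>v (n + n - n))) - P *\<^sub>v (0\<^sub>v n @\<^sub>v (V *\<^sub>v y)) \<in> lag n ?Q"
      using A unfolding tangent_endos_def by blast
    have P: "P \<in> frames (n + n)" "gr_chart n P (0\<^sub>m n n) = lag n ?Q" using PV(2) unfolding frames_at_def by auto
    have "(\<Sum>i<n. \<Sum>j<n. w $$ (j, i) * bform n (A *\<^sub>v (?Q *\<^sub>v (unit_vec n j @\<^sub>v 0\<^sub>v n))) (?Q *\<^sub>v (unit_vec n i @\<^sub>v 0\<^sub>v n))) = 0"
      by (rule tangent_endo_linear_equation[OF Q lin P PV(3,1)]) (use PV(4) in simp_all)
    then show ?thesis unfolding cotangent_pairing_form_mat[OF n Qc PV(1)] by (subst sum.swap)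
  qed
  then show ?thesis
    unfolding conormal_bundle_def ambient_dim[OF n] n[symmetric] using sm wedge by blast
qed

section \<open>The map to the dual variety\<close>

text \<open>A Lagrangian \<open>h\<close> of the other family that contains the hyperplane \<open>hyper n P v\<close> is orthogonal to
  it, so it consists of vectors \<open>P (a, s v)\<close>. One of them has \<open>s \<noteq> 0\<close>, and \<open>h\<close> is isotropic, so that
  all these \<open>a\<close> are orthogonal to \<open>v\<close>.\<close>

lemma q_map_eq:
  assumes n: "n = 2 * p + 1" and P: "orth n P" "det P = 1" and w: "skew n w" and v: "kernel_line n w v"
  shows "q_map p (lag n P) (form_mat n P w) = (\<lambda>x. P *\<^sub>v x) ` dual_lag n v"
  unfolding q_map_def form_image_eq[OF n P(1) w v] spinor_variety_eq[OF n] sign_det_def sign.case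
proof (rule the_equality)
  note vD = kernel_lineD[OF v] and Pc = orthD(1)[OF P(1)] and wc = skewD(1)[OF w]
  obtain Q where Q: "orth n Q" "P * Q = 1\<^sub>m (n + n)" "Q * P = 1\<^sub>m (n + n)" using orth_inverse[OF P(1)] by metis
  note Qc = orthD(1)[OF Q(1)]
  have QP: "Q *\<^sub>v (P *\<^sub>v x) = x" if "x \<in> carrier_vec (n + n)" for x
    unfolding assoc_mult_mat_vec[OF Qc Pc that, symmetric] Q(3) using that by simp
  have PQ: "P *\<^sub>v (Q *\<^sub>v x) = x" if "x \<in> carrier_vec (n + n)" for x
    unfolding assoc_mult_mat_vec[OF Pc Qc that, symmetric] Q(2) using that by simp
  obtain P' where P': "orth n P'" "det P' = - det P" "(\<lambda>x. P *\<^sub>v x) ` dual_lag n v = lag n P'"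
    using orth_image_dual_lag[OF P(1) vD(1,2)] by blast
  have "lag n P \<inter> (\<lambda>x. P *\<^sub>v x) ` dual_lag n v = hyper n P v"
  proof
    show "lag n P \<inter> (\<lambda>x. P *\<^sub>v x) ` dual_lag n v \<subseteq> hyper n P v"
    proof
      fix x assume "x \<in> lag n P \<inter> (\<lambda>x. P *\<^sub>v x) ` dual_lag n v"
      then obtain y y' s where y: "y \<in> carrier_vec n" "x = P *\<^sub>v (y @\<^sub>v 0\<^sub>v n)"
        "y' \<in> carrier_vec n" "y' \<bullet> v = 0" "x = P *\<^sub>v (y' @\<^sub>v (s \<cdot>\<^sub>v v))"
        unfolding lag_def dual_lag_def by auto
      have c: "y @\<^sub>v 0\<^sub>v n \<in> carrier_vec (n + n)" "y' @\<^sub>v (s \<cdot>\<^sub>v v) \<in> carrier_vec (n + n)"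
        using y vD(1) by auto
      have "y @\<^sub>v 0\<^sub>v n = y' @\<^sub>v (s \<cdot>\<^sub>v v)" using QP[OF c(1)] QP[OF c(2)] y(2,5) by simp
      then have "y = y'" using append_vec_eq[OF y(1,3)] by blast
      then show "x \<in> hyper n P v" unfolding hyper_def using y by blast
    qed
    show "hyper n P v \<subseteq> lag n P \<inter> (\<lambda>x. P *\<^sub>v x) ` dual_lag n v"
    proof
      fix x assume "x \<in> hyper n P v"
      then obtain y where y: "y \<in> carrier_vec n" "y \<bullet> v = 0" "x = P *\<^sub>v (y @\<^sub>v 0\<^sub>v n)" unfolding hyper_def by blast
      have "y @\<^sub>v (0 \<cdot>\<^sub>v v) \<in> dual_lag n v" unfolding dual_lag_def using y by blast
      then have "x \<in> (\<lambda>x. P *\<^sub>v x) ` dual_lag n v" unfolding y(3) zero_smult_vec[OF vD(1)] by blast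
      then show "x \<in> lag n P \<inter> (\<lambda>x. P *\<^sub>v x) ` dual_lag n v" unfolding lag_def using y by blast
    qed
  qed
  moreover have "(\<lambda>x. P *\<^sub>v x) ` dual_lag n v \<in> lags n (- 1)" unfolding P'(3) lag_in_lags_iff[OF P'(1)] using P'(2) P(2) by simp
  ultimately show "(\<lambda>x. P *\<^sub>v x) ` dual_lag n v \<in> lags n (- 1) \<and> lag n P \<inter> (\<lambda>x. P *\<^sub>v x) ` dual_lag n v = hyper n P v" by blast
  fix h assume h: "h \<in> lags n (- 1) \<and> lag n P \<inter> h = hyper n P v"
  then obtain R where R: "orth n R" "det R = - 1" "h = lag n R" unfolding lags_def by blast
  have iso: "bform n x y = 0" if "x \<in> h" "y \<in> h" for x y using lag_isotropic[OF R(1)] that unfolding R(3) by blast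
  \<comment> \<open>\<open>h\<close> is orthogonal to the hyperplane, whose orthogonal in the second factor is the line of \<open>v\<close>.\<close>
  have form: "\<exists>a s. a \<in> carrier_vec n \<and> x = P *\<^sub>v (a @\<^sub>v (s \<cdot>\<^sub>v v))" if x: "x \<in> h" for x
  proof -
    have xc: "x \<in> carrier_vec (n + n)" using x lag_carrier[OF orthD(1)[OF R(1)]] unfolding R(3) by blast
    have "Q *\<^sub>v x \<in> carrier_vec (n + n)" by (rule mult_mat_vec_carrier[OF Qc xc])
    then obtain a b where ab: "a \<in> carrier_vec n" "b \<in> carrier_vec n" "Q *\<^sub>v x = a @\<^sub>v b" by (rule split_vec)
    have xe: "x = P *\<^sub>v (a @\<^sub>v b)" using PQ[OF xc] ab(3) by simp
    have wb: "w *\<^sub>v b \<in> carrier_vec n" by (rule mult_mat_vec_carrier[OF wc ab(2)])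
    have "(w *\<^sub>v b) $ k = 0" if k: "k < n" for k
    proof -
      let ?e = "unit_vec n k"
      have ec: "w *\<^sub>v ?e \<in> carrier_vec n" by (rule mult_mat_vec_carrier[OF wc unit_vec_carrier])
      have "(w *\<^sub>v ?e) \<bullet> v = 0" using kernel_line_image[OF w v ec] unit_vec_carrier by blast
      then have "P *\<^sub>v ((w *\<^sub>v ?e) @\<^sub>v 0\<^sub>v n) \<in> h" using h ec unfolding hyper_def by blast
      then have "0 = bform n (P *\<^sub>v (a @\<^sub>v b)) (P *\<^sub>v ((w *\<^sub>v ?e) @\<^sub>v 0\<^sub>v n))" using iso[OF x] xe by simp
      also have "\<dots> = bform n (a @\<^sub>v b) ((w *\<^sub>v ?e) @\<^sub>v 0\<^sub>v n)" by (rule orthD(2)[OF P(1)]) (use ab ec in auto)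
      also have "\<dots> = a \<bullet> 0\<^sub>v n + b \<bullet> (w *\<^sub>v ?e)" by (rule bform_append[OF ab(1,2) ec zero_carrier_vec])
      also have "\<dots> = - ((w *\<^sub>v b) \<bullet> ?e)" using skew_scalar_prod[OF w ab(2) unit_vec_carrier] ab(1) by simp
      also have "\<dots> = - ((w *\<^sub>v b) $ k)" using k by simp
      finally show ?thesis by simp
    qed
    then have "w *\<^sub>v b = 0\<^sub>v n" using wb wc by (intro eq_vecI) auto
    then obtain s where "b = s \<cdot>\<^sub>v v" using vD(4)[OF ab(2)] by blast
    then show ?thesis using ab(1) xe by blast
  qed
  have pair: "bform n (P *\<^sub>v (a @\<^sub>v (s \<cdot>\<^sub>v v))) (P *\<^sub>v (a' @\<^sub>v (s' \<cdot>\<^sub>v v))) = s' * (a \<bullet> v) + s * (a' \<bullet> v)"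
    if a: "a \<in> carrier_vec n" "a' \<in> carrier_vec n" for a a' s s'
  proof -
    have c: "s \<cdot>\<^sub>v v \<in> carrier_vec n" "s' \<cdot>\<^sub>v v \<in> carrier_vec n" using vD(1) by auto
    have "bform n (P *\<^sub>v (a @\<^sub>v (s \<cdot>\<^sub>v v))) (P *\<^sub>v (a' @\<^sub>v (s' \<cdot>\<^sub>v v))) = bform n (a @\<^sub>v (s \<cdot>\<^sub>v v)) (a' @\<^sub>v (s' \<cdot>\<^sub>v v))"
      by (rule orthD(2)[OF P(1)]) (use a c in auto)
    also have "\<dots> = a \<bullet> (s' \<cdot>\<^sub>v v) + (s \<cdot>\<^sub>v v) \<bullet> a'" by (rule bform_append[OF a(1) c(1) a(2) c(2)])
    also have "\<dots> = s' * (a \<bullet> v) + s * (a' \<bullet> v)"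
      using a vD(1) comm_scalar_prod[OF vD(1) a(2)] by simp
    finally show ?thesis .
  qed
  have "\<not> h \<subseteq> lag n P"
  proof
    assume "h \<subseteq> lag n P"
    then have "lag n R = lag n P" using lag_subset_eq[OF R(1) P(1)] unfolding R(3) by blast
    moreover have "lag n R \<in> lags n (- 1)" using lag_in_lags_iff[OF R(1)] R(2) by blast
    ultimately have "det P = - 1" using lag_in_lags_iff[OF P(1)] by simp
    then show False using P(2) by simp
  qed
  then obtain x where x: "x \<in> h" "x \<notin> lag n P" by blast
  obtain a s where as: "a \<in> carrier_vec n" "x = P *\<^sub>v (a @\<^sub>v (s \<cdot>\<^sub>v v))" using form[OF x(1)] by blast
  have s: "s \<noteq> 0" using x(2) as zero_smult_vec[OF vD(1)] unfolding lag_def by auto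
  have av: "a \<bullet> v = 0" using iso[OF x(1) x(1)] s unfolding as(2) pair[OF as(1) as(1)] by simp
  have perp: "a' \<bullet> v = 0" if "a' \<in> carrier_vec n" "P *\<^sub>v (a' @\<^sub>v (s' \<cdot>\<^sub>v v)) \<in> h" for a' s'
    using iso[OF x(1) that(2)] av s unfolding as(2) pair[OF as(1) that(1)] by simp
  have "(\<lambda>x. P *\<^sub>v x) ` dual_lag n v \<subseteq> h"
  proof
    fix z assume "z \<in> (\<lambda>x. P *\<^sub>v x) ` dual_lag n v"
    then obtain y t where y: "y \<in> carrier_vec n" "y \<bullet> v = 0" "z = P *\<^sub>v (y @\<^sub>v (t \<cdot>\<^sub>v v))" unfolding dual_lag_def by auto
    show "z \<in> h"
      unfolding R(3)
    proof (rule lag_maximal[OF R(1)])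
      show "z \<in> carrier_vec (n + n)" unfolding y(3) by (rule mult_mat_vec_carrier[OF Pc]) (use y vD(1) in auto)
      fix u assume "u \<in> lag n R"
      then have u: "u \<in> h" unfolding R(3) .
      then obtain a' s' where a': "a' \<in> carrier_vec n" "u = P *\<^sub>v (a' @\<^sub>v (s' \<cdot>\<^sub>v v))" using form by blast
      show "bform n z u = 0" unfolding y(3) a'(2) pair[OF y(1) a'(1)] using perp[OF a'(1)] u y(2) unfolding a'(2) by auto
    qed
  qed
  then show "h = (\<lambda>x. P *\<^sub>v x) ` dual_lag n v" using lag_subset_eq[OF P'(1) R(1)] unfolding P'(3) R(3) by simp
qed

section \<open>Sign sequences\<close>

lemma count_sign_Plus:
  assumes n: "n = 2 * p + 1" and k: "k \<le> n"
  shows "count_sign \<eta> Plus k = card ({..<k} - minus_set p \<eta>)"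
proof -
  have "{j. 1 \<le> j \<and> j \<le> k \<and> \<eta> j = Plus} = Suc ` ({..<k} - minus_set p \<eta>)"
  proof
    show "{j. 1 \<le> j \<and> j \<le> k \<and> \<eta> j = Plus} \<subseteq> Suc ` ({..<k} - minus_set p \<eta>)"
    proof
      fix j assume j: "j \<in> {j. 1 \<le> j \<and> j \<le> k \<and> \<eta> j = Plus}"
      then obtain i where "j = Suc i" by (cases j) auto
      then show "j \<in> Suc ` ({..<k} - minus_set p \<eta>)" using j unfolding minus_set_def by auto
    qed
    show "Suc ` ({..<k} - minus_set p \<eta>) \<subseteq> {j. 1 \<le> j \<and> j \<le> k \<and> \<eta> j = Plus}"
    proof
      fix j assume "j \<in> Suc ` ({..<k} - minus_set p \<eta>)"
      then obtain i where i: "j = Suc i" "i < k" "i \<notin> minus_set p \<eta>" by blast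
      then have "\<eta> (Suc i) \<noteq> Minus" using k n unfolding minus_set_def by simp
      then show "j \<in> {j. 1 \<le> j \<and> j \<le> k \<and> \<eta> j = Plus}" using i sign_neq by simp
    qed
  qed
  then show ?thesis unfolding count_sign_def by (simp add: card_image)
qed

lemma count_sign_Minus:
  assumes n: "n = 2 * p + 1" and k: "k \<le> n"
  shows "count_sign \<eta> Minus k = card (minus_set p \<eta> \<inter> {..<k})"
proof -
  have "{j. 1 \<le> j \<and> j \<le> k \<and> \<eta> j = Minus} = Suc ` (minus_set p \<eta> \<inter> {..<k})"
  proof
    show "{j. 1 \<le> j \<and> j \<le> k \<and> \<eta> j = Minus} \<subseteq> Suc ` (minus_set p \<eta> \<inter> {..<k})"
    proof
      fix j assume j: "j \<in> {j. 1 \<le> j \<and> j \<le> k \<and> \<eta> j = Minus}"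
      then obtain i where "j = Suc i" by (cases j) auto
      then show "j \<in> Suc ` (minus_set p \<eta> \<inter> {..<k})" using j n k unfolding minus_set_def by auto
    qed
  qed (auto simp: minus_set_def)
  then show ?thesis unfolding count_sign_def by (simp add: card_image)
qed

lemma card_prefix_Suc:
  "card ({..<Suc k} - S) = card ({..<k} - S) + (if k \<in> S then 0 else 1)"
  "card (S \<inter> {..<Suc k}) = card (S \<inter> {..<k}) + (if k \<in> S then 1 else 0)"
  by (simp_all add: lessThan_Suc insert_Diff_if)

lemma card_prefix_add: "card ({..<k} - S) + card (S \<inter> {..<k}) = k"
  by (induction k) (auto simp: card_prefix_Suc)

lemma minus_set_flip:
  assumes n: "n = 2 * p + 1" and m: "m < n"
  shows "minus_set p (flip \<eta> (Suc m)) = toggle (minus_set p \<eta>) m"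
proof (rule Set.set_eqI)
  fix i
  show "i \<in> minus_set p (flip \<eta> (Suc m)) \<longleftrightarrow> i \<in> toggle (minus_set p \<eta>) m"
    using m n unfolding minus_set_def flip_def toggle_def by (cases "\<eta> (Suc m)"; cases "i = m") auto
qed

lemma not_admissible_prefix:
  assumes n: "n = 2 * p + 1" and adm: "\<not> admissible p \<eta>"
  obtains k where "k \<le> n" "card ({..<k} - minus_set p \<eta>) + 2 \<le> card (minus_set p \<eta> \<inter> {..<k})"
proof -
  obtain i where i: "i \<in> {1..p}" "count_sign \<eta> Plus (2 * i) < i" using adm unfolding admissible_def by force
  then have k: "2 * i \<le> n" using n by simp
  have "card ({..<2 * i} - minus_set p \<eta>) + 2 \<le> card (minus_set p \<eta> \<inter> {..<2 * i})"
    using i(2) card_prefix_add[of "2 * i" "minus_set p \<eta>"] unfolding count_sign_Plus[OF n k] by linarith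
  then show thesis using that k by blast
qed

text \<open>Remove position \<open>m\<close> and read the other signs as a path, up at \<open>+\<close> and down at \<open>-\<close>. For an
  admissible sequence the path of all signs stays at height at least \<open>-1\<close>, and at least \<open>0\<close> at even
  times. Its first visit to \<open>-1\<close>, or else its last departure from \<open>0\<close>, is the step to be changed:
  it starts at height \<open>0\<close>, and its removal leaves a path of nonnegative heights.\<close>

lemma admissible_eta_star:
  assumes n: "n = 2 * p + 1" and adm: "admissible p \<eta>" and S: "S = minus_set p \<eta>"
  obtains m where "m < n" "eta_star p \<eta> = flip \<eta> (Suc m)" "card ({..<m} - S) = card (S \<inter> {..<m})"
    "\<And>k. k \<le> n \<Longrightarrow> card (({..<k} \<inter> S) - {m}) \<le> card ({..<k} - S - {m})"
proof -
  define a where "a = (\<lambda>k. card ({..<k} - S))"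
  define b where "b = (\<lambda>k. card (S \<inter> {..<k}))"
  have ab: "a k + b k = k" for k unfolding a_def b_def by (rule card_prefix_add)
  have step: "a (Suc k) = a k + (if k \<in> S then 0 else 1)" "b (Suc k) = b k + (if k \<in> S then 1 else 0)" for k
    unfolding a_def b_def by (rule card_prefix_Suc)+
  have pl: "count_sign \<eta> Plus k = a k" and mi: "count_sign \<eta> Minus k = b k" if "k \<le> n" for k
    unfolding a_def b_def S using count_sign_Plus[OF n that] count_sign_Minus[OF n that] by auto
  have a_even: "i \<le> a (2 * i)" if i: "i \<le> p" for i
  proof (cases "i = 0")
    case False
    then have "i \<in> {1..p}" using i by simp
    then have "i \<le> count_sign \<eta> Plus (2 * i)" using adm unfolding admissible_def by blast
    then show ?thesis using pl[of "2 * i"] i n by simp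
  qed simp
  have a_odd: "i \<le> a (Suc (2 * i))" if "i \<le> p" for i using a_even[OF that] step(1)[of "2 * i"] by simp
  have removed: "card (({..<k} \<inter> S) - {m}) = b k - (if m \<in> S \<and> m < k then 1 else 0)"
    "card ({..<k} - S - {m}) = a k - (if m \<notin> S \<and> m < k then 1 else 0)" for k m
    unfolding a_def b_def Int_commute[of "{..<k}" S] by (simp_all add: card_Diff_singleton_if)
  have parity: "(\<exists>i\<le>p. k = 2 * i) \<or> (\<exists>i\<le>p. k = Suc (2 * i))" if "k \<le> n" for k
    using that n by (cases "even k") (auto elim!: evenE oddE)
  define P where "P = (\<lambda>i. i \<in> {1..p + 1} \<and> count_sign \<eta> Plus (2 * i - 1) = i - 1)"
  show thesis
  proof (cases "\<exists>i. P i")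
    case True
    define i0 where "i0 = (LEAST i. P i)"
    have i0: "P i0" unfolding i0_def by (rule LeastI_ex[OF True])
    then obtain j where j: "i0 = Suc j" "j \<le> p" unfolding P_def by (cases i0) auto
    have "Suc (2 * j) \<le> n" using j(2) n by simp
    then have aj: "a (Suc (2 * j)) = j" using i0 pl unfolding P_def j(1) by simp
    then have am: "a (2 * j) = j" "2 * j \<in> S" using a_even[OF j(2)] step(1)[of "2 * j"] by (auto split: if_splits)
    have bm: "b (2 * j) = j" using ab[of "2 * j"] am(1) by simp
    have "\<exists>i\<in>{1..p + 1}. count_sign \<eta> Plus (2 * i - 1) = i - 1" using True unfolding P_def by blast
    then have "eta_star p \<eta> = flip \<eta> (2 * i0 - 1)" unfolding eta_star_def i0_def P_def by simp
    then have star: "eta_star p \<eta> = flip \<eta> (Suc (2 * j))" unfolding j(1) by simp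
    have ballot: "card (({..<k} \<inter> S) - {2 * j}) \<le> card ({..<k} - S - {2 * j})" if k: "k \<le> n" for k
    proof -
      have "b k - (if 2 * j < k then 1 else 0) \<le> a k"
        using parity[OF k]
      proof
        assume "\<exists>i\<le>p. k = 2 * i"
        then obtain i where "i \<le> p" "k = 2 * i" by blast
        then show ?thesis using a_even[of i] ab[of k] by simp
      next
        assume "\<exists>i\<le>p. k = Suc (2 * i)"
        then obtain i where i: "i \<le> p" "k = Suc (2 * i)" by blast
        show ?thesis
        proof (cases "2 * j < k")
          case True
          then show ?thesis using a_odd[OF i(1)] ab[of k] i(2) by simp
        next
          case False
          then have "Suc i < i0" using i(2) j(1) by simp
          then have "\<not> P (Suc i)" unfolding i0_def by (rule not_less_Least)
          then have "a k \<noteq> i" using i pl[OF k] unfolding P_def by simp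
          then show ?thesis using a_odd[OF i(1)] ab[of k] i(2) by simp
        qed
      qed
      then show ?thesis unfolding removed using am(2) by simp
    qed
    have "2 * j < n" using j(2) n by simp
    then show thesis using that star ballot am(1) bm unfolding a_def b_def by simp
  next
    case False
    have ge: "b k \<le> a k \<and> (odd k \<longrightarrow> b k < a k)" if k: "k \<le> n" for k
      using parity[OF k]
    proof
      assume "\<exists>i\<le>p. k = 2 * i"
      then obtain i where "i \<le> p" "k = 2 * i" by blast
      then show ?thesis using a_even[of i] ab[of k] by simp
    next
      assume "\<exists>i\<le>p. k = Suc (2 * i)"
      then obtain i where i: "i \<le> p" "k = Suc (2 * i)" by blast
      have "\<not> P (Suc i)" using False by blast
      then have "a k \<noteq> i" using i pl[OF k] unfolding P_def by simp
      then show ?thesis using a_odd[OF i(1)] ab[of k] i(2) by simp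
    qed
    define R where "R = (\<lambda>i. i \<in> {1..2 * p + 1} \<and> (\<forall>k\<in>{i..2 * p + 1}. count_sign \<eta> Plus k > count_sign \<eta> Minus k))"
    have R: "R i \<longleftrightarrow> 1 \<le> i \<and> i \<le> n \<and> (\<forall>k. i \<le> k \<longrightarrow> k \<le> n \<longrightarrow> b k < a k)" for i
      unfolding R_def n[symmetric] using pl mi by auto
    have Rn: "R n" unfolding R using ge[of n] n by (auto dest: le_antisym)
    define i0 where "i0 = (LEAST i. R i)"
    have i0: "R i0" unfolding i0_def by (rule LeastI[of R, OF Rn])
    then obtain m where m: "i0 = Suc m" unfolding R by (cases i0) auto
    have mn: "m < n" using i0 m unfolding R by simp
    have above: "b k < a k" if "m < k" "k \<le> n" for k using i0 that unfolding R m by simp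
    have am: "a m = b m"
    proof (cases "m = 0")
      case False
      have "\<not> R m" using not_less_Least[of m R] m unfolding i0_def by simp
      then obtain k where k: "m \<le> k" "k \<le> n" "\<not> b k < a k" using False mn unfolding R by auto
      then have "k = m" using above[of k] by (cases "k = m") auto
      then show ?thesis using k ge[of m] mn by simp
    qed (simp add: a_def b_def)
    have mS: "m \<notin> S" using above[of "Suc m"] mn step[of m] am by auto
    have "\<not> (\<exists>i\<in>{1..p + 1}. count_sign \<eta> Plus (2 * i - 1) = i - 1)" using False unfolding P_def by blast
    then have "eta_star p \<eta> = flip \<eta> i0" unfolding eta_star_def i0_def R_def by simp
    moreover have "card (({..<k} \<inter> S) - {m}) \<le> card ({..<k} - S - {m})" if k: "k \<le> n" for k
      unfolding removed using mS ge[OF k] above[of k] k by auto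
    ultimately show thesis using that mn am unfolding m a_def b_def by simp
  qed
qed

section \<open>Suitability and duality\<close>

lemma dual_lag_unit_vec:
  assumes m: "m < n"
  shows "dual_lag n (unit_vec n m) = lag n (swap_mat n {m})"
proof -
  have "flip_chart n m (unit_vec n m) = 0\<^sub>m n n" unfolding flip_chart_def using m by (intro eq_matI) auto
  then show ?thesis
    using dual_lag_eq_chart[OF unit_vec_carrier m] m unfolding lag_eq_gr_chart by simp
qed

theorem proposition4p9:
  fixes p :: nat and \<eta> :: "nat \<Rightarrow> sign"
  assumes "p \<ge> 1" and "odd_sign p Plus \<eta>"
  shows "(suitable p (schubert_C p \<eta>) \<longleftrightarrow> admissible p \<eta>) \<and>
    (admissible p \<eta> \<longrightarrow> dual_variety p (schubert_C p \<eta>) = schubert_D p (eta_star p \<eta>))"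
proof -
  define n where n: "n = 2 * p + 1"
  define S where S: "S = minus_set p \<eta>"
  have odd: "odd n" by (simp add: n)
  have C: "schubert_C p \<eta> = schubert n S" unfolding S by (rule schubert_C_eq[OF n assms(2)])
  have det: "det (swap_mat n S) = 1" using assms(2) unfolding odd_sign_iff[OF n] S sign_det_def by simp
  have C1: "schubert n S \<subseteq> lags n 1" using schubert_subset_lags[of n S] unfolding det .
  have adm: "admissible p \<eta>" if suit: "suitable p (schubert_C p \<eta>)"
  proof (rule ccontr)
    assume "\<not> admissible p \<eta>"
    then obtain k where k: "k \<le> n" "card ({..<k} - S) + 2 \<le> card (S \<inter> {..<k})"
      unfolding S by (rule not_admissible_prefix[OF n])
    obtain L \<omega> where L: "(L, \<omega>) \<in> conormal_bundle p (schubert n S)" "generic_form p \<omega>"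
      using suit unfolding suitable_def C by blast
    obtain P w where P: "orth n P" "det P = 1" "lag n P \<in> schubert n S" "L = lag n P" "skew n w" "\<omega> = form_mat n P w"
      and con: "\<And>M. M \<in> chart_tangent n (n + n) P (schubert n S) \<Longrightarrow> (\<Sum>i<n. \<Sum>j<n. w $$ (j, i) * M $$ (i, j)) = 0"
      by (rule conormal_bundle_frame[OF n L(1) C1]) blast
    obtain v where "kernel_line n w v" using generic_form_kernel_line[OF n P(1,5)] L(2) unfolding P(6) by blast
    then show False
      using conormal_not_generic[OF P(1,3,5) con conormal_degenerate[OF _ k]] by blast
  qed
  have dual: "suitable p (schubert_C p \<eta>) \<and> dual_variety p (schubert_C p \<eta>) = schubert_D p (eta_star p \<eta>)"
    if adm: "admissible p \<eta>"
  proof -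
    obtain m where m: "m < n" "eta_star p \<eta> = flip \<eta> (Suc m)" "card ({..<m} - S) = card (S \<inter> {..<m})"
      and ballot: "\<And>k. k \<le> n \<Longrightarrow> card (({..<k} \<inter> S) - {m}) \<le> card ({..<k} - S - {m})"
      using admissible_eta_star[OF n adm S] by metis
    obtain w1 where w1: "w1 \<in> cell n (- S)" "kernel_line n w1 (unit_vec n m)"
      using matching_form[OF m(1) odd ballot] by blast
    \<comment> \<open>The form of the matching, moved by the Borel group.\<close>
    have point: "(lag n (b * swap_mat n S), form_mat n (b * swap_mat n S) w1) \<in> conormal_bundle p (schubert n S) \<and>
        generic_form p (form_mat n (b * swap_mat n S) w1)" if b: "b \<in> borel n" for b
      using cell_in_conormal_bundle[OF n b w1(1)]
        kernel_unit_vec_generic_form[OF n orth_mult[OF borelD(1)[OF b] orth_swap] cellD(1)[OF w1(1)] m(1) w1(2)] by blast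
    have suit: "suitable p (schubert_C p \<eta>)" unfolding suitable_def C using point[OF one_in_borel] by blast
    have toggle: "minus_set p (eta_star p \<eta>) = toggle S m" unfolding m(2) S by (rule minus_set_flip[OF n m(1)])
    have det': "det (swap_mat n (toggle S m)) = - 1" unfolding det_swap_toggle[OF m(1)] det ..
    have "odd_sign p Minus (eta_star p \<eta>)" unfolding odd_sign_iff[OF n] toggle det' sign_det_def by simp
    from schubert_D_eq[OF n this] have D: "schubert_D p (eta_star p \<eta>) = schubert n (toggle S m)" unfolding toggle .
    define Z where "Z = {q_map p L \<omega> | L \<omega>. (L, \<omega>) \<in> conormal_bundle p (schubert n S) \<and> generic_form p \<omega>}"
    let ?T = "lag_topology n (lags n (- 1))"
    have V: "dual_variety p (schubert_C p \<eta>) = ?T closure_of Z"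
      unfolding dual_variety_def C Z_def zariski_spinor_eq[OF n] sign_det_def by simp
    have D': "schubert n (toggle S m) = ?T closure_of orbit n (toggle S m)" unfolding schubert_def det' ..
    have "Z \<subseteq> schubert n (toggle S m)"
    proof
      fix h assume "h \<in> Z"
      then obtain L \<omega> where L: "(L, \<omega>) \<in> conormal_bundle p (schubert n S)" "generic_form p \<omega>" "h = q_map p L \<omega>"
        unfolding Z_def by blast
      obtain P w where P: "orth n P" "det P = 1" "lag n P \<in> schubert n S" "L = lag n P" "skew n w" "\<omega> = form_mat n P w"
        and con: "\<And>M. M \<in> chart_tangent n (n + n) P (schubert n S) \<Longrightarrow> (\<Sum>i<n. \<Sum>j<n. w $$ (j, i) * M $$ (i, j)) = 0"
        by (rule conormal_bundle_frame[OF n L(1) C1]) blast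
      obtain v where v: "kernel_line n w v" using generic_form_kernel_line[OF n P(1,5)] L(2) unfolding P(6) by blast
      show "h \<in> schubert n (toggle S m)"
        unfolding L(3) P(4,6) q_map_eq[OF n P(1,2,5) v]
        by (rule conormal_dual_in_schubert[OF P(1,3,5) odd con v m(1,3) w1])
    qed
    then have "?T closure_of Z \<subseteq> schubert n (toggle S m)"
      unfolding D' by (rule closure_of_minimal) simp
    moreover have "orbit n (toggle S m) \<subseteq> Z"
    proof
      fix h assume "h \<in> orbit n (toggle S m)"
      then obtain b where b: "b \<in> borel n" "h = lag n (b * swap_mat n (toggle S m))" unfolding orbit_def by blast
      let ?Q = "b * swap_mat n S"
      have Q: "orth n ?Q" by (rule orth_mult[OF borelD(1)[OF b(1)] orth_swap])
      have bc: "b \<in> carrier_mat (n + n) (n + n)" by (rule orthD(1)[OF borelD(1)[OF b(1)]])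
      have "det ?Q = 1" unfolding det_mult[OF bc swap_mat_carrier] det borelD(2)[OF b(1)] by simp
      then have "q_map p (lag n ?Q) (form_mat n ?Q w1) = (\<lambda>x. ?Q *\<^sub>v x) ` dual_lag n (unit_vec n m)"
        by (rule q_map_eq[OF n Q _ cellD(1)[OF w1(1)] w1(2)])
      also have "\<dots> = lag n (?Q * swap_mat n {m})"
        unfolding dual_lag_unit_vec[OF m(1)] by (rule lag_mult[OF orthD(1)[OF Q] swap_mat_carrier, symmetric])
      also have "\<dots> = h"
        unfolding b(2) swap_mat_toggle[OF m(1)] assoc_mult_mat[OF bc swap_mat_carrier swap_mat_carrier] ..
      finally show "h \<in> Z" unfolding Z_def using point[OF b(1)] by blast
    qed
    then have "schubert n (toggle S m) \<subseteq> ?T closure_of Z" unfolding D' by (rule closure_of_mono)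
    ultimately show ?thesis using suit unfolding V D by blast
  qed
  show ?thesis using adm dual by blast
qed

end
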